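(* Let $0<\lambda\le\Lambda$, $s>1$, $N_+=\frac{\lambda}{\Lambda}(N-1)+1$, and let $f$ be a radially symmetric function on $\mathbb{R}^N$ (written $f(x)=f(|x|)$) satisfying $$\int_0^R r^{N_+-1}|f(r)|\,dr<\infty\quad\text{for all }R>0.$$ Then the equation $$-\mathcal{M}^+_{\lambda,\Lambda}(D^2u)+|u|^{s-1}u=f(x)\quad\text{in }\mathbb{R}^N$$ has a unique weak radially symmetric solution $u$, and if $f$ is nonnegative then $u$ is also nonnegative.
   Context: Pucci operator: for a symmetric matrix $X$ with eigenvalues $e_i$, $\mathcal{M}^+_{\lambda,\Lambda}(X)=\Lambda\sum_{e_i>0}e_i+\lambda\sum_{e_i<0}e_i$. Radial form and weights: let $\theta(t)=\Lambda$ if $t\ge0$ and $\theta(t)=\lambda$ if $t<0$. For a radial function $u=u(r)$ (differentiable a.e.) define $$\Theta(r,u(r),u'(r))=\theta\Big(-\theta(u'(r))(N-1)\tfrac{u'(r)}{r}+|u(r)|^{s-1}u(r)-f(r)\Big),$$ $$N(r,u(r),u'(r))=\frac{\theta(u'(r))}{\Theta(r,u(r),u'(r))}(N-1)+1,$$ $$\rho(r)=\rho(r,u(r),u'(r))=\exp\Big(\int_1^r\frac{N(\tau,u(\tau),u'(\tau))-1}{\tau}\,d\tau\Big),\qquad \tilde\rho(r)=\frac{\rho(r)}{\Theta(r,u(r),u'(r))}.$$ For classical radial functions the equation is equivalent to $-(\rho u')'+\tilde\rho|u|^{s-1}u=\tilde\rho f$ on $(0,\infty)$. Test functions: $H$ is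 the set of $\varphi:[0,\infty)\to\mathbb{R}$ such that $\phi(x)=\varphi(|x|)$ defines a function in $W^{1,\infty}(\mathbb{R}^N)$ with compact support. Weak radially symmetric solution: a function $u:(0,\infty)\to\mathbb{R}$, absolutely continuous on each compact subinterval of $(0,\infty)$, such that for all $R>0$, $\int_0^R\rho|u|^s\,dr<\infty$ and $\int_0^R\rho|u'|\,dr<\infty$, and $$\int_0^\infty\big(\rho u'\varphi'+\tilde\rho|u|^{s-1}u\varphi\big)\,dr=\int_0^\infty\tilde\rho f\varphi\,dr\quad\text{for all }\varphi\in H.$$ *)

theory Defs
  imports "HOL-Analysis.Analysis"
begin

section \<open>Absolute continuity on a compact interval\<close>

definition absolutely_continuous_on_Icc :: "(real \<Rightarrow> real) \<Rightarrow> real \<Rightarrow> real \<Rightarrow> bool" where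
  "absolutely_continuous_on_Icc u a b \<longleftrightarrow>
     (\<forall>e>0. \<exists>d>0. \<forall>D :: (real \<times> real) set.
        finite D \<and>
        (\<forall>(x, y)\<in>D. a \<le> x \<and> x \<le> y \<and> y \<le> b) \<and>
        disjoint_family_on (\<lambda>(x, y). {x<..<y}) D \<and>
        (\<Sum>(x, y)\<in>D. y - x) < d
        \<longrightarrow> (\<Sum>(x, y)\<in>D. \<bar>u y - u x\<bar>) < e)"


section \<open>The Sobolev space of order one and exponent infinity on the whole space\<close>

definition essentially_bounded :: "(real ^ 'n \<Rightarrow> real) \<Rightarrow> bool" where
  "essentially_bounded g \<longleftrightarrow>
     g \<in> borel_measurable lebesgue \<and> (\<exists>C. AE x in lebesgue. \<bar>g x\<bar> \<le> C)"

definition partial :: "'n \<Rightarrow> (real ^ 'n \<Rightarrow> real) \<Rightarrow> real ^ 'n \<Rightarrow> real" where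
  "partial i \<psi> x = frechet_derivative \<psi> (at x) (axis i 1)"

text \<open>Weak derivatives are tested against compactly supported \<open>C\<^sup>1\<close> functions, as in
  Gilbarg--Trudinger, Section 7.3.\<close>

definition C1_compact_support :: "(real ^ 'n \<Rightarrow> real) \<Rightarrow> bool" where
  "C1_compact_support \<psi> \<longleftrightarrow>
     (\<forall>x. \<psi> differentiable (at x)) \<and>
     (\<forall>i. continuous_on UNIV (partial i \<psi>)) \<and>
     compact (closure {x. \<psi> x \<noteq> 0})"

definition has_weak_partial :: "'n \<Rightarrow> (real ^ 'n \<Rightarrow> real) \<Rightarrow> (real ^ 'n \<Rightarrow> real) \<Rightarrow> bool" where
  "has_weak_partial i v g \<longleftrightarrow>
     (\<forall>\<psi>. C1_compact_support \<psi> \<longrightarrow>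
        (LINT x|lebesgue. v x * partial i \<psi> x) = - (LINT x|lebesgue. g x * \<psi> x))"

definition W1_infinity :: "(real ^ 'n \<Rightarrow> real) set" where
  "W1_infinity =
     {v. essentially_bounded v \<and> (\<forall>i. \<exists>g. essentially_bounded g \<and> has_weak_partial i v g)}"

text \<open>The space \<open>H\<close> of radial test functions. Elements of \<open>W1_infinity\<close> are only determined
  almost everywhere; the continuous representative is chosen, so that the derivative
  occurring in the weak formulation can be taken pointwise almost everywhere.\<close>

definition radial_test_functions :: "'n::finite itself \<Rightarrow> (real \<Rightarrow> real) set" where
  "radial_test_functions _ =
     {\<phi>. continuous_on {0..} \<phi> \<and>
         (\<lambda>x :: real ^ 'n. \<phi> (norm x)) \<in> W1_infinity \<and>
         compact (closure {x :: real ^ 'n. \<phi> (norm x) \<noteq> 0})}"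


section \<open>Radial functions\<close>

definition radially_symmetric :: "(real ^ 'n \<Rightarrow> real) \<Rightarrow> bool" where
  "radially_symmetric F \<longleftrightarrow> (\<forall>x y. norm x = norm y \<longrightarrow> F x = F y)"

text \<open>The function \<open>f\<close> on \<open>[0, \<infinity>)\<close> with \<open>F x = f (norm x)\<close>, for \<open>F\<close> radially symmetric.\<close>

definition radial_profile :: "(real ^ 'n \<Rightarrow> real) \<Rightarrow> real \<Rightarrow> real" where
  "radial_profile F r = (THE c. \<forall>x. norm x = r \<longrightarrow> F x = c)"


section \<open>Weights and weak radial solutions\<close>

text \<open>Below, \<open>n\<close> is the space dimension, \<open>f\<close> the profile of the right-hand side, and the
  derivative of \<open>u\<close> is the pointwise one; it exists almost everywhere for the functions
  \<open>u\<close> under consideration, and only its values up to null sets matter.\<close>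

definition theta :: "real \<Rightarrow> real \<Rightarrow> real \<Rightarrow> real" where
  "theta lam Lam t = (if t \<ge> 0 then Lam else lam)"

definition Theta ::
    "real \<Rightarrow> real \<Rightarrow> real \<Rightarrow> real \<Rightarrow> (real \<Rightarrow> real) \<Rightarrow> (real \<Rightarrow> real) \<Rightarrow> real \<Rightarrow> real" where
  "Theta n lam Lam s f u r =
     theta lam Lam (- theta lam Lam (deriv u r) * (n - 1) * (deriv u r / r)
                    + \<bar>u r\<bar> powr (s - 1) * u r - f r)"

definition dim_fun ::
    "real \<Rightarrow> real \<Rightarrow> real \<Rightarrow> real \<Rightarrow> (real \<Rightarrow> real) \<Rightarrow> (real \<Rightarrow> real) \<Rightarrow> real \<Rightarrow> real" where
  "dim_fun n lam Lam s f u r =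
     theta lam Lam (deriv u r) / Theta n lam Lam s f u r * (n - 1) + 1"

text \<open>The interval integral is oriented, hence negative for \<open>r < 1\<close>.\<close>

definition rho ::
    "real \<Rightarrow> real \<Rightarrow> real \<Rightarrow> real \<Rightarrow> (real \<Rightarrow> real) \<Rightarrow> (real \<Rightarrow> real) \<Rightarrow> real \<Rightarrow> real" where
  "rho n lam Lam s f u r =
     exp (interval_lebesgue_integral lebesgue (ereal 1) (ereal r)
            (\<lambda>\<tau>. (dim_fun n lam Lam s f u \<tau> - 1) / \<tau>))"

definition rho_tilde ::
    "real \<Rightarrow> real \<Rightarrow> real \<Rightarrow> real \<Rightarrow> (real \<Rightarrow> real) \<Rightarrow> (real \<Rightarrow> real) \<Rightarrow> real \<Rightarrow> real" where
  "rho_tilde n lam Lam s f u r = rho n lam Lam s f u r / Theta n lam Lam s f u r"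

text \<open>\<open>weak_radial_solution lam Lam s F u\<close>: the function \<open>u\<close> on \<open>(0, \<infinity>)\<close> is a weak radially
  symmetric solution of \<open>- M\<^sup>+(D\<^sup>2 u) + |u|\<^bsup>s-1\<^esup> u = F\<close>, where \<open>M\<^sup>+\<close> is the maximal Pucci
  operator with ellipticity constants \<open>lam \<le> Lam\<close>. Values of \<open>u\<close> outside \<open>(0, \<infinity>)\<close> are
  irrelevant.\<close>

definition weak_radial_solution ::
    "real \<Rightarrow> real \<Rightarrow> real \<Rightarrow> (real ^ 'n \<Rightarrow> real) \<Rightarrow> (real \<Rightarrow> real) \<Rightarrow> bool" where
  "weak_radial_solution lam Lam s F u \<longleftrightarrow>
     (let f = radial_profile F;
          \<rho> = rho (real CARD('n)) lam Lam s f u;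
          \<rho>' = rho_tilde (real CARD('n)) lam Lam s f u
      in (\<forall>a b. 0 < a \<and> a \<le> b \<longrightarrow> absolutely_continuous_on_Icc u a b) \<and>
         (\<forall>R>0. set_integrable lebesgue {0<..<R} (\<lambda>r. \<rho> r * \<bar>u r\<bar> powr s) \<and>
                set_integrable lebesgue {0<..<R} (\<lambda>r. \<rho> r * \<bar>deriv u r\<bar>)) \<and>
         (\<forall>\<phi> \<in> radial_test_functions TYPE('n).
            (LINT r:{0<..}|lebesgue.
               \<rho> r * deriv u r * deriv \<phi> r + \<rho>' r * (\<bar>u r\<bar> powr (s - 1) * u r) * \<phi> r) =
            (LINT r:{0<..}|lebesgue. \<rho>' r * f r * \<phi> r)))"

end

theory Submission
  imports Defs "HOL-Complex_Analysis.Great_Picard"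
begin

text \<open>With \<open>\<Gamma> t = t / \<theta> t\<close>, a classical radial solution satisfies
  \<open>u'' = \<Gamma> (|u|\<^bsup>s-1\<^esup> u - f - \<theta>(u') (N - 1) u' / r)\<close>. Testing with \<open>C\<^sup>1\<close> functions that are
  constant near the origin identifies the flux \<open>\<rho> u'\<close> of a weak solution with the integral of
  \<open>\<rho>' (|u|\<^bsup>s-1\<^esup> u - f)\<close> over \<open>(0, r)\<close> (where \<open>\<rho>'\<close> is the second weight); hence weak solutions are
  exactly the \<open>C\<^sup>1\<close> solutions on \<open>(0, \<infinity>)\<close> whose flux vanishes at the origin.

  Comparison: \<open>\<Gamma>\<close> and \<open>p \<mapsto> \<theta>(p) p\<close> are increasing and Lipschitz, so the difference \<open>z = u - v\<close>
  of two solutions solves a linear equation with bounded coefficients, and its flux for a suitable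
  weight grows where \<open>z > 0\<close>. If \<open>z\<close> is positive and nondecreasing somewhere, superlinearity makes it blow up
  in finite time (Keller--Osserman); if it decreases, it has a nonzero flux at the origin. No condition at
  infinity is needed.

  Existence: shooting gives solutions on \<open>[a, b]\<close> with \<open>u'(a) = 0\<close> and \<open>u(b) = 0\<close>. The Keller--Osserman
  argument bounds them locally, independently of \<open>a\<close> and \<open>b\<close>, and a subsequence converges as \<open>a \<rightarrow> 0\<close>,
  \<open>b \<rightarrow> \<infinity>\<close>. Kato's inequality makes the nonlinear term integrable near the origin, so that the flux of
  the limit converges there; its limit is zero because the approximations have no flux at \<open>a\<close>.\<close>

section \<open>Absolutely continuous functions as primitives\<close>

text \<open>The weight depends on the solution: two solutions have different weights, and the linear
  equation for their difference brings a third. Zero flux of u and of v in their own weights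
  therefore says nothing directly about the flux of u - v. What all weights share is that the
  damping coefficient lies between \<open>\<kappa>\<close> = N_+ - 1 and \<open>\<kappa>'\<close>,
  so that on (0, 1] each of them is at most r^\<kappa>. This explains the exponent in the hypothesis
  on f: f is then integrable at the origin against every possible weight, with a bound
  \<open>mass f\<close> that tends to 0 and does not involve the solution.

  Fluxes are compared in r^\<kappa>: r^\<kappa> u' tends to 0 once u is bounded near the origin.
  Boundedness in turn rests on one inequality, u' sgn u \<ge> - \<open>mass f r\<close>
  r^(-\<kappa>). It comes from Kato's inequality, involves neither the size of u nor its weight,
  survives limits, and is carried through the whole existence proof.\<close>

lemma absolutely_integrable_subset:
  fixes h :: "'a::euclidean_space \<Rightarrow> 'b::euclidean_space"
  assumes "h absolutely_integrable_on S" "A \<subseteq> S" "A \<in> sets lebesgue"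
  shows "h absolutely_integrable_on A"
  using assms set_integrable_subset by blast

lemma absolutely_integrable_subinterval:
  fixes f :: "real \<Rightarrow> real"
  assumes "f absolutely_integrable_on {a..b}" "a \<le> c" "d \<le> b"
  shows "f absolutely_integrable_on {c..d}" "f integrable_on {c..d}"
proof -
  show 1: "f absolutely_integrable_on {c..d}"
    by (rule absolutely_integrable_on_subinterval[OF assms(1)]) (use assms in auto)
  show "f integrable_on {c..d}"
    by (rule set_lebesgue_integral_eq_integral(1)[OF 1])
qed

text \<open>Truncate \<bar>h\<bar> at height k. What is cut off has small integral over S by
  dominated convergence, and the truncated part contributes at most k times the measure of
  A.\<close>

lemma small_integral_on_small_sets:
  fixes h :: "'a::euclidean_space \<Rightarrow> real"
  assumes h: "h absolutely_integrable_on S" and e: "e > 0"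
  obtains d where "d > 0"
    "\<And>A. A \<subseteq> S \<Longrightarrow> A \<in> lmeasurable \<Longrightarrow> measure lebesgue A < d \<Longrightarrow> integral A (\<lambda>x. \<bar>h x\<bar>) < e"
proof -
  define H where "H = (\<lambda>x. \<bar>h x\<bar>)"
  have H: "H absolutely_integrable_on S"
    unfolding H_def using h by (rule set_integrable_abs)
  define Hk where "Hk k x = min (H x) (real k)" for k :: nat and x
  have Hk_le: "Hk k x \<le> H x" and Hk_k: "Hk k x \<le> real k" and Hk0: "0 \<le> Hk k x" for k x
    by (auto simp: Hk_def H_def)
  have ai: "Hk k absolutely_integrable_on S" for k
  proof -
    have 1: "(\<lambda>x. indicator S x *\<^sub>R H x) \<in> borel_measurable lebesgue"
      using H unfolding set_integrable_def by auto
    have "(\<lambda>x. indicator S x *\<^sub>R Hk k x) = (\<lambda>x. min (indicator S x *\<^sub>R H x) (real k))"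
      by (auto simp: Hk_def H_def indicator_def)
    then have "(\<lambda>x. indicator S x *\<^sub>R Hk k x) \<in> borel_measurable lebesgue"
      using 1 by simp
    then show ?thesis
      using H unfolding set_integrable_def
      by (rule_tac Bochner_Integration.integrable_bound[of _ "\<lambda>x. indicator S x *\<^sub>R H x"]) (auto simp: Hk_def H_def indicator_def)
  qed
  have "(\<lambda>k. integral S (Hk k)) \<longlonglongrightarrow> integral S H"
  proof (rule dominated_convergence(2)[where h = H])
    show "Hk k integrable_on S" for k
      using ai by (simp add: set_lebesgue_integral_eq_integral)
    show "H integrable_on S"
      using H by (simp add: set_lebesgue_integral_eq_integral)
    show "norm (Hk k x) \<le> H x" for k x
      using Hk_le Hk0 by simp
    show "(\<lambda>k. Hk k x) \<longlonglongrightarrow> H x" for x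
    proof -
      obtain k0 where k0: "H x \<le> real k0" using real_arch_simple by blast
      have "eventually (\<lambda>k. Hk k x = H x) sequentially"
        unfolding eventually_sequentially
      proof (intro exI allI impI)
        fix k assume "k0 \<le> k"
        then have "real k0 \<le> real k" by simp
        then show "Hk k x = H x" using k0 unfolding Hk_def by linarith
      qed
      then show ?thesis by (rule tendsto_eventually)
    qed
  qed
  then have "eventually (\<lambda>k. dist (integral S (Hk k)) (integral S H) < e/2) sequentially"
    using e half_gt_zero tendstoD by blast
  then obtain k where "dist (integral S (Hk k)) (integral S H) < e/2"
    using eventually_happens'[OF sequentially_bot] by blast
  then have k: "integral S H - integral S (Hk k) < e/2"
    unfolding dist_real_def by linarith
  show thesis
  proof
    \<comment> \<open>The truncated part then contributes less than e/2; k + 1 instead of k covers k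
      = 0.\<close>
    show "e / (2 * (real k + 1)) > 0" using e by simp
    fix A assume A: "A \<subseteq> S" "A \<in> lmeasurable" "measure lebesgue A < e / (2 * (real k + 1))"
    have iA: "H absolutely_integrable_on A" "Hk k absolutely_integrable_on A"
      using A H ai by (auto intro: absolutely_integrable_subset fmeasurableD)
    then have i: "H integrable_on A" "Hk k integrable_on A" "H integrable_on S" "Hk k integrable_on S"
      using H ai by (auto simp: set_lebesgue_integral_eq_integral)
    have "integral A H - integral A (Hk k) = integral A (\<lambda>x. H x - Hk k x)"
      using i by (simp add: Henstock_Kurzweil_Integration.integral_diff)
    also have "\<dots> \<le> integral S (\<lambda>x. H x - Hk k x)"
      using A i Hk_le by (intro integral_subset_le integrable_diff) auto
    also have "\<dots> = integral S H - integral S (Hk k)"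
      using i by (simp add: Henstock_Kurzweil_Integration.integral_diff)
    finally have 1: "integral A H - integral A (Hk k) < e/2" using k by linarith
    have "integral A (Hk k) \<le> integral A (\<lambda>x. real k)"
      using i A Hk_k by (intro integral_le) (auto intro: integrable_on_const)
    also have "\<dots> = real k * measure lebesgue A"
      using A lmeasure_integral[of A] integral_mult_right[of A "real k" "\<lambda>x. 1"] by simp
    also have "\<dots> \<le> (real k + 1) * measure lebesgue A"
      by (simp add: mult_right_mono)
    also have "\<dots> < e / 2"
      using A(3) by (simp add: field_simps)
    finally show "integral A (\<lambda>x. \<bar>h x\<bar>) < e"
      using 1 unfolding H_def by linarith
  qed
qed

text \<open>The exceptional points satisfy f x < p although arbitrarily short intervals around them
  have mean above q. Vitali's theorem gives disjoint such intervals inside an open set U that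
  exceeds G = {f < p} by little. For their union W, (q - p) times its measure is at most the
  integral of f - p over W, and only W - G can contribute positively to that integral; W - G is so
  small that this stays below (q - p) \<epsilon>.\<close>

lemma Lebesgue_differentiation_aux:
  fixes f :: "real \<Rightarrow> real"
  assumes f: "f absolutely_integrable_on {a..b}" and pq: "p < q"
  shows "negligible {x. a < x \<and> x < b \<and> f x < p \<and>
     (\<forall>d>0. \<exists>c e. c \<le> x \<and> x \<le> e \<and> c < e \<and> e - c < d \<and> q * (e - c) < integral {c..e} f)}"
    (is "negligible ?E")
  unfolding negligible_outer_le
proof (intro allI impI)
  fix \<epsilon> :: real assume \<epsilon>: "\<epsilon> > 0"
  define h where "h x = f x - p" for x
  have h: "h absolutely_integrable_on {a..b}"
    unfolding h_def using f by (intro set_integral_diff) auto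
  obtain \<delta> where \<delta>: "\<delta> > 0"
    "\<And>A. A \<subseteq> {a..b} \<Longrightarrow> A \<in> lmeasurable \<Longrightarrow> measure lebesgue A < \<delta> \<Longrightarrow> integral A (\<lambda>x. \<bar>h x\<bar>) < (q - p) * \<epsilon>"
    using small_integral_on_small_sets[OF h, of "(q - p) * \<epsilon>"] \<epsilon> pq by auto
  define G where "G = {x \<in> {a..b}. f x < p}"
  have "f \<in> borel_measurable (lebesgue_on {a..b})"
    using f by (intro absolutely_integrable_imp_borel_measurable) auto
  then have G: "G \<in> sets lebesgue"
    unfolding G_def borel_measurable_iff_less
    by (auto simp: space_restrict_space sets_restrict_space_iff)
  obtain U where U: "open U" "G \<subseteq> U" "U - G \<in> lmeasurable" "emeasure lebesgue (U - G) < ennreal \<delta>"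
    using sets_lebesgue_outer_open[OF G \<delta>(1)] by blast
  have UG: "measure lebesgue (U - G) < \<delta>"
    using U \<delta>(1) by (simp add: emeasure_eq_measure2 ennreal_less_iff)
  define K where "K = {(c, e). c < e \<and> {c..e} \<subseteq> U \<inter> {a..b} \<and> q * (e - c) < integral {c..e} f}"
  \<comment> \<open>The covering theorem speaks of balls; A and R are the centre and the radius of
    the interval.\<close>
  define A where "A ce = (fst ce + snd ce) / 2" for ce :: "real \<times> real"
  define R where "R ce = (snd ce - fst ce) / 2" for ce :: "real \<times> real"
  have cb: "cball (A ce) (R ce) = {fst ce..snd ce}" for ce
    unfolding A_def R_def cball_eq_atLeastAtMost by (auto simp: field_simps)
  obtain C where C: "countable C" "C \<subseteq> K"
     "pairwise (\<lambda>i j. disjnt (cball (A i) (R i)) (cball (A j) (R j))) C"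
     "negligible (?E - (\<Union>i \<in> C. cball (A i) (R i)))"
  proof (rule Vitali_covering_theorem_cballs[of K R ?E A])
    show "0 < R i" if "i \<in> K" for i using that by (auto simp: K_def R_def)
    fix x d :: real assume x: "x \<in> ?E" and d: "0 < d"
    from x have "a < x" "x < b" "f x < p" by blast+
    then have "x \<in> U \<inter> {a<..<b}" using U(2) unfolding G_def by auto
    moreover have "open (U \<inter> {a<..<b})" using U by auto
    ultimately obtain r where r: "r > 0" "ball x r \<subseteq> U \<inter> {a<..<b}"
      using open_contains_ball by blast
    then obtain c e where ce: "c \<le> x" "x \<le> e" "c < e" "e - c < min d r" "q * (e - c) < integral {c..e} f"
      using x d by (auto dest!: spec[of _ "min d r"])
    have "{c..e} \<subseteq> ball x r" using ce by (auto simp: dist_real_def)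
    then have "{c..e} \<subseteq> U \<inter> {a..b}" using r by (force)
    then have "(c, e) \<in> K" using ce by (auto simp: K_def)
    moreover have "x \<in> cball (A (c, e)) (R (c, e))" using ce cb by auto
    moreover have "R (c,e) < d" using ce d by (auto simp: R_def)
    ultimately show "\<exists>i. i \<in> K \<and> x \<in> cball (A i) (R i) \<and> R i < d" by blast
  qed (use that in blast)
  define D where "D = (\<lambda>i. cball (A i) (R i)) ` C"
  have Dcount: "countable D" using C by (simp add: D_def)
  have pD: "pairwise disjnt D"
    using C(3) unfolding D_def pairwise_image by (auto simp: pairwise_def)
  have Dprop: "\<exists>c e. d = {c..e} \<and> c < e \<and> {c..e} \<subseteq> U \<inter> {a..b} \<and> q * (e - c) < integral {c..e} f" if "d \<in> D" for d
    using that C(2) unfolding D_def K_def cb by fastforce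
  \<comment> \<open>Integrals are added over finitely many intervals; the bound then passes to the
    countable union.\<close>
  have fin: "measure lebesgue (\<Union>D') \<le> \<epsilon>" if D': "D' \<subseteq> D" "finite D'" for D'
  proof -
    define W where "W = \<Union>D'"
    have Wl: "W \<in> lmeasurable" unfolding W_def
      using D' Dprop by (intro fmeasurable.finite_Union) fastforce+
    have Wsub: "W \<subseteq> U \<inter> {a..b}" unfolding W_def using D' Dprop by blast
    have pn: "pairwise (\<lambda>S S'. negligible (S \<inter> S')) D'"
      using pD D'(1) unfolding pairwise_def disjnt_def by (metis negligible_empty subsetD)
    have hW: "(h has_integral (\<Sum>d\<in>D'. integral d h)) W"
      unfolding W_def
    proof (rule has_integral_Union[OF D'(2) _ pn])
      fix S assume "S \<in> D'"
      then obtain c e where ce: "S = {c..e}" "{c..e} \<subseteq> {a..b}" using Dprop D' by blast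
      have "h absolutely_integrable_on S" unfolding ce(1)
        by (rule absolutely_integrable_subset[OF h ce(2)]) simp
      then show "(h has_integral integral S h) S"
        by (intro integrable_integral set_lebesgue_integral_eq_integral(1))
    qed
    have mW: "((\<lambda>x. 1::real) has_integral (\<Sum>d\<in>D'. measure lebesgue d)) W"
      unfolding W_def
    proof (rule has_integral_Union[OF D'(2) _ pn])
      fix S assume "S \<in> D'"
      then obtain c e where ce: "S = {c..e}" "c < e" using Dprop D' by blast
      then show "((\<lambda>x. 1::real) has_integral measure lebesgue S) S"
        using has_integral_const_real[of "1::real" c e] by simp
    qed
    then have mWs: "measure lebesgue W = (\<Sum>d\<in>D'. measure lebesgue d)"
      using lmeasure_integral[OF Wl] by (simp add: has_integral_iff)
    have "(q - p) * measure lebesgue W = (\<Sum>d\<in>D'. (q - p) * measure lebesgue d)"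
      by (simp add: mWs sum_distrib_left)
    also have "\<dots> \<le> (\<Sum>d\<in>D'. integral d h)"
    proof (rule sum_mono)
      fix d assume "d \<in> D'"
      then obtain c e where ce: "d = {c..e}" "c < e" "{c..e} \<subseteq> {a..b}" "q * (e - c) < integral {c..e} f" using Dprop D' by blast
      have "f absolutely_integrable_on {c..e}"
        by (rule absolutely_integrable_subset[OF f ce(3)]) simp
      then have "f integrable_on {c..e}" by (rule set_lebesgue_integral_eq_integral(1))
      then have "integral {c..e} h = integral {c..e} f - p * (e - c)"
        unfolding h_def using ce by (subst Henstock_Kurzweil_Integration.integral_diff) auto
      then show "(q - p) * measure lebesgue d \<le> integral d h"
        using ce by (simp add: algebra_simps)
    qed
    also have "\<dots> = integral W h" using hW by (simp add: has_integral_iff)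
    also have "\<dots> \<le> integral W (\<lambda>x. if x \<in> W - G then \<bar>h x\<bar> else 0)"
    proof (rule integral_le)
      show "h integrable_on W" using hW by blast
      have "(\<lambda>x. \<bar>h x\<bar>) absolutely_integrable_on (W - G)"
        using h Wsub Wl G by (intro set_integrable_abs absolutely_integrable_subset[OF h]) (auto intro: fmeasurableD)
      then have "(\<lambda>x. \<bar>h x\<bar>) integrable_on (W - G)"
        by (simp add: set_lebesgue_integral_eq_integral)
      then show "(\<lambda>x. if x \<in> W - G then \<bar>h x\<bar> else 0) integrable_on W"
        by (subst integrable_restrict_Int) (simp add: Int_absorb2 Diff_subset)
      show "h x \<le> (if x \<in> W - G then \<bar>h x\<bar> else 0)" if "x \<in> W" for x
        using that by (auto simp: G_def h_def)
    qed
    also have "\<dots> = integral (W - G) (\<lambda>x. \<bar>h x\<bar>)"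
      by (subst integral_restrict_Int) (simp add: Int_absorb1 inf_commute)
    also have "\<dots> < (q - p) * \<epsilon>"
    proof (rule \<delta>(2))
      show "W - G \<subseteq> {a..b}" using Wsub by auto
      show "W - G \<in> lmeasurable" by (rule fmeasurable_Diff[OF Wl G])
      then have "measure lebesgue (W - G) \<le> measure lebesgue (U - G)"
        using Wsub U(3) by (intro measure_mono_fmeasurable) (auto intro: fmeasurableD)
      then show "measure lebesgue (W - G) < \<delta>"
        using UG by linarith
    qed
    finally have "(q - p) * measure lebesgue W < (q - p) * \<epsilon>" .
    then show ?thesis using pq unfolding W_def[symmetric] mult_less_cancel_left by linarith
  qed
  have Dl: "d \<in> lmeasurable" if "d \<in> D" for d
  proof -
    obtain c e where "d = {c..e}" using Dprop[OF \<open>d \<in> D\<close>] by blast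
    then show ?thesis by simp
  qed
  have DU: "\<Union>D \<in> lmeasurable" "measure lebesgue (\<Union>D) \<le> \<epsilon>"
    using fmeasurable_Union_bound[OF Dcount, of lebesgue \<epsilon>] measure_Union_bound[OF Dcount, of lebesgue \<epsilon>] Dl fin
    by blast+
  show "\<exists>T. ?E \<subseteq> T \<and> T \<in> lmeasurable \<and> measure lebesgue T \<le> \<epsilon>"
  proof (intro exI conjI)
    let ?N = "?E - (\<Union>i \<in> C. cball (A i) (R i))"
    show "?E \<subseteq> \<Union>D \<union> ?N" by (auto simp: D_def)
    have "?N \<in> lmeasurable" using C(4) negligible_imp_measurable by blast
    then show "\<Union>D \<union> ?N \<in> lmeasurable" using DU by blast
    have "measure lebesgue (\<Union>D \<union> ?N) \<le> measure lebesgue (\<Union>D) + measure lebesgue ?N"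
      using DU \<open>?N \<in> lmeasurable\<close> by (intro measure_Un_le) auto
    also have "\<dots> \<le> \<epsilon>" using DU C(4) by (simp add: negligible_imp_measure0)
    finally show "measure lebesgue (\<Union>D \<union> ?N) \<le> \<epsilon>" .
  qed
qed


text \<open>If the means around x do not converge to f x, some rational pair p < q separates f x
  from them, for f or for - f. This is a countable union of null sets.\<close>

theorem Lebesgue_differentiation:
  fixes f :: "real \<Rightarrow> real"
  assumes f: "f absolutely_integrable_on {a..b}"
  shows "AE x in lebesgue. a < x \<and> x < b \<longrightarrow> ((\<lambda>x. integral {a..x} f) has_real_derivative f x) (at x)"
proof -
  define E where "E g p q = {x. a < x \<and> x < b \<and> g x < p \<and>
     (\<forall>d>0. \<exists>c e. c \<le> x \<and> x \<le> e \<and> c < e \<and> e - c < d \<and> q * (e - c) < integral {c..e} g)}"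
    for g :: "real \<Rightarrow> real" and p q
  have E: "negligible (E g p q)" if "g absolutely_integrable_on {a..b}" "p < q" for g p q
    unfolding E_def using Lebesgue_differentiation_aux[OF that] .
  have f': "(\<lambda>x. - f x) absolutely_integrable_on {a..b}"
    using f by (simp add: set_integrable_def)
  define PQ where "PQ = {(p, q). p \<in> \<rat> \<and> q \<in> \<rat> \<and> p < (q::real)}"
  have "countable PQ"
    by (rule countable_subset[of _ "\<rat> \<times> \<rat>"]) (auto simp: PQ_def countable_rat)
  define N where "N = \<Union>((\<lambda>(p,q). E f p q \<union> E (\<lambda>x. - f x) p q) ` PQ)"
  have "negligible N"
    unfolding N_def using \<open>countable PQ\<close> E[OF f] E[OF f']
    by (intro negligible_countable_Union) (auto simp: PQ_def intro!: negligible_Un)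
  have upper: "\<exists>d>0. \<forall>c e. c \<le> x \<and> x \<le> e \<and> c < e \<and> e - c < d \<longrightarrow> integral {c..e} g \<le> (g x + \<epsilon>) * (e - c)"
    if x: "a < x" "x < b" "\<And>p q. (p, q) \<in> PQ \<Longrightarrow> x \<notin> E g p q" and \<epsilon>: "\<epsilon> > 0" for x g \<epsilon>
  proof -
    obtain p where p: "p \<in> \<rat>" "g x < p" "p < g x + \<epsilon>/2"
      using Rats_dense_in_real[of "g x" "g x + \<epsilon>/2"] \<epsilon> by auto
    obtain q where q: "q \<in> \<rat>" "g x + \<epsilon>/2 < q" "q < g x + \<epsilon>"
      using Rats_dense_in_real[of "g x + \<epsilon>/2" "g x + \<epsilon>"] \<epsilon> by auto
    have "x \<notin> E g p q" using x(3)[of p q] p q by (simp add: PQ_def)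
    then obtain d where d: "d > 0" "\<And>c e. c \<le> x \<Longrightarrow> x \<le> e \<Longrightarrow> c < e \<Longrightarrow> e - c < d \<Longrightarrow> integral {c..e} g \<le> q * (e - c)"
      using x(1,2) p(2) unfolding E_def mem_Collect_eq not_le[symmetric] by blast
    show ?thesis
    proof (intro exI[of _ d] conjI allI impI)
      fix c e assume "c \<le> x \<and> x \<le> e \<and> c < e \<and> e - c < d"
      then have "integral {c..e} g \<le> q * (e - c)" "0 \<le> e - c" using d by auto
      then show "integral {c..e} g \<le> (g x + \<epsilon>) * (e - c)"
        using q by (meson less_imp_le mult_right_mono order_trans)
    qed (use d in auto)
  qed
  have main: "((\<lambda>x. integral {a..x} f) has_real_derivative f x) (at x)"
    if x: "a < x" "x < b" "x \<notin> N" for x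
    unfolding has_field_derivative_iff
  proof (rule LIM_I)
    fix \<epsilon> :: real assume "\<epsilon> > 0"
    then have \<epsilon>: "\<epsilon>/2 > 0" by simp
    have nE: "x \<notin> E f p q" "x \<notin> E (\<lambda>x. - f x) p q" if "(p, q) \<in> PQ" for p q
      using x(3) that unfolding N_def by blast+
    obtain d1 where d1: "d1 > 0" "\<And>c e. c \<le> x \<Longrightarrow> x \<le> e \<Longrightarrow> c < e \<Longrightarrow> e - c < d1 \<Longrightarrow> integral {c..e} f \<le> (f x + \<epsilon>/2) * (e - c)"
      using upper[OF x(1,2) nE(1) \<epsilon>] by blast
    obtain d2 where d2: "d2 > 0" "\<And>c e. c \<le> x \<Longrightarrow> x \<le> e \<Longrightarrow> c < e \<Longrightarrow> e - c < d2 \<Longrightarrow> integral {c..e} (\<lambda>x. - f x) \<le> (- f x + \<epsilon>/2) * (e - c)"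
      using upper[OF x(1,2) nE(2) \<epsilon>] by blast
    have bd: "\<bar>integral {c..e} f - f x * (e - c)\<bar> \<le> \<epsilon>/2 * (e - c)"
      if "c \<le> x" "x \<le> e" "c < e" "e - c < min d1 d2" for c e
    proof -
      define A where "A = integral {c..e} f"
      have "A \<le> (f x + \<epsilon>/2) * (e - c)" "- A \<le> (- f x + \<epsilon>/2) * (e - c)"
        using d1(2)[of c e] d2(2)[of c e] that by (simp_all add: A_def)
      then show ?thesis unfolding A_def[symmetric] distrib_right by linarith
    qed
    have add: "integral {a..e} f - integral {a..c} f = integral {c..e} f" if "a \<le> c" "c \<le> e" "e \<le> b" for c e
    proof -
      have "f integrable_on {a..e}"
        using that by (rule_tac absolutely_integrable_subinterval(2)[OF f]) auto
      then show ?thesis using Henstock_Kurzweil_Integration.integral_combine[of a c e f] that by simp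
    qed
    show "\<exists>s>0. \<forall>y. y \<noteq> x \<and> norm (y - x) < s \<longrightarrow>
        norm ((integral {a..y} f - integral {a..x} f) / (y - x) - f x) < \<epsilon>"
    proof (intro exI[of _ "Min {d1, d2, x - a, b - x}"] conjI allI impI)
      show "0 < Min {d1, d2, x - a, b - x}" using d1 d2 x by simp
      fix y assume y: "y \<noteq> x \<and> norm (y - x) < Min {d1, d2, x - a, b - x}"
      have eq: "(A / D - F) = (A - F * D) / D" if "D \<noteq> 0" for A D F :: real
        using that by (simp add: field_simps)
      have "\<bar>(integral {a..y} f - integral {a..x} f) - f x * (y - x)\<bar> \<le> \<epsilon>/2 * \<bar>y - x\<bar>"
      proof (cases "x < y")
        case True
        then show ?thesis using add[of x y] bd[of x y] y x by auto
      next
        case False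
        then show ?thesis using add[of y x] bd[of y x] y x by (auto simp: algebra_simps abs_minus_commute)
      qed
      also have "\<dots> < \<epsilon> * \<bar>y - x\<bar>" using y \<open>\<epsilon> > 0\<close> by simp
      finally show "norm ((integral {a..y} f - integral {a..x} f) / (y - x) - f x) < \<epsilon>"
        using y by (simp add: eq abs_divide pos_divide_less_eq)
    qed
  qed
  show ?thesis
    using main AE_not_in[of N lebesgue] \<open>negligible N\<close> unfolding negligible_iff_null_sets
    by (auto elim!: eventually_mono)
qed

text \<open>Absolute continuity in integral form. The density is a parameter, so that an equation
  for a derivative becomes an equation between densities. \<open>ac_primitive_iff\<close> relates
  this to the \<epsilon>-\<delta> definition.\<close>

definition ac_primitive :: "(real \<Rightarrow> real) \<Rightarrow> (real \<Rightarrow> real) \<Rightarrow> real \<Rightarrow> real \<Rightarrow> bool" where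
  "ac_primitive F f a b \<longleftrightarrow>
     f absolutely_integrable_on {a..b} \<and> (\<forall>x\<in>{a..b}. F x = F a + integral {a..x} f)"

lemma ac_primitiveD:
  assumes "ac_primitive F f a b"
  shows "f absolutely_integrable_on {a..b}"
    and "a \<le> x \<Longrightarrow> x \<le> y \<Longrightarrow> y \<le> b \<Longrightarrow> integral {x..y} f = F y - F x"
proof -
  show ai: "f absolutely_integrable_on {a..b}" using assms by (simp add: ac_primitive_def)
  assume xy: "a \<le> x" "x \<le> y" "y \<le> b"
  have "f integrable_on {a..y}"
    using xy by (rule_tac absolutely_integrable_subinterval(2)[OF ai]) auto
  then show "integral {x..y} f = F y - F x"
    using Henstock_Kurzweil_Integration.integral_combine[of a x y f] xy
      assms[unfolded ac_primitive_def, THEN conjunct2, THEN bspec, of x]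
      assms[unfolded ac_primitive_def, THEN conjunct2, THEN bspec, of y] by auto
qed

lemma ac_primitiveI:
  assumes "f absolutely_integrable_on {a..b}" "\<And>x. a \<le> x \<Longrightarrow> x \<le> b \<Longrightarrow> F x - F a = integral {a..x} f"
  shows "ac_primitive F f a b"
  unfolding ac_primitive_def
proof (intro conjI ballI assms(1))
  show "F x = F a + integral {a..x} f" if "x \<in> {a..b}" for x
    using assms(2)[of x] that by simp
qed

lemma ac_primitive_subinterval:
  assumes F: "ac_primitive F f a b" and cd: "a \<le> c" "d \<le> b"
  shows "ac_primitive F f c d"
proof (rule ac_primitiveI)
  show "f absolutely_integrable_on {c..d}"
    by (rule absolutely_integrable_subinterval(1)[OF ac_primitiveD(1)[OF F] cd])
  show "F x - F c = integral {c..x} f" if "c \<le> x" "x \<le> d" for x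
    using ac_primitiveD(2)[OF F, of c x] that cd by simp
qed

lemma ac_primitive_has_derivative:
  assumes F: "ac_primitive F f a b"
  shows "AE x in lebesgue. a < x \<and> x < b \<longrightarrow> (F has_real_derivative f x) (at x)"
  using Lebesgue_differentiation[OF ac_primitiveD(1)[OF F]]
proof (rule AE_mp, intro AE_I2 impI)
  fix x assume *: "a < x \<and> x < b \<longrightarrow> ((\<lambda>x. integral {a..x} f) has_real_derivative f x) (at x)" and x: "a < x \<and> x < b"
  have "((\<lambda>x. F a + integral {a..x} f) has_real_derivative f x) (at x)"
    using * x by (auto intro!: derivative_eq_intros)
  moreover have "eventually (\<lambda>y. y \<in> {a<..<b}) (nhds x)"
    using x by (intro eventually_nhds_in_open) auto
  then have "eventually (\<lambda>y. F a + integral {a..y} f = F y) (nhds x)"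
    by eventually_elim (use ac_primitiveD(2)[OF F, of a] in auto)
  ultimately show "(F has_real_derivative f x) (at x)"
    using DERIV_cong_ev[of x x "\<lambda>x. F a + integral {a..x} f" F "f x" "f x"] by simp
qed

lemma ac_primitive_continuous:
  assumes F: "ac_primitive F f a b"
  shows "continuous_on {a..b} F"
proof -
  have "continuous_on {a..b} (\<lambda>x. F a + integral {a..x} f)"
    using ac_primitiveD(1)[OF F]
    by (intro continuous_intros indefinite_integral_continuous_1 set_lebesgue_integral_eq_integral(1))
  then show ?thesis
    by (rule continuous_on_eq) (use ac_primitiveD(2)[OF F, of a] in auto)
qed

section \<open>Nonoverlapping families of intervals and the variation\<close>

definition nonoverlapping :: "real \<Rightarrow> real \<Rightarrow> (real \<times> real) set \<Rightarrow> bool" where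
  "nonoverlapping a b D \<longleftrightarrow> finite D \<and> (\<forall>(x, y)\<in>D. a \<le> x \<and> x \<le> y \<and> y \<le> b) \<and>
     disjoint_family_on (\<lambda>(x, y). {x<..<y}) D"

definition increments :: "(real \<Rightarrow> real) \<Rightarrow> (real \<times> real) set \<Rightarrow> real" where
  "increments u D = (\<Sum>(x, y)\<in>D. \<bar>u y - u x\<bar>)"

definition mesh :: "(real \<times> real) set \<Rightarrow> real" where
  "mesh D = (\<Sum>(x, y)\<in>D. y - x)"

lemma absolutely_continuous_on_Icc_iff:
  "absolutely_continuous_on_Icc u a b \<longleftrightarrow>
     (\<forall>e>0. \<exists>d>0. \<forall>D. nonoverlapping a b D \<and> mesh D < d \<longrightarrow> increments u D < e)"
  unfolding absolutely_continuous_on_Icc_def nonoverlapping_def increments_def mesh_def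
  by (simp add: conj_assoc)

lemma nonoverlappingD:
  assumes "nonoverlapping a b D" "(x, y) \<in> D"
  shows "a \<le> x" "x \<le> y" "y \<le> b"
  using assms by (auto simp: nonoverlapping_def)

lemma nonoverlapping_subset:
  assumes "nonoverlapping a b D" "E \<subseteq> D" "a' \<le> a" "b \<le> b'"
  shows "nonoverlapping a' b' E"
  using assms unfolding nonoverlapping_def
  by (auto intro: finite_subset disjoint_family_on_mono) fastforce+

lemma nonoverlapping_eq:
  assumes "nonoverlapping a b D" "(x, y) \<in> D" "(x', y') \<in> D" "z \<in> {x<..<y}" "z \<in> {x'<..<y'}"
  shows "(x, y) = (x', y')"
  using assms unfolding nonoverlapping_def disjoint_family_on_def by fastforce

lemma increments_nonneg: "0 \<le> increments u D"
  unfolding increments_def by (intro sum_nonneg) auto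

lemma mesh_le_measure:
  assumes D: "nonoverlapping a b D" and T: "T \<in> lmeasurable" "\<And>x y. (x, y) \<in> D \<Longrightarrow> {x<..<y} \<subseteq> T"
  shows "mesh D \<le> measure lebesgue T"
proof -
  have fin: "finite D" using D by (simp add: nonoverlapping_def)
  have "mesh D = (\<Sum>p\<in>D. measure lebesgue ((\<lambda>(x,y). {x<..<y}) p))"
    unfolding mesh_def using nonoverlappingD[OF D] by (intro sum.cong) auto
  also have "\<dots> = measure lebesgue (\<Union>p\<in>D. (\<lambda>(x,y). {x<..<y}) p)"
    using D fin by (intro measure_finite_Union[symmetric]) (auto simp: nonoverlapping_def)
  also have "\<dots> \<le> measure lebesgue T"
  proof (rule measure_mono_fmeasurable[OF _ _ T(1)])
    show "(\<Union>p\<in>D. case p of (x, y) \<Rightarrow> {x<..<y}) \<subseteq> T" using T(2) by blast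
    show "(\<Union>p\<in>D. case p of (x, y) \<Rightarrow> {x<..<y}) \<in> sets lebesgue" using fin by (intro sets.finite_UN) auto
  qed
  finally show ?thesis .
qed

lemma mesh_le:
  assumes D: "nonoverlapping a b D" and ab: "a \<le> b"
  shows "mesh D \<le> b - a"
proof -
  have "{x<..<y} \<subseteq> {a..b}" if "(x, y) \<in> D" for x y
    using nonoverlappingD[OF D that] by auto
  then have "mesh D \<le> measure lebesgue {a..b}" by (intro mesh_le_measure[OF D]) auto
  then show ?thesis using ab by simp
qed

lemma nonoverlapping_insert:
  assumes D: "nonoverlapping a x D" and xy: "x < y" "a \<le> x"
  shows "nonoverlapping a y (insert (x, y) D)" "(x, y) \<notin> D"
proof -
  show "(x, y) \<notin> D" using nonoverlappingD[OF D] xy by fastforce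
  have "{s<..<t} \<inter> {x<..<y} = {}" if "(s, t) \<in> D" for s t
    using nonoverlappingD[OF D that] by auto
  then show "nonoverlapping a y (insert (x, y) D)"
    using D xy unfolding nonoverlapping_def disjoint_family_on_def by fastforce
qed

text \<open>Each interval is cut at x. Degenerate intervals are dropped first: then a piece
  determines its interval, because members sharing an interior point coincide, and the sums over the
  pieces can be reindexed.\<close>

lemma nonoverlapping_split:
  assumes D: "nonoverlapping a b D" and x: "a \<le> x" "x \<le> b"
  obtains D1 D2 where "nonoverlapping a x D1" "nonoverlapping x b D2"
    "increments u D \<le> increments u D1 + increments u D2"
proof -
  have fin: "finite D" using D by (simp add: nonoverlapping_def)
  define L where "L = {p \<in> D. fst p < snd p \<and> fst p < x}"
  define R where "R = {p \<in> D. fst p < snd p \<and> x < snd p}"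
  define l where "l p = (fst p, min (snd p) x)" for p :: "real \<times> real"
  define r where "r p = (max (fst p) x, snd p)" for p :: "real \<times> real"
  have LR: "finite L" "finite R" "L \<subseteq> D" "R \<subseteq> D" using fin by (auto simp: L_def R_def)
  have eq: "p = p'" if "p \<in> D" "p' \<in> D" "z \<in> {fst p<..<snd p}" "z \<in> {fst p'<..<snd p'}" for p p' z
    using nonoverlapping_eq[OF D, of "fst p" "snd p" "fst p'" "snd p'" z] that by (simp add: prod_eq_iff)
  have injl: "inj_on l L"
  proof (rule inj_onI)
    fix p p' assume *: "p \<in> L" "p' \<in> L" "l p = l p'"
    then have "fst p = fst p'" "min (snd p) x = min (snd p') x" by (auto simp: l_def)
    moreover obtain z where "fst p < z" "z < min (snd p) x"
      using * dense[of "fst p" "min (snd p) x"] by (auto simp: L_def)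
    ultimately show "p = p'" using * eq[of p p' z] by (auto simp: L_def)
  qed
  have injr: "inj_on r R"
  proof (rule inj_onI)
    fix p p' assume *: "p \<in> R" "p' \<in> R" "r p = r p'"
    then have "snd p = snd p'" "max (fst p) x = max (fst p') x" by (auto simp: r_def)
    moreover obtain z where "z < snd p" "max (fst p) x < z"
      using * dense[of "max (fst p) x" "snd p"] by (auto simp: R_def)
    ultimately show "p = p'" using * eq[of p p' z] by (auto simp: R_def)
  qed
  have "nonoverlapping a x (l ` L)"
    unfolding nonoverlapping_def
  proof (intro conjI)
    show "finite (l ` L)" using LR by simp
    show "\<forall>(s, t)\<in>l ` L. a \<le> s \<and> s \<le> t \<and> t \<le> x"
      using nonoverlappingD(1)[OF D] by (fastforce simp: L_def l_def)
    show "disjoint_family_on (\<lambda>(x, y). {x<..<y}) (l ` L)"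
      unfolding disjoint_family_on_def
    proof (intro ballI impI)
      fix m n assume "m \<in> l ` L" "n \<in> l ` L" and ne: "m \<noteq> n"
      then obtain p p' where pp: "p \<in> L" "p' \<in> L" "m = l p" "n = l p'" by auto
      then have "p \<noteq> p'" using ne by auto
      then have "{fst p<..<snd p} \<inter> {fst p'<..<snd p'} = {}"
        using eq[of p p'] pp LR by blast
      then show "(case m of (x, y) \<Rightarrow> {x<..<y}) \<inter> (case n of (x, y) \<Rightarrow> {x<..<y}) = {}"
        unfolding pp(3,4) l_def by auto
    qed
  qed
  moreover have "nonoverlapping x b (r ` R)"
    unfolding nonoverlapping_def
  proof (intro conjI)
    show "finite (r ` R)" using LR by simp
    show "\<forall>(s, t)\<in>r ` R. x \<le> s \<and> s \<le> t \<and> t \<le> b"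
      using nonoverlappingD(3)[OF D] by (fastforce simp: R_def r_def)
    show "disjoint_family_on (\<lambda>(x, y). {x<..<y}) (r ` R)"
      unfolding disjoint_family_on_def
    proof (intro ballI impI)
      fix m n assume "m \<in> r ` R" "n \<in> r ` R" and ne: "m \<noteq> n"
      then obtain p p' where pp: "p \<in> R" "p' \<in> R" "m = r p" "n = r p'" by auto
      then have "p \<noteq> p'" using ne by auto
      then have "{fst p<..<snd p} \<inter> {fst p'<..<snd p'} = {}"
        using eq[of p p'] pp LR by blast
      then show "(case m of (x, y) \<Rightarrow> {x<..<y}) \<inter> (case n of (x, y) \<Rightarrow> {x<..<y}) = {}"
        unfolding pp(3,4) r_def by auto
    qed
  qed
  moreover have "increments u D \<le> increments u (l ` L) + increments u (r ` R)"
  proof -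
    have sl: "increments u (l ` L) = (\<Sum>p\<in>D. if p \<in> L then \<bar>u (min (snd p) x) - u (fst p)\<bar> else 0)"
      unfolding increments_def using fin LR
      by (subst sum.reindex[OF injl]) (simp add: l_def case_prod_beta o_def sum.If_cases Int_absorb1)
    have sr: "increments u (r ` R) = (\<Sum>p\<in>D. if p \<in> R then \<bar>u (snd p) - u (max (fst p) x)\<bar> else 0)"
      unfolding increments_def using fin LR
      by (subst sum.reindex[OF injr]) (simp add: r_def case_prod_beta o_def sum.If_cases Int_absorb1)
    show ?thesis
      unfolding sl sr sum.distrib[symmetric] unfolding increments_def
    proof (rule sum_mono)
      fix p assume "p \<in> D"
      obtain s t where p: "p = (s, t)" by (cases p)
      have "s \<le> t" using nonoverlappingD[OF D] \<open>p \<in> D\<close> p by auto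
      then show "(case p of (x, y) \<Rightarrow> \<bar>u y - u x\<bar>) \<le> (if p \<in> L then \<bar>u (min (snd p) x) - u (fst p)\<bar> else 0) +
          (if p \<in> R then \<bar>u (snd p) - u (max (fst p) x)\<bar> else 0)"
        using \<open>p \<in> D\<close> unfolding p by (cases "s = t") (auto simp: L_def R_def min_def max_def)
    qed
  qed
  ultimately show thesis using that by blast
qed

definition variation :: "(real \<Rightarrow> real) \<Rightarrow> real \<Rightarrow> real \<Rightarrow> real" where
  "variation u a b = Sup {increments u D | D. nonoverlapping a b D}"

lemma nonoverlapping_empty [simp]: "nonoverlapping a b {}"
  by (simp add: nonoverlapping_def disjoint_family_on_def)

text \<open>Advance in steps of length d/2, where d belongs to e = 1: a family inside one step has
  mesh below d and adds less than 1.\<close>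

lemma increments_bounded:
  assumes u: "absolutely_continuous_on_Icc u a b" and ab: "a \<le> b"
  shows "\<exists>B. \<forall>D. nonoverlapping a b D \<longrightarrow> increments u D \<le> B"
proof -
  obtain d where d: "d > 0" "\<And>D. nonoverlapping a b D \<Longrightarrow> mesh D < d \<Longrightarrow> increments u D < 1"
    using u unfolding absolutely_continuous_on_Icc_iff by (meson zero_less_one)
  have *: "\<forall>D. nonoverlapping a (min b (a + real k * (d/2))) D \<longrightarrow> increments u D \<le> real k" for k
  proof (induction k)
    case 0
    show ?case
    proof (intro allI impI)
      fix D assume D: "nonoverlapping a (min b (a + real 0 * (d/2))) D"
      have "increments u D = (\<Sum>p\<in>D. 0)"
        unfolding increments_def
      proof (rule sum.cong)
        fix p assume p: "p \<in> D"
        obtain s t where "p = (s, t)" by (cases p)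
        then show "(case p of (x, y) \<Rightarrow> \<bar>u y - u x\<bar>) = 0"
          using nonoverlappingD[OF D, of s t] p ab by (cases "s = t") auto
      qed simp
      then show "increments u D \<le> real 0" by simp
    qed
  next
    case (Suc k)
    show ?case
    proof (intro allI impI)
      fix D assume D: "nonoverlapping a (min b (a + real (Suc k) * (d/2))) D"
      let ?x = "min b (a + real k * (d/2))" and ?y = "min b (a + real (Suc k) * (d/2))"
      have xy: "a \<le> ?x" "?x \<le> ?y" "?y - ?x \<le> d/2" "?y \<le> b" proof -
        have "0 \<le> real k * (d/2)" using d(1) by (intro mult_nonneg_nonneg) auto
        moreover have "real (Suc k) * (d/2) = real k * (d/2) + d/2" by (simp add: field_simps)
        ultimately show "a \<le> ?x" "?x \<le> ?y" "?y - ?x \<le> d/2" "?y \<le> b" using d(1) ab by linarith+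
      qed
      obtain D1 D2 where DD: "nonoverlapping a ?x D1" "nonoverlapping ?x ?y D2"
        "increments u D \<le> increments u D1 + increments u D2"
        using nonoverlapping_split[OF D xy(1,2)] by metis
      have "mesh D2 < d" using mesh_le[OF DD(2) xy(2)] xy d(1) by linarith
      moreover have "nonoverlapping a b D2"
        by (rule nonoverlapping_subset[OF DD(2) subset_refl xy(1) xy(4)])
      ultimately have "increments u D2 < 1" by (intro d)
      then show "increments u D \<le> real (Suc k)" using DD Suc.IH by fastforce
    qed
  qed
  obtain k where "b - a \<le> real k * (d/2)"
    using d(1) real_arch_simple[of "(b - a) / (d/2)"] by (auto simp: field_simps)
  then have "min b (a + real k * (d/2)) = b" by simp
  then show ?thesis using *[of k] by auto
qed

lemma absolutely_continuous_on_Icc_subset: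
  assumes "absolutely_continuous_on_Icc u a b" "a \<le> c" "d \<le> b"
  shows "absolutely_continuous_on_Icc u c d"
  using assms unfolding absolutely_continuous_on_Icc_iff
  by (meson nonoverlapping_subset order_refl)

lemma increments_le_variation:
  assumes u: "absolutely_continuous_on_Icc u a b" and D: "nonoverlapping a b D"
  shows "increments u D \<le> variation u a b"
proof (cases "a \<le> b")
  case True
  then obtain B where "\<forall>D. nonoverlapping a b D \<longrightarrow> increments u D \<le> B"
    using increments_bounded[OF u] by blast
  then have "bdd_above {increments u D | D. nonoverlapping a b D}"
    by (auto simp: bdd_above_def)
  then show ?thesis
    unfolding variation_def using D by (intro cSup_upper) auto
next
  case False
  then have "nonoverlapping a b D \<longleftrightarrow> D = {}" for D
    by (force simp: nonoverlapping_def disjoint_family_on_def)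
  then show ?thesis using D by (simp add: variation_def)
qed

lemma variation_le:
  assumes "\<And>D. nonoverlapping a b D \<Longrightarrow> increments u D \<le> B"
  shows "variation u a b \<le> B"
  unfolding variation_def using assms
  by (intro cSup_least) (auto intro!: exI[of _ "{}"])

lemma variation_approx:
  assumes "e > 0"
  obtains D where "nonoverlapping a b D" "variation u a b - e < increments u D"
proof -
  have "\<exists>y\<in>{increments u D | D. nonoverlapping a b D}. variation u a b - e < y"
    using assms unfolding variation_def by (intro less_cSupD) (auto intro!: exI[of _ "{}"])
  then show thesis using that by auto
qed

lemma variation_add_le:
  assumes u: "absolutely_continuous_on_Icc u a b" and x: "a \<le> x" "x \<le> b"
  shows "variation u a b \<le> variation u a x + variation u x b"
proof (rule variation_le)
  fix D assume D: "nonoverlapping a b D"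
  obtain D1 D2 where DD: "nonoverlapping a x D1" "nonoverlapping x b D2"
    "increments u D \<le> increments u D1 + increments u D2"
    using nonoverlapping_split[OF D x] by metis
  then show "increments u D \<le> variation u a x + variation u x b"
    using increments_le_variation[OF absolutely_continuous_on_Icc_subset[OF u, of a x]]
      increments_le_variation[OF absolutely_continuous_on_Icc_subset[OF u, of x b]] x by fastforce
qed

lemma variation_increment:
  assumes u: "absolutely_continuous_on_Icc u a b" and xy: "a \<le> x" "x \<le> y" "y \<le> b"
  shows "variation u a x + \<bar>u y - u x\<bar> \<le> variation u a y"
proof (cases "x = y")
  case False
  have "variation u a x \<le> variation u a y - \<bar>u y - u x\<bar>"
  proof (rule variation_le)
    fix D assume D: "nonoverlapping a x D"
    then have I: "nonoverlapping a y (insert (x, y) D)" "(x, y) \<notin> D"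
      using nonoverlapping_insert False xy by auto
    have "increments u (insert (x, y) D) = \<bar>u y - u x\<bar> + increments u D"
      using D I(2) by (simp add: increments_def nonoverlapping_def)
    then show "increments u D \<le> variation u a y - \<bar>u y - u x\<bar>"
      using increments_le_variation[OF absolutely_continuous_on_Icc_subset[OF u, of a y] I(1)] xy by simp
  qed
  then show ?thesis by simp
qed simp

text \<open>In every interval of D insert a family that almost attains the variation there. Together
  these form one nonoverlapping family whose mesh is at most that of D, so the d that u has for e/2
  serves for the variation.\<close>

lemma absolutely_continuous_variation:
  assumes u: "absolutely_continuous_on_Icc u a b"
  shows "absolutely_continuous_on_Icc (variation u a) a b"
  unfolding absolutely_continuous_on_Icc_iff
proof (intro allI impI)
  fix e :: real assume e: "e > 0"
  then obtain d where d: "d > 0" "\<And>D. nonoverlapping a b D \<Longrightarrow> mesh D < d \<Longrightarrow> increments u D < e/2"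
    using u unfolding absolutely_continuous_on_Icc_iff by (meson half_gt_zero)
  show "\<exists>d>0. \<forall>D. nonoverlapping a b D \<and> mesh D < d \<longrightarrow> increments (variation u a) D < e"
  proof (intro exI[of _ d] conjI allI impI d(1))
    fix D assume "nonoverlapping a b D \<and> mesh D < d"
    then have D: "nonoverlapping a b D" "mesh D < d" "finite D" by (auto simp: nonoverlapping_def)
    \<comment> \<open>One error \<eta> per interval of D, in total at most e/2; the + 1 covers empty
      D.\<close>
    define \<eta> where "\<eta> = e / (2 * (real (card D) + 1))"
    have \<eta>: "\<eta> > 0" using e by (simp add: \<eta>_def)
    have "\<forall>p. \<exists>E. nonoverlapping (fst p) (snd p) E \<and> variation u (fst p) (snd p) - \<eta> < increments u E"
      using variation_approx[OF \<eta>] by metis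
    then obtain S where S: "\<And>p. nonoverlapping (fst p) (snd p) (S p)"
      "\<And>p. variation u (fst p) (snd p) - \<eta> < increments u (S p)" by metis
    \<comment> \<open>A degenerate pair at a common endpoint could lie in two of the families;
      without such pairs the families are disjoint.\<close>
    define S' where "S' p = {q \<in> S p. fst q < snd q}" for p
    have fS: "finite (S p)" for p using S(1) by (simp add: nonoverlapping_def)
    then have fS': "finite (S' p)" for p by (simp add: S'_def)
    have nS': "nonoverlapping (fst p) (snd p) (S' p)" for p
      by (rule nonoverlapping_subset[OF S(1)]) (auto simp: S'_def)
    have incS': "increments u (S' p) = increments u (S p)" for p
      unfolding increments_def
    proof (rule sum.mono_neutral_left[OF fS])
      show "S' p \<subseteq> S p" by (auto simp: S'_def)
      show "\<forall>i\<in>S p - S' p. (case i of (x, y) \<Rightarrow> \<bar>u y - u x\<bar>) = 0"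
      proof
        fix q assume q: "q \<in> S p - S' p"
        then have "fst q \<le> snd q" using nonoverlappingD(2)[OF S(1), of "fst q" "snd q" p] by simp
        then have "fst q = snd q" using q by (auto simp: S'_def)
        then show "(case q of (x, y) \<Rightarrow> \<bar>u y - u x\<bar>) = 0" by (simp add: case_prod_beta)
      qed
    qed
    have Sin: "fst p \<le> fst q \<and> fst q < snd q \<and> snd q \<le> snd p" if "q \<in> S' p" for p q
      using that nonoverlappingD[OF nS', of "fst q" "snd q" p] by (auto simp: S'_def)
    have disj: "p = p' \<and> q = q'" if pq: "p \<in> D" "p' \<in> D" "q \<in> S' p" "q' \<in> S' p'"
      and z: "z \<in> {fst q<..<snd q}" "z \<in> {fst q'<..<snd q'}" for p p' q q' z
    proof -
      have "z \<in> {fst p<..<snd p}" "z \<in> {fst p'<..<snd p'}"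
        using Sin[OF pq(3)] Sin[OF pq(4)] z by auto
      then have "p = p'"
        using nonoverlapping_eq[OF D(1), of "fst p" "snd p" "fst p'" "snd p'" z] pq by (simp add: prod_eq_iff)
      moreover have "q = q'"
        using nonoverlapping_eq[OF nS', of "fst q" "snd q" p "fst q'" "snd q'" z] pq z \<open>p = p'\<close>
        by (simp add: prod_eq_iff)
      ultimately show ?thesis by simp
    qed
    define E where "E = (\<Union>p\<in>D. S' p)"
    have dS: "S' p \<inter> S' p' = {}" if "p \<in> D" "p' \<in> D" "p \<noteq> p'" for p p'
    proof (rule ccontr)
      assume "S' p \<inter> S' p' \<noteq> {}"
      then obtain q where q: "q \<in> S' p" "q \<in> S' p'" by blast
      obtain z where "fst q < z" "z < snd q" using Sin[OF q(1)] dense by blast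
      then show False using disj[OF that(1,2) q] that by auto
    qed
    have "nonoverlapping a b E"
      unfolding nonoverlapping_def
    proof (intro conjI)
      show "finite E" using D fS' by (simp add: E_def)
      show "\<forall>(x, y)\<in>E. a \<le> x \<and> x \<le> y \<and> y \<le> b"
      proof (clarify)
        fix x y assume "(x, y) \<in> E"
        then obtain p where p: "p \<in> D" "(x, y) \<in> S' p" by (auto simp: E_def)
        then show "a \<le> x \<and> x \<le> y \<and> y \<le> b"
          using Sin[OF p(2)] nonoverlappingD[OF D(1), of "fst p" "snd p"] by auto
      qed
      show "disjoint_family_on (\<lambda>(x, y). {x<..<y}) E"
        unfolding disjoint_family_on_def
      proof (intro ballI impI)
        fix q q' assume "q \<in> E" "q' \<in> E" "q \<noteq> q'"
        then show "(case q of (x, y) \<Rightarrow> {x<..<y}) \<inter> (case q' of (x, y) \<Rightarrow> {x<..<y}) = {}"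
          unfolding E_def using disj by (fastforce simp: case_prod_beta)
      qed
    qed
    moreover have "mesh E < d"
    proof -
      have "mesh E = (\<Sum>p\<in>D. mesh (S' p))"
        unfolding E_def mesh_def using D fS' dS by (intro sum.UNION_disjoint) auto
      also have "\<dots> \<le> mesh D"
        unfolding mesh_def[of D]
      proof (rule sum_mono)
        fix p assume "p \<in> D"
        then have "fst p \<le> snd p" using nonoverlappingD[OF D(1), of "fst p" "snd p"] by simp
        then show "mesh (S' p) \<le> (case p of (x, y) \<Rightarrow> y - x)"
          using mesh_le[OF nS', of p] by (simp add: case_prod_beta)
      qed
      finally show ?thesis using D by simp
    qed
    ultimately have E: "increments u E < e/2" by (rule d(2))
    have "increments (variation u a) D \<le> (\<Sum>p\<in>D. increments u (S' p) + \<eta>)"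
      unfolding increments_def[of "variation u a"]
    proof (rule sum_mono)
      fix p assume "p \<in> D"
      obtain x y where p: "p = (x, y)" by (cases p)
      then have xy: "a \<le> x" "x \<le> y" "y \<le> b" using nonoverlappingD[OF D(1), of x y] \<open>p \<in> D\<close> by auto
      have "variation u a x \<le> variation u a y"
        using variation_increment[OF u xy] by linarith
      moreover have "variation u a y - variation u a x \<le> variation u x y"
        using variation_add_le[OF absolutely_continuous_on_Icc_subset[OF u, of a y], of x] xy by simp
      ultimately show "(case p of (x, y) \<Rightarrow> \<bar>variation u a y - variation u a x\<bar>) \<le> increments u (S' p) + \<eta>"
        using S(2)[of p] incS'[of p] p by simp
    qed
    also have "\<dots> = (\<Sum>p\<in>D. increments u (S' p)) + real (card D) * \<eta>"
      by (simp add: sum.distrib)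
    also have "(\<Sum>p\<in>D. increments u (S' p)) = increments u E"
      unfolding E_def increments_def using D fS' dS by (intro sum.UNION_disjoint[symmetric]) auto
    also have "increments u E + real (card D) * \<eta> < e"
    proof -
      have "real (card D) * \<eta> \<le> (real (card D) + 1) * \<eta>" using \<eta> by (intro mult_right_mono) auto
      also have "\<dots> = e/2" unfolding \<eta>_def by (simp add: divide_simps del: distrib_left_numeral)
      finally show ?thesis using E by linarith
    qed
    finally show "increments (variation u a) D < e" .
  qed
qed


text \<open>Radon-Nikodym for the Stieltjes measure of F. A Lebesgue null set is covered by
  nonoverlapping intervals of total length below d, whose increments sum to less than e; so it is
  null for the Stieltjes measure as well.\<close>

lemma monotone_ac_has_density:
  assumes F: "absolutely_continuous_on_Icc F a b" and ab: "a \<le> b"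
    and mono: "\<And>x y. a \<le> x \<Longrightarrow> x \<le> y \<Longrightarrow> y \<le> b \<Longrightarrow> F x \<le> F y"
  shows "\<exists>g. ac_primitive F g a b"
proof -
  \<comment> \<open>\<open>interval_measure\<close> takes a function on the whole line, so F is
    continued by constants.\<close>
  define G where "G x = F (max a (min b x))" for x
  have G_eq: "G x = F x" if "a \<le> x" "x \<le> b" for x using that by (simp add: G_def)
  have Gmono: "G x \<le> G y" if "x \<le> y" for x y
    unfolding G_def using ab that by (intro mono) auto
  have contF: "continuous_on {a..b} F"
    unfolding continuous_on_iff
  proof (intro ballI allI impI)
    fix x e :: real assume x: "x \<in> {a..b}" and e: "e > 0"
    then obtain d where d: "d > 0" "\<And>D. nonoverlapping a b D \<Longrightarrow> mesh D < d \<Longrightarrow> increments F D < e"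
      using F unfolding absolutely_continuous_on_Icc_iff by meson
    show "\<exists>d>0. \<forall>x'\<in>{a..b}. dist x' x < d \<longrightarrow> dist (F x') (F x) < e"
    proof (intro exI[of _ d] conjI ballI impI d(1))
      fix y assume y: "y \<in> {a..b}" "dist y x < d"
      have "nonoverlapping a b {(min x y, max x y)}"
        using x y by (auto simp: nonoverlapping_def disjoint_family_on_def)
      moreover have "mesh {(min x y, max x y)} < d"
        using y by (auto simp: mesh_def dist_real_def)
      ultimately have "increments F {(min x y, max x y)} < e" by (rule d)
      then show "dist (F y) (F x) < e" by (auto simp: increments_def dist_real_def min_def max_def split: if_splits)
    qed
  qed
  have contG: "continuous_on UNIV G"
    unfolding G_def by (rule continuous_on_compose2[OF contF]) (use ab in \<open>auto intro!: continuous_intros\<close>)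
  define M where "M = interval_measure G"
  have M_Icc: "emeasure M {x..y} = G y - G x" if "x \<le> y" for x y
    unfolding M_def by (rule emeasure_interval_measure_Icc[OF that Gmono contG])
  have sM: "sets M = sets borel" by (simp add: M_def)
  define M0 where "M0 = density M (indicator {a..b})"
  have M0: "emeasure M0 N = emeasure M (N \<inter> {a..b})" if "N \<in> sets borel" for N
  proof -
    have "indicator {a..b} \<in> borel_measurable M" "N \<in> sets M" "N \<inter> {a..b} \<in> sets M"
      using that sM by (auto intro!: borel_measurable_indicator)
    then show ?thesis
      unfolding M0_def by (subst emeasure_density) (auto simp: indicator_inter_arith[symmetric] Int_commute)
  qed
  have "absolutely_continuous lborel M0"
    unfolding absolutely_continuous_def
  proof
    fix N assume N: "N \<in> null_sets (lborel :: real measure)"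
    then have Nb: "N \<in> sets borel" by auto
    have small: "emeasure M (N \<inter> {a..b}) \<le> ennreal e" if e: "e > 0" for e
    proof -
      obtain d where d: "d > 0" "\<And>D. nonoverlapping a b D \<Longrightarrow> mesh D < d \<Longrightarrow> increments F D < e"
        using F e unfolding absolutely_continuous_on_Icc_iff by meson
      have "N \<inter> {a..b} \<in> null_sets lebesgue"
        using N Nb by (metis null_set_Int2 null_sets_completionI sets_completionI_sets sets_lborel atLeastAtMost_borel inf_commute)
      then have Nl: "N \<inter> {a..b} \<in> lmeasurable" "measure lebesgue (N \<inter> {a..b}) = 0"
        by (auto simp: null_sets_def measure_def fmeasurable_def)
      obtain \<D> where \<D>: "countable \<D>"
        "\<And>K. K \<in> \<D> \<Longrightarrow> K \<subseteq> cbox a b \<and> K \<noteq> {} \<and> (\<exists>c d. K = cbox c d)"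
        "pairwise (\<lambda>A B. interior A \<inter> interior B = {}) \<D>"
        "N \<inter> {a..b} \<subseteq> \<Union>\<D>" "\<Union>\<D> \<in> lmeasurable" "measure lebesgue (\<Union>\<D>) \<le> measure lebesgue (N \<inter> {a..b}) + d/2"
      proof (rule measurable_outer_intervals_bounded[OF Nl(1), of a b "d/2"])
        show "N \<inter> {a..b} \<subseteq> cbox a b" "d/2 > 0" using d(1) by (auto simp: cbox_interval)
      qed (rule that; assumption)
      have K: "\<exists>c d. K = {c..d} \<and> c \<le> d \<and> a \<le> c \<and> d \<le> b" if "K \<in> \<D>" for K
      proof -
        obtain c d where cd: "K = {c..d}" "{c..d} \<subseteq> {a..b}" "{c..d} \<noteq> {}"
          using \<D>(2)[OF \<open>K \<in> \<D>\<close>] unfolding cbox_interval by blast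
        then have "c \<le> d" by simp
        then have "a \<le> c" "d \<le> b" using cd(2) by simp_all
        then show ?thesis using cd \<open>c \<le> d\<close> by blast
      qed
      have KM: "K \<in> fmeasurable M" if "K \<in> \<D>" for K
        using K[OF that] M_Icc by (auto simp: fmeasurable_def sM)
      have fin: "measure M (\<Union>E) \<le> e" if E: "E \<subseteq> \<D>" "finite E" for E
      proof -
        define D where "D = (\<lambda>K. (Inf K, Sup K)) ` E"
        have KE: "K = {Inf K..Sup K} \<and> Inf K \<le> Sup K \<and> a \<le> Inf K \<and> Sup K \<le> b" if "K \<in> E" for K
        proof -
          obtain c d where "K = {c..d}" "c \<le> d" "a \<le> c" "d \<le> b" using K[of K] E(1) \<open>K \<in> E\<close> by blast
          then show ?thesis by simp
        qed
        have inj: "inj_on (\<lambda>K. (Inf K, Sup K)) E"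
        proof (rule inj_onI)
          fix K L assume KL: "K \<in> E" "L \<in> E" "(Inf K, Sup K) = (Inf L, Sup L)"
          then have "{Inf K..Sup K} = {Inf L..Sup L}" by simp
          then show "K = L" using KE[OF KL(1)] KE[OF KL(2)] by argo
        qed
        have D: "nonoverlapping a b D"
          unfolding nonoverlapping_def
        proof (intro conjI)
          show "finite D" using E by (simp add: D_def)
          show "\<forall>(x, y)\<in>D. a \<le> x \<and> x \<le> y \<and> y \<le> b" using KE by (auto simp: D_def)
          show "disjoint_family_on (\<lambda>(x, y). {x<..<y}) D"
            unfolding disjoint_family_on_def
          proof (intro ballI impI)
            fix m n assume "m \<in> D" "n \<in> D" "m \<noteq> n"
            then obtain K L where KL: "K \<in> E" "L \<in> E" "K \<noteq> L" "m = (Inf K, Sup K)" "n = (Inf L, Sup L)"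
              unfolding D_def by blast
            then have "interior K \<inter> interior L = {}" using \<D>(3) E(1) unfolding pairwise_def by blast
            moreover have "interior K = {Inf K<..<Sup K}" "interior L = {Inf L<..<Sup L}"
              using KE KL by (metis interior_atLeastAtMost_real)+
            ultimately show "(case m of (x, y) \<Rightarrow> {x<..<y}) \<inter> (case n of (x, y) \<Rightarrow> {x<..<y}) = {}"
              using KL by simp
          qed
        qed
        have "mesh D \<le> measure lebesgue (\<Union>\<D>)"
        proof (rule mesh_le_measure[OF D \<D>(5)])
          fix x y assume "(x, y) \<in> D"
          then obtain K where "K \<in> E" "x = Inf K" "y = Sup K" by (auto simp: D_def)
          then have "{x<..<y} \<subseteq> K" "K \<in> \<D>" using KE[of K] E by auto
          then show "{x<..<y} \<subseteq> \<Union>\<D>" by blast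
        qed
        then have "increments F D < e" using \<D>(6) Nl(2) d(1) by (intro d(2)[OF D]) linarith
        have "measure M (\<Union>E) \<le> (\<Sum>K\<in>E. measure M K)"
          using E KM by (intro measure_Union_le) (auto dest: fmeasurableD)
        also have "\<dots> = (\<Sum>K\<in>E. \<bar>F (Sup K) - F (Inf K)\<bar>)"
        proof (rule sum.cong)
          fix K assume "K \<in> E"
          then have k: "K = {Inf K..Sup K}" "Inf K \<le> Sup K" "a \<le> Inf K" "Sup K \<le> b" using KE by auto
          have "measure M {Inf K..Sup K} = G (Sup K) - G (Inf K)"
            using M_Icc[OF k(2)] Gmono[OF k(2)] by (simp add: measure_def)
          also have "\<dots> = \<bar>F (Sup K) - F (Inf K)\<bar>"
            using mono[of "Inf K" "Sup K"] k by (simp add: G_eq)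
          finally show "measure M K = \<bar>F (Sup K) - F (Inf K)\<bar>" using k(1) by simp
        qed simp
        also have "\<dots> = increments F D"
          unfolding increments_def D_def by (subst sum.reindex[OF inj]) (simp add: o_def)
        finally show ?thesis using \<open>increments F D < e\<close> by simp
      qed
      have U: "\<Union>\<D> \<in> fmeasurable M" "measure M (\<Union>\<D>) \<le> e"
        using fmeasurable_Union_bound[OF \<D>(1), of M e] measure_Union_bound[OF \<D>(1), of M e] KM fin by blast+
      have "emeasure M (N \<inter> {a..b}) \<le> emeasure M (\<Union>\<D>)"
        using \<D>(4) U(1) by (intro emeasure_mono) (auto dest: fmeasurableD)
      also have "\<dots> \<le> ennreal e" using U by (simp add: emeasure_eq_measure2 ennreal_leI)
      finally show ?thesis .
    qed
    have "emeasure M (N \<inter> {a..b}) \<le> 0"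
      by (rule ennreal_le_epsilon) (use small in auto)
    then show "N \<in> null_sets M0"
      using M0[OF Nb] Nb by (simp add: null_sets_def M0_def sM)
  qed
  moreover have "sets M0 = sets lborel" by (simp add: M0_def sM)
  ultimately obtain f where f: "f \<in> borel_measurable lborel" "density lborel f = M0"
    using sigma_finite_measure.Radon_Nikodym[OF sigma_finite_lborel, of M0] by blast
  have If: "(\<integral>\<^sup>+t. f t * indicator {a..x} t \<partial>lborel) = ennreal (F x - F a)" if "a \<le> x" "x \<le> b" for x
  proof -
    have "(\<integral>\<^sup>+t. f t * indicator {a..x} t \<partial>lborel) = emeasure M0 {a..x}"
      unfolding f(2)[symmetric] using f(1) by (subst emeasure_density) auto
    also have "\<dots> = emeasure M {a..x}" using M0[of "{a..x}"] that by (simp add: min_def)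
    finally show ?thesis using M_Icc[OF that(1)] that by (simp add: G_eq)
  qed
  have ae: "AE t in lborel. f t * indicator {a..b} t \<noteq> \<infinity>"
    using f(1) If[of b] ab by (intro nn_integral_PInf_AE) auto
  \<comment> \<open>The Radon-Nikodym density is extended real valued, but finite almost everywhere
    on [a, b] because its integral there is finite.\<close>
  define g where "g t = enn2real (f t)" for t
  have int: "((\<lambda>t. indicator {a..x} t * g t) has_integral (F x - F a)) UNIV" if x: "a \<le> x" "x \<le> b" for x
  proof (rule nn_integral_has_integral)
    show "(\<lambda>t. indicator {a..x} t * g t) \<in> borel_measurable borel" using f(1) by (simp add: g_def)
    show "0 \<le> indicator {a..x} t * g t" for t by (simp add: g_def)
    show "0 \<le> F x - F a" using mono x by simp
    have "(\<integral>\<^sup>+ t. ennreal (indicator {a..x} t * g t) \<partial>lborel) = (\<integral>\<^sup>+t. f t * indicator {a..x} t \<partial>lborel)"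
    proof (rule nn_integral_cong_AE)
      show "AE t in lborel. ennreal (indicator {a..x} t * g t) = f t * indicator {a..x} t"
        using ae by eventually_elim (use x in \<open>auto simp: g_def indicator_def top.not_eq_extremum split: if_splits\<close>)
    qed
    then show "(\<integral>\<^sup>+ t. ennreal (indicator {a..x} t * g t) \<partial>lborel) = ennreal (F x - F a)"
      using If[OF x] by simp
  qed
  have int': "(g has_integral (F x - F a)) {a..x}" if "a \<le> x" "x \<le> b" for x
  proof -
    have "(\<lambda>t. indicator {a..x} t * g t) = (\<lambda>t. if t \<in> {a..x} then g t else 0)"
      by (auto simp: indicator_def)
    then show ?thesis using int[OF that] has_integral_restrict_UNIV[of "{a..x}" g] by metis
  qed
  have "ac_primitive F g a b"
  proof (rule ac_primitiveI)
    show "g absolutely_integrable_on {a..b}"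
      using int'[of b] ab by (intro nonnegative_absolutely_integrable_1) (auto simp: g_def)
    show "F x - F a = integral {a..x} g" if "a \<le> x" "x \<le> b" for x
      using int'[OF that] by (simp add: integral_unique)
  qed
  then show ?thesis by blast
qed

lemma ac_primitive_diff:
  assumes "ac_primitive F f a b" "ac_primitive G g a b"
  shows "ac_primitive (\<lambda>x. F x - G x) (\<lambda>x. f x - g x) a b"
proof (rule ac_primitiveI)
  show "(\<lambda>x. f x - g x) absolutely_integrable_on {a..b}"
    using assms by (intro set_integral_diff ac_primitiveD(1))
  show "F x - G x - (F a - G a) = integral {a..x} (\<lambda>x. f x - g x)" if "a \<le> x" "x \<le> b" for x
  proof -
    have "f integrable_on {a..x}" "g integrable_on {a..x}"
      using absolutely_integrable_subinterval(2)[OF ac_primitiveD(1)] assms that by blast+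
    then show ?thesis
      using ac_primitiveD(2)[OF assms(1), of a x] ac_primitiveD(2)[OF assms(2), of a x] that
      by (simp add: Henstock_Kurzweil_Integration.integral_diff)
  qed
qed

text \<open>Jordan decomposition: u is the difference of the nondecreasing functions
  \<open>variation u a\<close> and \<open>variation u a\<close> - u, both absolutely
  continuous.\<close>

lemma ac_has_density:
  assumes u: "absolutely_continuous_on_Icc u a b" and ab: "a \<le> b"
  shows "\<exists>g. ac_primitive u g a b"
proof -
  let ?V = "variation u a"
  have V: "absolutely_continuous_on_Icc ?V a b" by (rule absolutely_continuous_variation[OF u])
  have W: "absolutely_continuous_on_Icc (\<lambda>x. ?V x - u x) a b"
    unfolding absolutely_continuous_on_Icc_iff
  proof (intro allI impI)
    fix e :: real assume "e > 0"
    then have e2: "e/2 > 0" by simp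
    obtain d1 where d1: "d1 > 0" "\<And>D. nonoverlapping a b D \<Longrightarrow> mesh D < d1 \<Longrightarrow> increments u D < e/2"
      using u e2 unfolding absolutely_continuous_on_Icc_iff by meson
    obtain d2 where d2: "d2 > 0" "\<And>D. nonoverlapping a b D \<Longrightarrow> mesh D < d2 \<Longrightarrow> increments ?V D < e/2"
      using V e2 unfolding absolutely_continuous_on_Icc_iff by meson
    show "\<exists>d>0. \<forall>D. nonoverlapping a b D \<and> mesh D < d \<longrightarrow> increments (\<lambda>x. ?V x - u x) D < e"
    proof (intro exI[of _ "min d1 d2"] conjI allI impI)
      fix D assume D: "nonoverlapping a b D \<and> mesh D < min d1 d2"
      have "increments (\<lambda>x. ?V x - u x) D \<le> increments ?V D + increments u D"
        unfolding increments_def sum.distrib[symmetric] by (intro sum_mono) auto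
      also have "\<dots> < e" using d1(2)[of D] d2(2)[of D] D by simp
      finally show "increments (\<lambda>x. ?V x - u x) D < e" .
    qed (use d1 d2 in auto)
  qed
  have "?V x \<le> ?V y" "?V x - u x \<le> ?V y - u y" if "a \<le> x" "x \<le> y" "y \<le> b" for x y
    using variation_increment[OF u that] by linarith+
  then obtain g h where "ac_primitive ?V g a b" "ac_primitive (\<lambda>x. ?V x - u x) h a b"
    using monotone_ac_has_density[OF V ab] monotone_ac_has_density[OF W ab] by blast
  then have "ac_primitive (\<lambda>x. ?V x - (?V x - u x)) (\<lambda>x. g x - h x) a b"
    by (rule ac_primitive_diff)
  then show ?thesis by auto
qed


text \<open>By Lebesgue differentiation the density agrees almost everywhere with the pointwise
  derivative. This links the \<open>deriv u\<close> in the definition of weak solutions to an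
  integrable density.\<close>

theorem ac_primitive_deriv:
  assumes u: "absolutely_continuous_on_Icc u a b" and ab: "a \<le> b"
  shows "ac_primitive u (deriv u) a b"
proof -
  obtain g where g: "ac_primitive u g a b"
    using ac_has_density[OF assms] by blast
  have "AE x in lebesgue. x \<in> {a<..<b} \<longrightarrow> deriv u x = g x"
    using ac_primitive_has_derivative[OF g] by eventually_elim (auto intro: DERIV_imp_deriv)
  then obtain N where N: "negligible N" "\<And>x. x \<in> {a<..<b} - N \<Longrightarrow> deriv u x = g x"
    unfolding eventually_ae_filter_negligible by blast
  define N' where "N' = N \<union> {a, b}"
  have N': "negligible N'" "\<And>x. x \<in> {a..b} - N' \<Longrightarrow> deriv u x = g x"
    using N by (auto simp: N'_def)
  show ?thesis
  proof (rule ac_primitiveI)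
    show "deriv u absolutely_integrable_on {a..b}"
      using ac_primitiveD(1)[OF g] N' by (rule absolutely_integrable_spike)
    show "u x - u a = integral {a..x} (deriv u)" if "a \<le> x" "x \<le> b" for x
      using ac_primitiveD(2)[OF g, of a x] that N' integral_spike[of N' "{a..x}" "deriv u" g] by auto
  qed
qed

section \<open>Calculus with primitives\<close>

lemma ac_primitive_cong_AE:
  assumes F: "ac_primitive F f a b"
    and ae: "AE x in lebesgue. a < x \<and> x < b \<longrightarrow> f x = g x"
  shows "ac_primitive F g a b"
proof -
  obtain N where N: "negligible N" "\<And>x. x \<notin> N \<Longrightarrow> a < x \<and> x < b \<Longrightarrow> f x = g x"
    using ae unfolding eventually_ae_filter_negligible by blast
  define N' where "N' = N \<union> {a, b}"
  have N': "negligible N'" "\<And>x. x \<in> {a..b} - N' \<Longrightarrow> g x = f x"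
    using N by (auto simp: N'_def)
  show ?thesis
  proof (rule ac_primitiveI)
    show "g absolutely_integrable_on {a..b}"
      using ac_primitiveD(1)[OF F] N' by (rule absolutely_integrable_spike)
    show "F x - F a = integral {a..x} g" if "a \<le> x" "x \<le> b" for x
      using ac_primitiveD(2)[OF F, of a x] that N' integral_spike[of N' "{a..x}" g f] by auto
  qed
qed

lemma ac_primitive_absolutely_continuous:
  assumes F: "ac_primitive F f a b"
  shows "absolutely_continuous_on_Icc F a b"
  unfolding absolutely_continuous_on_Icc_iff
proof (intro allI impI)
  fix e :: real assume e: "e > 0"
  note f = ac_primitiveD(1)[OF F]
  obtain d where d: "d > 0"
    "\<And>A. A \<subseteq> {a..b} \<Longrightarrow> A \<in> lmeasurable \<Longrightarrow> measure lebesgue A < d \<Longrightarrow> integral A (\<lambda>x. \<bar>f x\<bar>) < e"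
    using small_integral_on_small_sets[OF f e] by metis
  show "\<exists>d>0. \<forall>D. nonoverlapping a b D \<and> mesh D < d \<longrightarrow> increments F D < e"
  proof (intro exI[of _ d] conjI allI impI d(1))
    fix D assume "nonoverlapping a b D \<and> mesh D < d"
    then have D: "nonoverlapping a b D" "mesh D < d" "finite D" by (auto simp: nonoverlapping_def)
    define I where "I p = {fst p<..<snd p}" for p :: "real \<times> real"
    have I: "I p \<subseteq> {a..b}" "I p \<in> lmeasurable" if "p \<in> D" for p
      using that nonoverlappingD[OF D(1), of "fst p" "snd p"] by (auto simp: I_def)
    have pd: "pairwise (\<lambda>p q. negligible (I p \<inter> I q)) D"
      using D(1) unfolding nonoverlapping_def disjoint_family_on_def pairwise_def I_def
      by (auto simp: case_prod_beta)
    have hi: "((\<lambda>x. \<bar>f x\<bar>) has_integral (\<Sum>p\<in>D. integral (I p) (\<lambda>x. \<bar>f x\<bar>))) (\<Union>p\<in>D. I p)"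
    proof (rule has_integral_UN[OF D(3) _ pd])
      fix p assume "p \<in> D"
      then have "(\<lambda>x. \<bar>f x\<bar>) absolutely_integrable_on I p"
        using I by (intro set_integrable_abs absolutely_integrable_subset[OF f]) (auto dest: fmeasurableD)
      then show "((\<lambda>x. \<bar>f x\<bar>) has_integral integral (I p) (\<lambda>x. \<bar>f x\<bar>)) (I p)"
        by (intro integrable_integral set_lebesgue_integral_eq_integral(1))
    qed
    have "increments F D \<le> (\<Sum>p\<in>D. integral (I p) (\<lambda>x. \<bar>f x\<bar>))"
      unfolding increments_def
    proof (rule sum_mono)
      fix p assume "p \<in> D"
      then have p: "a \<le> fst p" "fst p \<le> snd p" "snd p \<le> b"
        using nonoverlappingD[OF D(1), of "fst p" "snd p"] by auto
      have af: "f absolutely_integrable_on {fst p..snd p}"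
        by (rule absolutely_integrable_subinterval(1)[OF f]) (use p in auto)
      have "\<bar>F (snd p) - F (fst p)\<bar> = norm (integral {fst p..snd p} f)"
        using ac_primitiveD(2)[OF F] p by simp
      also have "\<dots> \<le> integral {fst p..snd p} (\<lambda>x. \<bar>f x\<bar>)"
        using af by (intro integral_norm_bound_integral set_lebesgue_integral_eq_integral(1) set_integrable_abs) auto
      also have "\<dots> = integral (I p) (\<lambda>x. \<bar>f x\<bar>)"
        unfolding I_def box_real(1)[symmetric] using integral_open_interval_real[of "fst p" "snd p"] by simp
      finally show "(case p of (x, y) \<Rightarrow> \<bar>F y - F x\<bar>) \<le> integral (I p) (\<lambda>x. \<bar>f x\<bar>)"
        by (simp add: case_prod_beta)
    qed
    also have "\<dots> = integral (\<Union>p\<in>D. I p) (\<lambda>x. \<bar>f x\<bar>)" using hi by (simp add: integral_unique)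
    also have "\<dots> < e"
    proof (rule d(2))
      show "(\<Union>p\<in>D. I p) \<subseteq> {a..b}" using I by blast
      show "(\<Union>p\<in>D. I p) \<in> lmeasurable" using I D by (intro fmeasurable.finite_UN) auto
      have "measure lebesgue (\<Union>p\<in>D. I p) \<le> (\<Sum>p\<in>D. measure lebesgue (I p))"
        using I D by (intro measure_UNION_le) (auto dest: fmeasurableD)
      also have "\<dots> = mesh D"
        unfolding mesh_def using nonoverlappingD(2)[OF D(1)]
        by (intro sum.cong) (auto simp: I_def)
      finally show "measure lebesgue (\<Union>p\<in>D. I p) < d" using D by simp
    qed
    finally show "increments F D < e" .
  qed
qed

theorem ac_primitive_iff:
  assumes ab: "a \<le> b"
  shows "ac_primitive F f a b \<longleftrightarrow> absolutely_continuous_on_Icc F a b \<and>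
    (AE x in lebesgue. a < x \<and> x < b \<longrightarrow> (F has_real_derivative f x) (at x))" (is "?l \<longleftrightarrow> ?r")
proof
  assume ?l then show ?r
    using ac_primitive_absolutely_continuous ac_primitive_has_derivative by blast
next
  assume r: ?r
  then have "ac_primitive F (deriv F) a b" using ac_primitive_deriv ab by blast
  moreover have "AE x in lebesgue. a < x \<and> x < b \<longrightarrow> deriv F x = f x"
    using r by (auto elim!: eventually_mono intro: DERIV_imp_deriv)
  ultimately show ?l by (rule ac_primitive_cong_AE)
qed

text \<open>Serves products, compositions with C^1 functions and Lipschitz functions alike: in each
  case the increments of w are controlled by those of known functions.\<close>

lemma absolutely_continuous_lipschitz_combination:
  assumes uv: "absolutely_continuous_on_Icc u a b" "absolutely_continuous_on_Icc v a b"
    and L: "L \<ge> 0" "\<And>x y. a \<le> x \<Longrightarrow> x \<le> y \<Longrightarrow> y \<le> b \<Longrightarrow> \<bar>w y - w x\<bar> \<le> L * (\<bar>u y - u x\<bar> + \<bar>v y - v x\<bar>)"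
  shows "absolutely_continuous_on_Icc w a b"
  unfolding absolutely_continuous_on_Icc_iff
proof (intro allI impI)
  fix e :: real assume "e > 0"
  define \<eta> where "\<eta> = e / (2 * (L + 1))"
  have \<eta>: "\<eta> > 0" "(L + 1) * \<eta> = e/2" using \<open>e > 0\<close> L(1) by (simp_all add: \<eta>_def divide_simps)
  obtain d1 where d1: "d1 > 0" "\<And>D. nonoverlapping a b D \<Longrightarrow> mesh D < d1 \<Longrightarrow> increments u D < \<eta>"
    using uv(1) \<eta> unfolding absolutely_continuous_on_Icc_iff by meson
  obtain d2 where d2: "d2 > 0" "\<And>D. nonoverlapping a b D \<Longrightarrow> mesh D < d2 \<Longrightarrow> increments v D < \<eta>"
    using uv(2) \<eta> unfolding absolutely_continuous_on_Icc_iff by meson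
  show "\<exists>d>0. \<forall>D. nonoverlapping a b D \<and> mesh D < d \<longrightarrow> increments w D < e"
  proof (intro exI[of _ "min d1 d2"] conjI allI impI)
    fix D assume D: "nonoverlapping a b D \<and> mesh D < min d1 d2"
    have "increments w D \<le> L * (increments u D + increments v D)"
      unfolding increments_def sum.distrib[symmetric] sum_distrib_left
    proof (rule sum_mono)
      fix p assume "p \<in> D"
      obtain s t where p: "p = (s, t)" by (cases p)
      then have st: "a \<le> s" "s \<le> t" "t \<le> b" using D nonoverlappingD[of a b D s t] \<open>p \<in> D\<close> by auto
      show "(case p of (x, y) \<Rightarrow> \<bar>w y - w x\<bar>) \<le> L * ((case p of (x, y) \<Rightarrow> \<bar>u y - u x\<bar>) + (case p of (x, y) \<Rightarrow> \<bar>v y - v x\<bar>))"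
        using L(2)[OF st] p by simp
    qed
    also have "\<dots> \<le> (L + 1) * (increments u D + increments v D)"
      using increments_nonneg[of u D] increments_nonneg[of v D] by (intro mult_right_mono) auto
    also have "\<dots> < (L + 1) * (\<eta> + \<eta>)"
      using d1(2)[of D] d2(2)[of D] D L(1) by (intro mult_strict_left_mono) auto
    also have "\<dots> = e" using \<eta>(2) by (simp add: distrib_left)
    finally show "increments w D < e" .
  qed (use d1 d2 in auto)
qed

lemma ac_primitive_mult:
  assumes F: "ac_primitive F f a b" and G: "ac_primitive G g a b" and ab: "a \<le> b"
  shows "ac_primitive (\<lambda>x. F x * G x) (\<lambda>x. F x * g x + f x * G x) a b"
  unfolding ac_primitive_iff[OF ab]
proof
  have "compact (F ` {a..b})" "compact (G ` {a..b})"
    using ac_primitive_continuous[OF F] ac_primitive_continuous[OF G] by (auto intro: compact_continuous_image)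
  then have "bounded (F ` {a..b})" "bounded (G ` {a..b})" by (auto intro: compact_imp_bounded)
  then obtain B C where B: "B > 0" "\<And>x. x \<in> {a..b} \<Longrightarrow> \<bar>F x\<bar> \<le> B" and C: "C > 0" "\<And>x. x \<in> {a..b} \<Longrightarrow> \<bar>G x\<bar> \<le> C"
    unfolding bounded_pos by auto
  show "absolutely_continuous_on_Icc (\<lambda>x. F x * G x) a b"
  proof (rule absolutely_continuous_lipschitz_combination)
    show "absolutely_continuous_on_Icc F a b" "absolutely_continuous_on_Icc G a b"
      using F G by (auto intro: ac_primitive_absolutely_continuous)
    fix x y assume xy: "a \<le> x" "x \<le> y" "y \<le> b"
    have "F y * G y - F x * G x = F y * (G y - G x) + (F y - F x) * G x"
      by (simp add: algebra_simps)
    then have "\<bar>F y * G y - F x * G x\<bar> \<le> \<bar>F y\<bar> * \<bar>G y - G x\<bar> + \<bar>F y - F x\<bar> * \<bar>G x\<bar>"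
      by (metis abs_mult abs_triangle_ineq)
    also have "\<dots> \<le> B * \<bar>G y - G x\<bar> + \<bar>F y - F x\<bar> * C"
      using B(2)[of y] C(2)[of x] xy by (intro add_mono mult_mono) auto
    also have "\<dots> \<le> (B + C) * (\<bar>F y - F x\<bar> + \<bar>G y - G x\<bar>)"
      using B(1) C(1) by (simp add: algebra_simps)
    finally show "\<bar>F y * G y - F x * G x\<bar> \<le> (B + C) * (\<bar>F y - F x\<bar> + \<bar>G y - G x\<bar>)" .
  qed (use B C in auto)
  show "AE x in lebesgue. a < x \<and> x < b \<longrightarrow> ((\<lambda>x. F x * G x) has_real_derivative F x * g x + f x * G x) (at x)"
    using ac_primitive_has_derivative[OF F] ac_primitive_has_derivative[OF G]
    by eventually_elim (auto intro!: derivative_eq_intros)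
qed

lemma ac_primitive_compose:
  assumes F: "ac_primitive F f a b" and ab: "a \<le> b"
    and \<phi>: "\<And>t. (\<phi> has_real_derivative \<phi>' t) (at t)" and cont: "continuous_on UNIV \<phi>'"
  shows "ac_primitive (\<lambda>x. \<phi> (F x)) (\<lambda>x. \<phi>' (F x) * f x) a b"
  unfolding ac_primitive_iff[OF ab]
proof
  have "bounded (F ` {a..b})"
    using ac_primitive_continuous[OF F] by (auto intro: compact_continuous_image compact_imp_bounded)
  then obtain B where B: "B > 0" "\<And>x. x \<in> {a..b} \<Longrightarrow> \<bar>F x\<bar> \<le> B"
    unfolding bounded_pos by auto
  have "bounded (\<phi>' ` {-B..B})"
    using cont by (auto intro!: compact_imp_bounded compact_continuous_image intro: continuous_on_subset)
  then obtain L where L: "L > 0" "\<And>t. t \<in> {-B..B} \<Longrightarrow> \<bar>\<phi>' t\<bar> \<le> L"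
    unfolding bounded_pos by auto
  show "absolutely_continuous_on_Icc (\<lambda>x. \<phi> (F x)) a b"
  proof (rule absolutely_continuous_lipschitz_combination)
    show "absolutely_continuous_on_Icc F a b" "absolutely_continuous_on_Icc F a b"
      using F by (auto intro: ac_primitive_absolutely_continuous)
    fix x y assume xy: "a \<le> x" "x \<le> y" "y \<le> b"
    have "F x \<in> {-B..B}" "F y \<in> {-B..B}" using B(2)[of x] B(2)[of y] xy by (auto simp: abs_le_iff)
    then have "norm (\<phi> (F y) - \<phi> (F x)) \<le> L * norm (F y - F x)"
      using \<phi> L by (intro field_differentiable_bound[of "{-B..B}"]) (auto intro: has_field_derivative_at_within)
    also have "\<dots> \<le> L * (\<bar>F y - F x\<bar> + \<bar>F y - F x\<bar>)" using L by (intro mult_left_mono) auto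
    finally show "\<bar>\<phi> (F y) - \<phi> (F x)\<bar> \<le> L * (\<bar>F y - F x\<bar> + \<bar>F y - F x\<bar>)" by simp
  qed (use L in auto)
  show "AE x in lebesgue. a < x \<and> x < b \<longrightarrow> ((\<lambda>x. \<phi> (F x)) has_real_derivative \<phi>' (F x) * f x) (at x)"
    using ac_primitive_has_derivative[OF F]
    by eventually_elim (auto intro!: DERIV_chain2[OF \<phi>])
qed

lemma ac_primitive_C1:
  assumes ab: "a \<le> b" and F: "\<And>x. a \<le> x \<Longrightarrow> x \<le> b \<Longrightarrow> (F has_real_derivative f x) (at x within {a..b})"
    and f: "continuous_on {a..b} f"
  shows "ac_primitive F f a b"
proof (rule ac_primitiveI)
  show "f absolutely_integrable_on {a..b}" using f by (rule absolutely_integrable_continuous_real)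
  show "F x - F a = integral {a..x} f" if x: "a \<le> x" "x \<le> b" for x
  proof -
    have "(f has_integral (F x - F a)) {a..x}"
      using x by (intro fundamental_theorem_of_calculus)
        (auto simp: has_real_derivative_iff_has_vector_derivative[symmetric] intro!: has_field_derivative_subset[OF F])
    then show ?thesis by (simp add: integral_unique)
  qed
qed

section \<open>Weights and linear radial equations\<close>

definition coefficient :: "(real \<Rightarrow> real) \<Rightarrow> real \<Rightarrow> real \<Rightarrow> bool" where
  "coefficient c k l \<longleftrightarrow> set_borel_measurable lebesgue {0<..} c \<and> (\<forall>r>0. k \<le> c r \<and> c r \<le> l)"

lemma coefficient_bounds:
  assumes "coefficient c k l" "r > 0"
  shows "k \<le> c r" "c r \<le> l"
  using assms by (auto simp: coefficient_def)

lemma set_borel_measurable_lebesgue_iff: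
  fixes f :: "real \<Rightarrow> real"
  assumes "S \<in> sets lebesgue"
  shows "set_borel_measurable lebesgue S f \<longleftrightarrow> f \<in> borel_measurable (lebesgue_on S)"
  unfolding set_borel_measurable_def using assms
  by (subst borel_measurable_restrict_space_iff) (auto simp: mult.commute)

lemma coefficient_measurable:
  assumes "coefficient c k l" "S \<subseteq> {0<..}" "S \<in> sets lebesgue"
  shows "c \<in> borel_measurable (lebesgue_on S)"
proof -
  have "c \<in> borel_measurable (lebesgue_on {0<..})"
    using assms(1) by (simp add: coefficient_def set_borel_measurable_lebesgue_iff[symmetric])
  then show ?thesis using measurable_restrict_mono assms(2) by blast
qed

lemma absolutely_integrable_bounded_mult:
  fixes c f :: "real \<Rightarrow> real"
  assumes c: "c \<in> borel_measurable (lebesgue_on S)" and S: "S \<in> sets lebesgue"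
    and B: "\<And>x. x \<in> S \<Longrightarrow> \<bar>c x\<bar> \<le> B" and f: "f absolutely_integrable_on S"
  shows "(\<lambda>x. c x * f x) absolutely_integrable_on S"
proof (rule measurable_bounded_by_integrable_imp_absolutely_integrable[where g = "\<lambda>x. B * \<bar>f x\<bar>"])
  have "f \<in> borel_measurable (lebesgue_on S)"
    using f S by (rule absolutely_integrable_imp_borel_measurable)
  then show "(\<lambda>x. c x * f x) \<in> borel_measurable (lebesgue_on S)" using c by simp
  have "(\<lambda>x. \<bar>f x\<bar>) absolutely_integrable_on S" using f by (rule set_integrable_abs)
  then show "(\<lambda>x. B * \<bar>f x\<bar>) integrable_on S"
    by (intro integrable_on_mult_right set_lebesgue_integral_eq_integral(1))
  show "norm (c x * f x) \<le> B * \<bar>f x\<bar>" if "x \<in> S" for x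
    using B[OF that] by (simp add: abs_mult mult_right_mono)
qed (fact S)

lemma coefficient_mult_integrable:
  assumes c: "coefficient c k l" and f: "f absolutely_integrable_on {x..y}" and "0 < x"
  shows "(\<lambda>r. c r * f r) absolutely_integrable_on {x..y}"
proof (rule absolutely_integrable_bounded_mult[OF _ _ _ f])
  show "c \<in> borel_measurable (lebesgue_on {x..y})"
    by (rule coefficient_measurable[OF c]) (use \<open>0 < x\<close> in auto)
  show "\<bar>c r\<bar> \<le> max \<bar>k\<bar> \<bar>l\<bar>" if "r \<in> {x..y}" for r
    using coefficient_bounds[OF c, of r] that \<open>0 < x\<close> by auto
qed auto

lemma continuous_mult_integrable:
  fixes c f :: "real \<Rightarrow> real"
  assumes c: "continuous_on {x..y} c" and f: "f absolutely_integrable_on {x..y}"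
  shows "(\<lambda>r. c r * f r) absolutely_integrable_on {x..y}"
proof -
  have "bounded (c ` {x..y})" using c by (auto intro: compact_imp_bounded compact_continuous_image)
  then obtain B where "\<And>r. r \<in> {x..y} \<Longrightarrow> \<bar>c r\<bar> \<le> B" unfolding bounded_iff real_norm_def by blast
  then show ?thesis
    using c by (intro absolutely_integrable_bounded_mult[OF _ _ _ f]) (auto intro: continuous_imp_measurable_on_sets_lebesgue)
qed

text \<open>The formula of \<open>rho\<close> for an arbitrary coefficient c, because it is also
  needed for the linear equation of a difference of two solutions, which has a coefficient of its
  own.\<close>

definition weight :: "(real \<Rightarrow> real) \<Rightarrow> real \<Rightarrow> real" where
  "weight c r = exp (interval_lebesgue_integral lebesgue (ereal 1) (ereal r) (\<lambda>\<tau>. c \<tau> / \<tau>))"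

lemma weight_pos [simp]: "weight c r > 0" "weight c r \<noteq> 0" "0 \<le> weight c r"
  by (simp_all add: weight_def)

lemma weight_1 [simp]: "weight c 1 = 1"
  by (simp add: weight_def interval_lebesgue_integral_def set_lebesgue_integral_def)

context
  fixes c k l
  assumes c: "coefficient c k l"
begin

lemma coefficient_quotient_integrable:
  assumes "0 < x"
  shows "(\<lambda>r. c r / r) absolutely_integrable_on {x..y}"
proof -
  have "(\<lambda>r. inverse r) absolutely_integrable_on {x..y}"
    using assms by (intro absolutely_integrable_continuous_real continuous_intros) auto
  then show ?thesis
    unfolding divide_inverse by (rule coefficient_mult_integrable[OF c _ assms])
qed

text \<open>The integral is oriented, so the position of the base point 1 relative to x and y gives
  three cases.\<close>

lemma weight_exponent:
  assumes x: "0 < x" "x \<le> y"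
  shows "interval_lebesgue_integral lebesgue (ereal 1) (ereal y) (\<lambda>\<tau>. c \<tau> / \<tau>) =
    interval_lebesgue_integral lebesgue (ereal 1) (ereal x) (\<lambda>\<tau>. c \<tau> / \<tau>) + integral {x..y} (\<lambda>\<tau>. c \<tau> / \<tau>)"
proof -
  have I: "(LINT \<tau>:einterval (ereal a) (ereal b)|lebesgue. c \<tau> / \<tau>) = integral {a..b} (\<lambda>\<tau>. c \<tau> / \<tau>)"
    if "0 < a" "a \<le> b" for a b
  proof -
    have "(\<lambda>\<tau>. c \<tau> / \<tau>) absolutely_integrable_on {a<..<b}"
      using coefficient_quotient_integrable[OF that(1)] by (simp add: absolutely_integrable_on_Icc_iff_Ioo[symmetric])
    then show ?thesis
      using set_lebesgue_integral_eq_integral(2)[of "{a<..<b}" "\<lambda>\<tau>. c \<tau> / \<tau>"] integral_open_interval_real[of a b "\<lambda>\<tau>. c \<tau> / \<tau>"]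
      by simp
  qed
  have comb: "integral {a..d} (\<lambda>\<tau>. c \<tau> / \<tau>) + integral {d..e} (\<lambda>\<tau>. c \<tau> / \<tau>) = integral {a..e} (\<lambda>\<tau>. c \<tau> / \<tau>)"
    if "0 < a" "a \<le> d" "d \<le> e" for a d e
    using that coefficient_quotient_integrable[OF that(1), of e]
    by (intro Henstock_Kurzweil_Integration.integral_combine set_lebesgue_integral_eq_integral(1))
  consider "y \<le> 1" | "x \<le> 1" "1 \<le> y" | "1 \<le> x" by linarith
  then show ?thesis
  proof cases
    case 1
    then show ?thesis using x I[of x 1] I[of y 1] comb[of x y 1]
      by (cases "x = y") (auto simp: interval_lebesgue_integral_def)
  next
    case 2
    then show ?thesis using x I[of x 1] I[of 1 y] comb[of x 1 y]
      by (auto simp: interval_lebesgue_integral_def)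
  next
    case 3
    then show ?thesis using x I[of 1 x] I[of 1 y] comb[of 1 x y]
      by (auto simp: interval_lebesgue_integral_def)
  qed
qed

lemma weight_eq:
  assumes "0 < x" "x \<le> y"
  shows "weight c y = weight c x * exp (integral {x..y} (\<lambda>\<tau>. c \<tau> / \<tau>))"
  unfolding weight_def weight_exponent[OF assms] by (simp add: exp_add)

text \<open>Integrate k / r \<le> c / r \<le> l / r. Later estimates use the size of a weight only
  through these powers.\<close>

lemma weight_le:
  assumes x: "0 < x" "x \<le> y"
  shows "weight c y \<le> weight c x * (y / x) powr l" "weight c x * (y / x) powr k \<le> weight c y"
proof -
  have int: "((\<lambda>r. 1 / r) has_integral (ln y - ln x)) {x..y}"
    using x by (intro fundamental_theorem_of_calculus)
      (auto simp: has_real_derivative_iff_has_vector_derivative[symmetric] intro!: derivative_eq_intros)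
  have int': "((\<lambda>r. K * (1 / r)) has_integral (K * (ln y - ln x))) {x..y}" for K
    using int by (rule has_integral_mult_right)
  have ci: "(\<lambda>r. c r / r) integrable_on {x..y}"
    using coefficient_quotient_integrable[OF x(1)] by (rule set_lebesgue_integral_eq_integral(1))
  have "integral {x..y} (\<lambda>r. c r / r) \<le> l * (ln y - ln x)"
    using integral_le[OF ci has_integral_integrable[OF int'[of l]]] coefficient_bounds[OF c] x int'[of l]
    by (auto simp: integral_unique divide_right_mono)
  moreover have "k * (ln y - ln x) \<le> integral {x..y} (\<lambda>r. c r / r)"
    using integral_le[OF has_integral_integrable[OF int'[of k]] ci] coefficient_bounds[OF c] x int'[of k]
    by (auto simp: integral_unique divide_right_mono)
  moreover have "(y / x) powr K = exp (K * (ln y - ln x))" for K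
    using x by (simp add: powr_def ln_div)
  ultimately show "weight c y \<le> weight c x * (y / x) powr l" "weight c x * (y / x) powr k \<le> weight c y"
    unfolding weight_eq[OF x] by simp_all
qed

lemma ac_primitive_weight:
  assumes x: "0 < x" "x \<le> y"
  shows "ac_primitive (weight c) (\<lambda>r. weight c r * (c r / r)) x y"
proof -
  let ?L = "\<lambda>r. interval_lebesgue_integral lebesgue (ereal 1) (ereal r) (\<lambda>\<tau>. c \<tau> / \<tau>)"
  have "ac_primitive ?L (\<lambda>r. c r / r) x y"
  proof (rule ac_primitiveI)
    show "(\<lambda>r. c r / r) absolutely_integrable_on {x..y}" by (rule coefficient_quotient_integrable[OF x(1)])
    show "?L r - ?L x = integral {x..r} (\<lambda>r. c r / r)" if "x \<le> r" "r \<le> y" for r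
      using weight_exponent[OF x(1) that(1)] by linarith
  qed
  then have "ac_primitive (\<lambda>r. exp (?L r)) (\<lambda>r. exp (?L r) * (c r / r)) x y"
    by (rule ac_primitive_compose) (use x in \<open>auto intro!: derivative_eq_intros continuous_intros\<close>)
  then show ?thesis unfolding weight_def[abs_def] .
qed

lemma continuous_on_weight:
  assumes "0 < x"
  shows "continuous_on {x..y} (weight c)"
  using ac_primitive_continuous[OF ac_primitive_weight[OF assms, of y]] by (cases "x \<le> y") auto

text \<open>The weight is the integrating factor of the damping term c p / r.\<close>

lemma ac_primitive_weight_mult:
  assumes x: "0 < x" "x \<le> y" and p: "ac_primitive p (\<lambda>r. h r - c r * p r / r) x y"
  shows "ac_primitive (\<lambda>r. weight c r * p r) (\<lambda>r. weight c r * h r) x y"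
proof -
  have "ac_primitive (\<lambda>r. weight c r * p r)
     (\<lambda>r. weight c r * (h r - c r * p r / r) + weight c r * (c r / r) * p r) x y"
    by (rule ac_primitive_mult[OF ac_primitive_weight[OF x] p x(2)])
  moreover have "(\<lambda>r. weight c r * (h r - c r * p r / r) + weight c r * (c r / r) * p r) = (\<lambda>r. weight c r * h r)"
    by (auto simp: algebra_simps)
  ultimately show ?thesis by simp
qed

lemma weight_le_powr:
  assumes "0 < x" "x \<le> 1"
  shows "weight c x \<le> x powr k"
proof -
  have "weight c x * (1 / x) powr k \<le> 1" using weight_le(2)[of x 1] assms by simp
  then show ?thesis using assms by (simp add: powr_divide field_simps)
qed

end

text \<open>The equation u'' + c u' / r = \<alpha> G as a first-order system: p is u', and the
  equation for p holds in integrated form since G is only integrable.\<close>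

definition linear_form ::
    "(real \<Rightarrow> real) \<Rightarrow> (real \<Rightarrow> real) \<Rightarrow> (real \<Rightarrow> real) \<Rightarrow> (real \<Rightarrow> real) \<Rightarrow> (real \<Rightarrow> real) \<Rightarrow> real \<Rightarrow> real \<Rightarrow> bool" where
  "linear_form \<alpha> c G u p a b \<longleftrightarrow> 0 < a \<and> a \<le> b \<and>
     (\<forall>r\<in>{a..b}. (u has_real_derivative p r) (at r within {a..b})) \<and>
     G absolutely_integrable_on {a..b} \<and>
     ac_primitive p (\<lambda>r. \<alpha> r * G r - c r * p r / r) a b"

lemma nondecreasing_of_deriv_nonneg:
  fixes F :: "real \<Rightarrow> real"
  assumes "a \<le> b" and F: "\<And>x. a \<le> x \<Longrightarrow> x \<le> b \<Longrightarrow> (F has_real_derivative F' x) (at x within {a..b})"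
    and "\<And>x. a < x \<Longrightarrow> x < b \<Longrightarrow> 0 \<le> F' x"
  shows "F a \<le> F b"
proof (cases "a = b")
  case False
  have "continuous_on {a..b} F"
    using F by (auto simp: continuous_on_eq_continuous_within intro!: DERIV_continuous)
  moreover have "(F has_real_derivative F' x) (at x)" if "a < x" "x < b" for x
    using F[of x] that at_within_Icc_at[of a x b] by simp
  ultimately show ?thesis
    using assms False by (intro DERIV_nonneg_imp_increasing_open[of a b F]) auto
qed simp

lemma first_crossing:
  fixes u :: "real \<Rightarrow> real"
  assumes u: "continuous_on {x..r} u" and xr: "x \<le> r" and v: "v < u x" "u r \<le> v"
  obtains z where "x < z" "z \<le> r" "u z = v" "\<And>y. x \<le> y \<Longrightarrow> y < z \<Longrightarrow> v < u y"
proof -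
  define E where "E = {z \<in> {x..r}. u z = v}"
  have "closed E" unfolding E_def
    by (rule continuous_closed_preimage_constant[OF u]) simp
  moreover have "E \<noteq> {}"
    using IVT2'[of u r v x] u v xr by (force simp: E_def)
  moreover have bb: "bdd_below E" by (auto simp: E_def bdd_below_def)
  ultimately have zE: "Inf E \<in> E" by (intro closed_contains_Inf)
  show thesis
  proof (rule that[of "Inf E"])
    show "Inf E \<le> r" "u (Inf E) = v" using zE by (auto simp: E_def)
    have "Inf E \<noteq> x" using zE v by (auto simp: E_def)
    then show "x < Inf E" using zE by (auto simp: E_def)
    fix y assume y: "x \<le> y" "y < Inf E"
    show "v < u y"
    proof (rule ccontr)
      assume "\<not> v < u y"
      moreover have "continuous_on {x..y} u" using u by (rule continuous_on_subset) (use y zE in \<open>auto simp: E_def\<close>)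
      ultimately obtain e where "x \<le> e" "e \<le> y" "u e = v"
        using IVT2'[of u y v x] v y by auto
      then have "e \<in> E" using y zE by (auto simp: E_def)
      then have "Inf E \<le> e" using bb by (rule cInf_lower)
      then show False using \<open>e \<le> y\<close> y by simp
    qed
  qed
qed

text \<open>As long as u > 0, u + \<Phi> is nondecreasing; follow it from a to the first zero of u,
  or to b.\<close>

lemma positive_part_le:
  fixes u :: "real \<Rightarrow> real"
  assumes ab: "a \<le> b"
    and u: "\<And>r. r \<in> {a..b} \<Longrightarrow> (u has_real_derivative p r) (at r within {a..b})"
    and \<Phi>: "\<And>r. r \<in> {a..b} \<Longrightarrow> (\<Phi> has_real_derivative \<kappa> r) (at r within {a..b})" "\<And>r. r \<in> {a..b} \<Longrightarrow> 0 \<le> \<kappa> r"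
    and p: "\<And>r. r \<in> {a..b} \<Longrightarrow> 0 < u r \<Longrightarrow> - \<kappa> r \<le> p r"
  shows "u a \<le> max (u b) 0 + (\<Phi> b - \<Phi> a)"
proof -
  have \<Phi>mono: "\<Phi> x \<le> \<Phi> y" if "a \<le> x" "x \<le> y" "y \<le> b" for x y
  proof (rule nondecreasing_of_deriv_nonneg[where F = \<Phi> and F' = \<kappa> and a = x and b = y])
    show "(\<Phi> has_real_derivative \<kappa> r) (at r within {x..y})" if "x \<le> r" "r \<le> y" for r
      by (rule has_field_derivative_subset[OF \<Phi>(1)]) (use that \<open>a \<le> x\<close> \<open>y \<le> b\<close> in auto)
    show "0 \<le> \<kappa> r" if "x < r" "r < y" for r
      using \<Phi>(2)[of r] that \<open>a \<le> x\<close> \<open>y \<le> b\<close> by auto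
  qed (use that in auto)
  have mono: "u a + \<Phi> a \<le> u z + \<Phi> z" if z: "a \<le> z" "z \<le> b" "\<And>y. a \<le> y \<Longrightarrow> y < z \<Longrightarrow> 0 < u y" for z
  proof (rule nondecreasing_of_deriv_nonneg[where F = "\<lambda>r. u r + \<Phi> r" and F' = "\<lambda>r. p r + \<kappa> r" and a = a and b = z])
    show "((\<lambda>r. u r + \<Phi> r) has_real_derivative p r + \<kappa> r) (at r within {a..z})" if "a \<le> r" "r \<le> z" for r
      using that z by (intro DERIV_add has_field_derivative_subset[OF u] has_field_derivative_subset[OF \<Phi>(1)]) auto
    show "0 \<le> p r + \<kappa> r" if "a < r" "r < z" for r using p[of r] z(3)[of r] that z by auto
  qed (use z in auto)
  show ?thesis
  proof (cases "0 < u a")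
    case False
    then show ?thesis using \<Phi>mono[of a b] ab by auto
  next
    case True
    show ?thesis
    proof (cases "\<exists>r\<in>{a..b}. u r \<le> 0")
      case True
      then obtain r where r: "r \<in> {a..b}" "u r \<le> 0" by blast
      have "continuous_on {a..r} u"
        by (rule continuous_on_subset[OF DERIV_continuous_on[OF u]]) (use r in auto)
      then obtain z where "a < z" "z \<le> r" "u z = 0" "\<And>y. a \<le> y \<Longrightarrow> y < z \<Longrightarrow> 0 < u y"
        using first_crossing[of a r u 0] r \<open>0 < u a\<close> by auto
      then show ?thesis using mono[of z] \<Phi>mono[of z b] r by auto
    next
      case False
      then show ?thesis using mono[of b] ab by (auto simp: not_le)
    qed
  qed
qed

lemma linear_form_subinterval:
  assumes "linear_form \<alpha> c G u p a b" "a \<le> x" "x \<le> y" "y \<le> b"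
  shows "linear_form \<alpha> c G u p x y"
proof -
  have sub: "{x..y} \<subseteq> {a..b}" using assms by auto
  show ?thesis
    using assms sub unfolding linear_form_def
    by (blast intro: ac_primitive_subinterval absolutely_integrable_subinterval has_field_derivative_subset order_trans less_le_trans)
qed

lemma linear_form_continuous:
  assumes "linear_form \<alpha> c G u p a b"
  shows "continuous_on {a..b} u" "continuous_on {a..b} p"
proof -
  show "continuous_on {a..b} u" using assms
    by (auto simp: linear_form_def continuous_on_eq_continuous_within intro!: DERIV_continuous)
  show "continuous_on {a..b} p" using assms by (auto simp: linear_form_def intro: ac_primitive_continuous)
qed

lemma linear_form_flux:
  assumes c: "coefficient c k l" and L: "linear_form \<alpha> c G u p a b"
  shows "ac_primitive (\<lambda>r. weight c r * p r) (\<lambda>r. weight c r * (\<alpha> r * G r)) a b"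
  using L by (intro ac_primitive_weight_mult[OF c]) (auto simp: linear_form_def)

lemma weight_coefficient_integrable:
  assumes c: "coefficient c k l" and \<alpha>: "coefficient \<alpha> k' l'" and f: "f absolutely_integrable_on {a..b}" and a: "0 < a"
  shows "(\<lambda>r. weight c r * (\<alpha> r * f r)) absolutely_integrable_on {a..b}"
  by (intro continuous_mult_integrable continuous_on_weight[OF c a] coefficient_mult_integrable[OF \<alpha> f a])

lemma tanh_real_times_tendsto_sgn: "(\<lambda>k. tanh (real k * t)) \<longlonglongrightarrow> sgn (t::real)"
proof -
  have pos: "(\<lambda>k. tanh (real k * t)) \<longlonglongrightarrow> 1" if "t > 0" for t :: real
  proof -
    have "filterlim (\<lambda>k. real k * t) at_top sequentially"
      using that by (intro filterlim_at_top_mult_tendsto_pos[OF tendsto_const that] filterlim_real_sequentially)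
    then show ?thesis using tanh_real_at_top filterlim_compose by blast
  qed
  consider "t > 0" | "t = 0" | "t < 0" by linarith
  then show ?thesis
  proof cases
    case 3
    then have "(\<lambda>k. - tanh (real k * (-t))) \<longlonglongrightarrow> - 1" by (intro tendsto_minus pos) simp
    then show ?thesis using 3 by simp
  qed (use pos in auto)
qed

text \<open>Kato's inequality: the equation is tested with a smooth approximation of \<open>sgn u\<close>.\<close>

lemma Kato_inequality:
  assumes c: "coefficient c k l" and \<alpha>: "coefficient \<alpha> m M" and m: "0 \<le> m"
    and L: "linear_form \<alpha> c (\<lambda>r. g (u r) - f r) u p a b"
    and g: "continuous_on UNIV g" "\<And>t. 0 \<le> t * g t" "g 0 = 0" and f: "f absolutely_integrable_on {a..b}"
  shows "integral {a..b} (\<lambda>r. weight c r * (\<alpha> r * \<bar>g (u r)\<bar>)) \<le>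
    weight c b * p b * sgn (u b) - weight c a * p a * sgn (u a) + integral {a..b} (\<lambda>r. weight c r * (\<alpha> r * \<bar>f r\<bar>))"
proof -
  have ab: "0 < a" "a \<le> b" and u: "\<And>r. r \<in> {a..b} \<Longrightarrow> (u has_real_derivative p r) (at r within {a..b})"
    using L by (auto simp: linear_form_def)
  note cont = linear_form_continuous[OF L]
  have up: "ac_primitive u p a b"
    using ab u cont by (intro ac_primitive_C1) auto
  define W where "W r = weight c r * p r" for r
  have W: "ac_primitive W (\<lambda>r. weight c r * (\<alpha> r * (g (u r) - f r))) a b"
    unfolding W_def by (rule linear_form_flux[OF c L])
  have gu: "continuous_on {a..b} (\<lambda>r. g (u r))"
    by (rule continuous_on_compose2[OF g(1) cont(1)]) auto
  define J where "J r = weight c r * (\<alpha> r * \<bar>g (u r)\<bar>)" for r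
  define K where "K r = weight c r * (\<alpha> r * \<bar>f r\<bar>)" for r
  \<comment> \<open>This is smooth and nondecreasing in t, has modulus at most 1 and tends to
    \<open>sgn t\<close>, including the value 0 at t = 0.\<close>
  define S where "S k t = tanh (real k * t)" for k t
  have J: "J absolutely_integrable_on {a..b}" unfolding J_def
    using gu ab by (intro weight_coefficient_integrable[OF c \<alpha>]) (auto intro!: absolutely_integrable_continuous_real continuous_intros)
  have K: "K absolutely_integrable_on {a..b}" unfolding K_def
    using f ab by (intro weight_coefficient_integrable[OF c \<alpha>] set_integrable_abs)
  have Scont: "continuous_on {a..b} (\<lambda>r. S k (u r))" for k
    unfolding S_def using cont by (intro continuous_intros) auto
  have JS: "(\<lambda>r. S k (u r) * (weight c r * (\<alpha> r * g (u r)))) absolutely_integrable_on {a..b}" for k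
    using gu ab by (intro continuous_mult_integrable Scont weight_coefficient_integrable[OF c \<alpha>] absolutely_integrable_continuous_real) auto
  have est: "integral {a..b} (\<lambda>r. S k (u r) * (weight c r * (\<alpha> r * g (u r)))) \<le>
     W b * S k (u b) - W a * S k (u a) + integral {a..b} K" for k
  proof -
    have "ac_primitive (\<lambda>r. S k (u r)) (\<lambda>r. (real k * (1 - tanh (real k * u r) ^ 2)) * p r) a b"
      unfolding S_def
    proof (rule ac_primitive_compose[OF up ab(2)])
      show "((\<lambda>t. tanh (real k * t)) has_real_derivative real k * (1 - (tanh (real k * t))\<^sup>2)) (at t)" for t
        by (auto intro!: derivative_eq_intros)
      show "continuous_on UNIV (\<lambda>t. real k * (1 - (tanh (real k * t))\<^sup>2))"
        by (intro continuous_intros) auto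
    qed
    from ac_primitive_mult[OF W this ab(2)]
    have P: "ac_primitive (\<lambda>r. W r * S k (u r)) (\<lambda>r. W r * (real k * (1 - (tanh (real k * u r))\<^sup>2) * p r) +
        weight c r * (\<alpha> r * (g (u r) - f r)) * S k (u r)) a b" (is "ac_primitive _ ?D a b") .
    have "integral {a..b} (\<lambda>r. S k (u r) * (weight c r * (\<alpha> r * g (u r))) - K r) \<le> integral {a..b} ?D"
    proof (rule integral_le)
      show "?D integrable_on {a..b}" using ac_primitiveD(1)[OF P] by (rule set_lebesgue_integral_eq_integral(1))
      show "(\<lambda>r. S k (u r) * (weight c r * (\<alpha> r * g (u r))) - K r) integrable_on {a..b}"
        using JS K by (intro set_lebesgue_integral_eq_integral(1) set_integral_diff)
      fix r assume r: "r \<in> {a..b}"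
      have tanh: "(tanh (real k * u r))\<^sup>2 \<le> 1" "\<bar>S k (u r)\<bar> \<le> 1"
        using tanh_real_bounds[of "real k * u r"] by (auto simp: S_def abs_square_le_1 abs_le_iff)
      \<comment> \<open>The derivative of tanh produces the weight times p^2 times a nonnegative
        factor; this term is dropped.\<close>
      have "0 \<le> weight c r * (p r * p r) * (real k * (1 - (tanh (real k * u r))\<^sup>2))"
        using tanh(1) by (intro mult_nonneg_nonneg[OF mult_nonneg_nonneg]) auto
      then have 1: "0 \<le> W r * (real k * (1 - (tanh (real k * u r))\<^sup>2) * p r)"
        by (simp add: W_def mult_ac)
      have ar: "0 \<le> \<alpha> r" using coefficient_bounds[OF \<alpha>, of r] r ab m by auto
      have "f r * S k (u r) \<le> \<bar>f r\<bar> * 1"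
        using tanh(2) by (metis abs_ge_zero abs_le_D1 abs_mult mult_left_mono)
      then have "weight c r * (\<alpha> r * (f r * S k (u r))) \<le> weight c r * (\<alpha> r * \<bar>f r\<bar>)"
        using ar by (intro mult_left_mono) auto
      then show "S k (u r) * (weight c r * (\<alpha> r * g (u r))) - K r \<le> ?D r"
        using 1 by (simp add: K_def algebra_simps)
    qed
    also have "\<dots> = W b * S k (u b) - W a * S k (u a)"
      using ac_primitiveD(2)[OF P, of a b] ab by simp
    finally show ?thesis
      using JS[of k] K by (subst (asm) Henstock_Kurzweil_Integration.integral_diff) (auto dest: set_lebesgue_integral_eq_integral(1))
  qed
  have lim1: "(\<lambda>k. integral {a..b} (\<lambda>r. S k (u r) * (weight c r * (\<alpha> r * g (u r))))) \<longlonglongrightarrow> integral {a..b} J"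
  proof (rule dominated_convergence(2)[where h = J])
    show "(\<lambda>r. S k (u r) * (weight c r * (\<alpha> r * g (u r)))) integrable_on {a..b}" for k
      using JS by (rule set_lebesgue_integral_eq_integral(1))
    show "J integrable_on {a..b}" using J by (rule set_lebesgue_integral_eq_integral(1))
    show "norm (S k (u r) * (weight c r * (\<alpha> r * g (u r)))) \<le> J r" if r: "r \<in> {a..b}" for k r
    proof -
      have ar: "0 \<le> \<alpha> r" using coefficient_bounds[OF \<alpha>, of r] r ab m by auto
      have "\<bar>S k (u r)\<bar> \<le> 1" using tanh_real_bounds[of "real k * u r"] by (auto simp: S_def abs_le_iff)
      then have "\<bar>S k (u r)\<bar> * J r \<le> 1 * J r" using ar by (intro mult_right_mono) (auto simp: J_def)
      then show ?thesis using ar by (simp add: J_def abs_mult)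
    qed
    show "(\<lambda>k. S k (u r) * (weight c r * (\<alpha> r * g (u r)))) \<longlonglongrightarrow> J r" if r: "r \<in> {a..b}" for r
    proof -
      have "sgn (u r) * g (u r) = \<bar>g (u r)\<bar>"
        using g(2)[of "u r"] g(3) by (auto simp: sgn_if zero_le_mult_iff)
      then have "J r = sgn (u r) * (weight c r * (\<alpha> r * g (u r)))" by (simp add: J_def mult_ac)
      then show ?thesis unfolding S_def
        by (auto intro!: tendsto_intros tanh_real_times_tendsto_sgn)
    qed
  qed
  have lim2: "(\<lambda>k. W b * S k (u b) - W a * S k (u a) + integral {a..b} K) \<longlonglongrightarrow> W b * sgn (u b) - W a * sgn (u a) + integral {a..b} K"
    unfolding S_def by (intro tendsto_intros tanh_real_times_tendsto_sgn)
  have "integral {a..b} J \<le> W b * sgn (u b) - W a * sgn (u a) + integral {a..b} K"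
    by (rule LIMSEQ_le[OF lim1 lim2]) (use est in auto)
  then show ?thesis by (simp add: J_def[abs_def] K_def[abs_def] W_def)
qed


section \<open>Bounds for the derivative in a linear equation\<close>

lemma integral_nonneg_real:
  fixes f :: "real \<Rightarrow> real"
  assumes "\<And>x. x \<in> S \<Longrightarrow> 0 \<le> f x"
  shows "0 \<le> integral S f"
  using assms Henstock_Kurzweil_Integration.integral_nonneg[of f S] not_integrable_integral[of f S]
  by (cases "f integrable_on S") auto

text \<open>Growth of the weight by at least the power k gives w(r) \<le> w(b) (r / b)^k. The bound
  then involves the weight only through w(b), which cancels when an estimate for w(b) p(b) is
  divided by it.\<close>

lemma weighted_integral_le:
  assumes c: "coefficient c k l" and \<alpha>: "coefficient \<alpha> m M" and m: "0 \<le> m"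
    and ab: "0 < a" "a \<le> b" and h: "h absolutely_integrable_on {a..b}" "\<And>r. r \<in> {a..b} \<Longrightarrow> 0 \<le> h r"
  shows "integral {a..b} (\<lambda>r. weight c r * (\<alpha> r * h r)) \<le>
    weight c b * (M * integral {a..b} (\<lambda>r. (r / b) powr k * h r))"
proof -
  have "(\<lambda>r. (r / b) powr k * h r) absolutely_integrable_on {a..b}"
    using ab h by (intro continuous_mult_integrable continuous_intros) auto
  then have hk: "(\<lambda>r. (r / b) powr k * h r) integrable_on {a..b}"
    by (rule set_lebesgue_integral_eq_integral(1))
  have "integral {a..b} (\<lambda>r. weight c r * (\<alpha> r * h r)) \<le>
      integral {a..b} (\<lambda>r. weight c b * (M * ((r / b) powr k * h r)))"
  proof (rule integral_le)
    show "(\<lambda>r. weight c r * (\<alpha> r * h r)) integrable_on {a..b}"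
      by (intro set_lebesgue_integral_eq_integral(1) weight_coefficient_integrable[OF c \<alpha> h(1) ab(1)])
    show "(\<lambda>r. weight c b * (M * ((r / b) powr k * h r))) integrable_on {a..b}"
      using hk by (intro integrable_on_mult_right)
    fix r assume r: "r \<in> {a..b}"
    have "weight c r * (b / r) powr k \<le> weight c b" using weight_le(2)[OF c, of r b] r ab by auto
    then have "weight c r \<le> weight c b * (r / b) powr k"
      using r ab by (simp add: powr_divide field_simps)
    moreover have "0 \<le> \<alpha> r" "\<alpha> r \<le> M" using coefficient_bounds[OF \<alpha>, of r] r ab m by auto
    ultimately have "weight c r * (\<alpha> r * h r) \<le> (weight c b * (r / b) powr k) * (M * h r)"
      using h(2)[OF r] by (intro mult_mono) auto
    then show "weight c r * (\<alpha> r * h r) \<le> weight c b * (M * ((r / b) powr k * h r))"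
      by (simp add: mult_ac)
  qed
  then show ?thesis by (simp add: integral_mult_right)
qed

text \<open>Kato's inequality with the nonlinear term dropped: a one-sided slope bound that does not
  depend on the size of u.\<close>

lemma linear_form_sgn_bound:
  assumes c: "coefficient c k l" and \<alpha>: "coefficient \<alpha> m M" and m: "0 \<le> m"
    and L: "linear_form \<alpha> c (\<lambda>r. g (u r) - f r) u p a b"
    and g: "continuous_on UNIV g" "\<And>t. 0 \<le> t * g t" "g 0 = 0" and f: "f absolutely_integrable_on {a..b}"
  shows "weight c a / weight c b * (p a * sgn (u a)) - M * integral {a..b} (\<lambda>r. (r / b) powr k * \<bar>f r\<bar>)
    \<le> p b * sgn (u b)"
proof -
  have ab: "0 < a" "a \<le> b" using L by (auto simp: linear_form_def)
  have "0 \<le> integral {a..b} (\<lambda>r. weight c r * (\<alpha> r * \<bar>g (u r)\<bar>))"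
  proof (rule integral_nonneg_real)
    fix r assume "r \<in> {a..b}"
    then have "0 \<le> \<alpha> r" using coefficient_bounds(1)[OF \<alpha>, of r] ab m by auto
    then show "0 \<le> weight c r * (\<alpha> r * \<bar>g (u r)\<bar>)" by simp
  qed
  moreover have "integral {a..b} (\<lambda>r. weight c r * (\<alpha> r * \<bar>f r\<bar>)) \<le>
    weight c b * (M * integral {a..b} (\<lambda>r. (r / b) powr k * \<bar>f r\<bar>))"
    using ab f by (intro weighted_integral_le[OF c \<alpha> m] set_integrable_abs) auto
  ultimately have "weight c a * p a * sgn (u a) - weight c b * (M * integral {a..b} (\<lambda>r. (r / b) powr k * \<bar>f r\<bar>))
    \<le> weight c b * p b * sgn (u b)"
    using Kato_inequality[OF c \<alpha> m L g f] by linarith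
  then show ?thesis by (simp add: field_simps)
qed

lemma linear_form_bound_right:
  assumes c: "coefficient c k l" and \<alpha>: "coefficient \<alpha> m M" and m: "0 \<le> m"
    and L: "linear_form \<alpha> c G u p a b"
  shows "\<bar>p b\<bar> \<le> weight c a / weight c b * \<bar>p a\<bar> + M * integral {a..b} (\<lambda>r. (r / b) powr k * \<bar>G r\<bar>)"
    and "\<bar>weight c b * p b - weight c a * p a\<bar> \<le> weight c b * (M * integral {a..b} (\<lambda>r. (r / b) powr k * \<bar>G r\<bar>))"
proof -
  have ab: "0 < a" "a \<le> b" and G: "G absolutely_integrable_on {a..b}" using L by (auto simp: linear_form_def)
  note W = linear_form_flux[OF c L]
  have "\<bar>weight c b * p b - weight c a * p a\<bar> = norm (integral {a..b} (\<lambda>r. weight c r * (\<alpha> r * G r)))"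
    using ac_primitiveD(2)[OF W, of a b] ab by simp
  also have "\<dots> \<le> integral {a..b} (\<lambda>r. weight c r * (\<alpha> r * \<bar>G r\<bar>))"
  proof (rule integral_norm_bound_integral)
    show "(\<lambda>r. weight c r * (\<alpha> r * G r)) integrable_on {a..b}"
      using ac_primitiveD(1)[OF W] by (rule set_lebesgue_integral_eq_integral(1))
    show "(\<lambda>r. weight c r * (\<alpha> r * \<bar>G r\<bar>)) integrable_on {a..b}"
      by (intro set_lebesgue_integral_eq_integral(1) weight_coefficient_integrable[OF c \<alpha> _ ab(1)] set_integrable_abs G)
    show "norm (weight c r * (\<alpha> r * G r)) \<le> weight c r * (\<alpha> r * \<bar>G r\<bar>)" if "r \<in> {a..b}" for r
      using coefficient_bounds(1)[OF \<alpha>, of r] m that ab by (auto simp: abs_mult)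
  qed
  also have "\<dots> \<le> weight c b * (M * integral {a..b} (\<lambda>r. (r / b) powr k * \<bar>G r\<bar>))"
    using ab G by (intro weighted_integral_le[OF c \<alpha> m] set_integrable_abs) auto
  finally show 1: "\<bar>weight c b * p b - weight c a * p a\<bar> \<le> weight c b * (M * integral {a..b} (\<lambda>r. (r / b) powr k * \<bar>G r\<bar>))" .
  have "weight c b * \<bar>p b\<bar> \<le> weight c a * \<bar>p a\<bar> + \<bar>weight c b * p b - weight c a * p a\<bar>"
  proof -
    have "\<bar>weight c b * p b\<bar> = weight c b * \<bar>p b\<bar>" "\<bar>weight c a * p a\<bar> = weight c a * \<bar>p a\<bar>"
      by (simp_all add: abs_mult)
    then show ?thesis by linarith
  qed
  then have "weight c b * \<bar>p b\<bar> \<le> weight c a * \<bar>p a\<bar> + weight c b * (M * integral {a..b} (\<lambda>r. (r / b) powr k * \<bar>G r\<bar>))"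
    using 1 by linarith
  then show "\<bar>p b\<bar> \<le> weight c a / weight c b * \<bar>p a\<bar> + M * integral {a..b} (\<lambda>r. (r / b) powr k * \<bar>G r\<bar>)"
    by (simp add: field_simps)
qed

lemma integral_powr_weight_le:
  assumes k: "0 \<le> (k::real)" and ab: "0 < a" and h: "h absolutely_integrable_on {a..b}" 
  shows "integral {a..b} (\<lambda>r. (r / b) powr k * \<bar>h r\<bar>) \<le> integral {a..b} (\<lambda>r. \<bar>h r\<bar>)"
proof (rule integral_le)
  have h': "(\<lambda>r. \<bar>h r\<bar>) absolutely_integrable_on {a..b}" using h by (rule set_integrable_abs)
  then show "(\<lambda>r. \<bar>h r\<bar>) integrable_on {a..b}" by (rule set_lebesgue_integral_eq_integral(1))
  have "(\<lambda>r. (r / b) powr k * \<bar>h r\<bar>) absolutely_integrable_on {a..b}"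
    using ab h' by (intro continuous_mult_integrable continuous_intros) auto
  then show "(\<lambda>r. (r / b) powr k * \<bar>h r\<bar>) integrable_on {a..b}" by (rule set_lebesgue_integral_eq_integral(1))
  show "(r / b) powr k * \<bar>h r\<bar> \<le> \<bar>h r\<bar>" if "r \<in> {a..b}" for r
  proof -
    have "(r / b) powr k \<le> 1 powr k" using that ab k by (intro powr_mono2) auto
    then show ?thesis by (simp add: mult_left_le_one_le)
  qed
qed

text \<open>From right to left the loss is the ratio of the weights, at most (b / a)^l; here the
  upper exponent enters, while the bounds from left to right use only k.\<close>

lemma linear_form_bound_left:
  assumes c: "coefficient c k l" and k: "0 \<le> k" and \<alpha>: "coefficient \<alpha> m M" and m: "0 \<le> m"
    and L: "linear_form \<alpha> c G u p a b"
  shows "\<bar>p a\<bar> \<le> (b / a) powr l * (\<bar>p b\<bar> + M * integral {a..b} (\<lambda>r. \<bar>G r\<bar>))"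
proof -
  have ab: "0 < a" "a \<le> b" and G: "G absolutely_integrable_on {a..b}" using L by (auto simp: linear_form_def)
  have M: "0 \<le> M" using coefficient_bounds[OF \<alpha>, of 1] m by simp
  let ?I = "integral {a..b} (\<lambda>r. \<bar>G r\<bar>)"
  have "weight c a * \<bar>p a\<bar> \<le> weight c b * \<bar>p b\<bar> + \<bar>weight c b * p b - weight c a * p a\<bar>"
  proof -
    have "\<bar>weight c b * p b\<bar> = weight c b * \<bar>p b\<bar>" "\<bar>weight c a * p a\<bar> = weight c a * \<bar>p a\<bar>"
      by (simp_all add: abs_mult)
    then show ?thesis by linarith
  qed
  also have "\<dots> \<le> weight c b * \<bar>p b\<bar> + weight c b * (M * integral {a..b} (\<lambda>r. (r / b) powr k * \<bar>G r\<bar>))"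
    using linear_form_bound_right(2)[OF c \<alpha> m L] by simp
  also have "\<dots> \<le> weight c b * \<bar>p b\<bar> + weight c b * (M * ?I)"
    using integral_powr_weight_le[OF k ab(1) G] M by (intro add_left_mono mult_left_mono) auto
  also have "\<dots> = weight c b * (\<bar>p b\<bar> + M * ?I)" by (simp add: distrib_left)
  also have "\<dots> \<le> (weight c a * (b / a) powr l) * (\<bar>p b\<bar> + M * ?I)"
    using weight_le(1)[OF c ab] M by (intro mult_right_mono add_nonneg_nonneg mult_nonneg_nonneg integral_nonneg_real) auto
  finally have "weight c a * \<bar>p a\<bar> \<le> weight c a * ((b / a) powr l * (\<bar>p b\<bar> + M * ?I))" by (simp add: mult_ac)
  then show ?thesis by simp
qed

text \<open>A Keller--Osserman argument: after the length \<open>D M\<^bsup>(1-s)/2\<^esup>\<close> the function \<open>u\<close> has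
  grown from \<open>M\<close> to \<open>2 M\<close>; these lengths form a geometric series, so \<open>u\<close> would blow up.\<close>

lemma Keller_Osserman:
  fixes u p :: "real \<Rightarrow> real"
  assumes s: "s > 1" and c0: "c0 > 0" and C: "C \<ge> 0" and B: "B > 0"
    and u: "\<And>r. r \<in> {a..b} \<Longrightarrow> (u has_real_derivative p r) (at r within {a..b})"
    and p: "\<And>x y m. a \<le> x \<Longrightarrow> x \<le> y \<Longrightarrow> y \<le> b \<Longrightarrow> 0 < m \<Longrightarrow> (\<And>r. r \<in> {x..y} \<Longrightarrow> m \<le> u r) \<Longrightarrow>
        c0 * m powr s * (y - x) - C \<le> p y"
    and T: "sqrt (3 * 2 powr s / c0) * B powr ((1 - s) / 2) \<le> (b - a) * (1 - 2 powr ((1 - s) / 2))"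
    and CB: "C * (sqrt (3 * 2 powr s / c0) * B powr ((1 - s) / 2)) < B / 2"
    and ab: "a \<le> b"
  shows "u a < B"
proof (rule ccontr)
  assume "\<not> u a < B" then have uB: "B \<le> u a" by simp
  \<comment> \<open>For t = D M^((1-s)/2) the gain c0 (M/2)^s t^2 / 2 equals 3M/2; subtracting C t <
    M/2 leaves at least M, hence the doubling.\<close>
  define D where "D = sqrt (3 * 2 powr s / c0)"
  \<comment> \<open>Doubling M multiplies the length by q < 1.\<close>
  define q where "q = 2 powr ((1 - s) / 2)"
  have q: "0 < q" "q < 1"
    using s powr_less_mono[of "(1 - s) / 2" 0 2] by (auto simp: q_def)
  define t where "t M = D * M powr ((1 - s) / 2)" for M
  have D: "D > 0" "D * D = 3 * 2 powr s / c0" using c0 by (auto simp: D_def)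
  have tpos: "0 < t M" if "M > 0" for M using D that by (simp add: t_def)
  have t2: "t (2 * M) = t M * q" if "M > 0" for M
    using that by (simp add: t_def q_def powr_mult)
  have contu: "continuous_on {a..b} u"
    using u by (rule DERIV_continuous_on)
  have sub: "(u has_real_derivative p r) (at r within {y..z})" if "a \<le> y" "z \<le> b" "r \<in> {y..z}" for y z r
    by (rule has_field_derivative_subset[OF u]) (use that in auto)
  have step: "2 * M \<le> u (x + t M)" if x: "a \<le> x" "x + t M \<le> b" "M \<le> u x" and M: "0 < M" "C * t M < M / 2" for x M
  proof -
    have tM: "0 < t M" using tpos M by blast
    \<comment> \<open>Until u falls to M/2 its slope is at least - C (the hypothesis on an interval
      of length 0), and C t(M) < M/2.\<close>
    have ge: "M / 2 \<le> u r" if r: "r \<in> {x..x + t M}" for r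
    proof (rule ccontr)
      assume nr: "\<not> M / 2 \<le> u r"
      have "continuous_on {x..r} u" using contu by (rule continuous_on_subset) (use x r in auto)
      then obtain z where z: "x < z" "z \<le> r" "u z = M / 2" "\<And>y. x \<le> y \<Longrightarrow> y < z \<Longrightarrow> M / 2 < u y"
        using first_crossing[of x r u "M / 2"] nr x M r by auto
      have "u x + C * x \<le> u z + C * z"
      proof (rule nondecreasing_of_deriv_nonneg[where F = "\<lambda>r. u r + C * r" and F' = "\<lambda>r. p r + C" and a = x and b = z])
        show "((\<lambda>r. u r + C * r) has_real_derivative p y + C) (at y within {x..z})" if "x \<le> y" "y \<le> z" for y
          using sub[of x z y] that x z r by (auto intro!: derivative_eq_intros)
        show "0 \<le> p y + C" if "x < y" "y < z" for y
          using p[of y y "M / 2"] z(4)[of y] that x z r M by auto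
      qed (use z in auto)
      moreover have "C * (z - x) \<le> C * t M" using C z r by (intro mult_left_mono) auto
      ultimately show False using z(3) x(3) M by (simp add: algebra_simps)
    qed
    define c1 where "c1 = c0 * (M / 2) powr s"
    have "u x - (c1 * (x - x)\<^sup>2 / 2 - C * (x - x)) \<le> u (x + t M) - (c1 * (x + t M - x)\<^sup>2 / 2 - C * (x + t M - x))"
    proof (rule nondecreasing_of_deriv_nonneg[where F = "\<lambda>r. u r - (c1 * (r - x)\<^sup>2 / 2 - C * (r - x))"
          and F' = "\<lambda>r. p r - (c1 * (r - x) - C)" and a = x and b = "x + t M"])
      show "((\<lambda>r. u r - (c1 * (r - x)\<^sup>2 / 2 - C * (r - x))) has_real_derivative p r - (c1 * (r - x) - C)) (at r within {x..x + t M})"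
        if "x \<le> r" "r \<le> x + t M" for r
        using sub[of x "x + t M" r] that x by (auto intro!: derivative_eq_intros)
      show "0 \<le> p r - (c1 * (r - x) - C)" if "x < r" "r < x + t M" for r
        using p[of x r "M / 2"] ge that x M by (auto simp: c1_def)
    qed (use tM in auto)
    then have *: "u x + c1 * (t M)\<^sup>2 / 2 - C * t M \<le> u (x + t M)" by simp
    have "M powr ((1 - s) / 2) * M powr ((1 - s) / 2) = M powr (1 - s)"
      unfolding powr_add[symmetric] by (rule arg_cong[where f = "\<lambda>z. M powr z"]) simp
    then have "(t M)\<^sup>2 = (3 * 2 powr s / c0) * M powr (1 - s)"
      unfolding t_def power2_eq_square using D(2) by (metis mult.assoc mult.left_commute)
    then have "c1 * (t M)\<^sup>2 = 3 * (M powr s * M powr (1 - s))"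
      using c0 M by (simp add: c1_def powr_divide)
    also have "M powr s * M powr (1 - s) = M" using M by (simp flip: powr_add)
    finally show ?thesis using * x(3) M by linarith
  qed
  \<comment> \<open>At R k the function has reached 2^k B; by the hypothesis on b - a the geometric
    series stays inside [a, b].\<close>
  define R where "R k = a + (\<Sum>i<k. t B * q ^ i)" for k
  have R_le: "R k \<le> b" for k
  proof -
    have "(\<Sum>i<k. t B * q ^ i) * (1 - q) = t B * ((\<Sum>i<k. q ^ i) * (1 - q))"
      by (simp add: sum_distrib_left[symmetric])
    also have "(\<Sum>i<k. q ^ i) * (1 - q) = 1 - q ^ k"
      using q by (simp add: sum_gp_strict)
    also have "t B * (1 - q ^ k) \<le> t B * 1"
      using q tpos[OF B] by (intro mult_left_mono) auto
    also have "\<dots> \<le> (b - a) * (1 - q)" using T by (simp add: t_def D_def q_def)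
    finally show ?thesis using q by (simp add: R_def)
  qed
  have tk: "t (2 ^ k * B) = t B * q ^ k" for k
  proof (induction k)
    case (Suc k)
    have "t (2 ^ Suc k * B) = t (2 * (2 ^ k * B))" by (simp add: mult_ac)
    also have "\<dots> = t B * q ^ Suc k" using t2[of "2 ^ k * B"] B Suc.IH by simp
    finally show ?case .
  qed simp
  have grow: "2 ^ k * B \<le> u (R k)" for k
  proof (induction k)
    case 0
    then show ?case using uB by (simp add: R_def)
  next
    case (Suc k)
    have RS: "R (Suc k) = R k + t (2 ^ k * B)" by (simp add: R_def tk)
    have "0 \<le> (\<Sum>i<k. t B * q ^ i)" using q tpos[OF B] by (intro sum_nonneg) auto
    then have "a \<le> R k" by (simp add: R_def)
    have "C * t (2 ^ k * B) \<le> C * t B"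
      unfolding tk using C q tpos[OF B] by (intro mult_left_mono) (auto simp: mult_left_le power_le_one)
    also have "\<dots> < B / 2" using CB by (simp add: t_def D_def)
    also have "\<dots> \<le> 2 ^ k * B / 2" using B by simp
    finally have "2 * (2 ^ k * B) \<le> u (R k + t (2 ^ k * B))"
      using R_le[of "Suc k"] RS Suc.IH B \<open>a \<le> R k\<close> by (intro step) auto
    then show ?case by (simp add: RS)
  qed
  have "bounded (u ` {a..b})"
    using contu by (auto intro: compact_imp_bounded compact_continuous_image)
  then obtain K where K: "\<And>r. r \<in> {a..b} \<Longrightarrow> \<bar>u r\<bar> \<le> K"
    unfolding bounded_iff real_norm_def by blast
  obtain k where k: "K / B < 2 ^ k" using real_arch_pow[of 2 "K / B"] by auto
  have "0 \<le> (\<Sum>i<k. t B * q ^ i)" using q tpos[OF B] by (intro sum_nonneg) auto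
  then have "R k \<in> {a..b}" using R_le[of k] by (simp add: R_def)
  then have "2 ^ k * B \<le> K" using grow[of k] K[of "R k"] by linarith
  then show False using k B by (simp add: pos_divide_less_eq)
qed

section \<open>The radial equation\<close>

definition spower :: "real \<Rightarrow> real \<Rightarrow> real" where
  "spower s t = \<bar>t\<bar> powr (s - 1) * t"

lemma spower_nonneg: "0 \<le> t \<Longrightarrow> spower s t = t powr s"
  by (cases "t = 0") (auto simp: spower_def powr_diff)

lemma spower_minus [simp]: "spower s (- t) = - spower s t"
  by (simp add: spower_def)

lemma spower_0 [simp]: "spower s 0 = 0"
  by (simp add: spower_def)

lemma abs_spower: "\<bar>spower s t\<bar> = \<bar>t\<bar> powr s"
  by (cases "t = 0") (auto simp: spower_def abs_mult powr_diff)

lemma spower_mult_nonneg: "0 \<le> t * spower s t"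
  by (simp add: spower_def mult.left_commute[of t])

lemma continuous_on_spower: "s > 1 \<Longrightarrow> continuous_on UNIV (spower s)"
  unfolding spower_def by (intro continuous_on_mult continuous_on_powr' continuous_intros) auto

text \<open>By homogeneity a + b = 1, where x^s \<le> x for both terms.\<close>

lemma powr_superadditive:
  fixes a b :: real
  assumes "0 \<le> a" "0 \<le> b" "s \<ge> 1"
  shows "a powr s + b powr s \<le> (a + b) powr s"
proof (cases "a + b = 0")
  case False
  then have ab: "0 < a + b" using assms by simp
  have le: "x powr s \<le> x" if "0 \<le> x" "x \<le> 1" for x :: real
  proof (cases "x = 0")
    case False
    then show ?thesis using that assms powr_mono'[of 1 s x] by simp
  qed simp
  have "(a / (a + b)) powr s + (b / (a + b)) powr s \<le> a / (a + b) + b / (a + b)"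
    using assms ab by (intro add_mono le) auto
  also have "\<dots> = 1" using ab by (simp flip: add_divide_distrib)
  finally show ?thesis using assms ab by (simp add: powr_divide flip: add_divide_distrib)
next
  case True
  then show ?thesis using assms by (simp add: add_nonneg_eq_0_iff)
qed

text \<open>For equal signs superadditivity even gives (u - v)^s. The half is for opposite signs,
  where the larger of u and - v is at least (u - v) / 2.\<close>

lemma spower_diff_ge:
  assumes s: "s > 1" and uv: "v \<le> u"
  shows "((u - v) / 2) powr s \<le> spower s u - spower s v"
proof -
  have half: "((u - v) / 2) powr s \<le> (u - v) powr s" using s uv by (intro powr_mono2) auto
  consider "0 \<le> v" | "v \<le> 0" "0 \<le> u" | "u \<le> 0" using uv by linarith
  then show ?thesis
  proof cases
    case 1
    then have "(u - v) powr s + v powr s \<le> (u - v + v) powr s" using s uv by (intro powr_superadditive) auto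
    then show ?thesis using half 1 uv by (simp add: spower_nonneg)
  next
    case 2
    have "((u - v) / 2) powr s \<le> max u (- v) powr s" using s 2 by (intro powr_mono2) auto
    also have "\<dots> \<le> u powr s + (- v) powr s" by (auto simp: max_def)
    also have "\<dots> = spower s u - spower s v"
      using 2 spower_nonneg[of u s] spower_nonneg[of "- v" s] by simp
    finally show ?thesis .
  next
    case 3
    then have "(u - v) powr s + (- u) powr s \<le> (u - v + - u) powr s" using s uv by (intro powr_superadditive) auto
    then show ?thesis using half 3 uv spower_nonneg[of "- u" s] spower_nonneg[of "- v" s] by simp
  qed
qed

section \<open>The Pucci nonlinearities and their difference quotients\<close>

locale pucci =
  fixes lam Lam s n :: real
  assumes lam: "0 < lam" "lam \<le> Lam" and s: "1 < s" and n: "1 \<le> n"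
begin

abbreviation "\<theta> \<equiv> theta lam Lam"

text \<open>This is N_+ - 1, the lower bound of the damping coefficient \<theta> t / \<theta> t' (n
  - 1); \<open>\<kappa>'\<close> is the upper bound.\<close>

definition "\<kappa> = lam / Lam * (n - 1)"
definition "\<kappa>' = Lam / lam * (n - 1)"
definition "\<Gamma> t = t / \<theta> t"
definition "drift p = \<theta> p * (n - 1) * p"

lemma theta_bounds: "lam \<le> \<theta> t" "\<theta> t \<le> Lam" "0 < \<theta> t"
  using lam by (auto simp: theta_def)

lemma Lam_pos: "0 < Lam" "1 / Lam \<le> 1 / lam" "0 \<le> 1 / Lam"
  using lam by (auto simp: divide_simps)

lemma kappa: "0 \<le> \<kappa>" "0 \<le> \<kappa>'" "\<kappa> \<le> \<kappa>'"
proof -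
  show "0 \<le> \<kappa>" "0 \<le> \<kappa>'" using lam n by (auto simp: \<kappa>_def \<kappa>'_def)
  have "lam / Lam \<le> 1" "1 \<le> Lam / lam" using lam by (auto simp: divide_simps)
  then show "\<kappa> \<le> \<kappa>'" unfolding \<kappa>_def \<kappa>'_def using n by (intro mult_right_mono) auto
qed

lemma inverse_theta_bounds: "1 / Lam \<le> 1 / \<theta> t" "1 / \<theta> t \<le> 1 / lam" "0 < 1 / \<theta> t"
  using theta_bounds[of t] lam by (auto simp: divide_simps)

lemma theta_ratio_bounds: "\<kappa> \<le> \<theta> t / \<theta> t' * (n - 1)" "\<theta> t / \<theta> t' * (n - 1) \<le> \<kappa>'"
proof -
  have pos: "0 \<le> \<theta> t" using theta_bounds(3) by (rule less_imp_le)
  have "lam / Lam \<le> \<theta> t / \<theta> t'" using theta_bounds lam pos by (intro frac_le) auto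
  then show "\<kappa> \<le> \<theta> t / \<theta> t' * (n - 1)" unfolding \<kappa>_def using n by (intro mult_right_mono) auto
  have "\<theta> t / \<theta> t' \<le> Lam / lam" using theta_bounds lam pos by (intro frac_le) auto
  then show "\<theta> t / \<theta> t' * (n - 1) \<le> \<kappa>'" unfolding \<kappa>'_def using n by (intro mult_right_mono) auto
qed

text \<open>Difference quotient with a free value d on the diagonal; d is later taken within the
  bounds of the quotients, so that these hold at every point.\<close>

definition slope :: "(real \<Rightarrow> real) \<Rightarrow> real \<Rightarrow> real \<Rightarrow> real \<Rightarrow> real" where
  "slope h d x y = (if x = y then d else (h x - h y) / (x - y))"

lemma slope_mult: "h x - h y = slope h d x y * (x - y)"
  by (simp add: slope_def)

lemma slope_bounds:
  assumes "\<And>x y. y < x \<Longrightarrow> m * (x - y) \<le> h x - h y \<and> h x - h y \<le> M * (x - y)" "m \<le> d" "d \<le> M"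
  shows "m \<le> slope h d x y" "slope h d x y \<le> M"
proof -
  have *: "m \<le> slope h d x y \<and> slope h d x y \<le> M" if "y < x" for x y
    using assms(1)[OF that] that by (auto simp: slope_def pos_le_divide_eq pos_divide_le_eq)
  have sym: "slope h d x y = slope h d y x"
    by (auto simp: slope_def) (metis minus_diff_eq minus_divide_divide)
  show "m \<le> slope h d x y" "slope h d x y \<le> M"
    using *[of y x] *[of x y] sym assms by (cases x y rule: linorder_cases; auto simp: slope_def)+
qed

lemma Gamma_increment:
  assumes "y < x"
  shows "1 / Lam * (x - y) \<le> \<Gamma> x - \<Gamma> y \<and> \<Gamma> x - \<Gamma> y \<le> 1 / lam * (x - y)"
proof -
  have L: "0 < Lam" using lam by simp
  have a: "x / Lam \<le> x / lam" if "0 \<le> x" for x using lam that by (intro divide_left_mono) auto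
  have b: "x / lam \<le> x / Lam" if "x \<le> 0" for x using a[of "- x"] that by simp
  consider "0 \<le> y" | "y < 0" "0 \<le> x" | "x < 0" using assms by linarith
  then show ?thesis
    by cases (use assms a[of "x - y"] a[of x] b[of y] in \<open>auto simp: \<Gamma>_def theta_def diff_divide_distrib\<close>)
qed

lemma drift_increment:
  assumes "y < x"
  shows "lam * (n - 1) * (x - y) \<le> drift x - drift y \<and> drift x - drift y \<le> Lam * (n - 1) * (x - y)"
proof -
  have a: "lam * x \<le> Lam * x" if "0 \<le> x" for x using lam that by (intro mult_right_mono) auto
  have b: "Lam * x \<le> lam * x" if "x \<le> 0" for x using a[of "- x"] that by simp
  have "lam * (x - y) \<le> \<theta> x * x - \<theta> y * y \<and> \<theta> x * x - \<theta> y * y \<le> Lam * (x - y)"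
  proof -
    consider "0 \<le> y" | "y < 0" "0 \<le> x" | "x < 0" using assms by linarith
    then show ?thesis
      by cases (use assms a[of "x - y"] a[of x] b[of y] in \<open>auto simp: theta_def right_diff_distrib\<close>)
  qed
  then have "(n - 1) * (lam * (x - y)) \<le> (n - 1) * (\<theta> x * x - \<theta> y * y)"
    "(n - 1) * (\<theta> x * x - \<theta> y * y) \<le> (n - 1) * (Lam * (x - y))"
    using n by (auto intro: mult_left_mono)
  then show ?thesis by (simp add: drift_def algebra_simps)
qed

lemma Gamma_lipschitz: "\<bar>\<Gamma> x - \<Gamma> y\<bar> \<le> 1 / lam * \<bar>x - y\<bar>"
proof -
  have "\<Gamma> x - \<Gamma> y = slope \<Gamma> (1 / lam) x y * (x - y)" by (rule slope_mult)
  moreover have "1 / Lam \<le> slope \<Gamma> (1/lam) x y" and le: "slope \<Gamma> (1/lam) x y \<le> 1 / lam"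
    using slope_bounds[OF Gamma_increment, of "1/lam" x y] Lam_pos by auto
  moreover have "0 \<le> slope \<Gamma> (1/lam) x y" using calculation(2) Lam_pos by linarith
  ultimately have "\<bar>\<Gamma> x - \<Gamma> y\<bar> = slope \<Gamma> (1 / lam) x y * \<bar>x - y\<bar>" by (simp add: abs_mult)
  then show ?thesis using mult_right_mono[OF le, of "\<bar>x - y\<bar>"] by simp
qed

lemma drift_lipschitz: "\<bar>drift x - drift y\<bar> \<le> Lam * (n - 1) * \<bar>x - y\<bar>"
proof -
  have "drift x - drift y = slope drift (Lam * (n - 1)) x y * (x - y)" by (rule slope_mult)
  moreover have "lam * (n - 1) \<le> Lam * (n - 1)" using lam n by (intro mult_right_mono) auto
  then have "lam * (n - 1) \<le> slope drift (Lam * (n - 1)) x y" "slope drift (Lam * (n - 1)) x y \<le> Lam * (n - 1)"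
    using slope_bounds[OF drift_increment, of "Lam * (n - 1)" x y] by auto
  moreover have "0 \<le> lam * (n - 1)" using lam n by simp
  ultimately show ?thesis by (simp add: abs_mult mult_right_mono)
qed

lemma Gamma_0 [simp]: "\<Gamma> 0 = 0" and drift_0 [simp]: "drift 0 = 0"
  by (simp_all add: \<Gamma>_def drift_def)

lemma continuous_Gamma: "continuous_on UNIV \<Gamma>" and continuous_drift: "continuous_on UNIV drift"
proof -
  have "(1 / lam)-lipschitz_on UNIV \<Gamma>" "(Lam * (n - 1))-lipschitz_on UNIV drift"
    using Gamma_lipschitz drift_lipschitz lam n by (auto simp: lipschitz_on_def dist_real_def)
  then show "continuous_on UNIV \<Gamma>" "continuous_on UNIV drift" by (auto intro: lipschitz_on_continuous_on)
qed

lemma borel_Gamma [measurable]: "\<Gamma> \<in> borel_measurable borel" and borel_drift [measurable]: "drift \<in> borel_measurable borel"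
  using continuous_Gamma continuous_drift by (auto intro: borel_measurable_continuous_onI)

lemma borel_theta [measurable]: "\<theta> \<in> borel_measurable borel"
  unfolding theta_def by measurable

text \<open>The argument of \<theta> inside \<open>Theta\<close>; the equation says that u'' is
  \<Gamma> of it. The nonlinearity g is a parameter because the power is first truncated.\<close>

definition driving :: "(real \<Rightarrow> real) \<Rightarrow> (real \<Rightarrow> real) \<Rightarrow> (real \<Rightarrow> real) \<Rightarrow> (real \<Rightarrow> real) \<Rightarrow> real \<Rightarrow> real" where
  "driving g f u p r = g (u r) - f r - drift (p r) / r"

definition solves :: "(real \<Rightarrow> real) \<Rightarrow> (real \<Rightarrow> real) \<Rightarrow> (real \<Rightarrow> real) \<Rightarrow> (real \<Rightarrow> real) \<Rightarrow> real \<Rightarrow> real \<Rightarrow> bool" where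
  "solves g f u p a b \<longleftrightarrow> 0 < a \<and> a \<le> b \<and>
     (\<forall>r\<in>{a..b}. (u has_real_derivative p r) (at r within {a..b})) \<and>
     f absolutely_integrable_on {a..b} \<and>
     ac_primitive p (\<lambda>r. \<Gamma> (driving g f u p r)) a b"

lemma solvesD:
  assumes "solves g f u p a b"
  shows "0 < a" "a \<le> b" "\<And>r. r \<in> {a..b} \<Longrightarrow> (u has_real_derivative p r) (at r within {a..b})"
    "f absolutely_integrable_on {a..b}" "ac_primitive p (\<lambda>r. \<Gamma> (driving g f u p r)) a b"
    "continuous_on {a..b} u" "continuous_on {a..b} p"
  using assms ac_primitive_continuous DERIV_continuous_on unfolding solves_def by blast+

lemma solves_subinterval:
  assumes S: "solves g f u p a b" and xy: "a \<le> x" "x \<le> y" "y \<le> b"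
  shows "solves g f u p x y"
proof -
  have sub: "{x..y} \<subseteq> {a..b}" using xy by auto
  show ?thesis
    unfolding solves_def
  proof (intro conjI ballI)
    show "0 < x" using solvesD(1)[OF S] xy by simp
    show "(u has_real_derivative p r) (at r within {x..y})" if "r \<in> {x..y}" for r
      using has_field_derivative_subset[OF solvesD(3)[OF S] sub] that sub by blast
    show "f absolutely_integrable_on {x..y}"
      by (rule absolutely_integrable_subinterval[OF solvesD(4)[OF S]]) (use xy in auto)
    show "ac_primitive p (\<lambda>r. \<Gamma> (driving g f u p r)) x y"
      by (rule ac_primitive_subinterval[OF solvesD(5)[OF S]]) (use xy in auto)
  qed (fact xy)
qed

lemma driving_measurable:
  assumes "solves g f u p a b" and g: "continuous_on UNIV g"
  shows "driving g f u p \<in> borel_measurable (lebesgue_on {a..b})"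
    and "(\<lambda>r. g (u r)) absolutely_integrable_on {a..b}"
    and "p \<in> borel_measurable (lebesgue_on {a..b})"
proof -
  note S = solvesD[OF assms(1)]
  have gu: "continuous_on {a..b} (\<lambda>r. g (u r))" "continuous_on {a..b} (\<lambda>r. drift (p r) / r)"
    using S continuous_on_compose2[OF g] continuous_on_compose2[OF continuous_drift]
    by (auto intro!: continuous_intros)
  then show "(\<lambda>r. g (u r)) absolutely_integrable_on {a..b}"
    by (auto intro: absolutely_integrable_continuous_real)
  show "p \<in> borel_measurable (lebesgue_on {a..b})"
    using S by (auto intro: continuous_imp_measurable_on_sets_lebesgue)
  have "(\<lambda>r. g (u r)) \<in> borel_measurable (lebesgue_on {a..b})" "(\<lambda>r. drift (p r) / r) \<in> borel_measurable (lebesgue_on {a..b})"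
    using gu by (auto intro: continuous_imp_measurable_on_sets_lebesgue)
  moreover have "f \<in> borel_measurable (lebesgue_on {a..b})"
    using S by (auto intro: absolutely_integrable_imp_borel_measurable)
  ultimately show "driving g f u p \<in> borel_measurable (lebesgue_on {a..b})"
    unfolding driving_def[abs_def] by simp
qed

text \<open>A linearisation is known on [a, b] only, whereas \<open>weight\<close> integrates from
  1; a constant within the bounds fills the rest.\<close>

lemma coefficient_extension:
  assumes c: "c \<in> borel_measurable (lebesgue_on {a..b})" "\<And>r. r \<in> {a..b} \<Longrightarrow> k \<le> c r \<and> c r \<le> l" and d: "k \<le> d" "d \<le> l"
  shows "coefficient (\<lambda>r. if r \<in> {a..b} then c r else d) k l"
proof -
  have "(\<lambda>r. indicator {a..b} r *\<^sub>R c r) \<in> borel_measurable lebesgue"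
    using c(1) by (subst (asm) borel_measurable_restrict_space_iff) auto
  moreover have "(indicator {a..b} :: real \<Rightarrow> real) \<in> borel_measurable lebesgue"
    by (intro borel_measurable_indicator) simp
  ultimately have "(\<lambda>r. indicator {a..b} r *\<^sub>R c r + d * (1 - indicator {a..b} r)) \<in> borel_measurable lebesgue"
    by (intro borel_measurable_add borel_measurable_times borel_measurable_diff borel_measurable_const)
  also have "(\<lambda>r. indicator {a..b} r *\<^sub>R c r + d * (1 - indicator {a..b} r)) = (\<lambda>r. if r \<in> {a..b} then c r else d)"
    by (auto simp: indicator_def)
  finally have "(\<lambda>r. if r \<in> {a..b} then c r else d) \<in> borel_measurable lebesgue" .
  then have "set_borel_measurable lebesgue {0<..} (\<lambda>r. if r \<in> {a..b} then c r else d)"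
    unfolding set_borel_measurable_def
    by (intro borel_measurable_scaleR borel_measurable_indicator) simp_all
  then show ?thesis using c d by (auto simp: coefficient_def)
qed

text \<open>\<Gamma> divides by \<theta>, so freezing the values of \<theta> along a solution leaves
  a linear equation.\<close>

lemma Gamma_driving_linear:
  "\<Gamma> (driving g f u p r) = 1 / \<theta> (driving g f u p r) * (g (u r) - f r)
     - (\<theta> (p r) / \<theta> (driving g f u p r) * (n - 1)) * p r / r"
  unfolding \<Gamma>_def driving_def[of g f u p r] drift_def
  by (simp add: diff_divide_distrib mult_ac)

lemma solves_linear_form:
  assumes S: "solves g f u p a b" and g: "continuous_on UNIV g"
    and \<alpha>: "\<And>r. r \<in> {a..b} \<Longrightarrow> \<alpha> r = 1 / \<theta> (driving g f u p r)"
    and c: "\<And>r. r \<in> {a..b} \<Longrightarrow> c r = \<theta> (p r) / \<theta> (driving g f u p r) * (n - 1)"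
  shows "linear_form \<alpha> c (\<lambda>r. g (u r) - f r) u p a b"
  unfolding linear_form_def
proof (intro conjI ballI)
  note S' = solvesD[OF S]
  show "(\<lambda>r. g (u r) - f r) absolutely_integrable_on {a..b}"
    using driving_measurable(2)[OF S g] S'(4) by (intro set_integral_diff) auto
  show "ac_primitive p (\<lambda>r. \<alpha> r * (g (u r) - f r) - c r * p r / r) a b"
    using S'(5) by (rule ac_primitive_cong_AE) (auto simp: \<alpha> c Gamma_driving_linear)
qed (use S solvesD[OF S] in auto)

lemma solves_linearisation:
  assumes S: "solves g f u p a b" and g: "continuous_on UNIV g"
  obtains \<alpha> c where "coefficient \<alpha> (1 / Lam) (1 / lam)" "coefficient c \<kappa> \<kappa>'"
    "linear_form \<alpha> c (\<lambda>r. g (u r) - f r) u p a b"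
proof -
  define \<alpha> where "\<alpha> r = (if r \<in> {a..b} then 1 / \<theta> (driving g f u p r) else 1 / lam)" for r
  define c where "c r = (if r \<in> {a..b} then \<theta> (p r) / \<theta> (driving g f u p r) * (n - 1) else \<kappa>)" for r
  note m = driving_measurable[OF S g]
  have "coefficient \<alpha> (1 / Lam) (1 / lam)"
    unfolding \<alpha>_def[abs_def]
  proof (rule coefficient_extension)
    show "(\<lambda>r. 1 / \<theta> (driving g f u p r)) \<in> borel_measurable (lebesgue_on {a..b})"
      using m(1) by measurable
  qed (use inverse_theta_bounds order_trans in \<open>blast+\<close>)
  moreover have "coefficient c \<kappa> \<kappa>'"
    unfolding c_def[abs_def]
  proof (rule coefficient_extension)
    show "(\<lambda>r. \<theta> (p r) / \<theta> (driving g f u p r) * (n - 1)) \<in> borel_measurable (lebesgue_on {a..b})"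
      using m(1,3) by measurable
  qed (use theta_ratio_bounds kappa in auto)
  moreover have "linear_form \<alpha> c (\<lambda>r. g (u r) - f r) u p a b"
    by (rule solves_linear_form[OF S g]) (auto simp: \<alpha>_def c_def)
  ultimately show thesis by (rule that)
qed

text \<open>The difference of two solutions solves a linear equation whose coefficients are the
  difference quotients of the nonlinearities.\<close>

lemma solves_difference:
  assumes S: "solves g f u p a b" and T: "solves g f' v w a b" and g: "continuous_on UNIV g"
  obtains \<alpha> c where "coefficient \<alpha> (1 / Lam) (1 / lam)" "coefficient c \<kappa> \<kappa>'"
    "linear_form \<alpha> c (\<lambda>r. (g (u r) - g (v r)) - (f r - f' r)) (\<lambda>r. u r - v r) (\<lambda>r. p r - w r) a b"
proof -
  define E where "E = driving g f u p"
  define F where "F = driving g f' v w"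
  define A where "A r = slope \<Gamma> (1 / lam) (E r) (F r)" for r
  define D where "D r = slope drift (Lam * (n - 1)) (p r) (w r)" for r
  define \<alpha> where "\<alpha> r = (if r \<in> {a..b} then A r else 1 / lam)" for r
  define c where "c r = (if r \<in> {a..b} then A r * D r else \<kappa>)" for r
  note mS = driving_measurable[OF S g] and mT = driving_measurable[OF T g]
  note S' = solvesD[OF S] and T' = solvesD[OF T]
  have [measurable]: "E \<in> borel_measurable (lebesgue_on {a..b})" "F \<in> borel_measurable (lebesgue_on {a..b})"
    "p \<in> borel_measurable (lebesgue_on {a..b})" "w \<in> borel_measurable (lebesgue_on {a..b})"
    using mS mT by (auto simp: E_def F_def)
  have [measurable]: "A \<in> borel_measurable (lebesgue_on {a..b})" "D \<in> borel_measurable (lebesgue_on {a..b})"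
    unfolding A_def[abs_def] D_def[abs_def] slope_def by measurable
  have A: "1 / Lam \<le> A r" "A r \<le> 1 / lam" for r
    unfolding A_def using slope_bounds[OF Gamma_increment, of "1 / lam"] Lam_pos by auto
  have "lam * (n - 1) \<le> Lam * (n - 1)" using lam n by (intro mult_right_mono) auto
  then have D: "lam * (n - 1) \<le> D r" "D r \<le> Lam * (n - 1)" for r
    unfolding D_def using slope_bounds[OF drift_increment, of "Lam * (n - 1)"] by auto
  have nn: "0 \<le> 1 / Lam" "0 \<le> lam * (n - 1)" using lam n by auto
  have AD: "\<kappa> \<le> A r * D r" "A r * D r \<le> \<kappa>'" for r
  proof -
    have "1 / Lam * (lam * (n - 1)) \<le> A r * D r" using A D nn order_trans[OF nn(1) A(1)] by (intro mult_mono) auto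
    then show "\<kappa> \<le> A r * D r" by (simp add: \<kappa>_def)
    have "A r * D r \<le> 1 / lam * (Lam * (n - 1))" using A D order_trans[OF nn(2) D(1)] lam by (intro mult_mono) auto
    then show "A r * D r \<le> \<kappa>'" by (simp add: \<kappa>'_def)
  qed
  have "coefficient \<alpha> (1 / Lam) (1 / lam)"
    unfolding \<alpha>_def[abs_def] by (rule coefficient_extension) (use A inverse_theta_bounds order_trans in \<open>auto intro: order_trans\<close>)
  moreover have "coefficient c \<kappa> \<kappa>'"
    unfolding c_def[abs_def] by (rule coefficient_extension) (use AD kappa in auto)
  moreover have "linear_form \<alpha> c (\<lambda>r. (g (u r) - g (v r)) - (f r - f' r)) (\<lambda>r. u r - v r) (\<lambda>r. p r - w r) a b"
    unfolding linear_form_def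
  proof (intro conjI ballI)
    show "((\<lambda>r. u r - v r) has_real_derivative p r - w r) (at r within {a..b})" if "r \<in> {a..b}" for r
      by (intro DERIV_diff S'(3) T'(3) that)
    show "(\<lambda>r. (g (u r) - g (v r)) - (f r - f' r)) absolutely_integrable_on {a..b}"
      using mS(2) mT(2) S'(4) T'(4) by (intro set_integral_diff) auto
    have P: "ac_primitive (\<lambda>r. p r - w r) (\<lambda>r. \<Gamma> (E r) - \<Gamma> (F r)) a b"
      unfolding E_def F_def by (rule ac_primitive_diff[OF S'(5) T'(5)])
    have eq: "\<Gamma> (E r) - \<Gamma> (F r) = \<alpha> r * ((g (u r) - g (v r)) - (f r - f' r)) - c r * (p r - w r) / r"
      if "a < r" "r < b" for r
    proof -
      have "drift (p r) - drift (w r) = D r * (p r - w r)" unfolding D_def by (rule slope_mult)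
      then have "E r - F r = (g (u r) - g (v r)) - (f r - f' r) - D r * (p r - w r) / r"
      proof -
        have "drift (p r) / r - drift (w r) / r = D r * (p r - w r) / r"
          using \<open>drift (p r) - drift (w r) = _\<close> by (metis diff_divide_distrib)
        then show ?thesis unfolding E_def F_def driving_def by linarith
      qed
      moreover have "\<Gamma> (E r) - \<Gamma> (F r) = A r * (E r - F r)" unfolding A_def by (rule slope_mult)
      ultimately have "\<Gamma> (E r) - \<Gamma> (F r) = A r * ((g (u r) - g (v r)) - (f r - f' r) - D r * (p r - w r) / r)" by simp
      also have "\<dots> = A r * ((g (u r) - g (v r)) - (f r - f' r)) - A r * D r * (p r - w r) / r"
        by (simp only: right_diff_distrib times_divide_eq_right mult.assoc)
      finally show ?thesis using that by (simp add: \<alpha>_def c_def)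
    qed
    show "ac_primitive (\<lambda>r. p r - w r) (\<lambda>r. \<alpha> r * ((g (u r) - g (v r)) - (f r - f' r)) - c r * (p r - w r) / r) a b"
      by (rule ac_primitive_cong_AE[OF P]) (use eq in auto)
  qed (use S' in auto)
  ultimately show thesis by (rule that)
qed

section \<open>Admissible right-hand sides and their mass near the origin\<close>

definition admissible :: "(real \<Rightarrow> real) \<Rightarrow> bool" where
  "admissible f \<longleftrightarrow> set_borel_measurable lebesgue {0<..} f \<and>
     (\<forall>R>0. (\<lambda>r. r powr \<kappa> * \<bar>f r\<bar>) absolutely_integrable_on {0..R})"

text \<open>The factor 1 / lam is the upper bound of \<alpha>. The term f contributes at most
  \<open>mass f r\<close> r^(-\<kappa>) to the slope at r, for every weight with exponent at least
  \<kappa>.\<close>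

definition mass :: "(real \<Rightarrow> real) \<Rightarrow> real \<Rightarrow> real" where
  "mass f r = integral {0..r} (\<lambda>\<tau>. \<tau> powr \<kappa> * \<bar>f \<tau>\<bar>) / lam"

lemma admissible_integrable:
  assumes f: "admissible f" and a: "0 < a"
  shows "f absolutely_integrable_on {a..b}"
proof (cases "a \<le> b")
  case True
  have "(\<lambda>r. r powr \<kappa> * \<bar>f r\<bar>) absolutely_integrable_on {0..b}"
    using f a True less_le_trans unfolding admissible_def by blast
  then have *: "(\<lambda>r. r powr \<kappa> * \<bar>f r\<bar>) absolutely_integrable_on {a..b}"
    by (rule absolutely_integrable_subinterval) (use a in auto)
  have "f \<in> borel_measurable (lebesgue_on {0<..})"
    using f by (simp add: admissible_def set_borel_measurable_lebesgue_iff[symmetric])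
  then have "f \<in> borel_measurable (lebesgue_on {a..b})"
    by (rule measurable_restrict_mono) (use a in auto)
  then show ?thesis
  proof (rule measurable_bounded_by_integrable_imp_absolutely_integrable)
    show "(\<lambda>r. a powr (- \<kappa>) * (r powr \<kappa> * \<bar>f r\<bar>)) integrable_on {a..b}"
      using * by (intro integrable_on_mult_right set_lebesgue_integral_eq_integral(1))
    fix r assume r: "r \<in> {a..b}"
    have "a powr \<kappa> \<le> r powr \<kappa>" using r a kappa by (intro powr_mono2) auto
    then have "1 \<le> a powr (- \<kappa>) * r powr \<kappa>" using a by (simp add: powr_minus field_simps)
    then have "1 * \<bar>f r\<bar> \<le> (a powr (- \<kappa>) * r powr \<kappa>) * \<bar>f r\<bar>" by (intro mult_right_mono) auto
    then show "norm (f r) \<le> a powr (- \<kappa>) * (r powr \<kappa> * \<bar>f r\<bar>)" by (simp only: mult_1 mult.assoc real_norm_def)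
  qed simp
qed auto

lemma mass_bound:
  assumes f: "admissible f" and ab: "0 < a" "a \<le> b"
  shows "1 / lam * integral {a..b} (\<lambda>r. (r / b) powr \<kappa> * \<bar>f r\<bar>) \<le> mass f b * b powr (- \<kappa>)"
proof -
  have i: "(\<lambda>r. r powr \<kappa> * \<bar>f r\<bar>) absolutely_integrable_on {0..b}" using f ab by (auto simp: admissible_def)
  have "integral {a..b} (\<lambda>r. (r / b) powr \<kappa> * \<bar>f r\<bar>) = integral {a..b} (\<lambda>r. b powr (- \<kappa>) * (r powr \<kappa> * \<bar>f r\<bar>))"
    using ab by (intro integral_cong) (auto simp: powr_divide powr_minus field_simps)
  also have "\<dots> = b powr (- \<kappa>) * integral {a..b} (\<lambda>r. r powr \<kappa> * \<bar>f r\<bar>)" by (rule integral_mult_right)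
  also have "\<dots> \<le> b powr (- \<kappa>) * integral {0..b} (\<lambda>r. r powr \<kappa> * \<bar>f r\<bar>)"
    using ab i absolutely_integrable_subinterval(2)[OF i, of a b] absolutely_integrable_subinterval(2)[OF i, of 0 b]
    by (intro mult_left_mono integral_subset_le) auto
  finally show ?thesis using lam by (simp add: mass_def divide_right_mono mult_ac)
qed

lemma mass_nonneg: "0 \<le> mass f r"
  unfolding mass_def using lam by (intro divide_nonneg_pos integral_nonneg_real) auto

lemma mass_mono:
  assumes f: "admissible f" and ab: "0 \<le> a" "a \<le> b"
  shows "mass f a \<le> mass f b"
proof (cases "b = 0")
  case False
  then have i: "(\<lambda>r. r powr \<kappa> * \<bar>f r\<bar>) absolutely_integrable_on {0..b}" using f ab by (auto simp: admissible_def)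
  have "integral {0..a} (\<lambda>r. r powr \<kappa> * \<bar>f r\<bar>) \<le> integral {0..b} (\<lambda>r. r powr \<kappa> * \<bar>f r\<bar>)"
    using ab absolutely_integrable_subinterval(2)[OF i, of 0 a] absolutely_integrable_subinterval(2)[OF i, of 0 b]
    by (intro integral_subset_le) auto
  then show ?thesis using lam by (simp add: mass_def divide_right_mono)
qed (use ab in auto)

lemma mass_tendsto_0:
  assumes f: "admissible f"
  shows "(mass f \<longlongrightarrow> 0) (at_right 0)"
proof -
  have i: "(\<lambda>r. r powr \<kappa> * \<bar>f r\<bar>) absolutely_integrable_on {0..1}" using f by (auto simp: admissible_def)
  have "continuous_on {0..1} (\<lambda>x. integral {0..x} (\<lambda>r. r powr \<kappa> * \<bar>f r\<bar>))"
    using i by (intro indefinite_integral_continuous_1 set_lebesgue_integral_eq_integral(1))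
  then have "((\<lambda>x. integral {0..x} (\<lambda>r. r powr \<kappa> * \<bar>f r\<bar>)) \<longlongrightarrow> integral {0..0} (\<lambda>r. r powr \<kappa> * \<bar>f r\<bar>)) (at 0 within {0..1})"
    unfolding continuous_on_def by (drule_tac bspec[of _ _ 0]) simp_all
  then have "((\<lambda>x. integral {0..x} (\<lambda>r. r powr \<kappa> * \<bar>f r\<bar>)) \<longlongrightarrow> 0) (at_right 0)"
    by (simp add: at_within_Icc_at_right)
  then show ?thesis unfolding mass_def[abs_def] using tendsto_divide[OF _ tendsto_const] lam by fastforce
qed


text \<open>This is \<open>dim_fun\<close> - 1 when p is the derivative of u, so its weight is
  \<open>rho\<close>.\<close>

definition damping :: "(real \<Rightarrow> real) \<Rightarrow> (real \<Rightarrow> real) \<Rightarrow> (real \<Rightarrow> real) \<Rightarrow> real \<Rightarrow> real" where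
  "damping f u p r = \<theta> (p r) / \<theta> (driving (spower s) f u p r) * (n - 1)"

text \<open>The condition at the origin accounts for the test functions that do not vanish there.\<close>

definition global_solution :: "(real \<Rightarrow> real) \<Rightarrow> (real \<Rightarrow> real) \<Rightarrow> (real \<Rightarrow> real) \<Rightarrow> bool" where
  "global_solution f u p \<longleftrightarrow> (\<forall>a b. 0 < a \<longrightarrow> a \<le> b \<longrightarrow> solves (spower s) f u p a b) \<and>
     ((\<lambda>r. weight (damping f u p) r * p r) \<longlongrightarrow> 0) (at_right 0)"

lemmas spower_continuous = continuous_on_spower[OF s]

text \<open>The flux condition is left out of the hypotheses, so that these facts also serve for a
  limit of approximations before its flux is known.\<close>

lemma global_coefficients:
  assumes S': "\<forall>a b. 0 < a \<longrightarrow> a \<le> b \<longrightarrow> solves (spower s) f u p a b" and f: "admissible f"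
  shows "coefficient (\<lambda>r. 1 / \<theta> (driving (spower s) f u p r)) (1 / Lam) (1 / lam)" (is ?A)
    and "coefficient (damping f u p) \<kappa> \<kappa>'" (is ?C)
    and "0 < a \<Longrightarrow> a \<le> b \<Longrightarrow>
      linear_form (\<lambda>r. 1 / \<theta> (driving (spower s) f u p r)) (damping f u p) (\<lambda>r. spower s (u r) - f r) u p a b"
    and "r > 0 \<Longrightarrow> (u has_real_derivative p r) (at r)"
    and "continuous_on {0<..} u" "continuous_on {0<..} p"
proof -
  note S = S'[rule_format]
  show D: "(u has_real_derivative p r) (at r)" if "r > 0" for r
  proof -
    have "(u has_real_derivative p r) (at r within {r/2..2*r})"
      using solvesD(3)[OF S[of "r/2" "2*r"]] that by auto
    then show ?thesis using at_within_Icc_at[of "r/2" r "2*r"] that by simp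
  qed
  then show cu: "continuous_on {0<..} u"
    by (auto simp: continuous_on_eq_continuous_at intro: DERIV_isCont)
  show cp: "continuous_on {0<..} p"
    unfolding continuous_on_eq_continuous_at[OF open_greaterThan]
  proof
    fix r :: real assume "r \<in> {0<..}"
    then have "continuous_on {r/2..2*r} p" "r \<in> interior {r/2..2*r}"
      using solvesD(7)[OF S[of "r/2" "2*r"]] by auto
    then show "isCont p r" by (rule continuous_on_interior)
  qed
  have "f \<in> borel_measurable (lebesgue_on {0<..})"
    using f by (simp add: admissible_def set_borel_measurable_lebesgue_iff[symmetric])
  moreover have pm: "p \<in> borel_measurable (lebesgue_on {0<..})"
    using cp by (auto intro: continuous_imp_measurable_on_sets_lebesgue)
  moreover have "(\<lambda>r. spower s (u r)) \<in> borel_measurable (lebesgue_on {0<..})"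
    "(\<lambda>r. drift (p r) / r) \<in> borel_measurable (lebesgue_on {0<..})"
    using continuous_on_compose2[OF spower_continuous cu] continuous_on_compose2[OF continuous_drift cp]
    by (auto intro!: continuous_imp_measurable_on_sets_lebesgue continuous_intros)
  ultimately have dm: "driving (spower s) f u p \<in> borel_measurable (lebesgue_on {0<..})"
    unfolding driving_def[abs_def] by simp
  have "(\<lambda>r. 1 / \<theta> (driving (spower s) f u p r)) \<in> borel_measurable (lebesgue_on {0<..})"
    using dm by measurable
  then show ?A using inverse_theta_bounds by (auto simp: coefficient_def set_borel_measurable_lebesgue_iff)
  have "damping f u p \<in> borel_measurable (lebesgue_on {0<..})"
    unfolding damping_def[abs_def] using dm pm by measurable
  then show ?C using theta_ratio_bounds by (auto simp: coefficient_def set_borel_measurable_lebesgue_iff damping_def)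
  show "linear_form (\<lambda>r. 1 / \<theta> (driving (spower s) f u p r)) (damping f u p) (\<lambda>r. spower s (u r) - f r) u p a b"
    if "0 < a" "a \<le> b"
    by (rule solves_linear_form[OF S[OF that] spower_continuous]) (auto simp: damping_def)
qed

text \<open>With u bounded, the power adds at most B^s y / lam to the slope at y, and f at most
  \<open>mass f y\<close> y^(-\<kappa>).\<close>

lemma bounded_local_estimate:
  assumes f: "admissible f" and \<alpha>: "coefficient \<alpha> (1 / Lam) (1 / lam)" and c: "coefficient c \<kappa> \<kappa>'"
    and L: "linear_form \<alpha> c (\<lambda>r. spower s (u r) - f r) u p x y"
    and B: "\<And>r. r \<in> {x..y} \<Longrightarrow> \<bar>u r\<bar> \<le> B"
  shows "\<bar>p y\<bar> \<le> weight c x / weight c y * \<bar>p x\<bar> + (B powr s / lam * y + mass f y * y powr (- \<kappa>))"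
proof -
  have xy: "0 < x" "x \<le> y" and G: "(\<lambda>r. spower s (u r) - f r) absolutely_integrable_on {x..y}"
    using L by (auto simp: linear_form_def)
  have fi: "f absolutely_integrable_on {x..y}" using admissible_integrable[OF f xy(1)] .
  have fi': "(\<lambda>r. (r / y) powr \<kappa> * \<bar>f r\<bar>) integrable_on {x..y}"
    using xy fi by (intro set_lebesgue_integral_eq_integral(1) continuous_mult_integrable set_integrable_abs continuous_intros) auto
  have "integral {x..y} (\<lambda>r. (r / y) powr \<kappa> * \<bar>spower s (u r) - f r\<bar>) \<le>
      integral {x..y} (\<lambda>r. B powr s + (r / y) powr \<kappa> * \<bar>f r\<bar>)"
  proof (rule integral_le)
    show "(\<lambda>r. (r / y) powr \<kappa> * \<bar>spower s (u r) - f r\<bar>) integrable_on {x..y}"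
      using xy G by (intro set_lebesgue_integral_eq_integral(1) continuous_mult_integrable set_integrable_abs continuous_intros) auto
    show "(\<lambda>r. B powr s + (r / y) powr \<kappa> * \<bar>f r\<bar>) integrable_on {x..y}"
      using fi' by (intro integrable_add) auto
    fix r assume r: "r \<in> {x..y}"
    have q1: "(r / y) powr \<kappa> \<le> 1 powr \<kappa>" using r xy kappa by (intro powr_mono2) auto
    have "\<bar>spower s (u r)\<bar> \<le> B powr s" unfolding abs_spower using B[OF r] s by (intro powr_mono2) auto
    then have "(r / y) powr \<kappa> * \<bar>spower s (u r)\<bar> \<le> 1 * B powr s" using q1 by (intro mult_mono) auto
    moreover have "(r / y) powr \<kappa> * \<bar>spower s (u r) - f r\<bar> \<le> (r / y) powr \<kappa> * (\<bar>spower s (u r)\<bar> + \<bar>f r\<bar>)"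
      by (intro mult_left_mono) auto
    ultimately show "(r / y) powr \<kappa> * \<bar>spower s (u r) - f r\<bar> \<le> B powr s + (r / y) powr \<kappa> * \<bar>f r\<bar>"
      by (simp add: distrib_left)
  qed
  also have "\<dots> = B powr s * (y - x) + integral {x..y} (\<lambda>r. (r / y) powr \<kappa> * \<bar>f r\<bar>)"
    using xy fi' by (subst Henstock_Kurzweil_Integration.integral_add) auto
  also have "\<dots> \<le> B powr s * y + integral {x..y} (\<lambda>r. (r / y) powr \<kappa> * \<bar>f r\<bar>)"
    using xy by (intro add_right_mono mult_left_mono) auto
  finally have "1 / lam * integral {x..y} (\<lambda>r. (r / y) powr \<kappa> * \<bar>spower s (u r) - f r\<bar>) \<le>
      1 / lam * (B powr s * y + integral {x..y} (\<lambda>r. (r / y) powr \<kappa> * \<bar>f r\<bar>))"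
    using lam by (intro mult_left_mono) auto
  also have "\<dots> \<le> B powr s / lam * y + mass f y * y powr (- \<kappa>)"
    using mass_bound[OF f xy] by (simp add: distrib_left)
  finally show ?thesis
    using linear_form_bound_right(1)[OF c \<alpha> Lam_pos(3) L] by linarith
qed

context
  fixes f u p
  assumes G: "global_solution f u p" and f: "admissible f"
begin

lemma global_solves: "0 < a \<Longrightarrow> a \<le> b \<Longrightarrow> solves (spower s) f u p a b"
  and flux_tendsto_0: "((\<lambda>r. weight (damping f u p) r * p r) \<longlongrightarrow> 0) (at_right 0)"
  using G by (auto simp: global_solution_def)

lemmas global_facts = global_coefficients[OF G[unfolded global_solution_def, THEN conjunct1] f]

text \<open>Let the left end tend to 0 in \<open>linear_form_sgn_bound\<close>; the vanishing flux
  removes the boundary term.\<close>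

lemma sgn_derivative_bound:
  assumes y: "0 < y"
  shows "- (mass f y * y powr (- \<kappa>)) \<le> p y * sgn (u y)"
proof -
  let ?w = "weight (damping f u p)"
  have "((\<lambda>x. ?w x * p x * sgn (u x)) \<longlongrightarrow> 0) (at_right 0)"
  proof (rule tendsto_0_le[OF flux_tendsto_0, where K = 1])
    show "\<forall>\<^sub>F x in at_right 0. norm (?w x * p x * sgn (u x)) \<le> norm (?w x * p x) * 1"
      by (intro always_eventually) (auto simp: abs_mult sgn_if)
  qed
  then have "((\<lambda>x. ?w x * p x * sgn (u x) / ?w y - mass f y * y powr (- \<kappa>)) \<longlongrightarrow> 0 / ?w y - mass f y * y powr (- \<kappa>)) (at_right 0)"
    by (intro tendsto_intros) auto
  moreover have "\<forall>\<^sub>F x in at_right 0. ?w x * p x * sgn (u x) / ?w y - mass f y * y powr (- \<kappa>) \<le> p y * sgn (u y)"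
    unfolding eventually_at_right_field
  proof (intro exI[of _ y] conjI allI impI y)
    fix x assume x: "0 < x" "x < y"
    have "?w x / ?w y * (p x * sgn (u x)) - 1 / lam * integral {x..y} (\<lambda>r. (r / y) powr \<kappa> * \<bar>f r\<bar>) \<le> p y * sgn (u y)"
      using x admissible_integrable[OF f x(1)]
      by (intro linear_form_sgn_bound[OF global_facts(2,1) Lam_pos(3) global_facts(3)]) (auto intro: spower_continuous spower_mult_nonneg)
    then show "?w x * p x * sgn (u x) / ?w y - mass f y * y powr (- \<kappa>) \<le> p y * sgn (u y)"
      using mass_bound[OF f x(1), of y] x by (simp add: mult_ac)
  qed
  ultimately have "0 / ?w y - mass f y * y powr (- \<kappa>) \<le> p y * sgn (u y)"
    by (rule tendsto_upperbound) simp
  then show ?thesis by simp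
qed

text \<open>The flux condition is stated in the weight of u, which can be much smaller than
  r^\<kappa> near 0. For bounded u it removes the boundary term of
  \<open>bounded_local_estimate\<close>, and the resulting bound on \<bar>p y\<bar>, a multiple of y
  plus \<open>mass f y\<close> y^(-\<kappa>), gives the limit in the common weight
  r^\<kappa>.\<close>

lemma bounded_flux_tendsto_0:
  assumes R: "0 < R" and B: "\<And>r. 0 < r \<Longrightarrow> r \<le> R \<Longrightarrow> \<bar>u r\<bar> \<le> B"
  shows "((\<lambda>r. r powr \<kappa> * p r) \<longlongrightarrow> 0) (at_right 0)"
proof -
  let ?w = "weight (damping f u p)"
  have bd: "\<bar>p y\<bar> \<le> B powr s / lam * y + mass f y * y powr (- \<kappa>)" if y: "0 < y" "y \<le> R" for y
  proof -
    have "((\<lambda>x. ?w x * \<bar>p x\<bar>) \<longlongrightarrow> 0) (at_right 0)"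
      using tendsto_rabs_zero[OF flux_tendsto_0] by (simp add: abs_mult)
    then have "((\<lambda>x. ?w x * \<bar>p x\<bar> / ?w y + (B powr s / lam * y + mass f y * y powr (- \<kappa>))) \<longlongrightarrow>
        0 / ?w y + (B powr s / lam * y + mass f y * y powr (- \<kappa>))) (at_right 0)"
      by (intro tendsto_intros) auto
    moreover have "\<forall>\<^sub>F x in at_right 0. \<bar>p y\<bar> \<le> ?w x * \<bar>p x\<bar> / ?w y + (B powr s / lam * y + mass f y * y powr (- \<kappa>))"
      unfolding eventually_at_right_field
    proof (intro exI[of _ y] conjI allI impI y)
      fix x assume x: "0 < x" "x < y"
      have "\<bar>p y\<bar> \<le> ?w x / ?w y * \<bar>p x\<bar> + (B powr s / lam * y + mass f y * y powr (- \<kappa>))"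
        using x y B by (intro bounded_local_estimate[OF f global_facts(1,2,3)]) auto
      then show "\<bar>p y\<bar> \<le> ?w x * \<bar>p x\<bar> / ?w y + (B powr s / lam * y + mass f y * y powr (- \<kappa>))"
        by simp
    qed
    ultimately have "\<bar>p y\<bar> \<le> 0 / ?w y + (B powr s / lam * y + mass f y * y powr (- \<kappa>))"
      by (rule tendsto_lowerbound) simp
    then show ?thesis by simp
  qed
  have "((\<lambda>r. B powr s / lam * r * r powr \<kappa> + mass f r) \<longlongrightarrow> B powr s / lam * 0 * 1 + 0) (at_right 0)"
  proof (intro tendsto_add mass_tendsto_0[OF f])
    have "((\<lambda>r. r) \<longlongrightarrow> 0) (at_right (0::real))" by (rule tendsto_ident_at)
    then have lim: "((\<lambda>r. B powr s / lam * r) \<longlongrightarrow> B powr s / lam * 0) (at_right 0)" by (intro tendsto_intros)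
    then have lim': "((\<lambda>r. B powr s / lam * r) \<longlongrightarrow> 0) (at_right 0)" by simp
    have "((\<lambda>r. B powr s / lam * r * r powr \<kappa>) \<longlongrightarrow> 0) (at_right 0)"
    proof (rule tendsto_0_le[OF lim', where K = 1])
      show "\<forall>\<^sub>F r in at_right 0. norm (B powr s / lam * r * r powr \<kappa>) \<le> norm (B powr s / lam * r) * 1"
        unfolding eventually_at_right_field
      proof (intro exI[of _ 1] conjI allI impI)
        fix r :: real assume r: "0 < r" "r < 1"
        have "r powr \<kappa> \<le> 1 powr \<kappa>" using r kappa by (intro powr_mono2) auto
        then show "norm (B powr s / lam * r * r powr \<kappa>) \<le> norm (B powr s / lam * r) * 1"
          unfolding norm_mult[of _ "r powr \<kappa>"] by (intro mult_left_mono) auto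
      qed simp
    qed
    then show "((\<lambda>r. B powr s / lam * r * r powr \<kappa>) \<longlongrightarrow> B powr s / lam * 0 * 1) (at_right 0)" by simp
  qed
  then have "((\<lambda>r. B powr s / lam * r * r powr \<kappa> + mass f r) \<longlongrightarrow> 0) (at_right 0)" by simp
  then show ?thesis
  proof (rule tendsto_0_le[where K = 1])
    show "\<forall>\<^sub>F r in at_right 0. norm (r powr \<kappa> * p r) \<le> norm (B powr s / lam * r * r powr \<kappa> + mass f r) * 1"
      unfolding eventually_at_right_field
    proof (intro exI[of _ R] conjI allI impI R)
      fix r assume r: "0 < r" "r < R"
      have "r powr \<kappa> * \<bar>p r\<bar> \<le> r powr \<kappa> * (B powr s / lam * r + mass f r * r powr (- \<kappa>))"
        using r bd[of r] by (intro mult_left_mono) auto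
      also have "\<dots> = B powr s / lam * r * r powr \<kappa> + mass f r"
        using r by (simp add: powr_minus distrib_left field_simps)
      finally show "norm (r powr \<kappa> * p r) \<le> norm (B powr s / lam * r * r powr \<kappa> + mass f r) * 1"
        by (simp add: abs_mult)
    qed
  qed
qed

end

end

section \<open>Comparison\<close>

context pucci
begin

text \<open>The one-sided bounds exclude that \<open>u > 0 > v\<close> near the origin. If, say, \<open>v \<ge> 0\<close>,
  then \<open>u + v / 3\<close> is nondecreasing.\<close>

lemma bounded_near_origin:
  assumes R: "0 < R" and c: "0 < c"
    and u: "\<And>r. 0 < r \<Longrightarrow> (u has_real_derivative p r) (at r)"
    and v: "\<And>r. 0 < r \<Longrightarrow> (v has_real_derivative w r) (at r)"
    and less: "\<And>r. 0 < r \<Longrightarrow> r \<le> R \<Longrightarrow> v r < u r"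
    and slope: "\<And>r. 0 < r \<Longrightarrow> r \<le> R \<Longrightarrow> p r - w r \<le> - (c * r powr (- \<kappa>))"
    and bu: "\<And>r. 0 < r \<Longrightarrow> r \<le> R \<Longrightarrow> - (c / 4 * r powr (- \<kappa>)) \<le> p r * sgn (u r)"
    and bv: "\<And>r. 0 < r \<Longrightarrow> r \<le> R \<Longrightarrow> - (c / 4 * r powr (- \<kappa>)) \<le> w r * sgn (v r)"
  shows "\<exists>B. \<forall>r. 0 < r \<longrightarrow> r \<le> R \<longrightarrow> \<bar>u r\<bar> \<le> B \<and> \<bar>v r\<bar> \<le> B"
proof -
  have A: "\<not> (0 < u r \<and> v r < 0)" if r: "0 < r" "r \<le> R" for r
  proof
    assume "0 < u r \<and> v r < 0"
    then have "- (c / 4 * r powr (- \<kappa>)) \<le> p r" "w r \<le> c / 4 * r powr (- \<kappa>)"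
      using bu[OF r] bv[OF r] by auto
    moreover have "0 < c * r powr (- \<kappa>)" using c r by simp
    ultimately show False using slope[OF r] by linarith
  qed
  \<comment> \<open>The case v \<ge> 0. The case u \<le> 0 follows by applying it to the pair - v, -
    u, which keeps the order, the slope gap and the sign bound.\<close>
  have key: "\<exists>B. \<forall>r. 0 < r \<longrightarrow> r \<le> R \<longrightarrow> \<bar>u r\<bar> \<le> B \<and> \<bar>v r\<bar> \<le> B"
    if u: "\<And>r. 0 < r \<Longrightarrow> (u has_real_derivative p r) (at r)"
      and v: "\<And>r. 0 < r \<Longrightarrow> (v has_real_derivative w r) (at r)"
      and less: "\<And>r. 0 < r \<Longrightarrow> r \<le> R \<Longrightarrow> v r < u r"
      and slope: "\<And>r. 0 < r \<Longrightarrow> r \<le> R \<Longrightarrow> p r - w r \<le> - (c * r powr (- \<kappa>))"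
      and bu: "\<And>r. 0 < r \<Longrightarrow> r \<le> R \<Longrightarrow> - (c / 4 * r powr (- \<kappa>)) \<le> p r * sgn (u r)"
      and nn: "\<And>r. 0 < r \<Longrightarrow> r \<le> R \<Longrightarrow> 0 \<le> v r" for u p v w
  proof (intro exI allI impI)
    fix r assume r: "0 < r" "r \<le> R"
    have "u r + v r / 3 \<le> u R + v R / 3"
    proof (rule nondecreasing_of_deriv_nonneg[where F = "\<lambda>r. u r + v r / 3" and F' = "\<lambda>r. p r + w r / 3" and a = r and b = R])
      show "((\<lambda>r. u r + v r / 3) has_real_derivative p t + w t / 3) (at t within {r..R})" if "r \<le> t" "t \<le> R" for t
      proof (rule has_field_derivative_at_within)
        show "((\<lambda>r. u r + v r / 3) has_real_derivative p t + w t / 3) (at t)"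
          using u[of t] v[of t] that r by (intro DERIV_add DERIV_cdivide) auto
      qed
      \<comment> \<open>With Q = c t^(-\<kappa>): p \<ge> - Q/4 and w \<ge> p + Q, hence p + w/3
        \<ge> 4p/3 + Q/3 \<ge> 0. The constants 1/4 and 1/3 are matched for this.\<close>
      show "0 \<le> p t + w t / 3" if t: "r < t" "t < R" for t
      proof -
        have "0 < u t" using less[of t] nn[of t] t r by auto
        then have "- (c / 4 * t powr (- \<kappa>)) \<le> p t" using bu[of t] t r by simp
        then show ?thesis using slope[of t] t r by auto
      qed
    qed (use r in auto)
    moreover have "0 \<le> v r" "v r < u r" using nn less r by auto
    ultimately show "\<bar>u r\<bar> \<le> u R + v R / 3 \<and> \<bar>v r\<bar> \<le> u R + v R / 3" by auto
  qed
  show ?thesis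
  proof (cases "\<forall>r. 0 < r \<longrightarrow> r \<le> R \<longrightarrow> 0 \<le> v r")
    case True
    then show ?thesis using key[OF u v less slope bu] by blast
  next
    case False
    then obtain r0 where r0: "0 < r0" "r0 \<le> R" "v r0 < 0" by force
    then have "u r0 \<le> 0" using A[of r0] by force
    \<comment> \<open>If u were positive somewhere, u + v would change sign; at a zero of u + v, v <
      u forces v < 0 < u, which A excludes.\<close>
    have np: "u r \<le> 0" if r: "0 < r" "r \<le> R" for r
    proof (rule ccontr)
      assume "\<not> u r \<le> 0"
      then have ur: "0 < u r" "0 \<le> v r" using A[OF r] by auto
      have cont: "continuous_on {min r r0..max r r0} (\<lambda>r. u r + v r)"
      proof (rule DERIV_continuous_on)
        show "((\<lambda>r. u r + v r) has_real_derivative p t + w t) (at t within {min r r0..max r r0})"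
          if "t \<in> {min r r0..max r r0}" for t
        proof (rule has_field_derivative_at_within)
          show "((\<lambda>r. u r + v r) has_real_derivative p t + w t) (at t)"
            using u[of t] v[of t] that r r0 by (intro DERIV_add) auto
        qed
      qed
      have "connected ((\<lambda>r. u r + v r) ` {min r r0..max r r0})"
        by (intro connected_continuous_image cont) auto
      moreover have "u r0 + v r0 \<in> (\<lambda>r. u r + v r) ` {min r r0..max r r0}" "u r + v r \<in> (\<lambda>r. u r + v r) ` {min r r0..max r r0}"
        by auto
      ultimately have "0 \<in> (\<lambda>r. u r + v r) ` {min r r0..max r r0}"
        unfolding connected_iff_interval using ur \<open>u r0 \<le> 0\<close> r0 by (meson add_nonpos_nonpos add_pos_nonneg less_imp_le)
      then obtain t where t: "t \<in> {min r r0..max r r0}" "u t + v t = 0" by auto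
      then have "0 < t" "t \<le> R" using r r0 by auto
      then show False using A[of t] less[of t] t(2) by linarith
    qed
    have "\<exists>B. \<forall>r. 0 < r \<longrightarrow> r \<le> R \<longrightarrow> \<bar>- v r\<bar> \<le> B \<and> \<bar>- u r\<bar> \<le> B"
    proof (rule key[where p = "\<lambda>r. - w r" and w = "\<lambda>r. - p r"])
      show "- (c / 4 * r powr (- \<kappa>)) \<le> - w r * sgn (- v r)" if "0 < r" "r \<le> R" for r
        using bv[OF that] by (simp add: sgn_minus)
      show "- w r - - p r \<le> - (c * r powr (- \<kappa>))" if "0 < r" "r \<le> R" for r
        using slope[OF that] by simp
    qed (use u v less np in \<open>auto intro: DERIV_minus\<close>)
    then show ?thesis by auto
  qed
qed

lemma flux_increasing:
  assumes \<alpha>: "coefficient \<alpha> (1 / Lam) (1 / lam)" and c: "coefficient c \<kappa> \<kappa>'"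
    and L: "linear_form \<alpha> c G z y a b" and G: "\<And>r. r \<in> {a..b} \<Longrightarrow> h \<le> G r" and h: "0 \<le> h"
  shows "weight c a * y a + h / Lam * integral {a..b} (weight c) \<le> weight c b * y b"
proof -
  have ab: "0 < a" "a \<le> b" using L by (auto simp: linear_form_def)
  note W = linear_form_flux[OF c L]
  have wi: "weight c integrable_on {a..b}"
    by (intro integrable_continuous_real continuous_on_weight[OF c ab(1)])
  have "h / Lam * integral {a..b} (weight c) = integral {a..b} (\<lambda>r. h / Lam * weight c r)"
    by simp
  also have "\<dots> \<le> integral {a..b} (\<lambda>r. weight c r * (\<alpha> r * G r))"
  proof (rule integral_le)
    show "(\<lambda>r. h / Lam * weight c r) integrable_on {a..b}" using wi by (rule integrable_on_mult_right)
    show "(\<lambda>r. weight c r * (\<alpha> r * G r)) integrable_on {a..b}"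
      using ac_primitiveD(1)[OF W] by (rule set_lebesgue_integral_eq_integral(1))
    fix r assume r: "r \<in> {a..b}"
    have \<alpha>r: "1 / Lam \<le> \<alpha> r" using coefficient_bounds(1)[OF \<alpha>, of r] r ab by auto
    then have "0 \<le> \<alpha> r" using Lam_pos(3) by linarith
    then have "1 / Lam * h \<le> \<alpha> r * G r"
      using G[OF r] h by (intro mult_mono \<alpha>r) auto
    then have "weight c r * (1 / Lam * h) \<le> weight c r * (\<alpha> r * G r)" by (intro mult_left_mono) auto
    then show "h / Lam * weight c r \<le> weight c r * (\<alpha> r * G r)" by (simp add: mult.commute)
  qed
  also have "\<dots> = weight c b * y b - weight c a * y a"
    using ac_primitiveD(2)[OF W, of a b] ab by simp
  finally show ?thesis by simp
qed

theorem comparison_principle: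
  assumes U: "global_solution f u p" and V: "global_solution f' v w"
    and f: "admissible f" and f': "admissible f'" and ff': "\<And>r. r > 0 \<Longrightarrow> f r \<le> f' r" and "r > 0"
  shows "u r \<le> v r"
proof (rule ccontr)
  assume "\<not> u r \<le> v r"
  define z where "z r = u r - v r" for r
  define y where "y r = p r - w r" for r
  note SU = global_solves[OF U f] and SV = global_solves[OF V f']
  note FU = global_facts[OF U f] and FV = global_facts[OF V f']
  have dz: "(z has_real_derivative y r) (at r)" if "r > 0" for r
    unfolding z_def[abs_def] y_def using FU(4)[OF that] FV(4)[OF that] by (rule DERIV_diff)
  have dz': "(z has_real_derivative y r) (at r within S)" if "r > 0" for r S
    by (rule has_field_derivative_at_within[OF dz[OF that]])
  have cz: "continuous_on {a..b} z" if "a > 0" for a b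
    using that by (intro DERIV_continuous_on[OF dz']) auto
  \<comment> \<open>The coefficients come from the linearisation on [a, b] and change with the
    interval, so every use has its own weight.\<close>
  have flux: "\<exists>c. coefficient c \<kappa> \<kappa>' \<and>
      weight c a * y a + (m / 2) powr s / Lam * integral {a..b} (weight c) \<le> weight c b * y b"
    if ab: "0 < a" "a \<le> b" and m: "0 \<le> m" "\<And>r. r \<in> {a..b} \<Longrightarrow> m \<le> z r" for a b m
  proof -
    obtain \<alpha> c where \<alpha>c: "coefficient \<alpha> (1 / Lam) (1 / lam)" "coefficient c \<kappa> \<kappa>'"
      "linear_form \<alpha> c (\<lambda>r. (spower s (u r) - spower s (v r)) - (f r - f' r)) (\<lambda>r. u r - v r) (\<lambda>r. p r - w r) a b"
      using solves_difference[OF SU[OF ab] SV[OF ab] spower_continuous] by blast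
    have "(m / 2) powr s \<le> (spower s (u r) - spower s (v r)) - (f r - f' r)" if r: "r \<in> {a..b}" for r
    proof -
      have "m \<le> u r - v r" using m(2)[OF r] by (simp add: z_def)
      then have "(m / 2) powr s \<le> ((u r - v r) / 2) powr s" using m(1) s by (intro powr_mono2) auto
      also have "\<dots> \<le> spower s (u r) - spower s (v r)"
        using s m(1) \<open>m \<le> u r - v r\<close> by (intro spower_diff_ge) auto
      finally show ?thesis using ff'[of r] r ab by simp
    qed
    from flux_increasing[OF \<alpha>c this] show ?thesis using \<alpha>c(2) unfolding y_def by auto
  qed
  have flux0: "\<exists>c. coefficient c \<kappa> \<kappa>' \<and> weight c a * y a \<le> weight c b * y b"
    if "0 < a" "a \<le> b" "\<And>r. r \<in> {a..b} \<Longrightarrow> 0 \<le> z r" for a b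
    using flux[OF that(1,2), of 0] that(3) by auto
  have zr: "0 < z r" using \<open>\<not> u r \<le> v r\<close> by (simp add: z_def)
  \<comment> \<open>Otherwise z decreases wherever it is positive, hence is positive on all of (0,
    r], and its slope there is at most - c0 x^(-\<kappa>). Together with the sign bounds this makes
    u and v bounded near the origin, so that both r^\<kappa> p and r^\<kappa> w tend to 0, although
    their difference stays below - c0.\<close>
  have "\<exists>r2>0. z r2 > 0 \<and> y r2 \<ge> 0"
  proof (rule ccontr)
    assume "\<not> (\<exists>r2>0. z r2 > 0 \<and> y r2 \<ge> 0)"
    then have yneg: "y x < 0" if "0 < x" "0 < z x" for x
      using that by force
    have pos: "0 < z x" if x: "0 < x" "x \<le> r" for x
    proof (rule ccontr)
      assume "\<not> 0 < z x"
      \<comment> \<open>Reflection: \<open>first_crossing\<close> moves to the right, and here the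
        zero nearest to r on its left is wanted.\<close>
      have "continuous_on {- r..- x} (\<lambda>t. z (- t))"
        by (rule continuous_on_compose2[OF cz[of x r]]) (use x in \<open>auto intro!: continuous_intros\<close>)
      then obtain t where t: "- r < t" "t \<le> - x" "z (- t) = 0" "\<And>q. - r \<le> q \<Longrightarrow> q < t \<Longrightarrow> 0 < z (- q)"
        using first_crossing[of "- r" "- x" "\<lambda>t. z (- t)" 0] zr \<open>\<not> 0 < z x\<close> x by auto
      have "- z (- t) \<le> - z r"
      proof (rule nondecreasing_of_deriv_nonneg[where F = "\<lambda>r. - z r" and F' = "\<lambda>r. - y r" and a = "- t" and b = r])
        show "((\<lambda>r. - z r) has_real_derivative - y q) (at q within {- t..r})" if "- t \<le> q" "q \<le> r" for q
          using dz'[of q] that t x by (intro DERIV_minus) auto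
        show "0 \<le> - y q" if "- t < q" "q < r" for q
          using yneg[of q] t(4)[of "- q"] that t x by auto
      qed (use t in auto)
      then show False using t zr by simp
    qed
    define c0 where "c0 = - y r * r powr \<kappa>"
    have yr: "y r < 0" using yneg \<open>r > 0\<close> zr by blast
    then have c0: "0 < c0" using \<open>r > 0\<close> by (simp add: c0_def mult_neg_pos)
    \<comment> \<open>The flux of z is nondecreasing and negative at r; towards 0 the weight shrinks
      at least like x^\<kappa>, so the slope must grow at least like x^(-\<kappa>).\<close>
    have slope: "y x \<le> - (c0 * x powr (- \<kappa>))" if x: "0 < x" "x \<le> r" for x
    proof -
      obtain c where c: "coefficient c \<kappa> \<kappa>'" "weight c x * y x \<le> weight c r * y r"
      proof -
        have "0 \<le> z q" if "q \<in> {x..r}" for q using pos[of q] that x by auto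
        then show thesis using flux0[OF x] that by blast
      qed
      have "weight c r * y r \<le> (weight c x * (r / x) powr \<kappa>) * y r"
        using weight_le(2)[OF c(1) x] yr by (intro mult_right_mono_neg) auto
      then have "weight c x * y x \<le> weight c x * ((r / x) powr \<kappa> * y r)" using c(2) by (simp only: mult.assoc)
      then have "y x \<le> (r / x) powr \<kappa> * y r" by (simp only: mult_le_cancel_left_pos[OF weight_pos(1)])
      also have "\<dots> = - (c0 * x powr (- \<kappa>))"
        using x \<open>r > 0\<close> by (simp add: c0_def powr_divide powr_minus field_simps)
      finally show ?thesis .
    qed
    have "\<forall>\<^sub>F x in at_right 0. mass f x < c0 / 4" "\<forall>\<^sub>F x in at_right 0. mass f' x < c0 / 4"
      using order_tendstoD(2)[OF mass_tendsto_0[OF f], of "c0 / 4"] order_tendstoD(2)[OF mass_tendsto_0[OF f'], of "c0 / 4"] c0 by auto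
    then have "\<forall>\<^sub>F x in at_right 0. mass f x < c0 / 4 \<and> mass f' x < c0 / 4" by (rule eventually_conj)
    then obtain R0 where R0: "R0 > 0" "\<And>x. 0 < x \<Longrightarrow> x < R0 \<Longrightarrow> mass f x < c0 / 4 \<and> mass f' x < c0 / 4"
      unfolding eventually_at_right_field by blast
    define R where "R = min r (R0 / 2)"
    have R: "0 < R" "R \<le> r" "R < R0" using R0 \<open>r > 0\<close> by (auto simp: R_def)
    have "\<exists>B. \<forall>x. 0 < x \<longrightarrow> x \<le> R \<longrightarrow> \<bar>u x\<bar> \<le> B \<and> \<bar>v x\<bar> \<le> B"
    proof (rule bounded_near_origin[OF R(1) c0])
      fix x assume x: "0 < x" "x \<le> R"
      show "v x < u x" using pos[of x] x R by (simp add: z_def)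
      show "p x - w x \<le> - (c0 * x powr (- \<kappa>))" using slope[of x] x R by (simp add: y_def)
      have "mass f x * x powr (- \<kappa>) \<le> c0 / 4 * x powr (- \<kappa>)" "mass f' x * x powr (- \<kappa>) \<le> c0 / 4 * x powr (- \<kappa>)"
        using R0(2)[of x] x R by (auto intro!: mult_right_mono)
      then show "- (c0 / 4 * x powr (- \<kappa>)) \<le> p x * sgn (u x)" "- (c0 / 4 * x powr (- \<kappa>)) \<le> w x * sgn (v x)"
        using sgn_derivative_bound[OF U f x(1)] sgn_derivative_bound[OF V f' x(1)] by linarith+
    qed (use FU(4) FV(4) in auto)
    then obtain B where B: "\<And>x. 0 < x \<Longrightarrow> x \<le> R \<Longrightarrow> \<bar>u x\<bar> \<le> B" "\<And>x. 0 < x \<Longrightarrow> x \<le> R \<Longrightarrow> \<bar>v x\<bar> \<le> B" by blast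
    have "((\<lambda>r. r powr \<kappa> * p r - r powr \<kappa> * w r) \<longlongrightarrow> 0 - 0) (at_right 0)"
      using bounded_flux_tendsto_0[OF U f R(1) B(1)] bounded_flux_tendsto_0[OF V f' R(1) B(2)] by (intro tendsto_diff) auto
    moreover have "\<forall>\<^sub>F x in at_right 0. x powr \<kappa> * p x - x powr \<kappa> * w x \<le> - c0"
        unfolding eventually_at_right_field
    proof (intro exI[of _ r] conjI allI impI \<open>r > 0\<close>)
        fix x assume x: "0 < x" "x < r"
        have "x powr \<kappa> * y x \<le> x powr \<kappa> * - (c0 * x powr (- \<kappa>))" using slope[of x] x by (intro mult_left_mono) auto
        also have "\<dots> = - c0" using x by (simp add: powr_minus)
        finally show "x powr \<kappa> * p x - x powr \<kappa> * w x \<le> - c0" by (simp add: y_def right_diff_distrib)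
    qed
    ultimately have "0 - 0 \<le> - c0" by (rule tendsto_upperbound) simp
    then show False using c0 by simp
  qed
  then obtain r2 where r2: "r2 > 0" "z r2 > 0" "y r2 \<ge> 0" by blast
  have ypos: "0 \<le> y x" if x: "r2 \<le> x" "\<And>q. r2 \<le> q \<Longrightarrow> q \<le> x \<Longrightarrow> 0 \<le> z q" for x
  proof -
    obtain c where c: "coefficient c \<kappa> \<kappa>'" "weight c r2 * y r2 \<le> weight c x * y x"
      using flux0[of r2 x] r2 x by auto
    have "0 \<le> weight c r2 * y r2" using r2 by simp
    then have "0 \<le> weight c x * y x" using c(2) by linarith
    then show ?thesis using zero_le_mult_iff[of "weight c x" "y x"] weight_pos(1)[of c x] by linarith
  qed
  have mono: "z r2 \<le> z x" if x: "r2 \<le> x" "\<And>q. r2 \<le> q \<Longrightarrow> q < x \<Longrightarrow> 0 \<le> z q" for x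
  proof (rule nondecreasing_of_deriv_nonneg[where F = z and F' = y and a = r2 and b = x])
    show "(z has_real_derivative y q) (at q within {r2..x})" if "r2 \<le> q" "q \<le> x" for q
      using dz' that r2 by auto
    show "0 \<le> y q" if "r2 < q" "q < x" for q using ypos[of q] x that by auto
  qed (use x in auto)
  have zpos: "0 < z x" if "r2 \<le> x" for x
  proof (rule ccontr)
    assume "\<not> 0 < z x"
    then obtain t where t: "r2 < t" "t \<le> x" "z t = 0" "\<And>q. r2 \<le> q \<Longrightarrow> q < t \<Longrightarrow> 0 < z q"
      using first_crossing[OF cz[OF r2(1)] \<open>r2 \<le> x\<close> r2(2)] by (metis not_less)
    then show False using mono[of t] r2 by force
  qed
  have zge: "z r2 \<le> z x" and yge: "0 \<le> y x" if "r2 \<le> x" for x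
    using mono[OF that] ypos[OF that] zpos by (auto intro: less_imp_le)
  \<comment> \<open>On [R, 2R] a weight varies by a factor of at most 2^\<kappa>'; the half comes
    from \<open>spower_diff_ge\<close> and 1 / Lam from the lower bound of \<alpha>.\<close>
  define c0 where "c0 = 2 powr (- \<kappa>') * (1 / 2) powr s / Lam"
  have c0: "c0 > 0" using Lam_pos by (simp add: c0_def)
  define T where "T = sqrt (3 * 2 powr s / c0) * z r2 powr ((1 - s) / 2)"
  define Q where "Q = (2::real) powr ((1 - s) / 2)"
  have Q: "Q < 1" using s powr_less_mono[of "(1 - s) / 2" 0 2] by (simp add: Q_def)
  \<comment> \<open>c0 is the same on every interval [R, 2R], so the blow-up length is fixed while
    the length R of the interval is free.\<close>
  define R where "R = max r2 (T / (1 - Q))"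
  have R: "r2 \<le> R" "0 < R" "T \<le> R * (1 - Q)" proof -
    show "r2 \<le> R" "0 < R" using r2 by (auto simp: R_def)
    have "T / (1 - Q) \<le> R" by (simp add: R_def)
    then show "T \<le> R * (1 - Q)" using Q by (simp add: pos_divide_le_eq)
  qed
  have "z R < z r2"
  proof (rule Keller_Osserman[where u = z and p = y and C = 0 and a = R and b = "2 * R" and B = "z r2" and s = s and ?c0.0 = c0])
    show "(z has_real_derivative y q) (at q within {R..2 * R})" if "q \<in> {R..2 * R}" for q
      using dz' that R by auto
    show "sqrt (3 * 2 powr s / c0) * z r2 powr ((1 - s) / 2) \<le> (2 * R - R) * (1 - 2 powr ((1 - s) / 2))"
      using R(3) by (simp add: T_def Q_def)
    fix a b m assume ab: "R \<le> a" "a \<le> b" "b \<le> 2 * R" and m: "0 < m" "\<And>r. r \<in> {a..b} \<Longrightarrow> m \<le> z r"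
    have a0: "0 < a" using ab R by simp
    obtain c where c: "coefficient c \<kappa> \<kappa>'"
      "weight c a * y a + (m / 2) powr s / Lam * integral {a..b} (weight c) \<le> weight c b * y b"
      using flux[OF a0 ab(2), of m] m by auto
    have "weight c b * 2 powr (- \<kappa>') * (b - a) = integral {a..b} (\<lambda>r. weight c b * 2 powr (- \<kappa>'))"
      using ab by simp
    also have "\<dots> \<le> integral {a..b} (weight c)"
    proof (rule integral_le)
      show "weight c integrable_on {a..b}" by (intro integrable_continuous_real continuous_on_weight[OF c(1) a0])
      fix r assume r: "r \<in> {a..b}"
      have "weight c b \<le> weight c r * (b / r) powr \<kappa>'" using weight_le(1)[OF c(1), of r b] r a0 by auto
      also have "\<dots> \<le> weight c r * 2 powr \<kappa>'"
        using r a0 ab R kappa by (intro mult_left_mono powr_mono2) (auto simp: pos_divide_le_eq)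
      finally show "weight c b * 2 powr (- \<kappa>') \<le> weight c r" by (simp add: powr_minus field_simps)
    qed auto
    finally have "(m / 2) powr s / Lam * (weight c b * 2 powr (- \<kappa>') * (b - a)) \<le> (m / 2) powr s / Lam * integral {a..b} (weight c)"
      using Lam_pos by (intro mult_left_mono) auto
    moreover have "0 \<le> weight c a * y a" using yge[of a] ab R by simp
    ultimately have "(m / 2) powr s / Lam * (weight c b * 2 powr (- \<kappa>') * (b - a)) \<le> weight c b * y b"
      using c(2) by linarith
    then have "weight c b * ((m / 2) powr s / Lam * 2 powr (- \<kappa>') * (b - a)) \<le> weight c b * y b"
      by (simp only: mult_ac)
    then have "(m / 2) powr s / Lam * 2 powr (- \<kappa>') * (b - a) \<le> y b"
      by (simp only: mult_le_cancel_left_pos[OF weight_pos(1)])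
    moreover have "(m / 2) powr s = m powr s * (1 / 2) powr s" using m(1) by (simp flip: powr_mult)
    ultimately show "c0 * m powr s * (b - a) - 0 \<le> y b" by (simp add: c0_def mult_ac)
  qed (use s c0 r2 R in auto)
  then show False using zge[OF R(1)] by simp
qed

end

section \<open>Approximate solutions\<close>

lemma integral_exp_le:
  fixes a r \<mu> :: real
  assumes "\<mu> > 0" "a \<le> r"
  shows "integral {a..r} (\<lambda>\<tau>. exp (\<mu> * \<tau>)) \<le> exp (\<mu> * r) / \<mu>"
proof -
  have "((\<lambda>\<tau>. exp (\<mu> * \<tau>)) has_integral (exp (\<mu> * r) / \<mu> - exp (\<mu> * a) / \<mu>)) {a..r}"
    using assms by (intro fundamental_theorem_of_calculus)
      (auto intro!: derivative_eq_intros simp: has_real_derivative_iff_has_vector_derivative[symmetric])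
  then show ?thesis using assms by (simp add: integral_unique)
qed

text \<open>Integration gains the factor 1 / \<mu> on functions of size exp(\<mu> r); a large \<mu>
  beats any Lipschitz constant.\<close>

lemma integral_exp_bound:
  fixes h h' :: "real \<Rightarrow> real"
  assumes "\<mu> > 0" "a \<le> r" "h integrable_on {a..r}" "h' integrable_on {a..r}" "0 \<le> K"
    and "\<And>\<tau>. \<tau> \<in> {a..r} \<Longrightarrow> \<bar>h \<tau> - h' \<tau>\<bar> \<le> K * exp (\<mu> * \<tau>) + e"
  shows "\<bar>integral {a..r} h - integral {a..r} h'\<bar> \<le> K * exp (\<mu> * r) / \<mu> + e * (r - a)"
proof -
  have i: "(\<lambda>\<tau>. exp (\<mu> * \<tau>)) integrable_on {a..r}"
    by (intro integrable_continuous_real continuous_intros)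
  have "\<bar>integral {a..r} h - integral {a..r} h'\<bar> = norm (integral {a..r} (\<lambda>\<tau>. h \<tau> - h' \<tau>))"
    using assms by (simp add: Henstock_Kurzweil_Integration.integral_diff)
  also have "\<dots> \<le> integral {a..r} (\<lambda>\<tau>. K * exp (\<mu> * \<tau>) + e)"
    using assms i by (intro integral_norm_bound_integral integrable_diff integrable_add integrable_on_mult_right) auto
  also have "\<dots> = K * integral {a..r} (\<lambda>\<tau>. exp (\<mu> * \<tau>)) + e * (r - a)"
    using assms i by (subst Henstock_Kurzweil_Integration.integral_add) (auto intro: integrable_on_mult_right)
  also have "\<dots> \<le> K * (exp (\<mu> * r) / \<mu>) + e * (r - a)"
    using integral_exp_le[of \<mu> a r] assms by (intro add_right_mono mult_left_mono) auto
  finally show ?thesis by simp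
qed

text \<open>The iteration is a contraction for the supremum norm with an exponential weight.\<close>

lemma Volterra_fixpoint:
  fixes H :: "(real \<Rightarrow> real) \<Rightarrow> real \<Rightarrow> real"
  assumes ab: "a \<le> b" and L: "0 \<le> L"
    and int: "\<And>p. continuous_on {a..b} p \<Longrightarrow> H p absolutely_integrable_on {a..b}"
    and lip: "\<And>p q \<tau> K. continuous_on {a..b} p \<Longrightarrow> continuous_on {a..b} q \<Longrightarrow> \<tau> \<in> {a..b} \<Longrightarrow>
       (\<And>\<sigma>. \<sigma> \<in> {a..\<tau>} \<Longrightarrow> \<bar>p \<sigma> - q \<sigma>\<bar> \<le> K) \<Longrightarrow> \<bar>H p \<tau> - H q \<tau>\<bar> \<le> L * K"
  shows "\<exists>p. continuous_on {a..b} p \<and> (\<forall>r\<in>{a..b}. p r = integral {a..r} (H p))"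
proof -
  \<comment> \<open>This gives L / \<mu> \<le> 1/2, the contraction constant.\<close>
  define \<mu> where "\<mu> = 2 * L + 1"
  have \<mu>: "\<mu> > 0" "L / \<mu> \<le> 1 / 2" using L by (auto simp: \<mu>_def)
  \<comment> \<open>The bounded continuous functions live on the whole line; c retracts it to
    [a, b].\<close>
  define c where "c r = max a (min b r)" for r
  have c: "c r \<in> {a..b}" "r \<in> {a..b} \<Longrightarrow> c r = r" for r using ab by (auto simp: c_def)
  \<comment> \<open>P stands for exp(-\<mu> r) p, so that the plain supremum norm of P is the
    weighted norm of p.\<close>
  define E where "E P r = exp (\<mu> * r) * apply_bcontfun P r" for P :: "real \<Rightarrow>\<^sub>C real" and r
  have contE: "continuous_on S (E P)" for P S
    unfolding E_def by (intro continuous_intros) auto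
  define J where "J P r = integral {a..r} (H (E P))" for P r
  define \<Psi>f where "\<Psi>f P r = exp (- \<mu> * c r) * J P (c r)" for P r
  have Hi: "H (E P) integrable_on {a..r}" if "r \<in> {a..b}" for P r
    by (rule absolutely_integrable_subinterval(2)[OF int[OF contE]]) (use that in auto)
  have mem: "\<Psi>f P \<in> bcontfun" for P
  proof -
    have "continuous_on {a..b} (J P)"
      unfolding J_def using Hi[of b P] ab by (intro indefinite_integral_continuous_1) auto
    then have 1: "continuous_on {a..b} (\<lambda>r. exp (- \<mu> * r) * J P r)" by (intro continuous_intros)
    have 2: "\<Psi>f P = (\<lambda>r. (\<lambda>r. exp (- \<mu> * r) * J P r) (c r))" by (simp add: \<Psi>f_def[abs_def])
    have "continuous_on UNIV (\<Psi>f P)"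
      unfolding 2 by (rule continuous_on_compose2[OF 1]) (use c in \<open>auto simp: c_def intro!: continuous_intros\<close>)
    moreover have "bounded (range (\<Psi>f P))"
    proof (rule bounded_subset)
      show "bounded ((\<lambda>r. exp (- \<mu> * r) * J P r) ` {a..b})"
        by (intro compact_imp_bounded compact_continuous_image 1) auto
      show "range (\<Psi>f P) \<subseteq> (\<lambda>r. exp (- \<mu> * r) * J P r) ` {a..b}" using c unfolding 2 by auto
    qed
    ultimately show ?thesis by (simp add: bcontfun_def)
  qed
  define \<Psi> where "\<Psi> P = Bcontfun (\<Psi>f P)" for P
  have \<Psi>: "apply_bcontfun (\<Psi> P) r = \<Psi>f P r" for P r
    unfolding \<Psi>_def using mem by (simp add: Bcontfun_inverse)
  have contr: "dist (\<Psi> P) (\<Psi> Q) \<le> 1 / 2 * dist P Q" for P Q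
  proof (rule dist_bound)
    fix r
    define t where "t = c r"
    have t: "t \<in> {a..b}" using c by (simp add: t_def)
    define D where "D = dist P Q"
    have D: "0 \<le> D" by (simp add: D_def)
    have EE: "\<bar>E P \<sigma> - E Q \<sigma>\<bar> \<le> exp (\<mu> * \<sigma>) * D" for \<sigma>
    proof -
      have "\<bar>E P \<sigma> - E Q \<sigma>\<bar> = exp (\<mu> * \<sigma>) * dist (apply_bcontfun P \<sigma>) (apply_bcontfun Q \<sigma>)"
        by (simp add: E_def dist_real_def abs_mult flip: right_diff_distrib)
      also have "\<dots> \<le> exp (\<mu> * \<sigma>) * D" unfolding D_def by (intro mult_left_mono dist_bounded) auto
      finally show ?thesis .
    qed
    have "\<bar>J P t - J Q t\<bar> \<le> (L * D) * exp (\<mu> * t) / \<mu> + 0 * (t - a)"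
      unfolding J_def
    proof (rule integral_exp_bound[OF \<mu>(1)])
      fix \<tau> assume \<tau>: "\<tau> \<in> {a..t}"
      have "\<bar>E P \<sigma> - E Q \<sigma>\<bar> \<le> exp (\<mu> * \<tau>) * D" if "\<sigma> \<in> {a..\<tau>}" for \<sigma>
      proof -
        have "exp (\<mu> * \<sigma>) * D \<le> exp (\<mu> * \<tau>) * D" using that \<mu> D by (intro mult_right_mono) auto
        then show ?thesis using EE[of \<sigma>] by linarith
      qed
      then have "\<bar>H (E P) \<tau> - H (E Q) \<tau>\<bar> \<le> L * (exp (\<mu> * \<tau>) * D)"
        using \<tau> t by (intro lip contE) auto
      then show "\<bar>H (E P) \<tau> - H (E Q) \<tau>\<bar> \<le> L * D * exp (\<mu> * \<tau>) + 0" by (simp add: mult_ac)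
    qed (use t Hi L D in auto)
    then have "exp (- \<mu> * t) * \<bar>J P t - J Q t\<bar> \<le> exp (- \<mu> * t) * ((L * D) * exp (\<mu> * t) / \<mu>)"
      by (intro mult_left_mono) auto
    also have "\<dots> = L / \<mu> * D" by (simp add: exp_minus field_simps)
    also have "\<dots> \<le> 1 / 2 * D" using \<mu> D by (intro mult_right_mono) auto
    finally show "dist (apply_bcontfun (\<Psi> P) r) (apply_bcontfun (\<Psi> Q) r) \<le> 1 / 2 * dist P Q"
      unfolding \<Psi> \<Psi>f_def t_def[symmetric] D_def[symmetric] dist_real_def
      by (simp add: abs_mult flip: right_diff_distrib)
  qed
  have "\<exists>!P\<in>UNIV. \<Psi> P = P"
    by (rule Banach_fix[where c = "1/2"]) (use contr complete_UNIV in auto)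
  then obtain P where P: "\<Psi> P = P" by auto
  have "E P r = integral {a..r} (H (E P))" if r: "r \<in> {a..b}" for r
  proof -
    have "apply_bcontfun P r = exp (- \<mu> * r) * J P r" using \<Psi>[of P r] r c(2) P by (simp add: \<Psi>f_def)
    then have "E P r = (exp (\<mu> * r) * exp (- \<mu> * r)) * J P r" by (simp add: E_def)
    then show ?thesis by (simp add: J_def flip: exp_add)
  qed
  then show ?thesis using contE by blast
qed

text \<open>At the maximum of exp(-\<mu> r) \<bar>p - p'\<bar> the Lipschitz term is at most half of
  that maximum and is absorbed; only the term with e remains.\<close>

lemma Volterra_stability:
  fixes p p' h h' :: "real \<Rightarrow> real"
  assumes ab: "a \<le> b" and L: "0 \<le> L" and e: "0 \<le> e"
    and p: "continuous_on {a..b} p" "\<And>r. r \<in> {a..b} \<Longrightarrow> p r = integral {a..r} h"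
    and p': "continuous_on {a..b} p'" "\<And>r. r \<in> {a..b} \<Longrightarrow> p' r = integral {a..r} h'"
    and h: "h integrable_on {a..b}" "h' integrable_on {a..b}"
    and lip: "\<And>\<tau> K. \<tau> \<in> {a..b} \<Longrightarrow> (\<And>\<sigma>. \<sigma> \<in> {a..\<tau>} \<Longrightarrow> \<bar>p \<sigma> - p' \<sigma>\<bar> \<le> K) \<Longrightarrow> \<bar>h \<tau> - h' \<tau>\<bar> \<le> L * K + e"
    and r: "r \<in> {a..b}"
  shows "\<bar>p r - p' r\<bar> \<le> exp ((2 * L + 1) * (b - a)) * (2 * (e * (b - a)))"
proof -
  define \<mu> where "\<mu> = 2 * L + 1"
  have \<mu>: "\<mu> > 0" "L / \<mu> \<le> 1 / 2" using L by (auto simp: \<mu>_def)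
  have "continuous_on {a..b} (\<lambda>r. exp (- \<mu> * r) * \<bar>p r - p' r\<bar>)"
    using p p' by (intro continuous_intros)
  then obtain t where t: "t \<in> {a..b}" "\<And>r. r \<in> {a..b} \<Longrightarrow> exp (- \<mu> * r) * \<bar>p r - p' r\<bar> \<le> exp (- \<mu> * t) * \<bar>p t - p' t\<bar>"
    using continuous_attains_sup[of "{a..b}" "\<lambda>r. exp (- \<mu> * r) * \<bar>p r - p' r\<bar>"] ab by auto
  define D where "D = exp (- \<mu> * t) * \<bar>p t - p' t\<bar>"
  have D: "0 \<le> D" by (simp add: D_def)
  have pp: "\<bar>p \<sigma> - p' \<sigma>\<bar> \<le> exp (\<mu> * \<sigma>) * D" if "\<sigma> \<in> {a..b}" for \<sigma>
    using t(2)[OF that] by (simp add: D_def exp_minus field_simps)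
  have hi: "h integrable_on {a..t}" "h' integrable_on {a..t}"
    using h t by (auto intro: integrable_on_subinterval)
  have "\<bar>p t - p' t\<bar> \<le> (L * D) * exp (\<mu> * t) / \<mu> + e * (t - a)"
    unfolding p(2)[OF t(1)] p'(2)[OF t(1)]
  proof (rule integral_exp_bound[OF \<mu>(1) _ hi])
    fix \<tau> assume \<tau>: "\<tau> \<in> {a..t}"
    have "\<bar>p \<sigma> - p' \<sigma>\<bar> \<le> exp (\<mu> * \<tau>) * D" if "\<sigma> \<in> {a..\<tau>}" for \<sigma>
    proof -
      have "exp (\<mu> * \<sigma>) * D \<le> exp (\<mu> * \<tau>) * D" using that \<mu> D by (intro mult_right_mono) auto
      then show ?thesis using pp[of \<sigma>] that \<tau> t by auto
    qed
    then have "\<bar>h \<tau> - h' \<tau>\<bar> \<le> L * (exp (\<mu> * \<tau>) * D) + e" using \<tau> t by (intro lip) auto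
    then show "\<bar>h \<tau> - h' \<tau>\<bar> \<le> L * D * exp (\<mu> * \<tau>) + e" by (simp add: mult_ac)
  qed (use t L D in auto)
  also have "e * (t - a) \<le> e * (b - a)" using e t by (intro mult_left_mono) auto
  finally have "exp (- \<mu> * t) * \<bar>p t - p' t\<bar> \<le> exp (- \<mu> * t) * ((L * D) * exp (\<mu> * t) / \<mu> + e * (b - a))"
    by (intro mult_left_mono) auto
  also have "\<dots> = L / \<mu> * D + exp (- \<mu> * t) * (e * (b - a))"
    by (simp add: exp_minus field_simps)
  also have "\<dots> \<le> 1 / 2 * D + exp (- \<mu> * a) * (e * (b - a))"
    using \<mu> D e ab t by (intro add_mono mult_right_mono) auto
  finally have "D \<le> exp (- \<mu> * a) * (2 * (e * (b - a)))" by (simp add: D_def)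
  then have "exp (\<mu> * r) * D \<le> exp (\<mu> * b) * (exp (- \<mu> * a) * (2 * (e * (b - a))))"
    using r \<mu> D by (intro mult_mono) auto
  also have "\<dots> = exp (\<mu> * (b - a)) * (2 * (e * (b - a)))"
    by (simp add: exp_diff exp_minus right_diff_distrib field_simps)
  finally show ?thesis using pp[OF r] by (simp add: \<mu>_def)
qed

text \<open>Unlike the Pucci equation, the linear form is invariant under a change of sign; lower
  bounds for u are thus upper bounds for - u.\<close>

lemma linear_form_minus:
  assumes "linear_form \<alpha> c G u p a b"
  shows "linear_form \<alpha> c (\<lambda>r. - G r) (\<lambda>r. - u r) (\<lambda>r. - p r) a b"
proof -
  have P: "ac_primitive p (\<lambda>r. \<alpha> r * G r - c r * p r / r) a b" using assms by (simp add: linear_form_def)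
  have "ac_primitive (\<lambda>r. 0) (\<lambda>r. 0) a b" by (rule ac_primitiveI) auto
  from ac_primitive_diff[OF this P]
  have "ac_primitive (\<lambda>r. - p r) (\<lambda>r. - (\<alpha> r * G r - c r * p r / r)) a b" by simp
  then show ?thesis
    using assms unfolding linear_form_def
    by (auto simp: set_integrable_def algebra_simps intro: DERIV_minus)
qed

section \<open>The truncated power\<close>

lemma powr_diff_le:
  fixes x y :: real
  assumes "0 \<le> y" "y \<le> x" "s > 1"
  shows "x powr s - y powr s \<le> s * x powr (s - 1) * (x - y)"
proof (cases "y = x")
  case False
  then have yx: "y < x" using assms by simp
  have "continuous_on {y..x} (\<lambda>t. t powr s)"
    using assms by (intro continuous_on_powr' continuous_intros) auto
  moreover have "((\<lambda>t. t powr s) has_derivative (*) (s * z powr (s - 1))) (at z)" if "y < z" for z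
    using has_real_derivative_powr[of z s] that assms by (simp add: has_field_derivative_def)
  ultimately obtain z where z: "y < z" "z < x" "x powr s - y powr s = s * z powr (s - 1) * (x - y)"
    using mvt[OF yx, of "\<lambda>t. t powr s" "\<lambda>z. (*) (s * z powr (s - 1))"] by blast
  have "z powr (s - 1) \<le> x powr (s - 1)" using z assms by (intro powr_mono2) auto
  then show ?thesis unfolding z(3) using assms by (intro mult_right_mono mult_left_mono) auto
qed simp


text \<open>Constant beyond level k, hence globally Lipschitz, so that initial value problems are
  solvable on the whole interval, and bounded, so that slopes are bounded for all initial values at
  once.\<close>

definition truncated_power :: "real \<Rightarrow> real \<Rightarrow> real \<Rightarrow> real" where
  "truncated_power s k t = spower s (max (- k) (min k t))"

lemma spower_diff_le:
  assumes s: "s > 1" and xy: "- k \<le> y" "y \<le> x" "x \<le> k"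
  shows "\<bar>spower s x - spower s y\<bar> \<le> s * k powr (s - 1) * (x - y)"
proof -
  have k: "0 \<le> k" using xy by simp
  have mono: "0 \<le> spower s x - spower s y" using spower_diff_ge[OF s xy(2)] powr_ge_zero[of "(x - y) / 2" s] by linarith
  have pos: "u powr s - v powr s \<le> s * k powr (s - 1) * (u - v)" if "0 \<le> v" "v \<le> u" "u \<le> k" for u v
  proof -
    have "u powr (s - 1) \<le> k powr (s - 1)" using that s by (intro powr_mono2) auto
    then have "s * u powr (s - 1) * (u - v) \<le> s * k powr (s - 1) * (u - v)"
      using that s by (intro mult_right_mono mult_left_mono) auto
    then show ?thesis using powr_diff_le[OF that(1,2) s] by linarith
  qed
  consider "0 \<le> y" | "y \<le> 0" "0 \<le> x" | "x \<le> 0" using xy by linarith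
  then have "spower s x - spower s y \<le> s * k powr (s - 1) * (x - y)"
  proof cases
    case 1
    then show ?thesis using pos[of y x] xy by (simp add: spower_nonneg)
  next
    case 2
    then show ?thesis using pos[of 0 x] pos[of 0 "- y"] xy spower_nonneg[of x s] spower_nonneg[of "- y" s] s
      by (simp add: right_diff_distrib)
  next
    case 3
    then show ?thesis using pos[of "- x" "- y"] xy spower_nonneg[of "- x" s] spower_nonneg[of "- y" s] by simp
  qed
  then show ?thesis using mono by simp
qed

lemma truncated_power:
  assumes s: "s > 1" and k: "0 \<le> k"
  shows "\<bar>truncated_power s k x - truncated_power s k y\<bar> \<le> s * k powr (s - 1) * \<bar>x - y\<bar>"
    and "\<bar>truncated_power s k x\<bar> \<le> k powr s"
    and "\<bar>x\<bar> \<le> k \<Longrightarrow> truncated_power s k x = spower s x"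
    and "0 \<le> x * truncated_power s k x" "truncated_power s k 0 = 0"
    and "continuous_on UNIV (truncated_power s k)"
proof -
  define c where "c x = max (- k) (min k x)" for x
  have c: "- k \<le> c x" "c x \<le> k" "\<bar>c x - c y\<bar> \<le> \<bar>x - y\<bar>" "x \<le> y \<Longrightarrow> c x \<le> c y" for x y using k by (auto simp: c_def)
  show lip: "\<bar>truncated_power s k x - truncated_power s k y\<bar> \<le> s * k powr (s - 1) * \<bar>x - y\<bar>" for x y
  proof -
    have "\<bar>truncated_power s k x - truncated_power s k y\<bar> \<le> s * k powr (s - 1) * \<bar>c x - c y\<bar>"
      using spower_diff_le[OF s, of k "c x" "c y"] spower_diff_le[OF s, of k "c y" "c x"] c
      by (cases "c x \<le> c y") (auto simp: truncated_power_def c_def[symmetric] abs_minus_commute)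
    also have "\<dots> \<le> s * k powr (s - 1) * \<bar>x - y\<bar>" using c s by (intro mult_left_mono) auto
    finally show ?thesis .
  qed
  show "\<bar>truncated_power s k x\<bar> \<le> k powr s"
    unfolding truncated_power_def abs_spower using k s by (intro powr_mono2) auto
  show "truncated_power s k x = spower s x" if "\<bar>x\<bar> \<le> k" using that by (auto simp: truncated_power_def)
  show 0: "truncated_power s k 0 = 0" using k by (simp add: truncated_power_def)
  show "0 \<le> x * truncated_power s k x"
    using k by (auto simp: truncated_power_def spower_def zero_le_mult_iff mult_le_0_iff max_def min_def)
  have "(s * k powr (s - 1))-lipschitz_on UNIV (truncated_power s k)"
    using lip s by (auto simp: lipschitz_on_def dist_real_def)
  then show "continuous_on UNIV (truncated_power s k)" by (rule lipschitz_on_continuous_on)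
qed

context pucci
begin

lemma Gamma_driving_lipschitz:
  assumes "r > 0"
  shows "\<bar>\<Gamma> (g (u r) - f r - drift (p r) / r) - \<Gamma> (g (v r) - f r - drift (w r) / r)\<bar> \<le>
    1 / lam * (\<bar>g (u r) - g (v r)\<bar> + Lam * (n - 1) / r * \<bar>p r - w r\<bar>)"
proof -
  have "\<bar>drift (p r) / r - drift (w r) / r\<bar> = \<bar>drift (p r) - drift (w r)\<bar> / r"
    using assms by (simp add: abs_divide flip: diff_divide_distrib)
  also have "\<dots> \<le> Lam * (n - 1) * \<bar>p r - w r\<bar> / r"
    using assms drift_lipschitz by (intro divide_right_mono) auto
  finally have "\<bar>(g (u r) - f r - drift (p r) / r) - (g (v r) - f r - drift (w r) / r)\<bar> \<le>
      \<bar>g (u r) - g (v r)\<bar> + Lam * (n - 1) / r * \<bar>p r - w r\<bar>" by simp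
  then have "1 / lam * \<bar>(g (u r) - f r - drift (p r) / r) - (g (v r) - f r - drift (w r) / r)\<bar> \<le>
      1 / lam * (\<bar>g (u r) - g (v r)\<bar> + Lam * (n - 1) / r * \<bar>p r - w r\<bar>)"
    using lam by (intro mult_left_mono) auto
  then show ?thesis using Gamma_lipschitz order_trans by blast
qed

text \<open>The unknown of the Volterra equation is p; u is d plus its integral. Continuity of u(b)
  in the initial value d is what shooting needs.\<close>

lemma initial_value_problem:
  assumes ab: "0 < a" "a \<le> b" and f: "f absolutely_integrable_on {a..b}"
    and g: "\<And>x y. \<bar>g x - g y\<bar> \<le> K * \<bar>x - y\<bar>" "0 \<le> K"
  obtains u p where "\<And>d. solves g f (u d) (p d) a b" "\<And>d. u d a = d" "\<And>d. p d a = 0"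
    "continuous_on UNIV (\<lambda>d. u d b)"
proof -
  define L where "L = 1 / lam * (K * (b - a) + Lam * (n - 1) / a)"
  have L: "0 \<le> L" using lam ab g n by (auto simp: L_def intro!: mult_nonneg_nonneg add_nonneg_nonneg divide_nonneg_pos)
  define U where "U d p r = d + integral {a..r} p" for d r and p :: "real \<Rightarrow> real"
  define H where "H d p r = \<Gamma> (g (U d p r) - f r - drift (p r) / r)" for d r and p :: "real \<Rightarrow> real"
  have contg: "continuous_on UNIV g"
  proof -
    have "K-lipschitz_on UNIV g" using g by (auto simp: lipschitz_on_def dist_real_def)
    then show ?thesis by (rule lipschitz_on_continuous_on)
  qed
  have contU: "continuous_on {a..b} (U d p)" if "continuous_on {a..b} p" for d p
    unfolding U_def using that
    by (intro continuous_intros indefinite_integral_continuous_1 integrable_continuous_real)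
  have HI: "H d p absolutely_integrable_on {a..b}" if p: "continuous_on {a..b} p" for d p
  proof -
    have k: "continuous_on {a..b} (\<lambda>r. g (U d p r))" "continuous_on {a..b} (\<lambda>r. drift (p r) / r)"
      using continuous_on_compose2[OF contg contU[OF p]] continuous_on_compose2[OF continuous_drift p] ab
      by (auto intro!: continuous_intros)
    then have E: "(\<lambda>r. g (U d p r) - f r - drift (p r) / r) absolutely_integrable_on {a..b}"
      by (intro set_integral_diff(1)[OF set_integral_diff(1)[OF _ f]] absolutely_integrable_continuous_real)
    show ?thesis
    proof (rule measurable_bounded_by_integrable_imp_absolutely_integrable[where g = "\<lambda>r. 1 / lam * \<bar>g (U d p r) - f r - drift (p r) / r\<bar>"])
      have "(\<lambda>r. g (U d p r) - f r - drift (p r) / r) \<in> borel_measurable (lebesgue_on {a..b})"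
        using E by (rule absolutely_integrable_imp_borel_measurable) simp
      then show "H d p \<in> borel_measurable (lebesgue_on {a..b})" unfolding H_def[abs_def] by measurable
      show "(\<lambda>r. 1 / lam * \<bar>g (U d p r) - f r - drift (p r) / r\<bar>) integrable_on {a..b}"
        by (intro integrable_on_mult_right set_lebesgue_integral_eq_integral(1) set_integrable_abs E)
      show "norm (H d p r) \<le> 1 / lam * \<bar>g (U d p r) - f r - drift (p r) / r\<bar>" for r
        using Gamma_lipschitz[of _ 0] by (simp add: H_def)
    qed simp
  qed
  have lip: "\<bar>H d p \<tau> - H d' q \<tau>\<bar> \<le> L * M + K / lam * \<bar>d - d'\<bar>"
    if "continuous_on {a..b} p" "continuous_on {a..b} q" "\<tau> \<in> {a..b}"
      "\<And>\<sigma>. \<sigma> \<in> {a..\<tau>} \<Longrightarrow> \<bar>p \<sigma> - q \<sigma>\<bar> \<le> M" for d d' p q \<tau> M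
  proof -
    have M: "0 \<le> M" using that(4)[of \<tau>] that(3) by (auto intro: order_trans[OF abs_ge_zero])
    have i: "p integrable_on {a..\<tau>}" "q integrable_on {a..\<tau>}"
      using that by (auto intro!: integrable_continuous_real intro: continuous_on_subset)
    have "\<bar>integral {a..\<tau>} p - integral {a..\<tau>} q\<bar> = norm (integral {a..\<tau>} (\<lambda>\<sigma>. p \<sigma> - q \<sigma>))"
      using i by (simp add: Henstock_Kurzweil_Integration.integral_diff)
    also have "\<dots> \<le> integral {a..\<tau>} (\<lambda>\<sigma>. M)"
      using that i by (intro integral_norm_bound_integral integrable_diff) auto
    also have "\<dots> \<le> M * (b - a)" using that M by (auto simp: mult.commute intro!: mult_left_mono)
    finally have "\<bar>U d p \<tau> - U d' q \<tau>\<bar> \<le> \<bar>d - d'\<bar> + M * (b - a)" by (simp add: U_def)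
    then have "K * \<bar>U d p \<tau> - U d' q \<tau>\<bar> \<le> K * (\<bar>d - d'\<bar> + M * (b - a))" using g by (intro mult_left_mono) auto
    then have 1: "\<bar>g (U d p \<tau>) - g (U d' q \<tau>)\<bar> \<le> K * (\<bar>d - d'\<bar> + M * (b - a))" using g(1) order_trans by blast
    have "Lam * (n - 1) / \<tau> * \<bar>p \<tau> - q \<tau>\<bar> \<le> Lam * (n - 1) / a * M"
      using that ab lam n by (intro mult_mono divide_left_mono) auto
    then have "1 / lam * (\<bar>g (U d p \<tau>) - g (U d' q \<tau>)\<bar> + Lam * (n - 1) / \<tau> * \<bar>p \<tau> - q \<tau>\<bar>) \<le>
        1 / lam * (K * (\<bar>d - d'\<bar> + M * (b - a)) + Lam * (n - 1) / a * M)"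
      using 1 lam by (intro mult_left_mono add_mono) auto
    also have "\<dots> = L * M + K / lam * \<bar>d - d'\<bar>" by (simp add: L_def algebra_simps)
    finally show ?thesis
      unfolding H_def using Gamma_driving_lipschitz[of \<tau> g "U d p" f p "U d' q" q] that ab by auto
  qed
  have "\<exists>p. continuous_on {a..b} p \<and> (\<forall>r\<in>{a..b}. p r = integral {a..r} (H d p))" for d
    using lip[of _ _ _ _ d d] by (intro Volterra_fixpoint[OF ab(2) L] HI) auto
  then obtain p where p: "\<And>d. continuous_on {a..b} (p d)" "\<And>d r. r \<in> {a..b} \<Longrightarrow> p d r = integral {a..r} (H d (p d))"
    by metis
  define C where "C = exp ((2 * L + 1) * (b - a)) * (2 * (K / lam * (b - a)))"
  have pa: "p d a = 0" for d using p(2)[of a d] ab by simp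
  have stab: "\<bar>p d r - p d' r\<bar> \<le> C * \<bar>d - d'\<bar>" if "r \<in> {a..b}" for d d' r
  proof -
    have "\<bar>p d r - p d' r\<bar> \<le> exp ((2 * L + 1) * (b - a)) * (2 * (K / lam * \<bar>d - d'\<bar> * (b - a)))"
      using that lam g lip[OF p(1) p(1), of _ d d' _ d d']
      by (intro Volterra_stability[OF ab(2) L _ p(1) p(2) p(1) p(2)] set_lebesgue_integral_eq_integral(1) HI p) auto
    then show ?thesis by (simp only: C_def mult_ac)
  qed
  show thesis
  proof
    fix d
    show "U d (p d) a = d" by (simp add: U_def)
    show "p d a = 0" by (rule pa)
    show "solves g f (U d (p d)) (p d) a b"
      unfolding solves_def driving_def
    proof (intro conjI ballI ab f)
      show "(U d (p d) has_real_derivative p d r) (at r within {a..b})" if "r \<in> {a..b}" for r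
        unfolding U_def[abs_def] using integral_has_real_derivative[OF p(1) that] by (auto intro!: derivative_eq_intros)
      show "ac_primitive (p d) (\<lambda>r. \<Gamma> (g (U d (p d) r) - f r - drift (p d r) / r)) a b"
        using HI[OF p(1), of d] p(2) pa unfolding H_def[abs_def] by (intro ac_primitiveI) auto
    qed
  next
    show "continuous_on UNIV (\<lambda>d. U d (p d) b)"
    proof (rule lipschitz_on_continuous_on)
      show "(1 + C * (b - a))-lipschitz_on UNIV (\<lambda>d. U d (p d) b)"
      proof (rule lipschitz_onI)
        fix d d'
        have i: "p d integrable_on {a..b}" "p d' integrable_on {a..b}"
          using p by (auto intro: integrable_continuous_real)
        have "\<bar>integral {a..b} (p d) - integral {a..b} (p d')\<bar> = norm (integral {a..b} (\<lambda>\<sigma>. p d \<sigma> - p d' \<sigma>))"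
          using i by (simp add: Henstock_Kurzweil_Integration.integral_diff)
        also have "\<dots> \<le> integral {a..b} (\<lambda>\<sigma>. C * \<bar>d - d'\<bar>)"
          using stab i by (intro integral_norm_bound_integral integrable_diff) auto
        finally show "dist (U d (p d) b) (U d' (p d') b) \<le> (1 + C * (b - a)) * dist d d'"
          using ab by (simp add: U_def dist_real_def algebra_simps)
      qed (use ab lam g in \<open>auto simp: C_def intro!: add_nonneg_nonneg mult_nonneg_nonneg divide_nonneg_pos\<close>)
    qed
  qed
qed


text \<open>Slopes of the truncated problem are bounded by C for every initial value d, so u(b)
  \<le> 0 for d = - C (b - a) and u(b) \<ge> 0 for d = C (b - a). A solution with u(b) = 0 stays
  within the truncation level and therefore solves the original equation.\<close>

lemma boundary_value_problem:
  assumes ab: "0 < a" "a \<le> b" and f: "f absolutely_integrable_on {a..b}"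
  obtains u p where "solves (spower s) f u p a b" "p a = 0" "u b = 0"
proof -
  define F where "F = integral {a..b} (\<lambda>r. \<bar>f r\<bar>)"
  have F: "0 \<le> F" unfolding F_def by (rule integral_nonneg_real) auto
  have Fy: "integral {a..y} (\<lambda>r. (r / y) powr \<kappa> * \<bar>f r\<bar>) \<le> F" if y: "y \<in> {a..b}" for y
  proof -
    have fy: "f absolutely_integrable_on {a..y}" by (rule absolutely_integrable_subinterval[OF f]) (use y in auto)
    have "integral {a..y} (\<lambda>r. (r / y) powr \<kappa> * \<bar>f r\<bar>) \<le> integral {a..y} (\<lambda>r. \<bar>f r\<bar>)"
      by (rule integral_powr_weight_le[OF kappa(1) ab(1) fy])
    also have "\<dots> \<le> F" unfolding F_def
      using y f fy by (intro integral_subset_le set_lebesgue_integral_eq_integral(1) set_integrable_abs) auto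
    finally show ?thesis .
  qed
  \<comment> \<open>The level is the a priori bound for a solution with u(b) = 0: its slope
    satisfies p sgn u \<ge> - F / lam, so \<bar>u\<bar> is at most F / lam times the distance to b.
    It can be fixed beforehand because this bound does not involve the nonlinearity.\<close>
  define k where "k = F / lam * (b - a)"
  have k: "0 \<le> k" using F lam ab by (simp add: k_def)
  define g where "g = truncated_power s k"
  note g = truncated_power[OF s k, folded g_def]
  obtain u p where up: "\<And>d. solves g f (u d) (p d) a b" "\<And>d. u d a = d" "\<And>d. p d a = 0"
    "continuous_on UNIV (\<lambda>d. u d b)"
  proof (rule initial_value_problem[OF ab f g(1)])
    show "0 \<le> s * k powr (s - 1)" using s by simp
  qed (rule that; assumption)
  define C where "C = 1 / lam * (k powr s * (b - a) + F)"
  have C: "0 \<le> C" using lam F ab by (simp add: C_def)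
  have p_bound: "\<bar>p d y\<bar> \<le> C" if y: "y \<in> {a..b}" for d y
  proof -
    obtain \<alpha> c where \<alpha>c: "coefficient \<alpha> (1 / Lam) (1 / lam)" "coefficient c \<kappa> \<kappa>'"
      "linear_form \<alpha> c (\<lambda>r. g (u d r) - f r) (u d) (p d) a b"
      using solves_linearisation[OF up(1) g(6)] by blast
    have L: "linear_form \<alpha> c (\<lambda>r. g (u d r) - f r) (u d) (p d) a y"
      by (rule linear_form_subinterval[OF \<alpha>c(3)]) (use y in auto)
    then have G: "(\<lambda>r. g (u d r) - f r) absolutely_integrable_on {a..y}" by (simp add: linear_form_def)
    have fy: "f absolutely_integrable_on {a..y}" by (rule absolutely_integrable_subinterval[OF f]) (use y in auto)
    then have fy': "(\<lambda>r. \<bar>f r\<bar>) integrable_on {a..y}"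
      by (intro set_lebesgue_integral_eq_integral(1) set_integrable_abs)
    have "integral {a..y} (\<lambda>r. (r / y) powr \<kappa> * \<bar>g (u d r) - f r\<bar>) \<le> integral {a..y} (\<lambda>r. \<bar>g (u d r) - f r\<bar>)"
      by (rule integral_powr_weight_le[OF kappa(1) ab(1) G])
    also have "\<dots> \<le> integral {a..y} (\<lambda>r. k powr s + \<bar>f r\<bar>)"
    proof (rule integral_le)
      show "(\<lambda>r. \<bar>g (u d r) - f r\<bar>) integrable_on {a..y}"
        using G by (intro set_lebesgue_integral_eq_integral(1) set_integrable_abs)
      show "(\<lambda>r. k powr s + \<bar>f r\<bar>) integrable_on {a..y}" using fy' by (intro integrable_add) auto
      show "\<bar>g (u d r) - f r\<bar> \<le> k powr s + \<bar>f r\<bar>" for r using g(2)[of "u d r"] by linarith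
    qed
    also have "\<dots> = k powr s * (y - a) + integral {a..y} (\<lambda>r. \<bar>f r\<bar>)"
      using fy' y by (subst Henstock_Kurzweil_Integration.integral_add) auto
    also have "\<dots> \<le> k powr s * (b - a) + F"
      unfolding F_def using y fy' set_lebesgue_integral_eq_integral(1)[OF set_integrable_abs[OF f]]
      by (intro add_mono mult_left_mono integral_subset_le) auto
    finally have "1 / lam * integral {a..y} (\<lambda>r. (r / y) powr \<kappa> * \<bar>g (u d r) - f r\<bar>) \<le> C"
      unfolding C_def using lam by (intro mult_left_mono) auto
    then show ?thesis
      using linear_form_bound_right(1)[OF \<alpha>c(2,1) Lam_pos(3) L] up(3) by simp
  qed
  have ub: "\<bar>u d b - d\<bar> \<le> C * (b - a)" for d
  proof -
    note S = solvesD[OF up(1)[of d]]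
    have "norm (u d b - u d a) \<le> C * norm (b - a)"
      by (rule field_differentiable_bound[of "{a..b}" "u d" "p d"]) (use S(3) p_bound ab in auto)
    then show ?thesis using up(2) ab by simp
  qed
  have "\<exists>d. - (C * (b - a)) \<le> d \<and> d \<le> C * (b - a) \<and> u d b = 0"
  proof (rule IVT')
    show "u (- (C * (b - a))) b \<le> 0" "0 \<le> u (C * (b - a)) b"
      using ub[of "- (C * (b - a))"] ub[of "C * (b - a)"] by linarith+
    show "- (C * (b - a)) \<le> C * (b - a)" using mult_nonneg_nonneg[OF C, of "b - a"] ab by linarith
    show "continuous_on {- (C * (b - a))..C * (b - a)} (\<lambda>d. u d b)"
      using up(4) by (rule continuous_on_subset) simp
  qed
  then obtain d where d: "u d b = 0" by blast
  note S = solvesD[OF up(1)[of d]]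
  obtain \<alpha> c where \<alpha>c: "coefficient \<alpha> (1 / Lam) (1 / lam)" "coefficient c \<kappa> \<kappa>'"
    "linear_form \<alpha> c (\<lambda>r. g (u d r) - f r) (u d) (p d) a b"
    using solves_linearisation[OF up(1) g(6)] by blast
  have sg: "- (F / lam) \<le> p d y * sgn (u d y)" if y: "y \<in> {a..b}" for y
  proof -
    have L: "linear_form \<alpha> c (\<lambda>r. g (u d r) - f r) (u d) (p d) a y"
      by (rule linear_form_subinterval[OF \<alpha>c(3)]) (use y in auto)
    have fy: "f absolutely_integrable_on {a..y}" by (rule absolutely_integrable_subinterval[OF f]) (use y in auto)
    have "weight c a / weight c y * (p d a * sgn (u d a)) - 1 / lam * integral {a..y} (\<lambda>r. (r / y) powr \<kappa> * \<bar>f r\<bar>) \<le> p d y * sgn (u d y)"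
      by (rule linear_form_sgn_bound[OF \<alpha>c(2,1) Lam_pos(3) L g(6) g(4) g(5) fy])
    moreover have "1 / lam * integral {a..y} (\<lambda>r. (r / y) powr \<kappa> * \<bar>f r\<bar>) \<le> 1 / lam * F"
      using Fy[OF y] lam by (intro mult_left_mono) auto
    ultimately show ?thesis using up(3) by simp
  qed
  have uk: "\<bar>u d r\<bar> \<le> k" if r: "r \<in> {a..b}" for r
  proof -
    have der: "(u d has_real_derivative p d x) (at x within {r..b})" if "x \<in> {r..b}" for x
      by (rule has_field_derivative_subset[OF S(3)]) (use that r in auto)
    have Fl: "0 \<le> F / lam" using F lam by simp
    have lin: "((\<lambda>r. F / lam * r) has_real_derivative F / lam) (at x within {r..b})" for x
      by (rule has_field_derivative_at_within) (rule DERIV_cmult_Id)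
    have sgx: "- (F / lam) \<le> p d x * sgn (u d x)" if "x \<in> {r..b}" for x
      using sg[of x] that r by simp
    have "u d r \<le> max (u d b) 0 + (F / lam * b - F / lam * r)"
    proof (rule positive_part_le[OF _ der lin])
      show "- (F / lam) \<le> p d x" if "x \<in> {r..b}" "0 < u d x" for x using sgx[OF that(1)] that(2) by simp
    qed (use r Fl in auto)
    moreover have "- u d r \<le> max (- u d b) 0 + (F / lam * b - F / lam * r)"
    proof (rule positive_part_le[OF _ DERIV_minus[OF der] lin])
      show "- (F / lam) \<le> - p d x" if "x \<in> {r..b}" "0 < - u d x" for x using sgx[OF that(1)] that(2) by simp
    qed (use r Fl in auto)
    moreover have "F / lam * b - F / lam * r \<le> k"
    proof -
      have "F / lam * (b - r) \<le> k" unfolding k_def using r Fl by (intro mult_left_mono) auto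
      then show ?thesis by (simp only: right_diff_distrib)
    qed
    ultimately show ?thesis using d by simp
  qed
  have "solves (spower s) f (u d) (p d) a b"
    unfolding solves_def
  proof (intro conjI ballI ab f S(3))
    show "ac_primitive (p d) (\<lambda>r. \<Gamma> (driving (spower s) f (u d) (p d) r)) a b"
      using S(5) by (rule ac_primitive_cong_AE) (use g(3) uk in \<open>auto simp: driving_def\<close>)
  qed auto
  then show thesis using up(3) d by (rule that)
qed

end

section \<open>Local bounds and compactness\<close>

lemma weight_mono:
  assumes c: "coefficient c k l" and k: "0 \<le> k" and x: "0 < x" "x \<le> y"
  shows "weight c x \<le> weight c y"
proof -
  have "weight c x * 1 \<le> weight c x * (y / x) powr k"
    using x k ge_one_powr_ge_zero[of "y / x" k] by (intro mult_left_mono) auto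
  then show ?thesis using weight_le(2)[OF c x] by linarith
qed

context pucci
begin

text \<open>Only \<open>\<bar>f'\<bar> = \<bar>f\<bar>\<close> is required, so that bounds apply to \<open>u\<close> and to \<open>- u\<close>.\<close>

definition linear_good ::
    "(real \<Rightarrow> real) \<Rightarrow> (real \<Rightarrow> real) \<Rightarrow> (real \<Rightarrow> real) \<Rightarrow> (real \<Rightarrow> real) \<Rightarrow> (real \<Rightarrow> real) \<Rightarrow> (real \<Rightarrow> real) \<Rightarrow> real \<Rightarrow> real \<Rightarrow> bool" where
  "linear_good f \<alpha> c f' u p a b \<longleftrightarrow> coefficient \<alpha> (1 / Lam) (1 / lam) \<and> coefficient c \<kappa> \<kappa>' \<and>
     linear_form \<alpha> c (\<lambda>r. spower s (u r) - f' r) u p a b \<and> f' absolutely_integrable_on {a..b} \<and>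
     (\<forall>r. \<bar>f' r\<bar> = \<bar>f r\<bar>) \<and> (\<forall>r\<in>{a..b}. - (mass f r * r powr (- \<kappa>)) \<le> p r * sgn (u r))"

text \<open>\<open>Keller_Osserman\<close> on [r, r + 1]. Where u > 0 the sign bound keeps the slope
  at the left end above a constant, so the hypotheses hold with constants that depend on f, \<delta>
  and R but not on u or the coefficients; B is then taken large.\<close>

lemma local_upper_bound:
  assumes \<delta>: "0 < \<delta>" "\<delta> \<le> R" and f: "admissible f"
  obtains B where "B > 0"
    "\<And>\<alpha> c f' u p r. linear_good f \<alpha> c f' u p \<delta> (R + 1) \<Longrightarrow> r \<in> {\<delta>..R} \<Longrightarrow> u r < B"
proof -
  define F where "F = integral {\<delta>..R + 1} (\<lambda>r. \<bar>f r\<bar>)"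
  \<comment> \<open>C0 bounds - p at a left end where u > 0, F / lam bounds the contribution of f,
    and c0 contains the least possible ratio of two values of a weight on [\<delta>, R + 1].\<close>
  define C0 where "C0 = mass f (R + 1) * \<delta> powr (- \<kappa>)"
  define c0 where "c0 = (\<delta> / (R + 1)) powr \<kappa>' / Lam"
  define C where "C = C0 + F / lam"
  have F: "0 \<le> F" unfolding F_def by (rule integral_nonneg_real) auto
  have C0: "0 \<le> C0" using mass_nonneg by (simp add: C0_def)
  have C: "0 \<le> C" using F C0 lam by (simp add: C_def)
  have c0: "0 < c0" using \<delta> Lam_pos by (simp add: c0_def)
  define D where "D = sqrt (3 * 2 powr s / c0)"
  define Q where "Q = (2::real) powr ((1 - s) / 2)"
  have Q: "Q < 1" using s powr_less_mono[of "(1 - s) / 2" 0 2] by (simp add: Q_def)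
  have "((\<lambda>B::real. B powr ((1 - s) / 2)) \<longlongrightarrow> 0) at_top"
    using s by (intro tendsto_neg_powr filterlim_ident) auto
  then have lim: "((\<lambda>B::real. K * B powr ((1 - s) / 2)) \<longlongrightarrow> K * 0) at_top" for K
    by (intro tendsto_intros)
  have "\<forall>\<^sub>F B in at_top. D * B powr ((1 - s) / 2) < 1 - Q" "\<forall>\<^sub>F B in at_top. C * D * B powr ((1 - s) / 2) < 1 / 2"
    using order_tendstoD(2)[OF lim[of D], of "1 - Q"] order_tendstoD(2)[OF lim[of "C * D"], of "1/2"] Q by auto
  then have "\<forall>\<^sub>F B in at_top. D * B powr ((1 - s) / 2) < 1 - Q \<and> C * D * B powr ((1 - s) / 2) < 1 / 2 \<and> 1 \<le> B"
    by (intro eventually_conj eventually_ge_at_top)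
  then obtain B where B: "D * B powr ((1 - s) / 2) < 1 - Q" "C * D * B powr ((1 - s) / 2) < 1 / 2" "1 \<le> B"
    using eventually_happens'[OF trivial_limit_at_top_linorder] by blast
  show thesis
  proof (rule that)
    show "B > 0" using B by simp
    fix \<alpha> c f' u p r
    assume "linear_good f \<alpha> c f' u p \<delta> (R + 1)" and r: "r \<in> {\<delta>..R}"
    then have \<alpha>: "coefficient \<alpha> (1 / Lam) (1 / lam)" and c: "coefficient c \<kappa> \<kappa>'"
      and L: "linear_form \<alpha> c (\<lambda>r. spower s (u r) - f' r) u p \<delta> (R + 1)"
      and f': "f' absolutely_integrable_on {\<delta>..R + 1}" "\<And>r. \<bar>f' r\<bar> = \<bar>f r\<bar>"
      and sg: "\<And>r. r \<in> {\<delta>..R + 1} \<Longrightarrow> - (mass f r * r powr (- \<kappa>)) \<le> p r * sgn (u r)"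
      by (auto simp: linear_good_def)
    show "u r < B"
    proof (rule Keller_Osserman[where u = u and p = p and C = C and a = r and b = "r + 1" and B = B and s = s and ?c0.0 = c0])
      show "(u has_real_derivative p t) (at t within {r..r + 1})" if "t \<in> {r..r + 1}" for t
        using linear_form_subinterval[OF L, of r "r + 1"] r that by (auto simp: linear_form_def)
      show "C * (sqrt (3 * 2 powr s / c0) * B powr ((1 - s) / 2)) < B / 2"
        using B by (simp add: D_def mult.assoc)
      show "sqrt (3 * 2 powr s / c0) * B powr ((1 - s) / 2) \<le> (r + 1 - r) * (1 - 2 powr ((1 - s) / 2))"
        using B(1) by (simp add: D_def Q_def)
      fix x y m assume xy: "r \<le> x" "x \<le> y" "y \<le> r + 1" and m: "0 < m" "\<And>t. t \<in> {x..y} \<Longrightarrow> m \<le> u t"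
      have x0: "0 < x" "\<delta> \<le> x" "y \<le> R + 1" using xy r \<delta> by auto
      have Lxy: "linear_form \<alpha> c (\<lambda>r. spower s (u r) - f' r) u p x y"
        by (rule linear_form_subinterval[OF L]) (use xy x0 in auto)
      have fxy: "f' absolutely_integrable_on {x..y}"
        by (rule absolutely_integrable_subinterval[OF f'(1)]) (use x0 in auto)
      have "- (mass f x * x powr (- \<kappa>)) \<le> p x" using sg[of x] m(2)[of x] m(1) x0 xy by simp
      moreover have "mass f x * x powr (- \<kappa>) \<le> C0"
        unfolding C0_def using x0 xy \<delta> kappa mass_mono[OF f, of x "R + 1"] mass_nonneg
        by (intro mult_mono powr_mono2') auto
      ultimately have "- C0 \<le> p x" by simp
      then have "weight c x * (- C0) \<le> weight c x * p x" by (intro mult_left_mono) auto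
      moreover have "weight c x * C0 \<le> weight c y * C0"
        using weight_mono[OF c kappa(1) x0(1) xy(2)] C0 by (rule mult_right_mono)
      ultimately have 1: "- (weight c y * C0) \<le> weight c x * p x" by simp
      note W = linear_form_flux[OF c Lxy]
      have if': "(\<lambda>t. weight c t * (\<alpha> t * \<bar>f' t\<bar>)) integrable_on {x..y}"
        by (intro set_lebesgue_integral_eq_integral(1) weight_coefficient_integrable[OF c \<alpha>] set_integrable_abs fxy x0)
      have "integral {x..y} (\<lambda>t. weight c t * (\<alpha> t * \<bar>f' t\<bar>)) \<le> weight c y * (1 / lam * integral {x..y} (\<lambda>t. (t / y) powr \<kappa> * \<bar>f' t\<bar>))"
        using x0 xy fxy by (intro weighted_integral_le[OF c \<alpha> Lam_pos(3)] set_integrable_abs) auto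
      also have "\<dots> \<le> weight c y * (1 / lam * F)"
      proof (intro mult_left_mono)
        have "integral {x..y} (\<lambda>t. (t / y) powr \<kappa> * \<bar>f' t\<bar>) \<le> integral {x..y} (\<lambda>t. \<bar>f' t\<bar>)"
          by (rule integral_powr_weight_le[OF kappa(1) x0(1) fxy])
        also have "\<dots> \<le> integral {\<delta>..R + 1} (\<lambda>t. \<bar>f' t\<bar>)"
          using x0 set_lebesgue_integral_eq_integral(1)[OF set_integrable_abs[OF fxy]]
            set_lebesgue_integral_eq_integral(1)[OF set_integrable_abs[OF f'(1)]]
          by (intro integral_subset_le) auto
        finally show "integral {x..y} (\<lambda>t. (t / y) powr \<kappa> * \<bar>f' t\<bar>) \<le> F" by (simp add: F_def f'(2))
      qed (use lam in auto)
      finally have 2: "integral {x..y} (\<lambda>t. weight c t * (\<alpha> t * \<bar>f' t\<bar>)) \<le> weight c y * (F / lam)" by simp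
      have "weight c y * (c0 * m powr s) * (y - x) - integral {x..y} (\<lambda>t. weight c t * (\<alpha> t * \<bar>f' t\<bar>)) =
          integral {x..y} (\<lambda>t. weight c y * (c0 * m powr s) - weight c t * (\<alpha> t * \<bar>f' t\<bar>))"
        using if' xy by (subst Henstock_Kurzweil_Integration.integral_diff) auto
      also have "\<dots> \<le> integral {x..y} (\<lambda>t. weight c t * (\<alpha> t * (spower s (u t) - f' t)))"
      proof (rule integral_le)
        show "(\<lambda>t. weight c y * (c0 * m powr s) - weight c t * (\<alpha> t * \<bar>f' t\<bar>)) integrable_on {x..y}"
          using if' by (intro integrable_diff) auto
        show "(\<lambda>t. weight c t * (\<alpha> t * (spower s (u t) - f' t))) integrable_on {x..y}"
          using ac_primitiveD(1)[OF W] by (rule set_lebesgue_integral_eq_integral(1))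
        fix t assume t: "t \<in> {x..y}"
        have \<alpha>t: "1 / Lam \<le> \<alpha> t" using coefficient_bounds[OF \<alpha>, of t] t x0 by auto
        then have \<alpha>0: "0 \<le> \<alpha> t" using Lam_pos(3) by linarith
        have "weight c y \<le> weight c t * (y / t) powr \<kappa>'" using weight_le(1)[OF c, of t y] t x0 by auto
        then have "weight c y * (t / y) powr \<kappa>' \<le> weight c t" using t x0 by (simp add: powr_divide field_simps)
        moreover have "(\<delta> / (R + 1)) powr \<kappa>' \<le> (t / y) powr \<kappa>'"
          using t x0 \<delta> kappa by (intro powr_mono2 frac_le) auto
        ultimately have wt: "weight c y * (\<delta> / (R + 1)) powr \<kappa>' \<le> weight c t"
          by (meson mult_left_mono order_trans weight_pos(3))
        have "m powr s \<le> spower s (u t)"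
          using m(2)[OF t] m(1) s by (simp add: spower_nonneg powr_mono2)
        then have P: "1 / Lam * m powr s \<le> \<alpha> t * spower s (u t)" using \<alpha>t \<alpha>0 by (intro mult_mono) auto
        have "(weight c y * (\<delta> / (R + 1)) powr \<kappa>') * (1 / Lam * m powr s) \<le> weight c t * (\<alpha> t * spower s (u t))"
          by (rule mult_mono[OF wt P]) (use Lam_pos in auto)
        moreover have "weight c t * (\<alpha> t * f' t) \<le> weight c t * (\<alpha> t * \<bar>f' t\<bar>)" using \<alpha>0 by (intro mult_left_mono) auto
        ultimately show "weight c y * (c0 * m powr s) - weight c t * (\<alpha> t * \<bar>f' t\<bar>) \<le> weight c t * (\<alpha> t * (spower s (u t) - f' t))"
          by (simp add: c0_def right_diff_distrib mult_ac)
      qed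
      also have "\<dots> = weight c y * p y - weight c x * p x" using ac_primitiveD(2)[OF W, of x y] xy by simp
      finally have "weight c y * (c0 * m powr s) * (y - x) - weight c y * (F / lam) - weight c y * C0 \<le> weight c y * p y"
        using 1 2 by linarith
      then have "weight c y * (c0 * m powr s * (y - x) - C) \<le> weight c y * p y"
        unfolding C_def by (simp only: algebra_simps)
      then show "c0 * m powr s * (y - x) - C \<le> p y" by (simp only: mult_le_cancel_left_pos[OF weight_pos(1)])
    qed (use s c0 C B in auto)
  qed
qed

text \<open>The sign bound holds for the approximations because p a = 0, passes to subintervals and
  limits, and yields the local bounds; the boundary conditions themselves are lost in the
  limit.\<close>

definition good :: "(real \<Rightarrow> real) \<Rightarrow> (real \<Rightarrow> real) \<Rightarrow> (real \<Rightarrow> real) \<Rightarrow> real \<Rightarrow> real \<Rightarrow> bool" where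
  "good f u p a b \<longleftrightarrow> solves (spower s) f u p a b \<and>
     (\<forall>r\<in>{a..b}. - (mass f r * r powr (- \<kappa>)) \<le> p r * sgn (u r))"

lemma good_subinterval:
  assumes "good f u p a b" "a \<le> x" "x \<le> y" "y \<le> b"
  shows "good f u p x y"
  using assms solves_subinterval unfolding good_def by auto

lemma exists_good:
  assumes f: "admissible f" and ab: "0 < a" "a \<le> b"
  obtains u p where "good f u p a b" "p a = 0"
proof -
  note fi = admissible_integrable[OF f ab(1)]
  obtain u p where S: "solves (spower s) f u p a b" "p a = 0"
    using boundary_value_problem[OF ab fi] by metis
  obtain \<alpha> c where \<alpha>c: "coefficient \<alpha> (1 / Lam) (1 / lam)" "coefficient c \<kappa> \<kappa>'"
    "linear_form \<alpha> c (\<lambda>r. spower s (u r) - f r) u p a b"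
    using solves_linearisation[OF S(1) spower_continuous] by blast
  have "- (mass f y * y powr (- \<kappa>)) \<le> p y * sgn (u y)" if y: "y \<in> {a..b}" for y
  proof -
    have L: "linear_form \<alpha> c (\<lambda>r. spower s (u r) - f r) u p a y"
      by (rule linear_form_subinterval[OF \<alpha>c(3)]) (use y in auto)
    have "weight c a / weight c y * (p a * sgn (u a)) - 1 / lam * integral {a..y} (\<lambda>r. (r / y) powr \<kappa> * \<bar>f r\<bar>) \<le> p y * sgn (u y)"
      by (rule linear_form_sgn_bound[OF \<alpha>c(2,1) Lam_pos(3) L spower_continuous spower_mult_nonneg spower_0 fi])
    then show ?thesis using mass_bound[OF f ab(1), of y] y S(2) by simp
  qed
  then have "good f u p a b" unfolding good_def using S(1) by blast
  then show thesis using S(2) by (rule that)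
qed

text \<open>The length 2 beyond R is used in two halves: one unit for the blow-up argument, which
  bounds u on [\<delta>, R + 1], and one for the mean value theorem, which gives \<xi> in (R, R + 1)
  with slope at most 2B. From \<xi> the slope bound is carried to the left.\<close>

lemma good_bounds:
  assumes \<delta>: "0 < \<delta>" "\<delta> \<le> R" and f: "admissible f"
  obtains B B' where "B \<ge> 0" "B' \<ge> 0"
    "\<And>u p r. good f u p \<delta> (R + 2) \<Longrightarrow> r \<in> {\<delta>..R} \<Longrightarrow> \<bar>u r\<bar> \<le> B \<and> \<bar>p r\<bar> \<le> B'"
proof -
  have two: "R + 1 + 1 = R + 2" by simp
  have "\<delta> \<le> R + 1" using \<delta> by simp
  then obtain B where B: "B > 0"
    "\<And>\<alpha> c f' u p r. linear_good f \<alpha> c f' u p \<delta> (R + 2) \<Longrightarrow> r \<in> {\<delta>..R + 1} \<Longrightarrow> u r < B"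
    using local_upper_bound[OF \<delta>(1) _ f, of "R + 1", unfolded two] by metis
  define F where "F = integral {\<delta>..R + 1} (\<lambda>r. \<bar>f r\<bar>)"
  have fi: "f absolutely_integrable_on {\<delta>..R + 2}" by (rule admissible_integrable[OF f \<delta>(1)])
  have F: "0 \<le> F" unfolding F_def by (rule integral_nonneg_real) auto
  define B' where "B' = ((R + 1) / \<delta>) powr \<kappa>' * (2 * B + 1 / lam * (B powr s * (R + 1 - \<delta>) + F))"
  show thesis
  proof (rule that)
    show "B \<ge> 0" using B by simp
    show "B' \<ge> 0" using B F lam \<delta> by (simp add: B'_def)
    fix u p r assume G: "good f u p \<delta> (R + 2)" and r: "r \<in> {\<delta>..R}"
    then have S: "solves (spower s) f u p \<delta> (R + 2)" by (simp add: good_def)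
    note S' = solvesD[OF S]
    obtain \<alpha> c where \<alpha>c: "coefficient \<alpha> (1 / Lam) (1 / lam)" "coefficient c \<kappa> \<kappa>'"
      "linear_form \<alpha> c (\<lambda>r. spower s (u r) - f r) u p \<delta> (R + 2)"
      using solves_linearisation[OF S spower_continuous] by blast
    have sg: "- (mass f r * r powr (- \<kappa>)) \<le> p r * sgn (u r)" if "r \<in> {\<delta>..R + 2}" for r
      using G that by (simp add: good_def)
    have uB: "\<bar>u x\<bar> \<le> B" if x: "x \<in> {\<delta>..R + 1}" for x
    proof -
      have "linear_good f \<alpha> c f u p \<delta> (R + 2)" unfolding linear_good_def using \<alpha>c fi sg by blast
      then have "u x < B" using x by (rule B(2))
      moreover have "linear_good f \<alpha> c (\<lambda>r. - f r) (\<lambda>r. - u r) (\<lambda>r. - p r) \<delta> (R + 2)"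
        unfolding linear_good_def
      proof (intro conjI \<alpha>c(1,2) ballI)
        show "linear_form \<alpha> c (\<lambda>r. spower s (- u r) - - f r) (\<lambda>r. - u r) (\<lambda>r. - p r) \<delta> (R + 2)"
          using linear_form_minus[OF \<alpha>c(3)] by simp
        show "(\<lambda>r. - f r) absolutely_integrable_on {\<delta>..R + 2}" using fi by (simp add: set_integrable_def)
        show "- (mass f r * r powr (- \<kappa>)) \<le> - p r * sgn (- u r)" if "r \<in> {\<delta>..R + 2}" for r
          using sg[OF that] by (simp add: sgn_minus)
      qed auto
      then have "- u x < B" using x by (rule B(2))
      ultimately show ?thesis by simp
    qed
    have "\<exists>\<xi>\<in>{R<..<R + 1}. u (R + 1) - u R = (\<lambda>h. p \<xi> * h) (R + 1 - R)"
    proof (rule mvt_simple)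
      show "(u has_derivative (\<lambda>h. p x * h)) (at x within {R..R + 1})" if "R \<le> x" "x \<le> R + 1" for x
        using has_field_derivative_subset[OF S'(3), of x "{R..R + 1}"] that \<delta>
        by (auto simp: has_field_derivative_def)
    qed simp
    then obtain \<xi> where \<xi>: "R < \<xi>" "\<xi> < R + 1" "p \<xi> = u (R + 1) - u R" by auto
    have p\<xi>: "\<bar>p \<xi>\<bar> \<le> 2 * B" using uB[of R] uB[of "R + 1"] \<delta> \<xi>(3) by auto
    have L: "linear_form \<alpha> c (\<lambda>r. spower s (u r) - f r) u p r \<xi>"
      by (rule linear_form_subinterval[OF \<alpha>c(3)]) (use r \<xi> in auto)
    have fr: "(\<lambda>r. \<bar>f r\<bar>) integrable_on {r..\<xi>}" "(\<lambda>r. \<bar>f r\<bar>) integrable_on {\<delta>..R + 1}"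
      using absolutely_integrable_subinterval(1)[OF fi, of r \<xi>] absolutely_integrable_subinterval(1)[OF fi, of \<delta> "R + 1"] r \<xi>
      by (auto intro!: set_lebesgue_integral_eq_integral(1) set_integrable_abs)
    have "integral {r..\<xi>} (\<lambda>r. \<bar>spower s (u r) - f r\<bar>) \<le> integral {r..\<xi>} (\<lambda>t. B powr s + \<bar>f t\<bar>)"
    proof (rule integral_le)
      show "(\<lambda>r. \<bar>spower s (u r) - f r\<bar>) integrable_on {r..\<xi>}"
        using L by (intro set_lebesgue_integral_eq_integral(1) set_integrable_abs) (simp add: linear_form_def)
      show "(\<lambda>t. B powr s + \<bar>f t\<bar>) integrable_on {r..\<xi>}" using fr by (intro integrable_add) auto
      fix t assume t: "t \<in> {r..\<xi>}"
      have "\<bar>u t\<bar> powr s \<le> B powr s" using uB[of t] t r \<xi> s by (intro powr_mono2) auto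
      then show "\<bar>spower s (u t) - f t\<bar> \<le> B powr s + \<bar>f t\<bar>" using abs_spower[of s "u t"] by linarith
    qed
    also have "\<dots> = B powr s * (\<xi> - r) + integral {r..\<xi>} (\<lambda>t. \<bar>f t\<bar>)"
      using fr r \<xi> by (subst Henstock_Kurzweil_Integration.integral_add) auto
    also have "\<dots> \<le> B powr s * (R + 1 - \<delta>) + F"
      unfolding F_def using r \<xi> fr by (intro add_mono mult_left_mono integral_subset_le) auto
    finally have I: "integral {r..\<xi>} (\<lambda>r. \<bar>spower s (u r) - f r\<bar>) \<le> B powr s * (R + 1 - \<delta>) + F" .
    have "\<bar>p r\<bar> \<le> (\<xi> / r) powr \<kappa>' * (\<bar>p \<xi>\<bar> + 1 / lam * integral {r..\<xi>} (\<lambda>r. \<bar>spower s (u r) - f r\<bar>))"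
      by (rule linear_form_bound_left[OF \<alpha>c(2) kappa(1) \<alpha>c(1) Lam_pos(3) L])
    also have "\<dots> \<le> ((R + 1) / \<delta>) powr \<kappa>' * (2 * B + 1 / lam * (B powr s * (R + 1 - \<delta>) + F))"
      using I p\<xi> r \<xi> \<delta> kappa lam
      by (intro mult_mono add_mono powr_mono2 frac_le add_nonneg_nonneg mult_nonneg_nonneg integral_nonneg_real) auto
    finally have "\<bar>p r\<bar> \<le> B'" by (simp add: B'_def)
    then show "\<bar>u r\<bar> \<le> B \<and> \<bar>p r\<bar> \<le> B'" using uB[of r] r by auto
  qed
qed

lemma Gamma_driving_bound:
  assumes "0 < \<delta>" "\<delta> \<le> r" "\<bar>u r\<bar> \<le> B" "\<bar>p r\<bar> \<le> B'"
  shows "\<bar>\<Gamma> (driving (spower s) f u p r)\<bar> \<le> 1 / lam * (B powr s + Lam * (n - 1) * B' / \<delta> + \<bar>f r\<bar>)"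
proof -
  have "\<bar>drift (p r)\<bar> \<le> Lam * (n - 1) * \<bar>p r\<bar>" using drift_lipschitz[of "p r" 0] by simp
  also have "\<dots> \<le> Lam * (n - 1) * B'" using assms Lam_pos n by (intro mult_left_mono) auto
  finally have "\<bar>drift (p r)\<bar> / r \<le> Lam * (n - 1) * B' / \<delta>" using assms by (intro frac_le) auto
  then have 1: "\<bar>drift (p r) / r\<bar> \<le> Lam * (n - 1) * B' / \<delta>" using assms by simp
  have "\<bar>spower s (u r)\<bar> \<le> B powr s" unfolding abs_spower using assms s by (intro powr_mono2) auto
  then have "\<bar>driving (spower s) f u p r\<bar> \<le> B powr s + Lam * (n - 1) * B' / \<delta> + \<bar>f r\<bar>"
    unfolding driving_def using 1 by linarith
  then have "1 / lam * \<bar>driving (spower s) f u p r\<bar> \<le> 1 / lam * (B powr s + Lam * (n - 1) * B' / \<delta> + \<bar>f r\<bar>)"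
    using lam by (intro mult_left_mono) auto
  then show ?thesis using Gamma_lipschitz[of "driving (spower s) f u p r" 0] by simp
qed

text \<open>A single function majorises both \<bar>p\<bar> and the density of p for all good
  solutions; its primitive \<omega> is a common modulus of continuity.\<close>

lemma good_modulus:
  assumes \<delta>: "0 < \<delta>" "\<delta> \<le> R" and f: "admissible f"
  obtains \<omega> where "continuous_on {\<delta>..R} \<omega>"
    "\<And>u p x y. good f u p \<delta> (R + 2) \<Longrightarrow> x \<in> {\<delta>..R} \<Longrightarrow> y \<in> {\<delta>..R} \<Longrightarrow>
       \<bar>u y - u x\<bar> \<le> \<bar>\<omega> y - \<omega> x\<bar> \<and> \<bar>p y - p x\<bar> \<le> \<bar>\<omega> y - \<omega> x\<bar>"
proof -
  obtain B B' where B: "B \<ge> 0" "B' \<ge> 0"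
    "\<And>u p r. good f u p \<delta> (R + 2) \<Longrightarrow> r \<in> {\<delta>..R} \<Longrightarrow> \<bar>u r\<bar> \<le> B \<and> \<bar>p r\<bar> \<le> B'"
    using good_bounds[OF \<delta> f] by metis
  define h where "h r = B' + 1 / lam * (B powr s + Lam * (n - 1) * B' / \<delta> + \<bar>f r\<bar>)" for r
  define \<omega> where "\<omega> x = integral {\<delta>..x} h" for x
  have fi: "(\<lambda>r. \<bar>f r\<bar>) integrable_on {\<delta>..R}"
    by (intro set_lebesgue_integral_eq_integral(1) set_integrable_abs admissible_integrable[OF f \<delta>(1)])
  have hi: "h integrable_on {\<delta>..R}"
    unfolding h_def[abs_def] by (intro integrable_add integrable_on_mult_right fi) auto
  have K: "0 \<le> B powr s + Lam * (n - 1) * B' / \<delta>" using B \<delta> Lam_pos n by simp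
  have hB: "B' \<le> h r" "1 / lam * (B powr s + Lam * (n - 1) * B' / \<delta> + \<bar>f r\<bar>) \<le> h r" for r
    using K B lam by (auto simp: h_def)
  have one: "\<bar>u y - u x\<bar> \<le> \<omega> y - \<omega> x \<and> \<bar>p y - p x\<bar> \<le> \<omega> y - \<omega> x"
    if G: "good f u p \<delta> (R + 2)" and xy: "\<delta> \<le> x" "x \<le> y" "y \<le> R" for u p x y
  proof -
    have "good f u p \<delta> R" by (rule good_subinterval[OF G]) (use \<delta> in auto)
    then have S: "solves (spower s) f u p x y"
      using solves_subinterval xy unfolding good_def by blast
    note S' = solvesD[OF S]
    have hxy: "h integrable_on {x..y}" by (rule integrable_on_subinterval[OF hi]) (use xy in auto)
    have "integral {\<delta>..x} h + integral {x..y} h = integral {\<delta>..y} h"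
      using xy by (intro Henstock_Kurzweil_Integration.integral_combine integrable_on_subinterval[OF hi]) auto
    then have \<omega>xy: "\<omega> y - \<omega> x = integral {x..y} h" by (simp add: \<omega>_def)
    have up: "ac_primitive u p x y" using S' by (intro ac_primitive_C1) auto
    have pi: "p integrable_on {x..y}"
      using ac_primitiveD(1)[OF up] by (rule set_lebesgue_integral_eq_integral(1))
    have "\<bar>u y - u x\<bar> = norm (integral {x..y} p)" using ac_primitiveD(2)[OF up, of x y] xy by simp
    also have "\<dots> \<le> integral {x..y} h"
    proof (rule integral_norm_bound_integral[OF pi hxy])
      show "norm (p r) \<le> h r" if "r \<in> {x..y}" for r
        using B(3)[OF G, of r] that xy hB(1)[of r] by auto
    qed
    finally have 1: "\<bar>u y - u x\<bar> \<le> integral {x..y} h" .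
    have "\<bar>p y - p x\<bar> = norm (integral {x..y} (\<lambda>r. \<Gamma> (driving (spower s) f u p r)))"
      using ac_primitiveD(2)[OF S'(5), of x y] xy by simp
    also have "\<dots> \<le> integral {x..y} h"
    proof (rule integral_norm_bound_integral[OF _ hxy])
      show "(\<lambda>r. \<Gamma> (driving (spower s) f u p r)) integrable_on {x..y}"
        using ac_primitiveD(1)[OF S'(5)] by (rule set_lebesgue_integral_eq_integral(1))
      show "norm (\<Gamma> (driving (spower s) f u p r)) \<le> h r" if "r \<in> {x..y}" for r
        using Gamma_driving_bound[OF \<delta>(1), of r u B p B' f] B(3)[OF G, of r] that xy hB(2)[of r] by auto
    qed
    finally show ?thesis using 1 \<omega>xy by simp
  qed
  show thesis
  proof (rule that[of \<omega>])
    show "continuous_on {\<delta>..R} \<omega>" unfolding \<omega>_def by (rule indefinite_integral_continuous_1[OF hi])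
    show "\<bar>u y - u x\<bar> \<le> \<bar>\<omega> y - \<omega> x\<bar> \<and> \<bar>p y - p x\<bar> \<le> \<bar>\<omega> y - \<omega> x\<bar>"
      if "good f u p \<delta> (R + 2)" "x \<in> {\<delta>..R}" "y \<in> {\<delta>..R}" for u p x y
    proof (cases "x \<le> y")
      case True
      then show ?thesis using one[OF that(1), of x y] that by auto
    next
      case False
      then show ?thesis using one[OF that(1), of y x] that by (auto simp: abs_minus_commute)
    qed
  qed
qed


text \<open>Dominated convergence in the integrated equations for u and p, with the bounds shared by
  all good solutions.\<close>

lemma good_limit:
  assumes f: "admissible f" and ab: "0 < a" "a \<le> b"
    and G: "\<And>j. good f (U j) (P j) a (b + 2)"
    and lim: "\<And>r. r \<in> {a..b} \<Longrightarrow> (\<lambda>j. U j r) \<longlonglongrightarrow> u r" "\<And>r. r \<in> {a..b} \<Longrightarrow> (\<lambda>j. P j r) \<longlonglongrightarrow> p r"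
  shows "good f u p a b"
proof -
  obtain B B' where B: "B \<ge> 0" "B' \<ge> 0"
    "\<And>u p r. good f u p a (b + 2) \<Longrightarrow> r \<in> {a..b} \<Longrightarrow> \<bar>u r\<bar> \<le> B \<and> \<bar>p r\<bar> \<le> B'"
    using good_bounds[OF ab f] by metis
  obtain \<omega> where \<omega>: "continuous_on {a..b} \<omega>"
    "\<And>u p x y. good f u p a (b + 2) \<Longrightarrow> x \<in> {a..b} \<Longrightarrow> y \<in> {a..b} \<Longrightarrow>
       \<bar>u y - u x\<bar> \<le> \<bar>\<omega> y - \<omega> x\<bar> \<and> \<bar>p y - p x\<bar> \<le> \<bar>\<omega> y - \<omega> x\<bar>"
    using good_modulus[OF ab f] by metis
  have S: "solves (spower s) f (U j) (P j) a b" for j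
    using good_subinterval[OF G[of j], of a b] ab by (simp add: good_def)
  note S' = solvesD[OF S]
  have fi: "f absolutely_integrable_on {a..b}" by (rule admissible_integrable[OF f ab(1)])
  have pmod: "\<bar>p y - p x\<bar> \<le> \<bar>\<omega> y - \<omega> x\<bar>" if "x \<in> {a..b}" "y \<in> {a..b}" for x y
  proof (rule tendsto_upperbound[OF _ _ sequentially_bot])
    show "(\<lambda>j. \<bar>P j y - P j x\<bar>) \<longlonglongrightarrow> \<bar>p y - p x\<bar>" using lim that by (intro tendsto_intros)
    show "\<forall>\<^sub>F j in sequentially. \<bar>P j y - P j x\<bar> \<le> \<bar>\<omega> y - \<omega> x\<bar>"
      using \<omega>(2)[OF G that] by (intro always_eventually) auto
  qed
  have cp: "continuous_on {a..b} p"
    unfolding continuous_on_iff dist_real_def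
  proof (intro ballI allI impI)
    fix x e :: real assume x: "x \<in> {a..b}" and e: "0 < e"
    then obtain d where "d > 0" "\<And>y. y \<in> {a..b} \<Longrightarrow> \<bar>y - x\<bar> < d \<Longrightarrow> \<bar>\<omega> y - \<omega> x\<bar> < e"
      using \<omega>(1) unfolding continuous_on_iff dist_real_def by meson
    then show "\<exists>d>0. \<forall>x'\<in>{a..b}. \<bar>x' - x\<bar> < d \<longrightarrow> \<bar>p x' - p x\<bar> < e"
      using pmod[OF x] by (meson order_le_less_trans)
  qed
  have int_p: "u x - u a = integral {a..x} p" if x: "a \<le> x" "x \<le> b" for x
  proof -
    have "(\<lambda>j. integral {a..x} (P j)) \<longlonglongrightarrow> integral {a..x} p"
    proof (rule dominated_convergence(2)[where h = "\<lambda>_. B'"])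
      show "P j integrable_on {a..x}" for j
        using x by (intro integrable_continuous_real continuous_on_subset[OF S'(7)]) auto
      show "norm (P j r) \<le> B'" if "r \<in> {a..x}" for j r using B(3)[OF G, of r] that x by auto
      show "(\<lambda>j. P j r) \<longlonglongrightarrow> p r" if "r \<in> {a..x}" for r using lim(2) that x by auto
    qed auto
    moreover have "integral {a..x} (P j) = U j x - U j a" for j
    proof -
      have "ac_primitive (U j) (P j) a b" using S' by (intro ac_primitive_C1) auto
      from ac_primitiveD(2)[OF this, of a x] show ?thesis using x by simp
    qed
    ultimately have "(\<lambda>j. U j x - U j a) \<longlonglongrightarrow> integral {a..x} p" by simp
    moreover have "(\<lambda>j. U j x - U j a) \<longlonglongrightarrow> u x - u a" using lim x by (intro tendsto_diff) auto
    ultimately show ?thesis using LIMSEQ_unique by blast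
  qed
  let ?D = "\<lambda>u p r. \<Gamma> (driving (spower s) f u p r)"
  define h where "h r = 1 / lam * (B powr s + Lam * (n - 1) * B' / a + \<bar>f r\<bar>)" for r
  have hi: "h integrable_on {a..b}"
    unfolding h_def[abs_def]
    by (intro integrable_on_mult_right integrable_add set_lebesgue_integral_eq_integral(1)[OF set_integrable_abs[OF fi]]) auto
  have Dh: "norm (?D (U j) (P j) r) \<le> h r" if "r \<in> {a..b}" for j r
    unfolding h_def using Gamma_driving_bound[OF ab(1), of r "U j" B "P j" B' f] B(3)[OF G, of r] that by auto
  have Dlim: "(\<lambda>j. ?D (U j) (P j) r) \<longlonglongrightarrow> ?D u p r" if r: "r \<in> {a..b}" for r
  proof -
    have c: "isCont \<Gamma> t" "isCont drift t" "isCont (spower s) t" for t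
      using continuous_Gamma continuous_drift spower_continuous by (auto simp: continuous_on_eq_continuous_at)
    show ?thesis unfolding driving_def
      using lim[OF r] r ab
      by (intro isCont_tendsto_compose[OF c(1)] tendsto_diff tendsto_divide isCont_tendsto_compose[OF c(2)]
          isCont_tendsto_compose[OF c(3)] tendsto_const) auto
  qed
  have DI: "?D (U j) (P j) absolutely_integrable_on {a..b}" for j using ac_primitiveD(1)[OF S'(5)] .
  have "?D u p absolutely_integrable_on {a..b}"
  proof (rule dominated_convergence_absolutely_integrable[where f = "\<lambda>j. ?D (U j) (P j)" and h = h])
    show "norm (?D u p r) \<le> h r" if "r \<in> {a..b}" for r
      by (rule tendsto_upperbound[OF tendsto_norm[OF Dlim[OF that]] _ sequentially_bot]) (use Dh[OF that] in auto)
  qed (use Dlim DI hi in auto)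
  moreover have "p x - p a = integral {a..x} (?D u p)" if x: "a \<le> x" "x \<le> b" for x
  proof -
    have "(\<lambda>j. integral {a..x} (?D (U j) (P j))) \<longlonglongrightarrow> integral {a..x} (?D u p)"
    proof (rule dominated_convergence(2)[where h = h])
      show "?D (U j) (P j) integrable_on {a..x}" for j
        by (rule absolutely_integrable_subinterval(2)[OF DI]) (use x in auto)
      show "h integrable_on {a..x}" by (rule integrable_on_subinterval[OF hi]) (use x in auto)
    qed (use Dh Dlim x in auto)
    moreover have "integral {a..x} (?D (U j) (P j)) = P j x - P j a" for j
      using ac_primitiveD(2)[OF S'(5), of a x] x by simp
    ultimately have "(\<lambda>j. P j x - P j a) \<longlonglongrightarrow> integral {a..x} (?D u p)" by simp
    moreover have "(\<lambda>j. P j x - P j a) \<longlonglongrightarrow> p x - p a" using lim x by (intro tendsto_diff) auto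
    ultimately show ?thesis using LIMSEQ_unique by blast
  qed
  ultimately have "ac_primitive p (?D u p) a b" by (rule ac_primitiveI)
  moreover have "(u has_real_derivative p r) (at r within {a..b})" if r: "r \<in> {a..b}" for r
  proof -
    have "((\<lambda>x. u a + integral {a..x} p) has_real_derivative p r) (at r within {a..b})"
      using integral_has_real_derivative[OF cp r] by (auto intro!: derivative_eq_intros)
    then show ?thesis
      by (rule has_field_derivative_transform_within[OF _ zero_less_one r]) (use int_p in force)
  qed
  ultimately have "solves (spower s) f u p a b" using ab fi unfolding solves_def by blast
  moreover have "- (mass f r * r powr (- \<kappa>)) \<le> p r * sgn (u r)" if r: "r \<in> {a..b}" for r
  \<comment> \<open>\<open>sgn\<close> is continuous away from 0, and at a zero of u the bound only
    says that the mass is nonnegative.\<close>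
  proof (cases "u r = 0")
    case True
    then show ?thesis using mass_nonneg[of f r] by simp
  next
    case False
    have "(\<lambda>j. P j r * sgn (U j r)) \<longlonglongrightarrow> p r * sgn (u r)"
      using lim[OF r] False by (intro tendsto_intros tendsto_sgn) auto
    moreover have "\<forall>\<^sub>F j in sequentially. - (mass f r * r powr (- \<kappa>)) \<le> P j r * sgn (U j r)"
      using G r unfolding good_def by (intro always_eventually) auto
    ultimately show ?thesis by (rule tendsto_lowerbound) simp
  qed
  ultimately show ?thesis by (simp add: good_def)
qed

lemma convergent_from_dense:
  fixes F :: "nat \<Rightarrow> real \<Rightarrow> real"
  assumes "\<And>e. e > 0 \<Longrightarrow> \<exists>q. convergent (\<lambda>j. F j q) \<and> (\<forall>\<^sub>F j in sequentially. \<bar>F j x - F j q\<bar> < e)"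
  shows "convergent (\<lambda>j. F j x)"
  unfolding Cauchy_convergent_iff[symmetric]
proof (rule metric_CauchyI)
  fix e :: real assume "e > 0"
  then obtain q where q: "convergent (\<lambda>j. F j q)" "\<forall>\<^sub>F j in sequentially. \<bar>F j x - F j q\<bar> < e / 3"
    using assms[of "e / 3"] by auto
  obtain M where M: "\<And>i j. i \<ge> M \<Longrightarrow> j \<ge> M \<Longrightarrow> dist (F i q) (F j q) < e / 3"
    using q(1) \<open>e > 0\<close> unfolding Cauchy_convergent_iff[symmetric] by (meson metric_CauchyD divide_pos_pos zero_less_numeral)
  obtain N where N: "\<And>j. j \<ge> N \<Longrightarrow> \<bar>F j x - F j q\<bar> < e / 3"
    using q(2) unfolding eventually_sequentially by blast
  show "\<exists>M. \<forall>m\<ge>M. \<forall>n\<ge>M. dist (F m x) (F n x) < e"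
  proof (intro exI[of _ "max M N"] allI impI)
    fix i j assume "max M N \<le> i" "max M N \<le> j"
    then have "\<bar>F i q - F j q\<bar> < e / 3" "\<bar>F i x - F i q\<bar> < e / 3" "\<bar>F j x - F j q\<bar> < e / 3"
      using M[of i j] N[of i] N[of j] by (auto simp: dist_real_def)
    then show "dist (F i x) (F j x) < e" unfolding dist_real_def by linarith
  qed
qed

text \<open>A diagonal sequence converges at the rational points, and the common modulus of
  continuity extends this to all r > 0. The approximations are returned with the limit, because the
  flux at the origin is controlled through them: they have slope 0 at their left ends.\<close>

lemma exists_good_global:
  assumes f: "admissible f"
  obtains U P :: "nat \<Rightarrow> real \<Rightarrow> real" and u p where
    "\<And>a b. 0 < a \<Longrightarrow> a \<le> b \<Longrightarrow> good f u p a b"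
    "\<And>a. 0 < a \<Longrightarrow> \<forall>\<^sub>F j in sequentially. \<exists>a'. 0 < a' \<and> a' < a \<and> P j a' = 0 \<and> good f (U j) (P j) a' (2 + 1 / a)"
    "\<And>r. 0 < r \<Longrightarrow> (\<lambda>j. U j r) \<longlonglongrightarrow> u r" "\<And>r. 0 < r \<Longrightarrow> (\<lambda>j. P j r) \<longlonglongrightarrow> p r"
proof -
  \<comment> \<open>The j-th approximation lives on [1 / (j + 2), j + 2].\<close>
  define \<alpha> where "\<alpha> j = 1 / (real j + 2)" for j
  have \<alpha>: "0 < \<alpha> j" "\<alpha> j \<le> 1" "\<alpha> j \<le> real j + 2" for j
  proof -
    show "0 < \<alpha> j" "\<alpha> j \<le> 1" by (auto simp: \<alpha>_def)
    then show "\<alpha> j \<le> real j + 2" by simp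
  qed
  have "\<forall>j. \<exists>u p. good f u p (\<alpha> j) (real j + 2) \<and> p (\<alpha> j) = 0"
    using exists_good[OF f \<alpha>(1,3)] by metis
  then obtain U P where UP: "\<And>j. good f (U j) (P j) (\<alpha> j) (real j + 2)" "\<And>j. P j (\<alpha> j) = 0"
    by metis
  have ev: "\<forall>\<^sub>F j in sequentially. \<alpha> j < a \<and> b \<le> real j + 2" if a: "0 < a" for a b
  proof -
    obtain N where N: "max (1 / a) b \<le> real N" using real_arch_simple by blast
    show ?thesis unfolding eventually_sequentially
    proof (intro exI[of _ N] allI impI)
      fix j assume "N \<le> j"
      then have "real N \<le> real j" by simp
      then have j: "1 / a < real j + 2" "b \<le> real j + 2" using N by auto
      then show "\<alpha> j < a \<and> b \<le> real j + 2" using a by (simp add: \<alpha>_def field_simps)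
    qed
  qed
  have sub: "good f (U j) (P j) a b" if "\<alpha> j < a" "a \<le> b" "b \<le> real j + 2" for j a b
    by (rule good_subinterval[OF UP(1)]) (use that in auto)
  have bd: "\<exists>M>0. \<forall>\<^sub>F j in sequentially. norm (U j x, P j x) \<le> M" if x: "0 < x" for x
  proof -
    obtain B B' where B: "B \<ge> 0" "B' \<ge> 0"
      "\<And>u p r. good f u p x (x + 2) \<Longrightarrow> r \<in> {x..x} \<Longrightarrow> \<bar>u r\<bar> \<le> B \<and> \<bar>p r\<bar> \<le> B'"
      using good_bounds[OF x order_refl f] by metis
    show ?thesis
    proof (intro exI[of _ "B + B' + 1"] conjI)
      show "\<forall>\<^sub>F j in sequentially. norm (U j x, P j x) \<le> B + B' + 1"
        using ev[OF x, of "x + 2"]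
      proof eventually_elim
        case (elim j)
        then have "\<bar>U j x\<bar> \<le> B \<and> \<bar>P j x\<bar> \<le> B'" using B(3)[OF sub] by auto
        then show ?case using norm_Pair_le[of "U j x" "P j x"] by simp
      qed
    qed (use B in auto)
  qed
  then obtain M where M: "\<And>x. 0 < x \<Longrightarrow> M x > 0" "\<And>x. 0 < x \<Longrightarrow> \<forall>\<^sub>F j in sequentially. norm (U j x, P j x) \<le> M x"
    by metis
  \<comment> \<open>The subsequence theorem wants a uniform bound for all j. The values are divided
    by a bound valid for large j, and replaced by 0 for the finitely many j where it may
    fail.\<close>
  define V where "V j x = (if norm (U j x, P j x) \<le> M x then (1 / M x) *\<^sub>R (U j x, P j x) else 0)" for j x
  define S where "S = {x \<in> \<rat>. 0 < (x::real)}"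
  have "countable S" unfolding S_def using countable_rat by (rule countable_subset[rotated]) auto
  moreover have "norm (V j x) \<le> 1" if "x \<in> S" for j x
    using M(1)[of x] that by (auto simp: V_def S_def pos_divide_le_eq simp del: scaleR_Pair)
  ultimately obtain k where k: "strict_mono (k :: nat \<Rightarrow> nat)" "\<And>x. x \<in> S \<Longrightarrow> \<exists>l. (\<lambda>j. V (k j) x) \<longlonglongrightarrow> l"
    using function_convergent_subsequence[of S V 1] by metis
  have evk: "\<forall>\<^sub>F j in sequentially. Q (k j)" if "\<forall>\<^sub>F j in sequentially. Q j" for Q
    using eventually_subseq[OF k(1) that] .
  have convS: "convergent (\<lambda>j. U (k j) x)" "convergent (\<lambda>j. P (k j) x)" if "x \<in> S" for x
  proof -
    have x: "0 < x" using that by (simp add: S_def)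
    obtain l where l: "(\<lambda>j. V (k j) x) \<longlonglongrightarrow> l" using k(2)[OF \<open>x \<in> S\<close>] by blast
    have "(\<lambda>j. M x *\<^sub>R V (k j) x) \<longlonglongrightarrow> M x *\<^sub>R l" by (intro tendsto_intros l)
    moreover have "\<forall>\<^sub>F j in sequentially. M x *\<^sub>R V (k j) x = (U (k j) x, P (k j) x)"
      using evk[OF M(2)[OF x]] by eventually_elim (use M(1)[OF x] in \<open>auto simp: V_def\<close>)
    ultimately have "(\<lambda>j. (U (k j) x, P (k j) x)) \<longlonglongrightarrow> M x *\<^sub>R l" by (rule Lim_transform_eventually)
    from tendsto_fst[OF this] tendsto_snd[OF this]
    show "convergent (\<lambda>j. U (k j) x)" "convergent (\<lambda>j. P (k j) x)" by (auto simp: convergent_def)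
  qed
  have conv: "convergent (\<lambda>j. U (k j) x) \<and> convergent (\<lambda>j. P (k j) x)" if x: "0 < x" for x
  proof -
    have x2: "0 < x/2" "x/2 \<le> 2*x" using x by auto
    obtain \<omega> where \<omega>: "continuous_on {x/2..2*x} \<omega>"
      "\<And>u p z y. good f u p (x/2) (2*x + 2) \<Longrightarrow> z \<in> {x/2..2*x} \<Longrightarrow> y \<in> {x/2..2*x} \<Longrightarrow>
       \<bar>u y - u z\<bar> \<le> \<bar>\<omega> y - \<omega> z\<bar> \<and> \<bar>p y - p z\<bar> \<le> \<bar>\<omega> y - \<omega> z\<bar>"
      using good_modulus[OF x2 f] by metis
    have key: "\<exists>q\<in>S. (\<forall>\<^sub>F j in sequentially. \<bar>U (k j) x - U (k j) q\<bar> < e \<and> \<bar>P (k j) x - P (k j) q\<bar> < e)"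
      if e: "e > 0" for e
    proof -
      obtain d where d: "d > 0" "\<And>y. y \<in> {x/2..2*x} \<Longrightarrow> dist y x < d \<Longrightarrow> dist (\<omega> y) (\<omega> x) < e"
        using \<omega>(1) e x unfolding continuous_on_iff by (metis atLeastAtMost_iff field_sum_of_halves less_add_same_cancel1 less_imp_le mult_2 half_gt_zero)
      obtain q where q: "q \<in> \<rat>" "x < q" "q < min (x + d) (2 * x)"
        using Rats_dense_in_real[of x "min (x + d) (2 * x)"] d x by auto
      have "\<bar>\<omega> x - \<omega> q\<bar> < e" using d(2)[of q] q x by (auto simp: dist_real_def abs_minus_commute)
      have "\<forall>\<^sub>F j in sequentially. \<bar>U (k j) x - U (k j) q\<bar> < e \<and> \<bar>P (k j) x - P (k j) q\<bar> < e"
        using evk[OF ev[OF x2(1), of "2 * x + 2"]]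
      proof eventually_elim
        case (elim j)
        then have "good f (U (k j)) (P (k j)) (x/2) (2*x + 2)" using x by (intro sub) auto
        from \<omega>(2)[OF this, of q x] show ?case using q x \<open>\<bar>\<omega> x - \<omega> q\<bar> < e\<close> by auto
      qed
      moreover have "q \<in> S" using q x by (simp add: S_def)
      ultimately show ?thesis by blast
    qed
    show ?thesis
    proof (intro conjI convergent_from_dense)
      fix e :: real assume "e > 0"
      then obtain q where q: "q \<in> S" "\<forall>\<^sub>F j in sequentially. \<bar>U (k j) x - U (k j) q\<bar> < e \<and> \<bar>P (k j) x - P (k j) q\<bar> < e"
        using key by blast
      show "\<exists>q. convergent (\<lambda>j. U (k j) q) \<and> (\<forall>\<^sub>F j in sequentially. \<bar>U (k j) x - U (k j) q\<bar> < e)"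
        "\<exists>q. convergent (\<lambda>j. P (k j) q) \<and> (\<forall>\<^sub>F j in sequentially. \<bar>P (k j) x - P (k j) q\<bar> < e)"
        using convS[OF q(1)] q(2) by (auto elim: eventually_mono)
    qed
  qed
  define u where "u x = lim (\<lambda>j. U (k j) x)" for x
  define p where "p x = lim (\<lambda>j. P (k j) x)" for x
  have lim: "(\<lambda>j. U (k j) x) \<longlonglongrightarrow> u x" "(\<lambda>j. P (k j) x) \<longlonglongrightarrow> p x" if "0 < x" for x
    using conv[OF that] by (auto simp: u_def p_def convergent_LIMSEQ_iff)
  have ggood: "good f u p a b" if ab: "0 < a" "a \<le> b" for a b
  proof -
    obtain N where N: "\<And>j. j \<ge> N \<Longrightarrow> \<alpha> (k j) < a \<and> b + 2 \<le> real (k j) + 2"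
      using evk[OF ev[OF ab(1), of "b + 2"]] unfolding eventually_sequentially by blast
    show ?thesis
    proof (rule good_limit[OF f ab, of "\<lambda>j. U (k (j + N))" "\<lambda>j. P (k (j + N))"])
      show "good f (U (k (j + N))) (P (k (j + N))) a (b + 2)" for j
        using N[of "j + N"] ab by (intro sub) auto
      show "(\<lambda>j. U (k (j + N)) r) \<longlonglongrightarrow> u r" "(\<lambda>j. P (k (j + N)) r) \<longlonglongrightarrow> p r" if "r \<in> {a..b}" for r
        using lim[of r] that ab LIMSEQ_ignore_initial_segment by fastforce+
    qed
  qed
  show thesis
  proof (rule that[of u p "\<lambda>j. P (k j)" "\<lambda>j. U (k j)"])
    show "\<forall>\<^sub>F j in sequentially. \<exists>a'. 0 < a' \<and> a' < a \<and> P (k j) a' = 0 \<and> good f (U (k j)) (P (k j)) a' (2 + 1 / a)"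
      if a: "0 < a" for a
      using evk[OF ev[OF a, of "2 + 1 / a"]]
    proof eventually_elim
      case (elim j)
      have "good f (U (k j)) (P (k j)) (\<alpha> (k j)) (2 + 1 / a)"
        using elim a \<alpha>(2)[of "k j"] by (intro good_subinterval[OF UP(1)]) (auto intro: order_trans)
      then show ?case using elim UP(2) \<alpha>(1) by blast
    qed
  qed (use ggood lim in auto)
qed

end

section \<open>The flux at the origin\<close>

text \<open>Monotone convergence for \<bar>h\<bar> along the intervals [R / (k + 1), R], then
  dominated convergence for h; the point 0 is negligible.\<close>

lemma absolutely_integrable_near_0:
  fixes h :: "real \<Rightarrow> real"
  assumes R: "0 < R" and h: "\<And>x. 0 < x \<Longrightarrow> x \<le> R \<Longrightarrow> h absolutely_integrable_on {x..R}"
    and M: "\<And>x. 0 < x \<Longrightarrow> x \<le> R \<Longrightarrow> integral {x..R} (\<lambda>r. \<bar>h r\<bar>) \<le> M"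
  shows "h absolutely_integrable_on {0..R}"
proof -
  define x where "x k = R / (real k + 1)" for k
  have x: "0 < x k" "x k \<le> R" "x (Suc k) \<le> x k" for k using R by (auto simp: x_def field_simps)
  have ind: "(\<lambda>r. if r \<in> {x k..R} then H r else 0) absolutely_integrable_on {0..R}"
    if "H absolutely_integrable_on {x k..R}" for H :: "real \<Rightarrow> real" and k
  proof -
    have "{0..R} \<inter> {x k..R} = {x k..R}" using x[of k] by auto
    moreover have "(\<lambda>r. indicator {0..R} r *\<^sub>R (if r \<in> {x k..R} then H r else 0)) = (\<lambda>r. indicator ({0..R} \<inter> {x k..R}) r *\<^sub>R H r)"
      by (auto simp: indicator_def)
    ultimately show ?thesis using that by (simp only: set_integrable_def)
  qed
  have ev: "\<forall>\<^sub>F k in sequentially. x k \<le> r" if "0 < r" for r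
  proof -
    obtain N where N: "R / r \<le> real N" using real_arch_simple by blast
    show ?thesis unfolding eventually_sequentially
    proof (intro exI[of _ N] allI impI)
      fix k assume "N \<le> k"
      then have "real N \<le> real k" by simp
      then have "R / r \<le> real k + 1" using N by linarith
      then show "x k \<le> r" using that R by (simp add: x_def field_simps)
    qed
  qed
  have conv: "(\<lambda>k. if r \<in> {x k..R} then H r else 0) \<longlonglongrightarrow> (if 0 < r then H r else 0)" if "r \<in> {0..R}" for r and H :: "real \<Rightarrow> real"
  proof (cases "0 < r")
    case True
    have "\<forall>\<^sub>F k in sequentially. (if r \<in> {x k..R} then H r else 0) = H r"
      using ev[OF True] by eventually_elim (use that in auto)
    then show ?thesis using True by (simp add: tendsto_eventually)
  next
    case False
    then have "r \<notin> {x k..R}" for k using x(1)[of k] by auto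
    then have "(\<lambda>k. if r \<in> {x k..R} then H r else 0) = (\<lambda>k. 0)" by (intro ext if_not_P)
    then show ?thesis using False by simp
  qed
  have "(\<lambda>r. if 0 < r then \<bar>h r\<bar> else 0) integrable_on {0..R} \<and>
      (\<lambda>k. integral {0..R} (\<lambda>r. if r \<in> {x k..R} then \<bar>h r\<bar> else 0)) \<longlonglongrightarrow> integral {0..R} (\<lambda>r. if 0 < r then \<bar>h r\<bar> else 0)"
  proof (rule monotone_convergence_increasing)
    show I: "(\<lambda>r. if r \<in> {x k..R} then \<bar>h r\<bar> else 0) integrable_on {0..R}" for k
      by (intro set_lebesgue_integral_eq_integral(1) ind set_integrable_abs h x)
    show "(if r \<in> {x k..R} then \<bar>h r\<bar> else 0) \<le> (if r \<in> {x (Suc k)..R} then \<bar>h r\<bar> else 0)" for k r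
      using x(3)[of k] by auto
    show "(\<lambda>k. if r \<in> {x k..R} then \<bar>h r\<bar> else 0) \<longlonglongrightarrow> (if 0 < r then \<bar>h r\<bar> else 0)" if "r \<in> {0..R}" for r
      by (rule conv[OF that])
    show "bounded (range (\<lambda>k. integral {0..R} (\<lambda>r. if r \<in> {x k..R} then \<bar>h r\<bar> else 0)))"
      unfolding bounded_iff
    proof (intro exI[of _ M] ballI)
      fix y assume "y \<in> range (\<lambda>k. integral {0..R} (\<lambda>r. if r \<in> {x k..R} then \<bar>h r\<bar> else 0))"
      then obtain k where y: "y = integral {0..R} (\<lambda>r. if r \<in> {x k..R} then \<bar>h r\<bar> else 0)" by blast
      also have "\<dots> = integral {x k..R} (\<lambda>r. \<bar>h r\<bar>)"
        using x[of k] by (subst integral_restrict_Int) (simp add: Int_absorb2)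
      finally have "y \<le> M" using M x by simp
      moreover have "0 \<le> y" unfolding y by (rule integral_nonneg_real) auto
      ultimately show "norm y \<le> M" by simp
    qed
  qed
  then have dom: "(\<lambda>r. if 0 < r then \<bar>h r\<bar> else 0) integrable_on {0..R}" ..
  have "(\<lambda>r. if 0 < r then h r else 0) absolutely_integrable_on {0..R}"
  proof (rule dominated_convergence_absolutely_integrable[where f = "\<lambda>k r. if r \<in> {x k..R} then h r else 0"
        and h = "\<lambda>r. if 0 < r then \<bar>h r\<bar> else 0"])
    show "(\<lambda>r. if r \<in> {x k..R} then h r else 0) absolutely_integrable_on {0..R}" for k
      by (intro ind h x)
  qed (use conv dom in auto)
  then show ?thesis
    by (rule absolutely_integrable_spike[where S = "{0}"]) auto
qed

lemma absolutely_integrable_from_0: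
  fixes h :: "real \<Rightarrow> real"
  assumes "h absolutely_integrable_on {0..1}" "\<And>x. h absolutely_integrable_on {1..x}"
  shows "h absolutely_integrable_on {0..R}"
proof -
  have "h absolutely_integrable_on ({0..1} \<union> {1..R})"
    using assms by (intro absolutely_integrable_Un)
  then show ?thesis by (rule absolutely_integrable_subset) auto
qed

context pucci
begin

text \<open>On (0, 1] every weight is at most r^\<kappa>, so r^\<kappa> \<bar>f\<bar> / lam
  dominates; this is the reason for the exponent N_+ - 1 in the hypothesis.\<close>

lemma weighted_admissible_integrable:
  assumes c: "coefficient c \<kappa> \<kappa>'" and \<alpha>: "coefficient \<alpha> (1 / Lam) (1 / lam)" and f: "admissible f"
  shows "(\<lambda>r. weight c r * (\<alpha> r * f r)) absolutely_integrable_on {0..R}"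
proof (rule absolutely_integrable_from_0)
  have loc: "(\<lambda>r. weight c r * (\<alpha> r * f r)) absolutely_integrable_on {x..y}" if "0 < x" for x y
    by (intro weight_coefficient_integrable[OF c \<alpha>] admissible_integrable[OF f] that)
  show "(\<lambda>r. weight c r * (\<alpha> r * f r)) absolutely_integrable_on {1..x}" for x by (rule loc) simp
  show "(\<lambda>r. weight c r * (\<alpha> r * f r)) absolutely_integrable_on {0..1}"
  proof (rule absolutely_integrable_near_0)
    show "integral {x..1} (\<lambda>r. \<bar>weight c r * (\<alpha> r * f r)\<bar>) \<le> mass f 1" if x: "0 < x" "x \<le> 1" for x
    proof -
      have "0 \<le> \<alpha> r" if "0 < r" for r
        using coefficient_bounds(1)[OF \<alpha> that] Lam_pos(3) by linarith
      then have "integral {x..1} (\<lambda>r. \<bar>weight c r * (\<alpha> r * f r)\<bar>) = integral {x..1} (\<lambda>r. weight c r * (\<alpha> r * \<bar>f r\<bar>))"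
        using x by (intro integral_cong) (simp add: abs_mult)
      also have "\<dots> \<le> weight c 1 * (1 / lam * integral {x..1} (\<lambda>r. (r / 1) powr \<kappa> * \<bar>f r\<bar>))"
        using x by (intro weighted_integral_le[OF c \<alpha> Lam_pos(3)] set_integrable_abs admissible_integrable[OF f]) auto
      finally show ?thesis using mass_bound[OF f x] by simp
    qed
  qed (use loc in auto)
qed

text \<open>If the flux had a positive limit, \<open>u\<close> would be nonnegative and increasing near the origin. This bounds
  the approximations \<open>U j\<close> uniformly down to the left ends of their intervals, and then the flux
  tends to 0.\<close>

lemma flux_not_positive:
  fixes U P :: "nat \<Rightarrow> real \<Rightarrow> real"
  assumes f: "admissible f" and R: "0 < R" "R \<le> 1" and c: "0 < c"
    and u: "\<And>r. 0 < r \<Longrightarrow> (u has_real_derivative p r) (at r)"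
    and p: "\<And>r. 0 < r \<Longrightarrow> r \<le> R \<Longrightarrow> c * r powr (- \<kappa>) \<le> p r"
    and m: "\<And>r. 0 < r \<Longrightarrow> r \<le> R \<Longrightarrow> mass f r < c"
    and sg: "\<And>r. 0 < r \<Longrightarrow> - (mass f r * r powr (- \<kappa>)) \<le> p r * sgn (u r)"
    and lim: "\<And>r. 0 < r \<Longrightarrow> (\<lambda>j. U j r) \<longlonglongrightarrow> u r" "\<And>r. 0 < r \<Longrightarrow> (\<lambda>j. P j r) \<longlonglongrightarrow> p r"
    and ev: "\<And>y. 0 < y \<Longrightarrow> y \<le> R \<Longrightarrow> \<forall>\<^sub>F j in sequentially. \<exists>a. 0 < a \<and> a < y \<and>
      (\<forall>r\<in>{a..R}. (U j has_real_derivative P j r) (at r within {a..R})) \<and>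
      (\<forall>r\<in>{a..R}. - (mass f r * r powr (- \<kappa>)) \<le> P j r * sgn (U j r)) \<and>
      (\<forall>B. (\<forall>r\<in>{a..y}. \<bar>U j r\<bar> \<le> B) \<longrightarrow> \<bar>P j y\<bar> \<le> B powr s / lam * y + mass f y * y powr (- \<kappa>))"
  shows False
proof -
  have mp: "mass f r * r powr (- \<kappa>) < p r" if "0 < r" "r \<le> R" for r
  proof -
    have "mass f r * r powr (- \<kappa>) < c * r powr (- \<kappa>)" using m[OF that] that by (intro mult_strict_right_mono) auto
    then show ?thesis using p[OF that] by linarith
  qed
  have ppos: "0 < p r" if "0 < r" "r \<le> R" for r
    using mp[OF that] mass_nonneg[of f r] by (meson mult_nonneg_nonneg order_le_less_trans powr_ge_zero)
  have der: "(u has_real_derivative p t) (at t within S)" if "0 < t" for t S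
    by (rule has_field_derivative_at_within[OF u[OF that]])
  have unn: "0 \<le> u r" if r: "0 < r" "r \<le> R" for r
  proof (rule ccontr)
    assume "\<not> 0 \<le> u r"
    then show False using sg[OF r(1)] mp[OF r] by simp
  qed
  \<comment> \<open>\<bar>U j r\<bar> will be at most \<bar>U j R\<bar> + u R - u r, where u r \<ge>
    0 and \<bar>U j R\<bar> \<le> \<bar>u R\<bar> + 1 for large j.\<close>
  define B where "B = 2 * \<bar>u R\<bar> + 1"
  have est: "p y \<le> B powr s / lam * y + mass f y * y powr (- \<kappa>)" if y: "0 < y" "y \<le> R" for y
  proof -
    have "\<forall>\<^sub>F j in sequentially. dist (U j R) (u R) < 1" using lim(1)[OF R(1)] by (rule tendstoD) simp
    with ev[OF y] have "\<forall>\<^sub>F j in sequentially. \<bar>P j y\<bar> \<le> B powr s / lam * y + mass f y * y powr (- \<kappa>)"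
    proof eventually_elim
      case (elim j)
      then obtain a where a: "0 < a" "a < y"
        "\<And>r. r \<in> {a..R} \<Longrightarrow> (U j has_real_derivative P j r) (at r within {a..R})"
        "\<And>r. r \<in> {a..R} \<Longrightarrow> - (mass f r * r powr (- \<kappa>)) \<le> P j r * sgn (U j r)"
        "\<And>B. (\<forall>r\<in>{a..y}. \<bar>U j r\<bar> \<le> B) \<Longrightarrow> \<bar>P j y\<bar> \<le> B powr s / lam * y + mass f y * y powr (- \<kappa>)"
        by blast
      have "\<bar>U j r\<bar> \<le> B" if r: "r \<in> {a..R}" for r
      proof -
        have dU: "(U j has_real_derivative P j t) (at t within {r..R})" if "t \<in> {r..R}" for t
          by (rule has_field_derivative_subset[OF a(3)]) (use that r in auto)
        have du: "(u has_real_derivative p t) (at t within {r..R})" if "t \<in> {r..R}" for t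
          by (rule der) (use that r a in auto)
        have pn: "0 \<le> p t" if "t \<in> {r..R}" for t using ppos[of t] that r a by auto
        \<comment> \<open>The limit u is a barrier: its slope exceeds \<open>mass f t\<close>
          t^(-\<kappa>), hence the rate at which \<bar>U j\<bar> can decrease. So \<bar>U j\<bar> at
          r exceeds its value at R by at most u R - u r, uniformly in j.\<close>
        have sgt: "- p t \<le> P j t * sgn (U j t)" if "t \<in> {r..R}" for t
        proof -
          have "- (mass f t * t powr (- \<kappa>)) \<le> P j t * sgn (U j t)" using a(4)[of t] that r by auto
          moreover have "mass f t * t powr (- \<kappa>) < p t" using mp[of t] that r a by auto
          ultimately show ?thesis by linarith
        qed
        have "U j r \<le> max (U j R) 0 + (u R - u r)"
        proof (rule positive_part_le[OF _ dU du pn])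
          show "- p t \<le> P j t" if "t \<in> {r..R}" "0 < U j t" for t using sgt[OF that(1)] that(2) by simp
        qed (use r in auto)
        moreover have "- U j r \<le> max (- U j R) 0 + (u R - u r)"
        proof (rule positive_part_le[OF _ DERIV_minus[OF dU] du pn])
          show "- p t \<le> - P j t" if "t \<in> {r..R}" "0 < - U j t" for t using sgt[OF that(1)] that(2) by simp
        qed (use r in auto)
        moreover have "\<bar>U j R\<bar> \<le> \<bar>u R\<bar> + 1" using elim by (simp add: dist_real_def)
        moreover have "0 \<le> u r" using unn r a by auto
        ultimately show ?thesis by (simp add: B_def)
      qed
      then show ?case using y by (intro a(5)) auto
    qed
    moreover have "(\<lambda>j. \<bar>P j y\<bar>) \<longlonglongrightarrow> \<bar>p y\<bar>" using lim(2)[OF y(1)] by (rule tendsto_rabs)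
    ultimately have "\<bar>p y\<bar> \<le> B powr s / lam * y + mass f y * y powr (- \<kappa>)"
      by (intro tendsto_upperbound) auto
    then show ?thesis by simp
  qed
  \<comment> \<open>The lower and the upper bound for p y, multiplied by y^\<kappa>; the right side
    tends to 0 with y.\<close>
  have cy: "c \<le> B powr s / lam * y + mass f y" if y: "0 < y" "y \<le> R" for y
  proof -
    have "y powr \<kappa> * (c * y powr (- \<kappa>)) \<le> y powr \<kappa> * (B powr s / lam * y + mass f y * y powr (- \<kappa>))"
      using order_trans[OF p[OF y] est[OF y]] by (intro mult_left_mono) auto
    moreover have "y powr \<kappa> * y powr (- \<kappa>) = 1" using y by (simp add: powr_minus)
    ultimately have "c \<le> y powr \<kappa> * (B powr s / lam * y) + mass f y"
      by (simp add: distrib_left mult.left_commute[of "y powr \<kappa>"])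
    also have "y powr \<kappa> * (B powr s / lam * y) \<le> 1 * (B powr s / lam * y)"
    proof (rule mult_right_mono)
      have "y powr \<kappa> \<le> 1 powr \<kappa>" using y R kappa by (intro powr_mono2) auto
      then show "y powr \<kappa> \<le> 1" by simp
    qed (use y lam in auto)
    finally show ?thesis by simp
  qed
  have "((\<lambda>y. B powr s / lam * y + mass f y) \<longlongrightarrow> B powr s / lam * 0 + 0) (at_right 0)"
    by (intro tendsto_intros mass_tendsto_0[OF f])
  moreover have "\<forall>\<^sub>F y in at_right 0. c \<le> B powr s / lam * y + mass f y"
    unfolding eventually_at_right_field using cy R by (intro exI[of _ R]) auto
  ultimately have "c \<le> B powr s / lam * 0 + 0" by (rule tendsto_lowerbound) simp
  then show False using c by simp
qed

context
  fixes f u p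
  assumes f: "admissible f" and G: "\<forall>a b. 0 < a \<longrightarrow> a \<le> b \<longrightarrow> good f u p a b"
begin

lemma all_solves: "\<forall>a b. 0 < a \<longrightarrow> a \<le> b \<longrightarrow> solves (spower s) f u p a b"
  using G by (auto simp: good_def)

lemmas all_facts = global_coefficients[OF all_solves f]

abbreviation "\<rho> \<equiv> weight (damping f u p)"
abbreviation "ellip r \<equiv> 1 / \<theta> (driving (spower s) f u p r)"

lemma rho_le: "0 < r \<Longrightarrow> r \<le> 1 \<Longrightarrow> \<rho> r \<le> r powr \<kappa>"
  by (rule weight_le_powr[OF all_facts(2)])

lemma rho_f_integral:
  assumes "0 < x" "x \<le> 1"
  shows "integral {x..1} (\<lambda>r. \<rho> r * (ellip r * \<bar>f r\<bar>)) \<le> mass f 1"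
proof -
  have "integral {x..1} (\<lambda>r. \<rho> r * (ellip r * \<bar>f r\<bar>)) \<le> \<rho> 1 * (1 / lam * integral {x..1} (\<lambda>r. (r / 1) powr \<kappa> * \<bar>f r\<bar>))"
    using assms by (intro weighted_integral_le[OF all_facts(2,1) Lam_pos(3)] set_integrable_abs admissible_integrable[OF f]) auto
  then show ?thesis using mass_bound[OF f assms] by simp
qed

text \<open>The boundary term of Kato's inequality at x is bounded by the sign bound together with
  \<open>\<rho> x\<close> \<le> x^\<kappa>; hence the estimate does not degenerate as x tends to
  0.\<close>

lemma rho_Kato:
  assumes x: "0 < x" "x \<le> 1"
  shows "integral {x..1} (\<lambda>r. \<rho> r * (ellip r * \<bar>spower s (u r)\<bar>)) \<le> \<bar>\<rho> 1 * p 1\<bar> + 2 * mass f 1"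
proof -
  have "integral {x..1} (\<lambda>r. \<rho> r * (ellip r * \<bar>spower s (u r)\<bar>)) \<le>
      \<rho> 1 * p 1 * sgn (u 1) - \<rho> x * p x * sgn (u x) + integral {x..1} (\<lambda>r. \<rho> r * (ellip r * \<bar>f r\<bar>))"
    using x by (intro Kato_inequality[OF all_facts(2,1) Lam_pos(3) all_facts(3)] spower_continuous
        spower_mult_nonneg spower_0 admissible_integrable[OF f]) auto
  moreover have "\<rho> 1 * p 1 * sgn (u 1) \<le> \<bar>\<rho> 1 * p 1\<bar>" by (auto simp: sgn_if)
  moreover have "- (\<rho> x * p x * sgn (u x)) \<le> mass f 1"
  proof -
    have "- (p x * sgn (u x)) \<le> mass f x * x powr (- \<kappa>)" using G x by (force simp: good_def)
    then have "\<rho> x * - (p x * sgn (u x)) \<le> \<rho> x * (mass f x * x powr (- \<kappa>))" by (intro mult_left_mono) auto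
    also have "\<dots> \<le> x powr \<kappa> * (mass f x * x powr (- \<kappa>))"
      using rho_le[OF x] mass_nonneg by (intro mult_right_mono) auto
    also have "\<dots> = mass f x" using x by (simp add: powr_minus)
    also have "\<dots> \<le> mass f 1" using x by (intro mass_mono[OF f]) auto
    finally show ?thesis by (simp add: mult.assoc)
  qed
  ultimately show ?thesis using rho_f_integral[OF x] by linarith
qed

lemma spower_u_integrable:
  assumes "0 < x"
  shows "(\<lambda>r. spower s (u r)) absolutely_integrable_on {x..y}"
  using continuous_on_compose2[OF spower_continuous all_facts(5)] assms
  by (intro absolutely_integrable_continuous_real) (auto intro: continuous_on_subset)

lemma rho_terms_integrable:
  "(\<lambda>r. \<rho> r * (ellip r * f r)) absolutely_integrable_on {0..1}"
  "(\<lambda>r. \<rho> r * (ellip r * spower s (u r))) absolutely_integrable_on {0..1}"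
proof -
  have e: "0 \<le> ellip r" for r using inverse_theta_bounds(3) by (rule less_imp_le)
  show "(\<lambda>r. \<rho> r * (ellip r * f r)) absolutely_integrable_on {0..1}"
    by (rule weighted_admissible_integrable[OF all_facts(2,1) f])
  show "(\<lambda>r. \<rho> r * (ellip r * spower s (u r))) absolutely_integrable_on {0..1}"
  proof (rule absolutely_integrable_near_0)
    show "(\<lambda>r. \<rho> r * (ellip r * spower s (u r))) absolutely_integrable_on {x..1}" if "0 < x" for x
      by (intro weight_coefficient_integrable[OF all_facts(2,1)] spower_u_integrable that)
    show "integral {x..1} (\<lambda>r. \<bar>\<rho> r * (ellip r * spower s (u r))\<bar>) \<le> \<bar>\<rho> 1 * p 1\<bar> + 2 * mass f 1" if "0 < x" "x \<le> 1" for x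
    proof -
      have "(\<lambda>r. \<bar>\<rho> r * (ellip r * spower s (u r))\<bar>) = (\<lambda>r. \<rho> r * (ellip r * \<bar>spower s (u r)\<bar>))"
        using e by (simp add: abs_mult)
      then show ?thesis using rho_Kato[OF that] by simp
    qed
  qed simp
qed

text \<open>The flux is a primitive of h, and h is integrable up to the origin.\<close>

lemma flux_converges: "\<exists>W. ((\<lambda>r. \<rho> r * p r) \<longlongrightarrow> W) (at_right 0)"
proof -
  define h where "h r = \<rho> r * (ellip r * (spower s (u r) - f r))" for r
  have "h = (\<lambda>r. \<rho> r * (ellip r * spower s (u r)) - \<rho> r * (ellip r * f r))"
    by (auto simp: h_def right_diff_distrib diff_divide_distrib)
  then have h: "h absolutely_integrable_on {0..1}"
    using rho_terms_integrable by (simp add: set_integral_diff)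
  then have hi: "h integrable_on {0..1}" by (rule set_lebesgue_integral_eq_integral(1))
  have "continuous_on {0..1} (\<lambda>x. integral {0..x} h)" by (rule indefinite_integral_continuous_1[OF hi])
  then have "((\<lambda>x. integral {0..x} h) \<longlongrightarrow> integral {0..0} h) (at 0 within {0..1})"
    unfolding continuous_on_def by (drule_tac bspec[of _ _ 0]) simp_all
  then have "((\<lambda>x. \<rho> 1 * p 1 - integral {0..1} h + integral {0..x} h) \<longlongrightarrow> \<rho> 1 * p 1 - integral {0..1} h + 0) (at_right 0)"
    by (intro tendsto_intros) (simp add: at_within_Icc_at_right)
  moreover have "\<forall>\<^sub>F x in at_right 0. \<rho> 1 * p 1 - integral {0..1} h + integral {0..x} h = \<rho> x * p x"
    unfolding eventually_at_right_field
  proof (intro exI[of _ 1] conjI allI impI)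
    fix x :: real assume x: "0 < x" "x < 1"
    have "ac_primitive (\<lambda>r. \<rho> r * p r) h x 1"
      unfolding h_def[abs_def] by (rule linear_form_flux[OF all_facts(2) all_facts(3)]) (use x in auto)
    from ac_primitiveD(2)[OF this, of x 1] have "integral {x..1} h = \<rho> 1 * p 1 - \<rho> x * p x" using x by simp
    moreover have "integral {0..x} h + integral {x..1} h = integral {0..1} h"
      using x hi by (intro Henstock_Kurzweil_Integration.integral_combine) auto
    ultimately show "\<rho> 1 * p 1 - integral {0..1} h + integral {0..x} h = \<rho> x * p x" by linarith
  qed simp
  ultimately show ?thesis by (blast intro: Lim_transform_eventually)
qed

end

theorem exists_global_solution:
  assumes f: "admissible f"
  obtains u p where "global_solution f u p"
proof -
  obtain U P u p where UP:
    "\<And>a b. 0 < a \<Longrightarrow> a \<le> b \<Longrightarrow> good f u p a b"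
    "\<And>a. 0 < a \<Longrightarrow> \<forall>\<^sub>F j in sequentially. \<exists>a'. 0 < a' \<and> a' < a \<and> P j a' = 0 \<and> good f (U j) (P j) a' (2 + 1 / a)"
    "\<And>r. 0 < r \<Longrightarrow> (\<lambda>j. U j r) \<longlonglongrightarrow> u r" "\<And>r. 0 < r \<Longrightarrow> (\<lambda>j. P j r) \<longlonglongrightarrow> p r"
  proof (rule exists_good_global[OF f])
  qed (rule that; assumption)
  have G: "\<forall>a b. 0 < a \<longrightarrow> a \<le> b \<longrightarrow> good f u p a b" using UP(1) by blast
  note facts = all_facts[OF f G]
  let ?\<rho> = "weight (damping f u p)"
  obtain W where W: "((\<lambda>r. ?\<rho> r * p r) \<longlongrightarrow> W) (at_right 0)" using flux_converges[OF f G] by blast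
  have sg: "- (mass f r * r powr (- \<kappa>)) \<le> p r * sgn (u r)" if "0 < r" for r
    using UP(1)[OF that order_refl] by (auto simp: good_def)
  \<comment> \<open>\<open>P j\<close> vanishes at the left end of its interval, so
    \<open>bounded_local_estimate\<close> has no boundary term and its bound does not depend on
    where that end lies.\<close>
  have ev: "\<forall>\<^sub>F j in sequentially. \<exists>a. 0 < a \<and> a < y \<and>
      (\<forall>r\<in>{a..1}. (U j has_real_derivative P j r) (at r within {a..1})) \<and>
      (\<forall>r\<in>{a..1}. - (mass f r * r powr (- \<kappa>)) \<le> P j r * sgn (U j r)) \<and>
      (\<forall>B. (\<forall>r\<in>{a..y}. \<bar>U j r\<bar> \<le> B) \<longrightarrow> \<bar>P j y\<bar> \<le> B powr s / lam * y + mass f y * y powr (- \<kappa>))"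
    if y: "0 < y" "y \<le> 1" for y
    using UP(2)[OF y(1)]
  proof eventually_elim
    case (elim j)
    then obtain a where a: "0 < a" "a < y" "P j a = 0" "good f (U j) (P j) a (2 + 1 / y)" by blast
    have b: "1 \<le> 2 + 1 / y" using y by simp
    have g1: "good f (U j) (P j) a 1" by (rule good_subinterval[OF a(4)]) (use a y b in auto)
    have "good f (U j) (P j) a y" by (rule good_subinterval[OF g1]) (use a y in auto)
    then have S: "solves (spower s) f (U j) (P j) a y" by (simp add: good_def)
    obtain \<alpha> c where \<alpha>c: "coefficient \<alpha> (1 / Lam) (1 / lam)" "coefficient c \<kappa> \<kappa>'"
      "linear_form \<alpha> c (\<lambda>r. spower s (U j r) - f r) (U j) (P j) a y"
      using solves_linearisation[OF S spower_continuous] by blast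
    have "\<bar>P j y\<bar> \<le> B powr s / lam * y + mass f y * y powr (- \<kappa>)" if "\<forall>r\<in>{a..y}. \<bar>U j r\<bar> \<le> B" for B
      using bounded_local_estimate[OF f \<alpha>c, of B] that a(3) by simp
    then show ?case using a(1,2) g1 solvesD(3) unfolding good_def by blast
  qed
  \<comment> \<open>Both signs of the limit are excluded at once. The equation is not odd, but apart
    from the sign of the flux the hypotheses of \<open>flux_not_positive\<close> are estimates
    invariant under a change of sign.\<close>
  have lower: False if W0: "W * \<sigma> > 0" and \<sigma>: "\<sigma> = 1 \<or> \<sigma> = - 1" for \<sigma>
  proof -
    define c where "c = W * \<sigma> / 2"
    have c: "0 < c" using W0 by (simp add: c_def)
    have "((\<lambda>r. ?\<rho> r * p r * \<sigma>) \<longlongrightarrow> W * \<sigma>) (at_right 0)" by (intro tendsto_intros W)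
    then have "\<forall>\<^sub>F r in at_right 0. c < ?\<rho> r * p r * \<sigma>" by (rule order_tendstoD(1)) (use c in \<open>simp add: c_def\<close>)
    moreover have "\<forall>\<^sub>F r in at_right 0. mass f r < c" by (rule order_tendstoD(2)[OF mass_tendsto_0[OF f] c])
    ultimately have "\<forall>\<^sub>F r in at_right 0. c < ?\<rho> r * p r * \<sigma> \<and> mass f r < c" by (rule eventually_conj)
    then obtain R0 where R0: "0 < R0" "\<And>r. 0 < r \<Longrightarrow> r < R0 \<Longrightarrow> c < ?\<rho> r * p r * \<sigma> \<and> mass f r < c"
      unfolding eventually_at_right_field by blast
    define R where "R = min 1 (R0 / 2)"
    have R: "0 < R" "R \<le> 1" "R < R0" using R0 by (auto simp: R_def)
    show False
    proof (rule flux_not_positive[OF f R(1,2) c, where u = "\<lambda>r. \<sigma> * u r" and p = "\<lambda>r. \<sigma> * p r"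
          and U = "\<lambda>j r. \<sigma> * U j r" and P = "\<lambda>j r. \<sigma> * P j r"])
      show "((\<lambda>r. \<sigma> * u r) has_real_derivative \<sigma> * p r) (at r)" if "0 < r" for r
        by (intro DERIV_cmult facts(4) that)
      show "mass f r < c" if "0 < r" "r \<le> R" for r using R0(2)[of r] that R by auto
      show "c * r powr (- \<kappa>) \<le> \<sigma> * p r" if r: "0 < r" "r \<le> R" for r
      proof -
        have "c < ?\<rho> r * (\<sigma> * p r)" using R0(2)[of r] r R by (simp add: mult_ac)
        moreover from this have "0 < \<sigma> * p r" using c by (metis less_trans zero_less_mult_pos weight_pos(1))
        then have "?\<rho> r * (\<sigma> * p r) \<le> r powr \<kappa> * (\<sigma> * p r)"
          using rho_le[OF f G, of r] r R by (intro mult_right_mono) auto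
        ultimately have "c \<le> r powr \<kappa> * (\<sigma> * p r)" by linarith
        then show ?thesis using r by (simp add: powr_minus field_simps)
      qed
      have sg\<sigma>: "\<sigma> * a * sgn (\<sigma> * b) = a * sgn b" for a b :: real using \<sigma> by (auto simp: sgn_minus)
      have ab\<sigma>: "\<bar>\<sigma> * b\<bar> = \<bar>b\<bar>" for b :: real using \<sigma> by auto
      show "- (mass f r * r powr (- \<kappa>)) \<le> \<sigma> * p r * sgn (\<sigma> * u r)" if "0 < r" for r
        unfolding sg\<sigma> by (rule sg[OF that])
      show "(\<lambda>j. \<sigma> * U j r) \<longlonglongrightarrow> \<sigma> * u r" "(\<lambda>j. \<sigma> * P j r) \<longlonglongrightarrow> \<sigma> * p r" if "0 < r" for r
        using UP(3,4)[OF that] by (auto intro: tendsto_mult)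
      show "\<forall>\<^sub>F j in sequentially. \<exists>a. 0 < a \<and> a < y \<and>
          (\<forall>r\<in>{a..R}. ((\<lambda>r. \<sigma> * U j r) has_real_derivative \<sigma> * P j r) (at r within {a..R})) \<and>
          (\<forall>r\<in>{a..R}. - (mass f r * r powr (- \<kappa>)) \<le> \<sigma> * P j r * sgn (\<sigma> * U j r)) \<and>
          (\<forall>B. (\<forall>r\<in>{a..y}. \<bar>\<sigma> * U j r\<bar> \<le> B) \<longrightarrow> \<bar>\<sigma> * P j y\<bar> \<le> B powr s / lam * y + mass f y * y powr (- \<kappa>))"
        if y: "0 < y" "y \<le> R" for y
        using ev[OF y(1) order_trans[OF y(2) R(2)]]
      proof eventually_elim
        case (elim j)
        then obtain a where a: "0 < a" "a < y"
          "\<And>r. r \<in> {a..1} \<Longrightarrow> (U j has_real_derivative P j r) (at r within {a..1})"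
          "\<And>r. r \<in> {a..1} \<Longrightarrow> - (mass f r * r powr (- \<kappa>)) \<le> P j r * sgn (U j r)"
          "\<And>B. (\<forall>r\<in>{a..y}. \<bar>U j r\<bar> \<le> B) \<Longrightarrow> \<bar>P j y\<bar> \<le> B powr s / lam * y + mass f y * y powr (- \<kappa>)"
          by blast
        show ?case
          unfolding sg\<sigma> ab\<sigma>
        proof (intro exI[of _ a] conjI ballI allI impI a(1,2))
          show "((\<lambda>r. \<sigma> * U j r) has_real_derivative \<sigma> * P j r) (at r within {a..R})" if "r \<in> {a..R}" for r
            by (intro DERIV_cmult has_field_derivative_subset[OF a(3)]) (use that R in auto)
          show "- (mass f r * r powr (- \<kappa>)) \<le> P j r * sgn (U j r)" if "r \<in> {a..R}" for r
            using a(4)[of r] that R by auto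
        qed (rule a(5))
      qed
    qed
  qed
  have "W = 0"
  proof (rule ccontr)
    assume "W \<noteq> 0"
    then have "0 < W * 1 \<or> 0 < W * - 1" by auto
    then show False using lower by blast
  qed
  then have "global_solution f u p"
    using W G unfolding global_solution_def good_def by auto
  then show thesis by (rule that)
qed

lemma global_solution_good:
  assumes G: "global_solution f u p" and f: "admissible f"
  shows "\<forall>a b. 0 < a \<longrightarrow> a \<le> b \<longrightarrow> good f u p a b"
  using global_solves[OF G f] sgn_derivative_bound[OF G f] unfolding good_def by auto

end

section \<open>Radial test functions\<close>

lemma integrable_compact_support:
  fixes w :: "'a::euclidean_space \<Rightarrow> real"
  assumes w: "continuous_on UNIV w" and K: "compact K" "\<forall>x. x \<notin> K \<longrightarrow> w x = 0"
  shows "integrable lborel w" "w \<in> borel_measurable borel" "integrable lebesgue w"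
    "(LINT x|lebesgue. w x) = (LINT x|lborel. w x)"
proof -
  have "indicator K x *\<^sub>R w x = w x" for x using K(2) by (cases "x \<in> K") auto
  then have "(\<lambda>x. indicator K x *\<^sub>R w x) = w" by blast
  then show i: "integrable lborel w"
    using borel_integrable_compact[OF K(1), of w] w by (simp add: continuous_on_subset)
  show "w \<in> borel_measurable borel" by (rule borel_measurable_continuous_onI[OF w])
  then show "integrable lebesgue w" "(LINT x|lebesgue. w x) = (LINT x|lborel. w x)"
    using i by (auto simp: integrable_completion integral_completion)
qed

lemma lborel_integral_translate:
  fixes w :: "'a::euclidean_space \<Rightarrow> real"
  assumes "w \<in> borel_measurable borel"
  shows "(LINT x|lborel. w (c + x)) = (LINT x|lborel. w x)"
proof -
  have "(LINT x|distr lborel borel ((+) c). w x) = (LINT x|lborel. w (c + x))"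
    using assms by (intro integral_distr) auto
  then show ?thesis by (simp add: lborel_distr_plus)
qed

lemma partial_eq:
  assumes "(w has_derivative D) (at x)"
  shows "partial i w x = D (axis i 1)"
  unfolding partial_def using frechet_derivative_at[OF assms] by simp

lemma continuous_on_differentiable:
  fixes w :: "'a::euclidean_space \<Rightarrow> real"
  assumes "\<forall>x. w differentiable (at x)"
  shows "continuous_on UNIV w"
  using assms differentiable_imp_continuous_within[of w] by (intro continuous_at_imp_continuous_on) blast

lemma partial_eq_0:
  fixes w :: "real ^ 'n \<Rightarrow> real"
  assumes "compact K" "\<forall>x. x \<notin> K \<longrightarrow> w x = 0" "x \<notin> K"
  shows "partial i w x = 0"
proof -
  have K: "open (- K)" "x \<in> - K" using assms by (auto intro: compact_imp_closed)
  have "(w has_derivative (\<lambda>_. 0)) (at x)"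
    by (rule has_derivative_transform_within_open[where f = "\<lambda>_. 0" and s = "- K"])
       (use K assms(2) in auto)
  then show ?thesis by (rule partial_eq)
qed

text \<open>Along a bounded sequence of translations the difference quotients are supported in one
  compact set K', and there they are bounded; so the limit passes under the integral. The derivative
  falls on w, and v is merely continuous.\<close>

lemma DERIV_integral_translate:
  fixes v w :: "real ^ 'n \<Rightarrow> real"
  assumes v: "continuous_on UNIV v"
    and d: "\<forall>x. w differentiable (at x)" and c: "continuous_on UNIV (partial i w)"
    and K: "compact K" "\<forall>x. x \<notin> K \<longrightarrow> w x = 0"
  shows "((\<lambda>t. LINT x|lborel. v x * w (x + t *\<^sub>R axis i 1)) has_real_derivative
           (LINT x|lborel. v x * partial i w x)) (at 0)"
proof -
  let ?e = "axis i 1 :: real ^ 'n"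
  have cw: "continuous_on UNIV w" using d by (rule continuous_on_differentiable)
  have line: "((\<lambda>t. w (x + t *\<^sub>R ?e)) has_real_derivative partial i w (x + t *\<^sub>R ?e)) (at t)" for x t
  proof -
    obtain D where D: "(w has_derivative D) (at (x + t *\<^sub>R ?e))" using d by (auto simp: differentiable_def)
    have "((\<lambda>t. w (x + t *\<^sub>R ?e)) has_derivative (\<lambda>h. D (h *\<^sub>R ?e))) (at t)"
      by (rule has_derivative_compose[where f = "\<lambda>t. x + t *\<^sub>R ?e" and g = w, OF _ D]) (auto intro!: derivative_eq_intros)
    moreover have "D (h *\<^sub>R ?e) = partial i w (x + t *\<^sub>R ?e) * h" for h
      using partial_eq[OF D] linear_scale[OF has_derivative_linear[OF D]] by simp
    ultimately show ?thesis by (simp add: has_field_derivative_def)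
  qed
  have int: "integrable lborel (\<lambda>x. v x * w (x + t *\<^sub>R ?e))" for t
  proof (rule integrable_compact_support(1)[where K = "{y + z | y z. y \<in> K \<and> z \<in> {- (t *\<^sub>R ?e)}}"])
    show "continuous_on UNIV (\<lambda>x. v x * w (x + t *\<^sub>R ?e))"
      by (intro continuous_on_mult v continuous_on_compose2[OF cw] continuous_intros) auto
    show "compact {y + z | y z. y \<in> K \<and> z \<in> {- (t *\<^sub>R ?e)}}" by (intro compact_sums K) auto
    show "\<forall>x. x \<notin> {y + z | y z. y \<in> K \<and> z \<in> {- (t *\<^sub>R ?e)}} \<longrightarrow> v x * w (x + t *\<^sub>R ?e) = 0"
    proof (intro allI impI)
      fix x assume "x \<notin> {y + z | y z. y \<in> K \<and> z \<in> {- (t *\<^sub>R ?e)}}"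
      then have "x + t *\<^sub>R ?e \<notin> K" by (auto dest: spec[of _ "x + t *\<^sub>R ?e"])
      then show "v x * w (x + t *\<^sub>R ?e) = 0" using K(2) by simp
    qed
  qed
  have "(\<lambda>k. ((LINT x|lborel. v x * w (x + (0 + X k) *\<^sub>R ?e)) - (LINT x|lborel. v x * w (x + 0 *\<^sub>R ?e))) / X k)
      \<longlonglongrightarrow> (LINT x|lborel. v x * partial i w x)"
    if X: "\<forall>k. X k \<in> UNIV - {0}" "X \<longlonglongrightarrow> 0" for X :: "nat \<Rightarrow> real"
  proof -
    have "Bseq X" using X(2) by (intro convergent_imp_Bseq) (auto simp: convergent_def)
    then obtain B where B: "0 < B" "\<And>k. \<bar>X k\<bar> \<le> B" unfolding Bseq_def by auto
    define K' where "K' = {x + y | x y. x \<in> K \<and> y \<in> cball 0 B}"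
    have K': "compact K'" unfolding K'_def by (intro compact_sums K) auto
    have "bounded (partial i w ` K')" "bounded (v ` K')"
      using K' by (auto intro!: compact_imp_bounded compact_continuous_image continuous_on_subset[OF c] continuous_on_subset[OF v])
    then obtain M M' where M: "M > 0" "\<And>x. x \<in> K' \<Longrightarrow> \<bar>partial i w x\<bar> \<le> M" "M' > 0" "\<And>x. x \<in> K' \<Longrightarrow> \<bar>v x\<bar> \<le> M'"
      unfolding bounded_pos by auto
    have KK': "x \<in> K'" if "x \<in> K" for x unfolding K'_def
      by (intro CollectI exI[of _ x] exI[of _ 0]) (use that B in auto)
    have Mall: "\<bar>partial i w x\<bar> \<le> M" for x
      using M(1,2) partial_eq_0[OF K] KK' by (cases "x \<in> K") auto
    define q where "q k x = v x * ((w (x + X k *\<^sub>R ?e) - w x) / X k)" for k x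
    have qM: "\<bar>q k x\<bar> \<le> M' * M * indicator K' x" for k x
    proof (cases "x \<in> K'")
      case True
      have "norm (w (x + X k *\<^sub>R ?e) - w (x + 0 *\<^sub>R ?e)) \<le> M * norm (X k - 0)"
        by (rule field_differentiable_bound[of UNIV "\<lambda>t. w (x + t *\<^sub>R ?e)" "\<lambda>t. partial i w (x + t *\<^sub>R ?e)"])
           (use line Mall in auto)
      then have "\<bar>(w (x + X k *\<^sub>R ?e) - w x) / X k\<bar> \<le> M" using X(1) by (simp add: pos_divide_le_eq)
      then have "\<bar>v x\<bar> * \<bar>(w (x + X k *\<^sub>R ?e) - w x) / X k\<bar> \<le> M' * M"
        using M True by (intro mult_mono) auto
      then show ?thesis using True by (simp add: q_def abs_mult)
    next
      case False
      have "x \<notin> K" using False KK' by blast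
      moreover have "x + X k *\<^sub>R ?e \<notin> K"
      proof
        assume "x + X k *\<^sub>R ?e \<in> K"
        then have "x \<in> K'" unfolding K'_def
          by (intro CollectI exI[of _ "x + X k *\<^sub>R ?e"] exI[of _ "- (X k *\<^sub>R ?e)"]) (use B in auto)
        then show False using False by blast
      qed
      ultimately show ?thesis using K False by (simp add: q_def)
    qed
    have q: "integrable lborel (q k)"
      "(LINT x|lborel. q k x) = ((LINT x|lborel. v x * w (x + X k *\<^sub>R ?e)) - (LINT x|lborel. v x * w (x + 0 *\<^sub>R ?e))) / X k" for k
    proof -
      have 1: "q k = (\<lambda>x. (v x * w (x + X k *\<^sub>R ?e) - v x * w (x + 0 *\<^sub>R ?e)) / X k)"
        by (simp add: q_def fun_eq_iff right_diff_distrib diff_divide_distrib)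
      show "integrable lborel (q k)" unfolding 1 using int[of "X k"] int[of 0] by auto
      show "(LINT x|lborel. q k x) = ((LINT x|lborel. v x * w (x + X k *\<^sub>R ?e)) - (LINT x|lborel. v x * w (x + 0 *\<^sub>R ?e))) / X k"
        unfolding 1 integral_divide_zero Bochner_Integration.integral_diff[OF int int] ..
    qed
    have "(\<lambda>k. LINT x|lborel. q k x) \<longlonglongrightarrow> (LINT x|lborel. v x * partial i w x)"
    proof (rule integral_dominated_convergence[where w = "\<lambda>x. M' * M * indicator K' x"])
      show "(\<lambda>x. v x * partial i w x) \<in> borel_measurable lborel"
        using borel_measurable_continuous_onI[OF continuous_on_mult[OF v c]] by simp
      show "q k \<in> borel_measurable lborel" for k using q(1) by (rule borel_measurable_integrable)
      show "integrable lborel (\<lambda>x. M' * M * indicator K' x :: real)"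
        using compact_imp_bounded[OF K'] compact_imp_closed[OF K']
        by (intro integrable_mult_right integrable_real_indicator emeasure_bounded_finite) auto
      show "AE x in lborel. (\<lambda>k. q k x) \<longlonglongrightarrow> v x * partial i w x"
      proof (rule AE_I2)
        fix x
        have "(\<lambda>h. (w (x + (0 + h) *\<^sub>R ?e) - w (x + 0 *\<^sub>R ?e)) / h) \<midarrow>0\<rightarrow> partial i w (x + 0 *\<^sub>R ?e)"
          using line[of x 0] unfolding DERIV_def .
        moreover have "filterlim X (at 0) sequentially"
          using X unfolding filterlim_at by auto
        ultimately have "(\<lambda>k. (w (x + (0 + X k) *\<^sub>R ?e) - w (x + 0 *\<^sub>R ?e)) / X k) \<longlonglongrightarrow> partial i w (x + 0 *\<^sub>R ?e)"
          by (rule filterlim_compose)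
        then show "(\<lambda>k. q k x) \<longlonglongrightarrow> v x * partial i w x" unfolding q_def by (intro tendsto_mult tendsto_const) simp
      qed
      show "AE x in lborel. norm (q k x) \<le> M' * M * indicator K' x" for k using qM by (intro AE_I2) simp
    qed
    then show ?thesis unfolding q(2) by simp
  qed
  then show ?thesis unfolding DERIV_def tendsto_at_iff_sequentially comp_def by blast
qed

text \<open>By translation invariance the function in \<open>DERIV_integral_translate\<close> is constant for \<open>v = 1\<close>.\<close>

lemma integral_partial_eq_0:
  fixes w :: "real ^ 'n \<Rightarrow> real"
  assumes d: "\<forall>x. w differentiable (at x)" and c: "continuous_on UNIV (partial i w)"
    and K: "compact K" "\<forall>x. x \<notin> K \<longrightarrow> w x = 0"
  shows "(LINT x|lborel. partial i w x) = 0"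
proof -
  have "w \<in> borel_measurable borel"
    using d by (intro borel_measurable_continuous_onI continuous_on_differentiable)
  then have "(LINT x|lborel. w (x + t *\<^sub>R axis i 1)) = (LINT x|lborel. w x)" for t
    using lborel_integral_translate[of w "t *\<^sub>R axis i 1"] by (simp add: add.commute)
  then show ?thesis
    using DERIV_integral_translate[OF continuous_on_const[of _ 1] assms] DERIV_unique[OF DERIV_const] by fastforce
qed

text \<open>Apply \<open>integral_partial_eq_0\<close> to the product v \<psi>, which inherits the
  compact support of \<psi>.\<close>

lemma C1_integration_by_parts:
  fixes v \<psi> :: "real ^ 'n \<Rightarrow> real"
  assumes v: "\<forall>x. v differentiable (at x)" "continuous_on UNIV (partial i v)"
    and \<psi>: "\<forall>x. \<psi> differentiable (at x)" "continuous_on UNIV (partial i \<psi>)"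
    and K: "compact K" "\<forall>x. x \<notin> K \<longrightarrow> \<psi> x = 0"
  shows "(LINT x|lebesgue. v x * partial i \<psi> x) = - (LINT x|lebesgue. partial i v x * \<psi> x)"
proof -
  have cv: "continuous_on UNIV v" "continuous_on UNIV \<psi>"
    by (rule continuous_on_differentiable[OF v(1)]) (rule continuous_on_differentiable[OF \<psi>(1)])
  have prod: "partial i (\<lambda>x. v x * \<psi> x) = (\<lambda>x. v x * partial i \<psi> x + partial i v x * \<psi> x)"
  proof
    fix x
    obtain D E where DE: "(v has_derivative D) (at x)" "(\<psi> has_derivative E) (at x)"
      using v(1) \<psi>(1) unfolding differentiable_def by blast
    have "partial i (\<lambda>x. v x * \<psi> x) x = v x * E (axis i 1) + D (axis i 1) * \<psi> x"
      by (rule partial_eq, rule has_derivative_mult[OF DE])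
    then show "partial i (\<lambda>x. v x * \<psi> x) x = v x * partial i \<psi> x + partial i v x * \<psi> x"
      using partial_eq[OF DE(1)] partial_eq[OF DE(2)] by simp
  qed
  have zero: "\<forall>x. x \<notin> K \<longrightarrow> v x * partial i \<psi> x = 0" "\<forall>x. x \<notin> K \<longrightarrow> partial i v x * \<psi> x = 0"
    using partial_eq_0[OF K] K(2) by auto
  have 1: "continuous_on UNIV (\<lambda>x. v x * partial i \<psi> x)" "continuous_on UNIV (\<lambda>x. partial i v x * \<psi> x)"
    by (rule continuous_on_mult[OF cv(1) \<psi>(2)]) (rule continuous_on_mult[OF v(2) cv(2)])
  note A = integrable_compact_support[OF 1(1) K(1) zero(1)]
    and B = integrable_compact_support[OF 1(2) K(1) zero(2)]
  have "(LINT x|lborel. partial i (\<lambda>x. v x * \<psi> x) x) = 0"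
  proof (rule integral_partial_eq_0[OF _ _ K(1)])
    show "\<forall>x. (\<lambda>x. v x * \<psi> x) differentiable at x" using v(1) \<psi>(1) by (blast intro: differentiable_mult)
    show "continuous_on UNIV (partial i (\<lambda>x. v x * \<psi> x))"
      unfolding prod using 1 by (rule continuous_on_add)
    show "\<forall>x. x \<notin> K \<longrightarrow> v x * \<psi> x = 0" using K(2) by simp
  qed
  then have "(LINT x|lborel. v x * partial i \<psi> x) + (LINT x|lborel. partial i v x * \<psi> x) = 0"
    unfolding prod Bochner_Integration.integral_add[OF A(1) B(1)] .
  then show ?thesis unfolding A(4) B(4) by linarith
qed

lemma C1_weak_partial:
  fixes v :: "real ^ 'n \<Rightarrow> real"
  assumes v: "\<forall>x. v differentiable (at x)" "continuous_on UNIV (partial i v)"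
  shows "has_weak_partial i v (partial i v)"
  unfolding has_weak_partial_def
proof (intro allI impI)
  fix \<psi> :: "real ^ 'n \<Rightarrow> real" assume \<psi>: "C1_compact_support \<psi>"
  have 0: "\<forall>x. x \<notin> closure {x. \<psi> x \<noteq> 0} \<longrightarrow> \<psi> x = 0" using closure_subset[of "{x. \<psi> x \<noteq> 0}"] by blast
  from \<psi> have 1: "\<forall>x. \<psi> differentiable (at x)" "continuous_on UNIV (partial i \<psi>)"
    "compact (closure {x. \<psi> x \<noteq> 0})"
    unfolding C1_compact_support_def by blast+
  show "(LINT x|lebesgue. v x * partial i \<psi> x) = - (LINT x|lebesgue. partial i v x * \<psi> x)"
    by (rule C1_integration_by_parts[OF v 1 0])
qed

text \<open>Being constant on [0, \<epsilon>] makes \<phi> (norm x) a C^1 function in spite of the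
  kink of the norm at the origin. The value at 0 stays free, which is what gives weak solutions
  their flux condition.\<close>

lemma C1_in_radial_test_functions:
  fixes \<phi> :: "real \<Rightarrow> real"
  assumes \<phi>: "\<And>r. (\<phi> has_real_derivative \<phi>' r) (at r)" "continuous_on UNIV \<phi>'"
    and \<epsilon>: "0 < \<epsilon>" "\<And>r. r \<le> \<epsilon> \<Longrightarrow> \<phi>' r = 0" and R: "\<And>r. R \<le> r \<Longrightarrow> \<phi> r = 0"
  shows "\<phi> \<in> radial_test_functions TYPE('n::finite)"
proof -
  define v where "v x = \<phi> (norm x)" for x :: "real ^ 'n"
  have c\<phi>: "continuous_on UNIV \<phi>" using \<phi>(1) by (auto simp: continuous_on_eq_continuous_at intro: DERIV_isCont)
  have const: "\<phi> r = \<phi> 0" if "r \<le> \<epsilon>" "0 \<le> r" for r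
  proof -
    have "norm (\<phi> r - \<phi> 0) \<le> 0 * norm (r - 0)"
    proof (rule field_differentiable_bound[of "{0..r}" \<phi> \<phi>'])
      show "(\<phi> has_real_derivative \<phi>' z) (at z within {0..r})" for z
        using \<phi>(1)[of z] by (rule has_field_derivative_at_within)
    qed (use \<epsilon> that in auto)
    then show ?thesis by simp
  qed
  have dv: "(v has_derivative (\<lambda>h. \<phi>' (norm x) * (h \<bullet> sgn x))) (at x)" for x
  proof (cases "norm x < \<epsilon>")
    case True
    have "(v has_derivative (\<lambda>_. 0)) (at x)"
    proof (rule has_derivative_transform_within_open[where f = "\<lambda>_. \<phi> 0" and s = "ball 0 \<epsilon>"])
      show "\<phi> 0 = v y" if "y \<in> ball 0 \<epsilon>" for y using const[of "norm y"] that by (simp add: v_def)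
    qed (use True in auto)
    then show ?thesis using \<epsilon>(2)[of "norm x"] True by simp
  next
    case False
    then have "x \<noteq> 0" using \<epsilon> by auto
    have "(\<phi> has_derivative (*) (\<phi>' (norm x))) (at (norm x))"
      using \<phi>(1) by (simp add: has_field_derivative_def)
    from has_derivative_compose[OF has_derivative_norm[OF \<open>x \<noteq> 0\<close>] this]
    show ?thesis unfolding v_def[abs_def] .
  qed
  have pv: "partial i v x = \<phi>' (norm x) * (sgn x $ i)" for i x
    using partial_eq[OF dv[of x], of i] by (simp add: inner_axis')
  have cp: "continuous_on UNIV (partial i v)" for i
    unfolding continuous_on_eq_continuous_at[OF open_UNIV]
  proof
    fix x
    show "isCont (partial i v) x"
    proof (cases "norm x < \<epsilon>")
      case True
      have "\<forall>\<^sub>F y in nhds x. y \<in> ball 0 \<epsilon>" by (rule eventually_nhds_in_open) (use True in auto)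
      then have "\<forall>\<^sub>F y in nhds x. 0 = partial i v y"
        by eventually_elim (use \<epsilon>(2) in \<open>auto simp: pv\<close>)
      then show ?thesis using isCont_cong[of "\<lambda>_. 0" "partial i v" x] by simp
    next
      case False
      then have "x \<noteq> 0" using \<epsilon> by auto
      have "isCont \<phi>' t" for t using \<phi>(2) by (simp add: continuous_on_eq_continuous_at)
      then have 1: "isCont (\<lambda>x. \<phi>' (norm x)) x"
        by (intro isCont_o2[where g = \<phi>' and f = norm] continuous_norm continuous_ident)
      have 2: "isCont (\<lambda>x. sgn x $ i) x"
        unfolding sgn_div_norm using \<open>x \<noteq> 0\<close> by (intro continuous_intros) auto
      have "partial i v = (\<lambda>x. \<phi>' (norm x) * (sgn x $ i))" using pv by blast
      then show ?thesis using continuous_mult[OF 1 2] by simp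
    qed
  qed
  have d: "\<forall>x. v differentiable (at x)" using dv by (auto simp: differentiable_def)
  have bounded: "essentially_bounded w" if w: "continuous_on UNIV w" "\<And>x. max R 0 < norm x \<Longrightarrow> w x = 0"
    for w :: "real ^ 'n \<Rightarrow> real"
  proof -
    have "bounded (w ` cball 0 (max R 0))"
      by (intro compact_imp_bounded compact_continuous_image continuous_on_subset[OF w(1)]) auto
    then obtain C where C: "C > 0" "\<And>x. x \<in> cball 0 (max R 0) \<Longrightarrow> \<bar>w x\<bar> \<le> C" unfolding bounded_pos by auto
    have "\<bar>w x\<bar> \<le> C" for x using C w(2)[of x] by (cases "max R 0 < norm x") auto
    then show ?thesis
      using borel_measurable_continuous_onI[OF w(1)] unfolding essentially_bounded_def
      by (auto intro: measurable_completion)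
  qed
  have \<phi>'0: "\<phi>' r = 0" if "R < r" for r
  proof -
    have "\<forall>\<^sub>F t in nhds r. t \<in> {R<..}" by (rule eventually_nhds_in_open) (use that in auto)
    then have "\<forall>\<^sub>F t in nhds r. \<phi> t = 0" by eventually_elim (use R in auto)
    then have "(\<phi> has_real_derivative 0) (at r)" using DERIV_cong_ev[of r r \<phi> "\<lambda>_. 0" 0 0] by simp
    then show ?thesis using DERIV_unique \<phi>(1) by blast
  qed
  have "v \<in> W1_infinity"
    unfolding W1_infinity_def
  proof (intro CollectI conjI allI exI)
    show "essentially_bounded v"
    proof (rule bounded)
      show "continuous_on UNIV v" unfolding v_def by (rule continuous_on_compose2[OF c\<phi>]) (auto intro!: continuous_intros)
    qed (use R in \<open>auto simp: v_def\<close>)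
    show "essentially_bounded (partial i v)" for i
      by (rule bounded[OF cp]) (use \<phi>'0 in \<open>auto simp: pv\<close>)
    show "has_weak_partial i v (partial i v)" for i by (rule C1_weak_partial[OF d cp])
  qed
  moreover have "compact (closure {x :: real ^ 'n. \<phi> (norm x) \<noteq> 0})"
  proof -
    have "{x :: real ^ 'n. \<phi> (norm x) \<noteq> 0} \<subseteq> cball 0 R" using R linear by (force simp: dist_norm)
    then have "bounded {x :: real ^ 'n. \<phi> (norm x) \<noteq> 0}" by (rule bounded_subset[OF bounded_cball])
    then show ?thesis by (simp add: compact_closure)
  qed
  ultimately show ?thesis
    using continuous_on_subset[OF c\<phi>] unfolding radial_test_functions_def v_def by auto
qed

section \<open>Lipschitz continuity of radial test functions\<close>

lemma DERIV_max_0_power2: "((\<lambda>y::real. (max 0 y)\<^sup>2) has_real_derivative 2 * max 0 y) (at y)"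
proof -
  consider "y > 0" | "y < 0" | "y = 0" by linarith
  then show ?thesis
  proof cases
    case 1
    have "((\<lambda>y::real. y\<^sup>2) has_real_derivative 2 * max 0 y) (at y)"
      using 1 by (auto intro!: derivative_eq_intros)
    then show ?thesis
      by (rule has_field_derivative_transform_within_open[where S = "{0<..}"]) (use 1 in auto)
  next
    case 2
    have "((\<lambda>y::real. 0) has_real_derivative 2 * max 0 y) (at y)" using 2 by simp
    then show ?thesis
      by (rule has_field_derivative_transform_within_open[where S = "{..<0}"]) (use 2 in auto)
  next
    case 3
    have "((\<lambda>h. ((max 0 (0 + h))\<^sup>2 - (max 0 0)\<^sup>2) / h) \<longlongrightarrow> 0) (at (0::real))"
      by (rule Lim_null_comparison[where g = "\<lambda>h. \<bar>h\<bar>"])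
         (auto simp: max_def power2_eq_square intro!: always_eventually tendsto_eq_intros)
    then show ?thesis using 3 by (simp add: DERIV_def)
  qed
qed

text \<open>A C^1 mollifier with a derivative in closed form. It is not normalised; its integral is
  positive and the same for all centres, which suffices.\<close>

definition bump :: "real \<Rightarrow> real ^ 'n \<Rightarrow> real ^ 'n \<Rightarrow> real" where
  "bump \<delta> c x = (max 0 (\<delta>\<^sup>2 - (x - c) \<bullet> (x - c)))\<^sup>2"

lemma bump:
  fixes c :: "real ^ 'n"
  assumes "0 < \<delta>"
  shows "\<forall>x. bump \<delta> c differentiable (at x)" "continuous_on UNIV (partial i (bump \<delta> c))"
    "\<forall>x. x \<notin> cball c \<delta> \<longrightarrow> bump \<delta> c x = 0" "C1_compact_support (bump \<delta> c)" "0 \<le> bump \<delta> c x"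
    "bump \<delta> c (x + y) = bump \<delta> (c - y) x"
proof -
  have D: "(bump \<delta> c has_derivative (\<lambda>h. 2 * max 0 (\<delta>\<^sup>2 - (x - c) \<bullet> (x - c)) * (- 2 * ((x - c) \<bullet> h)))) (at x)" for x
  proof -
    have "((\<lambda>x. \<delta>\<^sup>2 - (x - c) \<bullet> (x - c)) has_derivative (\<lambda>h. - 2 * ((x - c) \<bullet> h))) (at x)"
      by (auto intro!: derivative_eq_intros simp: inner_commute)
    moreover have "((\<lambda>y. (max 0 y)\<^sup>2) has_derivative (*) (2 * max 0 (\<delta>\<^sup>2 - (x - c) \<bullet> (x - c)))) (at (\<delta>\<^sup>2 - (x - c) \<bullet> (x - c)))"
      using DERIV_max_0_power2 unfolding has_field_derivative_def .
    ultimately show ?thesis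
      unfolding bump_def[abs_def] by (rule has_derivative_compose)
  qed
  show d: "\<forall>x. bump \<delta> c differentiable (at x)" using D by (auto simp: differentiable_def)
  have "partial i (bump \<delta> c) = (\<lambda>x. 2 * max 0 (\<delta>\<^sup>2 - (x - c) \<bullet> (x - c)) * (- 2 * ((x - c) \<bullet> axis i 1)))" for i
    using partial_eq[OF D] by blast
  then show c: "continuous_on UNIV (partial i (bump \<delta> c))" for i
    by (simp only:) (intro continuous_intros)
  show z: "\<forall>x. x \<notin> cball c \<delta> \<longrightarrow> bump \<delta> c x = 0"
  proof (intro allI impI)
    fix x assume "x \<notin> cball c \<delta>"
    then have "\<delta>\<^sup>2 \<le> (norm (x - c))\<^sup>2" using assms by (intro power_mono) (auto simp: dist_norm norm_minus_commute)
    then show "bump \<delta> c x = 0" by (simp add: bump_def power2_norm_eq_inner)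
  qed
  have "{x. bump \<delta> c x \<noteq> 0} \<subseteq> cball c \<delta>" using z by blast
  then have "compact (closure {x. bump \<delta> c x \<noteq> 0})" using bounded_subset[OF bounded_cball] by (metis compact_closure)
  then show "C1_compact_support (bump \<delta> c)" using d c unfolding C1_compact_support_def by blast
  show "0 \<le> bump \<delta> c x" by (simp add: bump_def)
  show "bump \<delta> c (x + y) = bump \<delta> (c - y) x" by (simp add: bump_def algebra_simps)
qed

lemma integral_bump:
  fixes c :: "real ^ 'n"
  assumes "0 < \<delta>"
  shows "integrable lborel (bump \<delta> c)" "(LINT x|lborel. bump \<delta> c x) = (LINT x|lborel. bump \<delta> (0 :: real ^ 'n) x)"
    "0 < (LINT x|lborel. bump \<delta> c x)"
proof -
  have cont: "continuous_on UNIV (bump \<delta> c)" for c :: "real ^ 'n"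
    using bump(1)[OF assms] by (rule continuous_on_differentiable)
  note i = integrable_compact_support[OF cont compact_cball bump(3)[OF assms]]
  show int: "integrable lborel (bump \<delta> c)" by (rule i(1))
  have "(\<lambda>x. bump \<delta> c (c + x)) = bump \<delta> 0"
    by (simp add: fun_eq_iff bump_def)
  then show "(LINT x|lborel. bump \<delta> c x) = (LINT x|lborel. bump \<delta> (0 :: real ^ 'n) x)"
    using lborel_integral_translate[OF i(2), of c c] by metis
  have fin: "emeasure lborel (ball c (\<delta> / 2)) < \<infinity>" by (intro emeasure_bounded_finite) auto
  have int': "integrable lborel (\<lambda>x. (3 / 4 * \<delta>\<^sup>2)\<^sup>2 * indicator (ball c (\<delta> / 2)) x)"
    by (intro integrable_mult_right integrable_real_indicator fin) auto
  \<comment> \<open>On the ball of half the radius the function is at least a positive constant;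
    this makes its integral positive.\<close>
  have le: "(3 / 4 * \<delta>\<^sup>2)\<^sup>2 * indicator (ball c (\<delta> / 2)) x \<le> bump \<delta> c x" for x
  proof (cases "x \<in> ball c (\<delta> / 2)")
    case True
    have "(norm (x - c))\<^sup>2 \<le> (\<delta> / 2)\<^sup>2" using True by (intro power_mono) (auto simp: dist_norm norm_minus_commute)
    then have "4 * ((x - c) \<bullet> (x - c)) \<le> \<delta>\<^sup>2" by (simp add: power2_norm_eq_inner power_divide)
    then have "3 / 4 * \<delta>\<^sup>2 \<le> max 0 (\<delta>\<^sup>2 - (x - c) \<bullet> (x - c))" by linarith
    then have "(3 / 4 * \<delta>\<^sup>2)\<^sup>2 \<le> (max 0 (\<delta>\<^sup>2 - (x - c) \<bullet> (x - c)))\<^sup>2" by (intro power_mono) auto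
    then show ?thesis using True by (simp add: bump_def)
  qed (simp add: bump_def)
  have "0 < measure lborel (ball c (\<delta> / 2))" using assms content_ball_pos[of "\<delta> / 2" c] by simp
  then have "0 < (3 / 4 * \<delta>\<^sup>2)\<^sup>2 * measure lborel (ball c (\<delta> / 2))" using assms by simp
  also have "\<dots> = (LINT x|lborel. (3 / 4 * \<delta>\<^sup>2)\<^sup>2 * indicator (ball c (\<delta> / 2)) x)" by simp
  also have "\<dots> \<le> (LINT x|lborel. bump \<delta> c x)" using int' int le by (intro integral_mono) auto
  finally show "0 < (LINT x|lborel. bump \<delta> c x)" .
qed

text \<open>Average v against \<open>bump\<close> centred at a moving point. The average is
  differentiable along the axis, and its derivative is the integral of g against the bump, at most C
  times the integral of the bump. For a small radius the average is close to v.\<close>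

lemma weak_partial_Lipschitz:
  fixes v g :: "real ^ 'n \<Rightarrow> real"
  assumes v: "continuous_on UNIV v" and weak: "has_weak_partial i v g"
    and g: "AE x in lebesgue. \<bar>g x\<bar> \<le> C" "0 \<le> C" and h: "0 \<le> h"
  shows "\<bar>v (c + h *\<^sub>R axis i 1) - v c\<bar> \<le> C * h"
proof (rule ccontr)
  let ?e = "axis i 1 :: real ^ 'n" and ?d = "c + h *\<^sub>R axis i 1"
  assume "\<not> \<bar>v ?d - v c\<bar> \<le> C * h"
  \<comment> \<open>A third of the excess: the approximation at the two ends costs 2 \<mu>, less
    than 3 \<mu>.\<close>
  define \<mu> where "\<mu> = (\<bar>v ?d - v c\<bar> - C * h) / 3"
  have \<mu>: "0 < \<mu>" using \<open>\<not> _\<close> by (simp add: \<mu>_def)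
  have "\<exists>\<delta>>0. \<forall>x. dist x b \<le> \<delta> \<longrightarrow> \<bar>v x - v b\<bar> \<le> \<mu>" for b
  proof -
    have "isCont v b" using v by (simp add: continuous_on_eq_continuous_at)
    then obtain \<delta> where \<delta>: "0 < \<delta>" "\<forall>x. dist x b < \<delta> \<longrightarrow> dist (v x) (v b) < \<mu>"
      using \<mu> unfolding continuous_at_eps_delta by blast
    then show ?thesis by (intro exI[of _ "\<delta> / 2"]) (force simp: dist_real_def intro: less_imp_le)
  qed
  then obtain \<delta>1 \<delta>2 where "\<delta>1 > 0" "\<delta>2 > 0" and
    \<delta>12: "\<forall>x. dist x c \<le> \<delta>1 \<longrightarrow> \<bar>v x - v c\<bar> \<le> \<mu>" "\<forall>x. dist x ?d \<le> \<delta>2 \<longrightarrow> \<bar>v x - v ?d\<bar> \<le> \<mu>" by metis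
  define \<delta> where "\<delta> = min \<delta>1 \<delta>2"
  have \<delta>: "0 < \<delta>" and near: "\<forall>x\<in>cball c \<delta>. \<bar>v x - v c\<bar> \<le> \<mu>" "\<forall>x\<in>cball ?d \<delta>. \<bar>v x - v ?d\<bar> \<le> \<mu>"
    using \<open>\<delta>1 > 0\<close> \<open>\<delta>2 > 0\<close> \<delta>12 by (auto simp: \<delta>_def dist_commute)
  define I where "I = (LINT x|lborel. bump \<delta> (0 :: real ^ 'n) x)"
  have I: "0 < I" "integrable lborel (bump \<delta> b)" "(LINT x|lborel. bump \<delta> b x) = I" for b :: "real ^ 'n"
    using integral_bump[OF \<delta>, of b] integral_bump(3)[OF \<delta>, of "0 :: real ^ 'n"] unfolding I_def by blast+
  define V where "V b = (LINT x|lborel. v x * bump \<delta> b x)" for b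
  have V: "integrable lborel (\<lambda>x. v x * bump \<delta> b x)" for b
    by (rule integrable_compact_support(1)[OF continuous_on_mult[OF v continuous_on_differentiable[OF bump(1)[OF \<delta>]]] compact_cball])
       (use bump(3)[OF \<delta>] in auto)
  have approx: "\<bar>V b - v b * I\<bar> \<le> \<mu> * I" if "\<forall>x\<in>cball b \<delta>. \<bar>v x - v b\<bar> \<le> \<mu>" for b
  proof -
    have "V b - v b * I = (LINT x|lborel. v x * bump \<delta> b x - v b * bump \<delta> b x)"
      unfolding V_def I(3)[of b, symmetric] using V[of b] I(2)[of b] by simp
    also have "\<bar>\<dots>\<bar> \<le> (LINT x|lborel. \<bar>v x * bump \<delta> b x - v b * bump \<delta> b x\<bar>)" by (rule integral_abs_bound)
    also have "\<dots> \<le> (LINT x|lborel. \<mu> * bump \<delta> b x)"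
    proof (rule integral_mono)
      fix x
      show "\<bar>v x * bump \<delta> b x - v b * bump \<delta> b x\<bar> \<le> \<mu> * bump \<delta> b x"
      proof (cases "x \<in> cball b \<delta>")
        case True
        have "\<bar>v x - v b\<bar> * bump \<delta> b x \<le> \<mu> * bump \<delta> b x"
          using that True bump(5)[OF \<delta>] by (intro mult_right_mono) auto
        then show ?thesis using bump(5)[OF \<delta>, of b x] by (simp add: left_diff_distrib[symmetric] abs_mult)
      next
        case False
        then have "bump \<delta> b x = 0" using bump(3)[OF \<delta>, of b] by blast
        then show ?thesis by simp
      qed
    qed (use V[of b] I(2)[of b] in auto)
    also have "\<dots> = \<mu> * I" using I(3)[of b] by simp
    finally show ?thesis .
  qed
  have W: "\<bar>LINT x|lborel. v x * partial i (bump \<delta> b) x\<bar> \<le> C * I" for b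
  proof -
    have c: "continuous_on UNIV (\<lambda>x. v x * partial i (bump \<delta> b) x)"
      by (rule continuous_on_mult[OF v bump(2)[OF \<delta>]])
    have z: "\<forall>x. x \<notin> cball b \<delta> \<longrightarrow> v x * partial i (bump \<delta> b) x = 0"
      using partial_eq_0[OF compact_cball bump(3)[OF \<delta>, of b]] by (blast intro: mult_zero_right[THEN trans[rotated]] mult_eq_0_iff[THEN iffD2])
    have cb: "continuous_on UNIV (bump \<delta> b)" using bump(1)[OF \<delta>] by (rule continuous_on_differentiable)
    note ib = integrable_compact_support[OF cb compact_cball bump(3)[OF \<delta>]]
    have "(LINT x|lborel. v x * partial i (bump \<delta> b) x) = - (LINT x|lebesgue. g x * bump \<delta> b x)"
      using weak bump(4)[OF \<delta>] integrable_compact_support(4)[OF c compact_cball z]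
      unfolding has_weak_partial_def by metis
    also have "\<bar>\<dots>\<bar> \<le> (LINT x|lebesgue. \<bar>g x * bump \<delta> b x\<bar>)" using integral_abs_bound by (simp only: abs_minus_cancel)
    also have "\<dots> \<le> (LINT x|lebesgue. C * bump \<delta> b x)"
    proof (rule integral_mono_AE')
      show "AE x in lebesgue. \<bar>g x * bump \<delta> b x\<bar> \<le> C * bump \<delta> b x"
        using g(1) by eventually_elim (auto simp: abs_mult bump(5)[OF \<delta>] intro!: mult_right_mono)
      show "AE x in lebesgue. 0 \<le> C * bump \<delta> b x" using g(2) bump(5)[OF \<delta>, of b] by (intro AE_I2 mult_nonneg_nonneg) auto
      show "integrable lebesgue (\<lambda>x. C * bump \<delta> b x)" using ib(3) by simp
    qed
    also have "(LINT x|lebesgue. C * bump \<delta> b x) = C * I" using ib(4) I(3)[of b] by simp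
    finally show ?thesis .
  qed
  \<comment> \<open>Moving the centre by \<tau> means moving the argument of the bump by - \<tau>,
    hence the minus sign.\<close>
  have "((\<lambda>t. V (c + t *\<^sub>R ?e)) has_real_derivative - (LINT x|lborel. v x * partial i (bump \<delta> (c + t *\<^sub>R ?e)) x)) (at t)" for t
  proof -
    have 1: "((\<lambda>\<tau>. LINT x|lborel. v x * bump \<delta> (c + t *\<^sub>R ?e) (x + \<tau> *\<^sub>R ?e)) has_real_derivative
        (LINT x|lborel. v x * partial i (bump \<delta> (c + t *\<^sub>R ?e)) x)) (at 0)"
      by (rule DERIV_integral_translate[OF v bump(1,2)[OF \<delta>] compact_cball bump(3)[OF \<delta>]])
    have 2: "(LINT x|lborel. v x * bump \<delta> (c + t *\<^sub>R ?e) (x + (t - \<tau>) *\<^sub>R ?e)) = V (c + \<tau> *\<^sub>R ?e)" for \<tau>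
      unfolding V_def bump(6)[OF \<delta>] by (simp add: algebra_simps)
    have "((\<lambda>\<tau>. LINT x|lborel. v x * bump \<delta> (c + t *\<^sub>R ?e) (x + (t - \<tau>) *\<^sub>R ?e)) has_real_derivative
        (LINT x|lborel. v x * partial i (bump \<delta> (c + t *\<^sub>R ?e)) x) * (0 - 1)) (at t)"
      by (rule DERIV_chain2[where f = "\<lambda>\<tau>. LINT x|lborel. v x * bump \<delta> (c + t *\<^sub>R ?e) (x + \<tau> *\<^sub>R ?e)" and g = "\<lambda>\<tau>. t - \<tau>"])
         (use 1 in \<open>auto intro!: derivative_eq_intros\<close>)
    then show ?thesis unfolding 2 by simp
  qed
  then have "norm (V (c + h *\<^sub>R ?e) - V (c + 0 *\<^sub>R ?e)) \<le> C * I * norm (h - 0)"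
    by (intro field_differentiable_bound[of UNIV "\<lambda>t. V (c + t *\<^sub>R ?e)" "\<lambda>t. - (LINT x|lborel. v x * partial i (bump \<delta> (c + t *\<^sub>R ?e)) x)"])
       (use W in auto)
  then have "\<bar>V ?d - V c\<bar> \<le> C * h * I" using h by (simp add: mult_ac)
  then have "\<bar>v ?d * I - v c * I\<bar> \<le> C * h * I + 2 * (\<mu> * I)" using approx[OF near(1)] approx[OF near(2)] by linarith
  then have "\<bar>v ?d - v c\<bar> * I \<le> (C * h + 2 * \<mu>) * I"
    using I(1) by (simp add: left_diff_distrib[symmetric] abs_mult distrib_right)
  then have "\<bar>v ?d - v c\<bar> \<le> C * h + 2 * \<mu>" using I(1) by simp
  then show False using \<mu> by (simp add: \<mu>_def field_simps)
qed

text \<open>\<phi> is the restriction of \<phi> (norm x) to a half-line along one axis, so one weak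
  partial derivative gives the Lipschitz bound.\<close>

lemma radial_test_function_Lipschitz:
  assumes "\<phi> \<in> radial_test_functions TYPE('n::finite)"
  shows "\<exists>C R. (\<forall>x\<ge>0. \<forall>y\<ge>0. \<bar>\<phi> x - \<phi> y\<bar> \<le> C * \<bar>x - y\<bar>) \<and> (\<forall>r>R. \<phi> r = 0)"
proof -
  define v where "v x = \<phi> (norm x)" for x :: "real ^ 'n"
  obtain i :: 'n where True by blast
  have \<phi>: "continuous_on {0..} \<phi>" "v \<in> W1_infinity" "compact (closure {x. v x \<noteq> 0})"
    using assms unfolding radial_test_functions_def v_def by auto
  then obtain g C' where g': "AE x in lebesgue. \<bar>g x\<bar> \<le> C'" "has_weak_partial i v g"
    unfolding W1_infinity_def essentially_bounded_def by blast
  define C where "C = max C' 0"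
  have g: "AE x in lebesgue. \<bar>g x\<bar> \<le> C" "0 \<le> C"
    using g'(1) by (auto simp: C_def le_max_iff_disj elim: eventually_mono)
  have v: "continuous_on UNIV v"
    unfolding v_def by (rule continuous_on_compose2[OF \<phi>(1)]) (auto intro!: continuous_intros)
  have ve: "v (r *\<^sub>R axis i 1) = \<phi> r" if "0 \<le> r" for r using that by (simp add: v_def norm_axis_1)
  have le: "\<bar>\<phi> (r + h) - \<phi> r\<bar> \<le> C * h" if "0 \<le> r" "0 \<le> h" for r h
    using weak_partial_Lipschitz[OF v g'(2) g that(2), of "r *\<^sub>R axis i 1"] ve[of r] ve[of "r + h"] that
    by (simp add: scaleR_add_left)
  have lip: "\<bar>\<phi> x - \<phi> y\<bar> \<le> C * \<bar>x - y\<bar>" if "0 \<le> x" "0 \<le> y" for x y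
  proof (cases "x \<le> y")
    case True
    then show ?thesis using le[of x "y - x"] that by (simp add: abs_minus_commute)
  next
    case False
    then show ?thesis using le[of y "x - y"] that by simp
  qed
  have "bounded {x. v x \<noteq> 0}"
    using bounded_subset[OF compact_imp_bounded[OF \<phi>(3)] closure_subset] .
  then obtain R where R: "0 < R" "\<And>x. v x \<noteq> 0 \<Longrightarrow> norm x \<le> R" unfolding bounded_pos by blast
  have "\<phi> r = 0" if "r > R" for r
    using R(2)[of "r *\<^sub>R axis i 1"] ve[of r] that R(1) by (auto simp: norm_axis_1)
  then show ?thesis using lip by blast
qed

section \<open>Weak solutions\<close>

lemma weight_cong:
  assumes "\<And>r. 0 < r \<Longrightarrow> c r = d r" "0 < r"
  shows "weight c r = weight d r"
proof -
  have "(LINT \<tau>:einterval (ereal a) (ereal b)|lebesgue. c \<tau> / \<tau>) = (LINT \<tau>:einterval (ereal a) (ereal b)|lebesgue. d \<tau> / \<tau>)"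
    if "0 < a" for a b
    by (rule set_lebesgue_integral_cong) (use assms(1) that in \<open>auto simp: einterval_def\<close>)
  then show ?thesis using assms(2) by (simp add: weight_def interval_lebesgue_integral_def)
qed

lemma weight_uminus: "weight (\<lambda>r. - c r) r = 1 / weight c r"
  unfolding weight_def by (simp add: interval_lebesgue_integral_uminus exp_minus inverse_eq_divide)

lemma coefficient_uminus: "coefficient c k l \<Longrightarrow> coefficient (\<lambda>r. - c r) (- l) (- k)"
  by (auto simp: coefficient_def set_borel_measurable_def)

lemma ac_primitive_cong:
  assumes "\<And>x. x \<in> {a..b} \<Longrightarrow> F x = G x" "\<And>x. x \<in> {a..b} \<Longrightarrow> f x = g x"
  shows "ac_primitive F f a b \<longleftrightarrow> ac_primitive G g a b"
proof -
  have "f absolutely_integrable_on {a..b} \<longleftrightarrow> g absolutely_integrable_on {a..b}"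
    by (rule set_integrable_cong) (use assms in auto)
  moreover have "integral {a..x} f = integral {a..x} g" if "x \<in> {a..b}" for x
    by (rule integral_cong) (use assms(2) that in auto)
  ultimately show ?thesis using assms(1) by (auto simp: ac_primitive_def)
qed

lemma lipschitz_absolutely_continuous:
  fixes \<phi> :: "real \<Rightarrow> real"
  assumes "\<And>x y. a \<le> x \<Longrightarrow> x \<le> y \<Longrightarrow> y \<le> b \<Longrightarrow> \<bar>\<phi> y - \<phi> x\<bar> \<le> C * (y - x)" and ab: "a \<le> b"
  shows "absolutely_continuous_on_Icc \<phi> a b"
proof -
  have id: "absolutely_continuous_on_Icc (\<lambda>x. x) a b"
    by (rule ac_primitive_absolutely_continuous, rule ac_primitive_C1[where f = "\<lambda>_. 1"])
       (use ab in \<open>auto intro!: derivative_eq_intros\<close>)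
  show ?thesis
  proof (rule absolutely_continuous_lipschitz_combination[OF id id, of "max C 0"])
    fix x y assume xy: "a \<le> x" "x \<le> y" "y \<le> b"
    have "C * (y - x) \<le> max C 0 * (\<bar>y - x\<bar> + \<bar>y - x\<bar>)" using xy by (intro mult_mono) auto
    then show "\<bar>\<phi> y - \<phi> x\<bar> \<le> max C 0 * (\<bar>y - x\<bar> + \<bar>y - x\<bar>)" using assms(1)[OF xy] by linarith
  qed simp
qed

lemma ac_primitive_from_0:
  assumes h: "h absolutely_integrable_on {0..R}" and W: "\<And>x. 0 < x \<Longrightarrow> x \<le> R \<Longrightarrow> ac_primitive W h x R"
    and lim: "(W \<longlongrightarrow> W 0) (at_right 0)"
  shows "ac_primitive W h 0 R"
proof (rule ac_primitiveI[OF h])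
  fix x assume x: "0 \<le> x" "x \<le> R"
  show "W x - W 0 = integral {0..x} h"
  proof (cases "x = 0")
    case False
    then have x0: "0 < x" using x by simp
    have hi: "h integrable_on {0..x}" by (rule absolutely_integrable_subinterval(2)[OF h]) (use x in auto)
    have "continuous_on {0..x} (\<lambda>y. integral {0..y} h)" by (rule indefinite_integral_continuous_1[OF hi])
    then have "((\<lambda>y. integral {0..y} h) \<longlongrightarrow> integral {0..0} h) (at 0 within {0..x})"
      unfolding continuous_on_def using x0 by (meson atLeastAtMost_iff less_imp_le order_refl)
    then have "((\<lambda>y. integral {0..x} h - integral {0..y} h) \<longlongrightarrow> integral {0..x} h - 0) (at_right 0)"
      using x0 by (intro tendsto_intros) (simp add: at_within_Icc_at_right)
    moreover have "\<forall>\<^sub>F y in at_right 0. integral {0..x} h - integral {0..y} h = W x - W y"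
      unfolding eventually_at_right_field
    proof (intro exI[of _ x] conjI allI impI)
      fix y :: real assume y: "0 < y" "y < x"
      have "integral {0..y} h + integral {y..x} h = integral {0..x} h"
        using y hi by (intro Henstock_Kurzweil_Integration.integral_combine) auto
      then show "integral {0..x} h - integral {0..y} h = W x - W y"
        using ac_primitiveD(2)[OF W, of y y x] x y by simp
    qed (rule x0)
    ultimately have "((\<lambda>y. W x - W y) \<longlongrightarrow> integral {0..x} h - 0) (at_right 0)" by (rule Lim_transform_eventually)
    moreover have "((\<lambda>y. W x - W y) \<longlongrightarrow> W x - W 0) (at_right 0)" by (intro tendsto_intros lim)
    ultimately show ?thesis using tendsto_unique[OF trivial_limit_at_right_real] by fastforce
  qed simp
qed

lemma set_lebesgue_integral_positive:
  fixes h :: "real \<Rightarrow> real"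
  assumes h: "h absolutely_integrable_on {0..R}" and z: "\<And>r. R < r \<Longrightarrow> h r = 0"
  shows "set_integrable lebesgue {0<..} h" "(LINT r:{0<..}|lebesgue. h r) = integral {0..R} h"
proof -
  have eq: "indicator {0<..} r *\<^sub>R h r = indicator {0<..R} r *\<^sub>R h r" for r
    using z[of r] by (auto simp: indicator_def)
  have i: "h absolutely_integrable_on {0<..R}" by (rule absolutely_integrable_subset[OF h]) auto
  then show "set_integrable lebesgue {0<..} h" unfolding set_integrable_def eq .
  have "(LINT r:{0<..}|lebesgue. h r) = (LINT r:{0<..R}|lebesgue. h r)"
    unfolding set_lebesgue_integral_def eq ..
  also have "\<dots> = integral {0<..R} h" using i by (rule set_lebesgue_integral_eq_integral(2))
  also have "\<dots> = integral {0..R} h"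
    by (rule integral_spike_set; rule negligible_subset[of "{0}"]) auto
  finally show "(LINT r:{0<..}|lebesgue. h r) = integral {0..R} h" .
qed

context pucci
begin

section \<open>Equivalence of weak and global solutions\<close>

lemma Theta_eq: "Theta n lam Lam s f u r = \<theta> (driving (spower s) f u (deriv u) r)"
  unfolding Theta_def driving_def spower_def drift_def
  by (rule arg_cong[where f = \<theta>]) (simp add: mult.assoc)

lemma rho_eq: "rho n lam Lam s f u = \<rho> f u (deriv u)"
  by (simp add: fun_eq_iff rho_def dim_fun_def Theta_eq weight_def damping_def)

lemma rho_tilde_eq: "rho_tilde n lam Lam s f u r = \<rho> f u (deriv u) r * ellip f u (deriv u) r"
  by (simp add: rho_tilde_def rho_eq Theta_eq)

text \<open>\<open>deriv u\<close> agrees with p on (0, \<infinity>), and both the equation and the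
  weight at positive radii depend on the values there only.\<close>

lemma global_solution_deriv:
  assumes G: "global_solution f u p" and f: "admissible f"
  shows "global_solution f u (deriv u)"
proof -
  have p: "deriv u r = p r" if "0 < r" for r
    using global_facts(4)[OF G f that] by (rule DERIV_imp_deriv)
  have d: "driving (spower s) f u (deriv u) r = driving (spower s) f u p r" if "0 < r" for r
    using p[OF that] by (simp add: driving_def)
  have w: "\<rho> f u (deriv u) r = \<rho> f u p r" if "0 < r" for r
    by (rule weight_cong[OF _ that]) (simp add: damping_def p d)
  have "solves (spower s) f u (deriv u) a b" if ab: "0 < a" "a \<le> b" for a b
  proof -
    note S = solvesD[OF global_solves[OF G f ab]]
    have "ac_primitive (deriv u) (\<lambda>r. \<Gamma> (driving (spower s) f u (deriv u) r)) a b
       \<longleftrightarrow> ac_primitive p (\<lambda>r. \<Gamma> (driving (spower s) f u p r)) a b"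
      by (rule ac_primitive_cong) (use ab p d in auto)
    then show ?thesis
      unfolding solves_def using S(1,2,3,4,5) p by auto
  qed
  moreover have "((\<lambda>r. \<rho> f u (deriv u) r * deriv u r) \<longlongrightarrow> 0) (at_right 0)"
  proof (rule Lim_transform_eventually)
    show "((\<lambda>r. \<rho> f u p r * p r) \<longlongrightarrow> 0) (at_right 0)" using G by (simp add: global_solution_def)
    show "\<forall>\<^sub>F r in at_right 0. \<rho> f u p r * p r = \<rho> f u (deriv u) r * deriv u r"
      using eventually_at_right_less by eventually_elim (simp add: p w)
  qed
  ultimately show ?thesis by (auto simp: global_solution_def)
qed

text \<open>The set H is a parameter: from global to weak solutions its members must be Lipschitz
  with bounded support, and for the converse H must contain the C^1 functions that are constant near
  0 and vanish for large r.\<close>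

definition weak_solution :: "(real \<Rightarrow> real) set \<Rightarrow> (real \<Rightarrow> real) \<Rightarrow> (real \<Rightarrow> real) \<Rightarrow> bool" where
  "weak_solution H f u \<longleftrightarrow>
     (\<forall>a b. 0 < a \<and> a \<le> b \<longrightarrow> absolutely_continuous_on_Icc u a b) \<and>
     (\<forall>R>0. set_integrable lebesgue {0<..<R} (\<lambda>r. \<rho> f u (deriv u) r * \<bar>u r\<bar> powr s) \<and>
            set_integrable lebesgue {0<..<R} (\<lambda>r. \<rho> f u (deriv u) r * \<bar>deriv u r\<bar>)) \<and>
     (\<forall>\<phi>\<in>H. (LINT r:{0<..}|lebesgue. \<rho> f u (deriv u) r * deriv u r * deriv \<phi> r
                + \<rho> f u (deriv u) r * ellip f u (deriv u) r * spower s (u r) * \<phi> r) =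
             (LINT r:{0<..}|lebesgue. \<rho> f u (deriv u) r * ellip f u (deriv u) r * f r * \<phi> r))"

text \<open>With the value 0 at the origin the flux W is absolutely continuous on [0, R], since 0 is
  its limit there. Then W \<phi> is zero at both ends, even if \<phi> is not zero at 0, and the
  product rule is the weak formulation.\<close>

theorem global_solution_weak_solution:
  assumes G: "global_solution f u (deriv u)" and f: "admissible f"
    and H: "\<And>\<phi>. \<phi> \<in> H \<Longrightarrow> \<exists>C R. (\<forall>x\<ge>0. \<forall>y\<ge>0. \<bar>\<phi> x - \<phi> y\<bar> \<le> C * \<bar>x - y\<bar>) \<and> (\<forall>r>R. \<phi> r = 0)"
  shows "weak_solution H f u"
proof -
  let ?\<rho> = "\<rho> f u (deriv u)" and ?\<alpha> = "ellip f u (deriv u)"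
  have good: "\<forall>a b. 0 < a \<longrightarrow> a \<le> b \<longrightarrow> good f u (deriv u) a b" by (rule global_solution_good[OF G f])
  note facts = global_facts[OF G f]
  define W where "W r = (if r \<le> 0 then 0 else ?\<rho> r * deriv u r)" for r
  define h where "h r = ?\<rho> r * (?\<alpha> r * (spower s (u r) - f r))" for r
  have su: "(\<lambda>r. ?\<rho> r * (?\<alpha> r * spower s (u r))) absolutely_integrable_on {0..R}" for R
  proof (rule absolutely_integrable_from_0[OF rho_terms_integrable(2)[OF f good]])
    show "(\<lambda>r. ?\<rho> r * (?\<alpha> r * spower s (u r))) absolutely_integrable_on {1..x}" for x
      by (intro weight_coefficient_integrable[OF facts(2,1)] spower_u_integrable[OF f good]) simp_all
  qed
  have fi: "(\<lambda>r. ?\<rho> r * (?\<alpha> r * f r)) absolutely_integrable_on {0..R}" for R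
    by (rule weighted_admissible_integrable[OF facts(2,1) f])
  have h_eq: "h = (\<lambda>r. ?\<rho> r * (?\<alpha> r * spower s (u r)) - ?\<rho> r * (?\<alpha> r * f r))"
    by (simp add: h_def fun_eq_iff right_diff_distrib diff_divide_distrib)
  have W: "ac_primitive W h 0 R" for R
  proof (rule ac_primitive_from_0)
    show "h absolutely_integrable_on {0..R}" unfolding h_eq by (rule set_integral_diff(1)[OF su fi])
    show "ac_primitive W h x R" if "0 < x" "x \<le> R" for x
    proof -
      have "ac_primitive (\<lambda>r. ?\<rho> r * deriv u r) h x R"
        unfolding h_def by (rule linear_form_flux[OF facts(2) facts(3)[OF that]])
      moreover have "ac_primitive W h x R \<longleftrightarrow> ac_primitive (\<lambda>r. ?\<rho> r * deriv u r) h x R"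
        by (rule ac_primitive_cong) (use that in \<open>auto simp: W_def\<close>)
      ultimately show ?thesis by blast
    qed
    have "((\<lambda>r. ?\<rho> r * deriv u r) \<longlongrightarrow> 0) (at_right 0)" using G by (simp add: global_solution_def)
    moreover have "\<forall>\<^sub>F r in at_right 0. ?\<rho> r * deriv u r = W r"
      using eventually_at_right_less[of "0::real"] by eventually_elim (simp add: W_def)
    ultimately have "(W \<longlongrightarrow> 0) (at_right 0)" by (rule Lim_transform_eventually)
    then show "(W \<longlongrightarrow> W 0) (at_right 0)" by (simp add: W_def)
  qed
  show ?thesis
    unfolding weak_solution_def
  proof (intro conjI allI impI ballI)
    fix a b :: real assume ab: "0 < a \<and> a \<le> b"
    then have S: "solves (spower s) f u (deriv u) a b" using global_solves[OF G f] by blast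
    show "absolutely_continuous_on_Icc u a b"
      by (rule ac_primitive_absolutely_continuous, rule ac_primitive_C1[where f = "deriv u"])
         (use ab solvesD[OF S] in auto)
  next
    fix R :: real assume R: "0 < R"
    have sub: "{0<..<R} \<subseteq> {0..R}" by auto
    \<comment> \<open>Integrability is known with the second weight; multiplying by \<theta>, which
      is bounded by Lam, turns it back into \<rho>.\<close>
    have "set_integrable lebesgue {0<..<R} (\<lambda>r. \<theta> (driving (spower s) f u (deriv u) r) * \<bar>?\<rho> r * (?\<alpha> r * spower s (u r))\<bar>)"
    proof (rule absolutely_integrable_bounded_mult)
      have "(\<lambda>r. 1 / ?\<alpha> r) \<in> borel_measurable (lebesgue_on {0<..<R})"
        by (intro borel_measurable_divide borel_measurable_const coefficient_measurable[OF facts(1)]) auto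
      then show "(\<lambda>r. \<theta> (driving (spower s) f u (deriv u) r)) \<in> borel_measurable (lebesgue_on {0<..<R})" by simp
      show "\<bar>\<theta> (driving (spower s) f u (deriv u) r)\<bar> \<le> Lam" for r
        using theta_bounds[of "driving (spower s) f u (deriv u) r"] by simp
      show "(\<lambda>r. \<bar>?\<rho> r * (?\<alpha> r * spower s (u r))\<bar>) absolutely_integrable_on {0<..<R}"
        by (intro set_integrable_abs absolutely_integrable_subset[OF su sub]) auto
    qed auto
    moreover have "\<theta> (driving (spower s) f u (deriv u) r) * \<bar>?\<rho> r * (?\<alpha> r * spower s (u r))\<bar> = ?\<rho> r * \<bar>u r\<bar> powr s" for r
      using theta_bounds(3)[of "driving (spower s) f u (deriv u) r"] by (simp add: abs_mult abs_spower)
    ultimately show "set_integrable lebesgue {0<..<R} (\<lambda>r. ?\<rho> r * \<bar>u r\<bar> powr s)" by simp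
    have "(\<lambda>r. \<bar>W r\<bar>) absolutely_integrable_on {0..R}"
      by (intro absolutely_integrable_continuous_real continuous_on_rabs ac_primitive_continuous[OF W])
    then have "(\<lambda>r. \<bar>W r\<bar>) absolutely_integrable_on {0<..<R}" by (rule absolutely_integrable_subset[OF _ sub]) auto
    then show "set_integrable lebesgue {0<..<R} (\<lambda>r. ?\<rho> r * \<bar>deriv u r\<bar>)"
      by (rule iffD1[OF set_integrable_cong, rotated -1]) (auto simp: W_def abs_mult)
  next
    fix \<phi> assume "\<phi> \<in> H"
    then obtain C R0 where \<phi>: "\<forall>x\<ge>0. \<forall>y\<ge>0. \<bar>\<phi> x - \<phi> y\<bar> \<le> C * \<bar>x - y\<bar>" "\<forall>r>R0. \<phi> r = 0" using H by blast
    define R where "R = max R0 0 + 1"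
    have R: "0 < R" "R0 < R" by (auto simp: R_def)
    have P: "ac_primitive \<phi> (deriv \<phi>) 0 R"
    proof (intro ac_primitive_deriv lipschitz_absolutely_continuous[of _ _ _ C])
      show "\<bar>\<phi> y - \<phi> x\<bar> \<le> C * (y - x)" if "0 \<le> x" "x \<le> y" for x y
        using \<phi>(1)[THEN spec, of y] that by (auto dest!: spec[of _ x])
    qed (use R in auto)
    have z: "\<phi> r = 0" "deriv \<phi> r = 0" if "R \<le> r" for r
    proof -
      show "\<phi> r = 0" using \<phi>(2) that R by simp
      have "\<forall>\<^sub>F t in nhds r. t \<in> {R0<..}" by (rule eventually_nhds_in_open) (use that R in auto)
      then have "\<forall>\<^sub>F t in nhds r. \<phi> t = 0" by eventually_elim (use \<phi>(2) in auto)
      then have "(\<phi> has_real_derivative 0) (at r)" using DERIV_cong_ev[of r r \<phi> "\<lambda>_. 0" 0 0] by simp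
      then show "deriv \<phi> r = 0" by (rule DERIV_imp_deriv)
    qed
    have c\<phi>: "continuous_on {0..R} \<phi>" by (rule ac_primitive_continuous[OF P])
    have A: "(\<lambda>r. W r * deriv \<phi> r) absolutely_integrable_on {0..R}"
      by (rule continuous_mult_integrable[OF ac_primitive_continuous[OF W] ac_primitiveD(1)[OF P]])
    have B: "(\<lambda>r. \<phi> r * (?\<rho> r * (?\<alpha> r * spower s (u r)))) absolutely_integrable_on {0..R}"
      by (rule continuous_mult_integrable[OF c\<phi> su])
    have C: "(\<lambda>r. \<phi> r * (?\<rho> r * (?\<alpha> r * f r))) absolutely_integrable_on {0..R}"
      by (rule continuous_mult_integrable[OF c\<phi> fi])
    let ?l = "\<lambda>r. W r * deriv \<phi> r + \<phi> r * (?\<rho> r * (?\<alpha> r * spower s (u r)))"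
    let ?r = "\<lambda>r. \<phi> r * (?\<rho> r * (?\<alpha> r * f r))"
    have AB: "?l absolutely_integrable_on {0..R}" by (rule set_integral_add(1)[OF A B])
    have "ac_primitive (\<lambda>r. W r * \<phi> r) (\<lambda>r. W r * deriv \<phi> r + h r * \<phi> r) 0 R"
      by (rule ac_primitive_mult[OF W P]) (use R in simp)
    from ac_primitiveD(2)[OF this, of 0 R] have "integral {0..R} (\<lambda>r. W r * deriv \<phi> r + h r * \<phi> r) = 0"
      using R z(1)[of R] by (simp add: W_def)
    moreover have "(\<lambda>r. W r * deriv \<phi> r + h r * \<phi> r) = (\<lambda>r. ?l r - ?r r)"
      unfolding h_eq by (simp add: fun_eq_iff left_diff_distrib mult.commute[of _ "\<phi> _"] right_diff_distrib[of "\<phi> _"])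
    moreover have "integral {0..R} (\<lambda>r. ?l r - ?r r) = integral {0..R} ?l - integral {0..R} ?r"
      by (intro Henstock_Kurzweil_Integration.integral_diff set_lebesgue_integral_eq_integral(1) AB C)
    ultimately have eq: "integral {0..R} ?l = integral {0..R} ?r" by simp
    have "(LINT r:{0<..}|lebesgue. ?\<rho> r * deriv u r * deriv \<phi> r + ?\<rho> r * ?\<alpha> r * spower s (u r) * \<phi> r) = (LINT r:{0<..}|lebesgue. ?l r)"
      by (rule set_lebesgue_integral_cong) (auto simp: W_def mult_ac)
    also have "\<dots> = integral {0..R} ?l" by (rule set_lebesgue_integral_positive[OF AB]) (simp add: z)
    also have "\<dots> = integral {0..R} ?r" by (rule eq)
    also have "\<dots> = (LINT r:{0<..}|lebesgue. ?r r)" by (rule set_lebesgue_integral_positive(2)[OF C, symmetric]) (simp add: z)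
    also have "\<dots> = (LINT r:{0<..}|lebesgue. ?\<rho> r * ?\<alpha> r * f r * \<phi> r)"
      by (rule set_lebesgue_integral_cong) (auto simp: mult_ac)
    finally show "(LINT r:{0<..}|lebesgue. ?\<rho> r * deriv u r * deriv \<phi> r + ?\<rho> r * ?\<alpha> r * spower s (u r) * \<phi> r) =
      (LINT r:{0<..}|lebesgue. ?\<rho> r * ?\<alpha> r * f r * \<phi> r)" .
  qed
qed

text \<open>Du Bois-Reymond: with W the integral of h from 0, testing with an antiderivative of
  \<psi> shows that \<rho> v' - W is orthogonal to every continuous \<psi> supported in [a, b]. No
  constant of integration remains, since the antiderivative vanishes at b but is free at 0; so
  \<rho> v' = W, which tends to 0.\<close>

theorem weak_solution_global_solution:
  assumes v: "weak_solution H f v" and f: "admissible f"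
    and H: "\<And>\<phi> \<phi>' \<epsilon> R. (\<And>r. (\<phi> has_real_derivative \<phi>' r) (at r)) \<Longrightarrow> continuous_on UNIV \<phi>' \<Longrightarrow> 0 < \<epsilon> \<Longrightarrow>
      (\<And>r. r \<le> \<epsilon> \<Longrightarrow> \<phi>' r = 0) \<Longrightarrow> (\<And>r. R \<le> r \<Longrightarrow> \<phi> r = 0) \<Longrightarrow> \<phi> \<in> H"
  shows "global_solution f v (deriv v)"
proof -
  let ?\<rho> = "\<rho> f v (deriv v)" and ?\<alpha> = "ellip f v (deriv v)" and ?c = "damping f v (deriv v)"
  have P: "ac_primitive v (deriv v) a b" if "0 < a" "a \<le> b" for a b
    using v that by (intro ac_primitive_deriv) (auto simp: weak_solution_def)
  have cv: "continuous_on {a..b} v" if "0 < a" for a b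
    using ac_primitive_continuous[OF P[OF that]] by (cases "a \<le> b") auto
  have meas: "g \<in> borel_measurable (lebesgue_on {0<..})"
    if g: "\<And>a b. 0 < a \<Longrightarrow> g \<in> borel_measurable (lebesgue_on {a..b})" for g :: "real \<Rightarrow> real"
  proof -
    have "(\<lambda>r. indicator {0<..} r *\<^sub>R g r) \<in> borel_measurable lebesgue"
    proof (rule borel_measurable_LIMSEQ_real)
      fix r :: real
      let ?S = "\<lambda>k. {1 / (real k + 1)..real k + 1}"
      show "(\<lambda>k. indicator (?S k) r *\<^sub>R g r) \<longlonglongrightarrow> indicator {0<..} r *\<^sub>R g r"
      proof (cases "0 < r")
        case True
        obtain k0 :: nat where k0: "max r (1 / r) < real k0" using reals_Archimedean2 by blast
        have "r \<in> ?S k" if "k0 \<le> k" for k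
        proof -
          have "1 / r < real k + 1" "r < real k + 1" using k0 that by simp_all
          then show ?thesis using True by (auto simp: field_simps)
        qed
        then have "\<forall>\<^sub>F k in sequentially. indicator {0<..} r *\<^sub>R g r = indicator (?S k) r *\<^sub>R g r"
          unfolding eventually_sequentially using True by (intro exI[of _ k0]) auto
        then show ?thesis by (rule Lim_transform_eventually[OF tendsto_const])
      next
        case False
        have "r \<notin> ?S k" for k
        proof -
          have "0 < 1 / (real k + 1)" by simp
          then show ?thesis using False unfolding atLeastAtMost_iff by linarith
        qed
        then show ?thesis using False by simp
      qed
      show "(\<lambda>r. indicator (?S k) r *\<^sub>R g r) \<in> borel_measurable lebesgue" for k
      proof -
        have "g \<in> borel_measurable (lebesgue_on (?S k))" by (rule g) simp
        then show ?thesis by (subst (asm) borel_measurable_restrict_space_iff) auto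
      qed
    qed
    then show ?thesis by (subst borel_measurable_restrict_space_iff) auto
  qed
  have mv: "v \<in> borel_measurable (lebesgue_on {0<..})" "deriv v \<in> borel_measurable (lebesgue_on {0<..})"
  proof -
    show "v \<in> borel_measurable (lebesgue_on {0<..})"
      by (rule meas, rule continuous_imp_measurable_on_sets_lebesgue[OF cv]) auto
    have "deriv v \<in> borel_measurable (lebesgue_on {a..b})" if "0 < a" for a b
    proof (cases "a \<le> b")
      case True
      show ?thesis by (rule absolutely_integrable_imp_borel_measurable[OF ac_primitiveD(1)[OF P[OF that True]]]) simp
    qed (simp add: measurable_def space_restrict_space)
    then show "deriv v \<in> borel_measurable (lebesgue_on {0<..})" by (rule meas)
  qed
  have mf: "f \<in> borel_measurable (lebesgue_on {0<..})"
    using f by (simp add: admissible_def set_borel_measurable_lebesgue_iff[symmetric])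
  have mr: "(\<lambda>r::real. r) \<in> borel_measurable (lebesgue_on {0<..})"
    by (rule continuous_imp_measurable_on_sets_lebesgue) auto
  have msp: "spower s \<in> borel_measurable borel" by (rule borel_measurable_continuous_onI[OF spower_continuous])
  have mE: "driving (spower s) f v (deriv v) \<in> borel_measurable (lebesgue_on {0<..})"
    unfolding driving_def[abs_def]
    by (intro borel_measurable_diff borel_measurable_divide mf mr measurable_compose[OF mv(1) msp]
        measurable_compose[OF mv(2) borel_drift])
  have \<alpha>: "coefficient ?\<alpha> (1 / Lam) (1 / lam)"
    unfolding coefficient_def
    using inverse_theta_bounds measurable_compose[OF mE borel_theta]
    by (subst set_borel_measurable_lebesgue_iff) auto
  have c: "coefficient ?c \<kappa> \<kappa>'"
    unfolding coefficient_def damping_def[abs_def]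
    using theta_ratio_bounds measurable_compose[OF mE borel_theta] measurable_compose[OF mv(2) borel_theta]
    by (subst set_borel_measurable_lebesgue_iff) auto
  have c\<rho>: "continuous_on {a..b} ?\<rho>" if "0 < a" for a b by (rule continuous_on_weight[OF c that])
  define h where "h r = ?\<rho> r * (?\<alpha> r * (spower s (v r) - f r))" for r
  have fi: "(\<lambda>r. ?\<rho> r * (?\<alpha> r * f r)) absolutely_integrable_on {0..R}" for R
    by (rule weighted_admissible_integrable[OF c \<alpha> f])
  \<comment> \<open>The definition gives integrability of \<rho> \<bar>v\<bar>^s; the bounded
    measurable factor sgn v / \<theta> turns it into the term with the second weight.\<close>
  have su: "(\<lambda>r. ?\<rho> r * (?\<alpha> r * spower s (v r))) absolutely_integrable_on {0..R}" for R
  proof -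
    define S where "S = max R 1"
    have S: "0 < S" "R \<le> S" by (auto simp: S_def)
    have "(\<lambda>r. (?\<alpha> r * sgn (v r)) * (?\<rho> r * \<bar>v r\<bar> powr s)) absolutely_integrable_on {0<..<S}"
    proof (rule absolutely_integrable_bounded_mult)
      have "sgn \<in> borel_measurable (borel :: real measure)" unfolding sgn_if[abs_def] by measurable
      from measurable_compose[OF mv(1) this] have m: "(\<lambda>r. ?\<alpha> r * sgn (v r)) \<in> borel_measurable (lebesgue_on {0<..})"
        by (intro borel_measurable_times coefficient_measurable[OF \<alpha>]) auto
      show "(\<lambda>r. ?\<alpha> r * sgn (v r)) \<in> borel_measurable (lebesgue_on {0<..<S})"
        by (rule measurable_restrict_mono[OF m]) auto
      show "\<bar>?\<alpha> r * sgn (v r)\<bar> \<le> 1 / lam" for r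
        using inverse_theta_bounds[of "driving (spower s) f v (deriv v) r"] lam
        by (auto simp: sgn_if abs_mult)
      show "(\<lambda>r. ?\<rho> r * \<bar>v r\<bar> powr s) absolutely_integrable_on {0<..<S}"
        using v S by (simp add: weak_solution_def)
    qed simp
    moreover have "(\<lambda>r. (?\<alpha> r * sgn (v r)) * (?\<rho> r * \<bar>v r\<bar> powr s)) = (\<lambda>r. ?\<rho> r * (?\<alpha> r * spower s (v r)))"
    proof
      fix r
      have "sgn t * \<bar>t\<bar> powr s = spower s t" for t
        by (cases "t = 0") (auto simp: spower_def powr_diff sgn_if)
      from this[of "v r", symmetric]
      show "(?\<alpha> r * sgn (v r)) * (?\<rho> r * \<bar>v r\<bar> powr s) = ?\<rho> r * (?\<alpha> r * spower s (v r))" by (simp only: mult_ac)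
    qed
    ultimately have "(\<lambda>r. ?\<rho> r * (?\<alpha> r * spower s (v r))) absolutely_integrable_on {0..S}"
      by (simp only: absolutely_integrable_on_Icc_iff_Ioo)
    then show ?thesis by (rule absolutely_integrable_subset) (use S in auto)
  qed
  have h_eq: "h = (\<lambda>r. ?\<rho> r * (?\<alpha> r * spower s (v r)) - ?\<rho> r * (?\<alpha> r * f r))"
    by (simp add: h_def fun_eq_iff right_diff_distrib diff_divide_distrib)
  have h: "h absolutely_integrable_on {0..R}" for R unfolding h_eq by (rule set_integral_diff(1)[OF su fi])
  define W where "W r = integral {0..r} h" for r
  have W: "ac_primitive W h 0 R" for R
    by (rule ac_primitiveI[OF h]) (simp add: W_def)
  have Dint: "(\<lambda>r. ?\<rho> r * deriv v r - W r) absolutely_integrable_on {a..b}" if "0 < a" "a \<le> b" for a b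
    using that by (intro set_integral_diff(1) continuous_mult_integrable c\<rho> ac_primitiveD(1)[OF P]
      absolutely_integrable_continuous_real continuous_on_subset[OF ac_primitive_continuous[OF W, of b]]) auto
  have test: "integral {a..b} (\<lambda>r. \<psi> r * (?\<rho> r * deriv v r - W r)) = 0"
    if ab: "0 < a" "a \<le> b" and \<psi>: "continuous_on UNIV \<psi>" "\<And>r. r \<le> a \<Longrightarrow> \<psi> r = 0" "\<And>r. b \<le> r \<Longrightarrow> \<psi> r = 0" for a b \<psi>
  proof -
    have "isCont \<psi> r" for r using \<psi>(1) by (simp add: continuous_on_eq_continuous_at)
    then obtain G where "\<forall>r. (G has_vector_derivative \<psi> r) (at r)"
      using einterval_antiderivative[of "- \<infinity>" "\<infinity>" \<psi>] by auto
    then have G: "(G has_real_derivative \<psi> r) (at r)" for r by (simp add: has_real_derivative_iff_has_vector_derivative)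
    \<comment> \<open>Normalised at b, and hence constant, in general nonzero, to the left of
      a.\<close>
    define \<phi> where "\<phi> r = G r - G b" for r
    have \<phi>: "(\<phi> has_real_derivative \<psi> r) (at r)" for r
      unfolding \<phi>_def using G[of r] by (auto intro!: derivative_eq_intros)
    have d\<phi>: "deriv \<phi> r = \<psi> r" for r using \<phi> by (rule DERIV_imp_deriv)
    have z: "\<phi> r = 0" if "b \<le> r" for r
    proof -
      have "norm (\<phi> r - \<phi> b) \<le> 0 * norm (r - b)"
      proof (rule field_differentiable_bound[of "{b..r}" \<phi> \<psi>])
        show "(\<phi> has_real_derivative \<psi> z) (at z within {b..r})" for z
          using \<phi> by (rule has_field_derivative_at_within)
      qed (use \<psi>(3) that in auto)
      then show ?thesis by (simp add: \<phi>_def)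
    qed
    have "\<phi> \<in> H" by (rule H[OF \<phi> \<psi>(1) ab(1) \<psi>(2) z])
    then have weak: "(LINT r:{0<..}|lebesgue. ?\<rho> r * deriv v r * deriv \<phi> r + ?\<rho> r * ?\<alpha> r * spower s (v r) * \<phi> r) =
        (LINT r:{0<..}|lebesgue. ?\<rho> r * ?\<alpha> r * f r * \<phi> r)"
      using v by (simp add: weak_solution_def)
    have P\<phi>: "ac_primitive \<phi> \<psi> 0 b"
    proof (rule ac_primitive_C1)
      show "(\<phi> has_real_derivative \<psi> x) (at x within {0..b})" for x
        using \<phi> by (rule has_field_derivative_at_within)
    qed (use ab continuous_on_subset[OF \<psi>(1)] in auto)
    note c\<phi> = ac_primitive_continuous[OF P\<phi>]
    let ?A = "\<lambda>r. \<psi> r * (?\<rho> r * deriv v r)"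
    let ?l = "\<lambda>r. ?A r + \<phi> r * (?\<rho> r * (?\<alpha> r * spower s (v r)))"
    let ?r = "\<lambda>r. \<phi> r * (?\<rho> r * (?\<alpha> r * f r))"
    have Aab: "?A absolutely_integrable_on {a..b}"
      using ab by (intro continuous_mult_integrable continuous_on_subset[OF \<psi>(1)] c\<rho> ac_primitiveD(1)[OF P]) auto
    have "?A absolutely_integrable_on {0..a}"
      by (rule iffD1[OF set_integrable_cong[of lebesgue lebesgue "{0..a}" "{0..a}" "\<lambda>_. 0"]])
         (auto simp: \<psi>(2) set_integrable_def)
    then have "?A absolutely_integrable_on ({0..a} \<union> {a..b})" by (rule absolutely_integrable_Un[OF _ Aab])
    then have A: "?A absolutely_integrable_on {0..b}" by (rule absolutely_integrable_subset) auto
    have B: "(\<lambda>r. \<phi> r * (?\<rho> r * (?\<alpha> r * spower s (v r)))) absolutely_integrable_on {0..b}"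
      by (rule continuous_mult_integrable[OF c\<phi> su])
    have C: "?r absolutely_integrable_on {0..b}" by (rule continuous_mult_integrable[OF c\<phi> fi])
    have AB: "?l absolutely_integrable_on {0..b}" by (rule set_integral_add(1)[OF A B])
    have "(LINT r:{0<..}|lebesgue. ?l r) = (LINT r:{0<..}|lebesgue. ?\<rho> r * deriv v r * deriv \<phi> r + ?\<rho> r * ?\<alpha> r * spower s (v r) * \<phi> r)"
      by (rule set_lebesgue_integral_cong) (auto simp: d\<phi> mult_ac)
    also have "\<dots> = (LINT r:{0<..}|lebesgue. ?\<rho> r * ?\<alpha> r * f r * \<phi> r)" by (rule weak)
    also have "\<dots> = (LINT r:{0<..}|lebesgue. ?r r)" by (rule set_lebesgue_integral_cong) (auto simp: mult_ac)
    finally have "(LINT r:{0<..}|lebesgue. ?l r) = (LINT r:{0<..}|lebesgue. ?r r)" .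
    moreover have "(LINT r:{0<..}|lebesgue. ?l r) = integral {0..b} ?l"
      by (rule set_lebesgue_integral_positive(2)[OF AB]) (simp add: z \<psi>(3))
    moreover have "(LINT r:{0<..}|lebesgue. ?r r) = integral {0..b} ?r"
      by (rule set_lebesgue_integral_positive(2)[OF C]) (simp add: z)
    moreover have PP: "ac_primitive (\<lambda>r. W r * \<phi> r) (\<lambda>r. W r * \<psi> r + h r * \<phi> r) 0 b"
      by (rule ac_primitive_mult[OF W P\<phi>]) (use ab in simp)
    then have "integral {0..b} (\<lambda>r. W r * \<psi> r + h r * \<phi> r) = 0"
      using ac_primitiveD(2)[OF PP, of 0 b] ab z[of b] by (simp add: W_def)
    ultimately have "integral {0..b} (\<lambda>r. ?l r - ?r r - (W r * \<psi> r + h r * \<phi> r)) = 0"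
      using AB C ac_primitiveD(1)[OF PP]
      by (simp add: Henstock_Kurzweil_Integration.integral_diff integrable_diff set_lebesgue_integral_eq_integral(1))
    moreover have "?l r - ?r r - (W r * \<psi> r + h r * \<phi> r) = \<psi> r * (?\<rho> r * deriv v r - W r)" for r
    proof -
      have "h r * \<phi> r = \<phi> r * (?\<rho> r * (?\<alpha> r * spower s (v r))) - \<phi> r * (?\<rho> r * (?\<alpha> r * f r))"
        unfolding h_eq left_diff_distrib by (simp only: mult.commute[of _ "\<phi> r"])
      then show ?thesis by (simp only: right_diff_distrib mult.commute[of _ "\<psi> r"])
    qed
    ultimately have "integral {0..b} (\<lambda>r. \<psi> r * (?\<rho> r * deriv v r - W r)) = 0" by simp
    moreover have "(\<lambda>r. \<psi> r * (?\<rho> r * deriv v r - W r)) = (\<lambda>r. if r \<in> {a..b} then \<psi> r * (?\<rho> r * deriv v r - W r) else 0)"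
      using \<psi>(2,3) by (auto simp: fun_eq_iff)
    moreover have "{a..b} \<inter> {0..b} = {a..b}" using ab by auto
    ultimately show ?thesis
      using integral_restrict_Int[of "{0..b}" "{a..b}" "\<lambda>r. \<psi> r * (?\<rho> r * deriv v r - W r)"] by (simp only:)
  qed
  let ?D = "\<lambda>r. ?\<rho> r * deriv v r - W r"
  have D0: "integral {a..b} ?D = 0" if ab: "0 < a" "a \<le> b" for a b
  proof -
    \<comment> \<open>Trapezoids that increase to the indicator of (a, b).\<close>
    define \<psi> where "\<psi> k r = max 0 (min 1 (real k * min (r - a) (b - r)))" for k :: nat and r
    have c\<psi>: "continuous_on S (\<psi> k)" for k S unfolding \<psi>_def by (intro continuous_intros)
    have \<psi>0: "\<psi> k r = 0" if "min (r - a) (b - r) \<le> 0" for k r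
    proof -
      have "real k * min (r - a) (b - r) \<le> 0" by (rule mult_nonneg_nonpos) (use that in simp_all)
      then have "min 1 (real k * min (r - a) (b - r)) \<le> 0" by (rule min.coboundedI2)
      then show ?thesis unfolding \<psi>_def by (rule max_absorb1)
    qed
    have Di: "?D absolutely_integrable_on {a..b}" by (rule Dint[OF ab])
    have "(\<lambda>k. integral {a..b} (\<lambda>r. \<psi> k r * ?D r)) \<longlonglongrightarrow> integral {a..b} (\<lambda>r. if a < r \<and> r < b then ?D r else 0)"
    proof (rule dominated_convergence(2)[where h = "\<lambda>r. \<bar>?D r\<bar>"])
      show "(\<lambda>r. \<psi> k r * ?D r) integrable_on {a..b}" for k
        by (intro set_lebesgue_integral_eq_integral(1) continuous_mult_integrable c\<psi> Di)
      show "(\<lambda>r. \<bar>?D r\<bar>) integrable_on {a..b}"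
        by (intro set_lebesgue_integral_eq_integral(1) set_integrable_abs Di)
      show "norm (\<psi> k r * ?D r) \<le> \<bar>?D r\<bar>" for k r
        by (auto simp: \<psi>_def abs_mult intro!: mult_left_le_one_le)
      fix r assume r: "r \<in> {a..b}"
      show "(\<lambda>k. \<psi> k r * ?D r) \<longlonglongrightarrow> (if a < r \<and> r < b then ?D r else 0)"
      proof (cases "a < r \<and> r < b")
        case True
        define m where "m = min (r - a) (b - r)"
        have m: "0 < m" using True by (simp add: m_def)
        obtain k0 :: nat where k0: "1 / m < real k0" using reals_Archimedean2 by blast
        have "\<psi> k r = 1" if "k0 \<le> k" for k
        proof -
          have "1 / m < real k" using k0 that by simp
          then have "1 < real k * m" using m by (simp add: field_simps)
          then show ?thesis by (simp add: \<psi>_def m_def)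
        qed
        then have "\<forall>\<^sub>F k in sequentially. ?D r = \<psi> k r * ?D r"
          unfolding eventually_sequentially by (intro exI[of _ k0]) auto
        then have "(\<lambda>k. \<psi> k r * ?D r) \<longlonglongrightarrow> ?D r" by (rule Lim_transform_eventually[OF tendsto_const])
        then show ?thesis using True by simp
      next
        case False
        then have "(\<lambda>k. \<psi> k r * ?D r) \<longlonglongrightarrow> 0" using \<psi>0[of r] by (auto simp: min_le_iff_disj)
        then show ?thesis using False by (simp only: if_False)
      qed
    qed
    moreover have "integral {a..b} (\<lambda>r. \<psi> k r * ?D r) = 0" for k
    proof (rule test[OF ab c\<psi>])
      show "\<psi> k r = 0" if "r \<le> a" for r using that by (intro \<psi>0) (simp add: min_le_iff_disj)
      show "\<psi> k r = 0" if "b \<le> r" for r using that by (intro \<psi>0) (simp add: min_le_iff_disj)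
    qed
    ultimately have "integral {a..b} (\<lambda>r. if a < r \<and> r < b then ?D r else 0) = 0"
      using LIMSEQ_unique[OF _ tendsto_const] by fastforce
    moreover have "integral {a..b} (\<lambda>r. if a < r \<and> r < b then ?D r else 0) = integral {a..b} ?D"
      by (rule integral_spike[of "{a, b}"]) auto
    ultimately show ?thesis by simp
  qed
  \<comment> \<open>The continuous version of v'; since v is a primitive of it, v is differentiable
    at every positive r.\<close>
  define p where "p r = W r / ?\<rho> r" for r
  have cW: "continuous_on {a..b} W" if "0 < a" for a b
    by (rule continuous_on_subset[OF ac_primitive_continuous[OF W, of b]]) (use that in auto)
  have cp: "continuous_on {a..b} p" if "0 < a" for a b
    unfolding p_def by (intro continuous_on_divide cW c\<rho> that) simp
  have Pp: "ac_primitive v p a b" if ab: "0 < a" "a \<le> b" for a b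
  proof (rule ac_primitive_cong_AE[OF P[OF ab]])
    show "AE x in lebesgue. a < x \<and> x < b \<longrightarrow> deriv v x = p x"
      using Lebesgue_differentiation[OF Dint[OF ab]]
    proof (rule AE_mp, intro AE_I2 impI)
      fix x assume *: "a < x \<and> x < b \<longrightarrow> ((\<lambda>x. integral {a..x} ?D) has_real_derivative ?D x) (at x)" and x: "a < x \<and> x < b"
      have "\<forall>\<^sub>F y in nhds x. y \<in> {a<..<b}" by (rule eventually_nhds_in_open) (use x in auto)
      then have "\<forall>\<^sub>F y in nhds x. integral {a..y} ?D = 0" by eventually_elim (use D0 ab in auto)
      then have "((\<lambda>x. integral {a..x} ?D) has_real_derivative 0) (at x)"
        using DERIV_cong_ev[of x x "\<lambda>x. integral {a..x} ?D" "\<lambda>_. 0" 0 0] by simp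
      then have "?D x = 0" using * x DERIV_unique by blast
      then show "deriv v x = p x" by (simp add: p_def field_simps)
    qed
  qed
  have Dp: "(v has_real_derivative p r) (at r)" if r: "0 < r" for r
  proof -
    have ab: "0 < r / 2" "r / 2 \<le> 2 * r" using r by auto
    have "((\<lambda>x. v (r / 2) + integral {r / 2..x} p) has_real_derivative 0 + p r) (at r within {r / 2..2 * r})"
      by (intro DERIV_add DERIV_const integral_has_real_derivative cp) (use r in auto)
    then have "((\<lambda>x. v (r / 2) + integral {r / 2..x} p) has_real_derivative p r) (at r within {r / 2..2 * r})" by simp
    then have "(v has_real_derivative p r) (at r within {r / 2..2 * r})"
      by (rule has_field_derivative_transform_within[where d = 1])
         (use r ac_primitiveD(2)[OF Pp[OF ab], of "r / 2"] in auto)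
    moreover have "at r within {r / 2..2 * r} = at r" using r by (intro at_within_Icc_at) auto
    ultimately show ?thesis by simp
  qed
  have vp: "deriv v r = p r" if "0 < r" for r using Dp[OF that] by (rule DERIV_imp_deriv)
  have "solves (spower s) f v (deriv v) a b" if ab: "0 < a" "a \<le> b" for a b
    unfolding solves_def
  proof (intro conjI ballI ab)
    show "(v has_real_derivative deriv v r) (at r within {a..b})" if "r \<in> {a..b}" for r
      using has_field_derivative_at_within[OF Dp[of r]] vp[of r] that ab by simp
    show "f absolutely_integrable_on {a..b}" by (rule admissible_integrable[OF f ab(1)])
    have "ac_primitive W h a b" by (rule ac_primitive_subinterval[OF W]) (use ab in auto)
    \<comment> \<open>v' is W times the reciprocal weight, which is the weight of the negative
      coefficient; the product rule brings back the damping term.\<close>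
    from ac_primitive_mult[OF ac_primitive_weight[OF coefficient_uminus[OF c] ab] this ab(2)]
    show "ac_primitive (deriv v) (\<lambda>r. \<Gamma> (driving (spower s) f v (deriv v) r)) a b"
    proof (rule iffD1[OF ac_primitive_cong, rotated 2])
      fix r assume "r \<in> {a..b}"
      then have r: "0 < r" using ab by auto
      show eq: "weight (\<lambda>r. - ?c r) r * W r = deriv v r" by (simp add: vp[OF r] p_def weight_uminus)
      have "weight (\<lambda>r. - ?c r) r * (- ?c r / r) * W r = - (?c r * (weight (\<lambda>r. - ?c r) r * W r) / r)" by simp
      then have "weight (\<lambda>r. - ?c r) r * (- ?c r / r) * W r = - (?c r * deriv v r / r)" unfolding eq .
      moreover have "weight (\<lambda>r. - ?c r) r * h r = ?\<alpha> r * (spower s (v r) - f r)"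
        by (simp add: weight_uminus h_def)
      ultimately show "weight (\<lambda>r. - ?c r) r * h r + weight (\<lambda>r. - ?c r) r * (- ?c r / r) * W r =
          \<Gamma> (driving (spower s) f v (deriv v) r)"
        unfolding Gamma_driving_linear damping_def by linarith
    qed
  qed
  moreover have "((\<lambda>r. ?\<rho> r * deriv v r) \<longlongrightarrow> 0) (at_right 0)"
  proof (rule Lim_transform_eventually)
    have "(W \<longlongrightarrow> W 0) (at 0 within {0..1})"
      using ac_primitive_continuous[OF W, of 1] unfolding continuous_on_def by simp
    then show "(W \<longlongrightarrow> 0) (at_right 0)" by (simp add: at_within_Icc_at_right W_def)
    show "\<forall>\<^sub>F r in at_right 0. W r = ?\<rho> r * deriv v r"
      using eventually_at_right_less by eventually_elim (simp add: vp p_def)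
  qed
  ultimately show ?thesis by (auto simp: global_solution_def)
qed

lemma weak_radial_solution_iff:
  fixes F :: "real ^ 'n \<Rightarrow> real"
  assumes "n = real CARD('n)"
  shows "weak_radial_solution lam Lam s F u \<longleftrightarrow>
    weak_solution (radial_test_functions TYPE('n)) (radial_profile F) u"
  by (simp add: weak_radial_solution_def weak_solution_def rho_eq rho_tilde_eq spower_def Let_def flip: assms)

lemma global_solution_0:
  assumes f: "admissible f" and ae: "AE r in lebesgue. 0 < r \<longrightarrow> f r = 0"
  shows "global_solution f (\<lambda>_. 0) (\<lambda>_. 0)"
proof -
  have "solves (spower s) f (\<lambda>_. 0) (\<lambda>_. 0) a b" if "0 < a" "a \<le> b" for a b
    unfolding solves_def
  proof (intro conjI that admissible_integrable[OF f])
    have "ac_primitive (\<lambda>_. 0) (\<lambda>_. 0) a b" by (simp add: ac_primitive_def set_integrable_def)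
    then show "ac_primitive (\<lambda>_. 0) (\<lambda>r. \<Gamma> (driving (spower s) f (\<lambda>_. 0) (\<lambda>_. 0) r)) a b"
    proof (rule ac_primitive_cong_AE)
      show "AE r in lebesgue. a < r \<and> r < b \<longrightarrow> 0 = \<Gamma> (driving (spower s) f (\<lambda>_. 0) (\<lambda>_. 0) r)"
        using ae by eventually_elim (use that in \<open>simp add: driving_def\<close>)
    qed
  qed simp
  then show ?thesis by (simp add: global_solution_def)
qed

text \<open>f is nonnegative almost everywhere, while \<open>comparison_principle\<close> orders the
  right-hand sides at every point. The function min f 0 vanishes almost everywhere, lies below f
  everywhere and has the solution 0.\<close>

lemma global_solution_nonneg:
  assumes G: "global_solution f u p" and f: "admissible f"
    and ae: "AE r in lebesgue. 0 < r \<longrightarrow> 0 \<le> f r" and r: "0 < r"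
  shows "0 \<le> u r"
proof -
  let ?g = "\<lambda>r. min (f r) 0"
  have meas: "f \<in> borel_measurable (lebesgue_on {0<..})"
    using f by (simp add: admissible_def set_borel_measurable_lebesgue_iff[symmetric])
  have g: "admissible ?g"
    unfolding admissible_def
  proof (intro conjI allI impI)
    show "set_borel_measurable lebesgue {0<..} ?g"
      using meas by (subst set_borel_measurable_lebesgue_iff) auto
    fix R :: real assume R: "0 < R"
    have "(\<lambda>r. (if f r < 0 then 1 else 0) * (r powr \<kappa> * \<bar>f r\<bar>)) absolutely_integrable_on {0<..<R}"
    proof (rule absolutely_integrable_bounded_mult)
      have "f \<in> borel_measurable (lebesgue_on {0<..<R})" using meas by (rule measurable_restrict_mono) auto
      then show "(\<lambda>r. if f r < 0 then 1 else 0 :: real) \<in> borel_measurable (lebesgue_on {0<..<R})" by measurable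
      show "\<bar>if f r < 0 then 1 else 0 :: real\<bar> \<le> 1" for r by simp
      show "(\<lambda>r. r powr \<kappa> * \<bar>f r\<bar>) absolutely_integrable_on {0<..<R}"
        using f R by (simp add: admissible_def absolutely_integrable_on_Icc_iff_Ioo)
    qed simp
    moreover have "(\<lambda>r. (if f r < 0 then 1 else 0) * (r powr \<kappa> * \<bar>f r\<bar>)) = (\<lambda>r. r powr \<kappa> * \<bar>?g r\<bar>)"
      by (auto simp: fun_eq_iff)
    ultimately show "(\<lambda>r. r powr \<kappa> * \<bar>?g r\<bar>) absolutely_integrable_on {0..R}"
      by (simp add: absolutely_integrable_on_Icc_iff_Ioo)
  qed
  have "global_solution ?g (\<lambda>_. 0) (\<lambda>_. 0)"
    by (rule global_solution_0[OF g]) (use ae in \<open>auto elim: eventually_mono\<close>)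
  then show ?thesis using comparison_principle[OF _ G g f _ r] by fastforce
qed

end

theorem theorem1p3:
  fixes F :: "real ^ 'n \<Rightarrow> real" and lam Lam s Nplus :: real
  assumes "0 < lam" and "lam \<le> Lam" and "s > 1"
    and "Nplus = lam / Lam * (real CARD('n) - 1) + 1"
    and "radially_symmetric F"
    and "set_borel_measurable lebesgue {0<..} (radial_profile F)"
    and "\<forall>R>0. set_integrable lebesgue {0<..<R}
                  (\<lambda>r. r powr (Nplus - 1) * \<bar>radial_profile F r\<bar>)"
  shows "\<exists>u. weak_radial_solution lam Lam s F u \<and>
             (\<forall>v. weak_radial_solution lam Lam s F v \<longrightarrow> (\<forall>r>0. v r = u r)) \<and>
             ((AE r in lebesgue. 0 < r \<longrightarrow> 0 \<le> radial_profile F r) \<longrightarrow> (\<forall>r>0. 0 \<le> u r))"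
proof -
  interpret pucci lam Lam s "real CARD('n)"
    by unfold_locales (use assms(1-3) in \<open>auto simp: Suc_le_eq\<close>)
  let ?f = "radial_profile F" and ?H = "radial_test_functions TYPE('n)"
  note iff = weak_radial_solution_iff[OF refl, of F]
  have f: "admissible ?f"
    unfolding admissible_def using assms(4,6,7)
    by (simp add: \<kappa>_def absolutely_integrable_on_Icc_iff_Ioo)
  obtain u p where "global_solution ?f u p" using exists_global_solution[OF f] .
  then have u: "global_solution ?f u (deriv u)" by (rule global_solution_deriv[OF _ f])
  show ?thesis
    unfolding iff
  proof (intro exI[of _ u] conjI allI impI)
    show "weak_solution ?H ?f u"
      by (rule global_solution_weak_solution[OF u f]) (rule radial_test_function_Lipschitz)
    show "v r = u r" if v: "weak_solution ?H ?f v" and r: "0 < r" for v r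
    proof -
      have "global_solution ?f v (deriv v)"
        by (rule weak_solution_global_solution[OF v f], rule C1_in_radial_test_functions)
      then show ?thesis
        using comparison_principle[OF _ u f f _ r] comparison_principle[OF u _ f f _ r] by (meson order_antisym order_refl)
    qed
    show "0 \<le> u r" if "AE r in lebesgue. 0 < r \<longrightarrow> 0 \<le> ?f r" "0 < r" for r
      using u f that by (rule global_solution_nonneg)
  qed
qed

end
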